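(* Let $\widehat\gamma=(\gamma_\infty,\gamma_2,\gamma_3,\dots)$ be a sequence of complex numbers indexed by $V_{\mathbb Q}$. The adelic Lizorkin spaces of test functions $\Phi(\mathbb A)$ and of distributions $\Phi'(\mathbb A)$ are invariant under the adelic fractional operator $D^{\widehat\gamma}$, and $D^{\widehat\gamma}(\Phi'(\mathbb A))=\Phi'(\mathbb A)$.
   Context: $V_{\mathbb Q}=\{\infty,2,3,5,\dots\}$; $\mathbb Q_\infty=\mathbb R$; for a prime $p$, $\mathbb Q_p$, $|\cdot|_p$, $\mathbb Z_p$ are the $p$-adic numbers, norm, integers; $\Omega$ is the characteristic function of $[0,1]$. $\mathbb A$ is the adele ring of $\mathbb Q$ (all $(x_p)_{p\in V_{\mathbb Q}}$, $x_p\in\mathbb Q_p$, with $x_p\in\mathbb Z_p$ for almost all primes $p$) with Haar measure $dx=dx_\infty dx_2dx_3\cdots$ ($dx_\infty$ Lebesgue, $\int_{\mathbb Z_p}dx_p=1$). The Fourier transform is $F[\varphi](\xi)=\int_{\mathbb A}\prod_{p\in V_{\mathbb Q}}\chi_p(\xi_px_p)\varphi(x)\,dx$ with $\chi_\infty(t)=e^{2\pi it}$, $\chi_p(t)=e^{2\pi i\{t\}_p}$ ($\{t\}_p$ the $p$-adic fractional part). $\mathcal S(\mathbb R)$ is the Schwartz space; $\mathcal D(\mathbb Q_p)$ is the space of locally constant compactly supported complex functions on $\mathbb Q_p$. For a prime $m$, $\Psi^{[m]}(\mathbb A)$ is the space of finite linear combinations of elementary functions $\eta(\xi)=\prod_{p\in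 V_{\mathbb Q}}\eta_p(\xi_p)$ with $\eta_\infty\in\mathcal S(\mathbb R)$, $\eta_p\in\mathcal D(\mathbb Q_p)$ for primes $p$, $\eta_p(\xi_p)=\Omega(|\xi_p|_p)$ for primes $p>m$, and $\frac{\partial^s}{\partial\xi_\infty^s}\eta\big|_{\xi_r=0}=0$ for all $s=0,1,2,\dots$ and all $r\in\{\infty\}\cup\{\text{primes}\le m\}$. Put $\Phi^{[m]}(\mathbb A)=F[\Psi^{[m]}(\mathbb A)]$, and let $\Phi(\mathbb A)$ be the linear span of all $\Phi^{[m]}(\mathbb A)$, $m$ prime, with the inductive limit topology. Here $\Phi^{[m]}(\mathbb A)$ is topologized as the inductive limit of the subspaces $\Phi(\mathbb R)\otimes E$, where $\Phi(\mathbb R)\subset\mathcal S(\mathbb R)$ (with the topology of $\mathcal S(\mathbb R)$) is the set of Fourier transforms of Schwartz functions all of whose derivatives vanish at $0$, and $E$ runs over finite-dimensional spaces of functions of $(x_p)_{p\text{ prime}}$ spanned by products of mean-zero elements of $\mathcal D(\mathbb Q_p)$, $p\le m$, times $\prod_{p>m}\Omega(|x_p|_p)$. $\Phi'(\mathbb A)$ is the topological dual of $\Phi(\mathbb A)$. The fractional operator $D^{\widehat\gamma}$ is defined on each $\Phi^{[m]}(\mathbb A)$ by $D^{\widehat\gamma}\zeta=F^{-1}\big[|\cdot|^{\widehat\gamma}_{(m)}F[\zeta]\big]$, where $|\xi|^{\widehat\gamma}_{(m)}=|\xi_\infty|^{\gamma_\infty}\prod_{p\le m}|\xi_p|_p^{\gamma_p}\prod_{p>m}\Omega(|\xi_p|_p)$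 (product with $F[\zeta]$ understood as $0$ where some $\xi_r=0$, $r\in\{\infty,2,\dots,m\}$), extended linearly to $\Phi(\mathbb A)$; on distributions, $\langle D^{\widehat\gamma}f,\zeta\rangle=\langle f,D^{\widehat\gamma}\zeta\rangle$ for $\zeta\in\Phi(\mathbb A)$. *)

theory Defs
  imports "HOL-Analysis.Analysis" "HOL-Library.Function_Algebras"
    "HOL-Computational_Algebra.Primes"
begin

section \<open>Complex vector spaces of functions\<close>

definition cscale :: "complex \<Rightarrow> ('a \<Rightarrow> complex) \<Rightarrow> 'a \<Rightarrow> complex" where
  "cscale c f = (\<lambda>x. c * f x)"

interpretation cfun: vector_space "cscale :: complex \<Rightarrow> ('a \<Rightarrow> complex) \<Rightarrow> 'a \<Rightarrow> complex"
  by unfold_locales (auto simp: cscale_def fun_eq_iff algebra_simps)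

definition linear_on :: "('a \<Rightarrow> complex) set \<Rightarrow> (complex \<Rightarrow> 'b \<Rightarrow> 'b)
    \<Rightarrow> (('a \<Rightarrow> complex) \<Rightarrow> 'b::plus) \<Rightarrow> bool" where
  "linear_on X s T \<longleftrightarrow> (\<forall>f\<in>X. \<forall>g\<in>X. T (f + g) = T f + T g) \<and>
     (\<forall>c. \<forall>f\<in>X. T (cscale c f) = s c (T f))"

text \<open>Locally convex vector topologies on a subspace \<open>X\<close>; Hausdorffness is not demanded.\<close>

definition locally_convex :: "('a \<Rightarrow> complex) set \<Rightarrow> ('a \<Rightarrow> complex) topology \<Rightarrow> bool" where
  "locally_convex X T \<longleftrightarrow> topspace T = X \<and>
     continuous_map (prod_topology T T) T (\<lambda>(f, g). f + g) \<and>
     continuous_map (prod_topology euclidean T) T (\<lambda>(c, f). cscale c f) \<and>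
     (\<forall>U. openin T U \<and> 0 \<in> U \<longrightarrow>
        (\<exists>V. openin T V \<and> 0 \<in> V \<and> V \<subseteq> U \<and>
           (\<forall>f\<in>V. \<forall>g\<in>V. \<forall>t\<in>{0..1::real}.
              cscale (of_real t) f + cscale (of_real (1 - t)) g \<in> V)))"

text \<open>The inductive limit topology on \<open>X\<close> of a family of topologized subspaces: the finest
  locally convex topology making all inclusions continuous. It is obtained as the supremum of
  all such topologies.\<close>

definition inductive_limit ::
    "('a \<Rightarrow> complex) set \<Rightarrow> ('a \<Rightarrow> complex) topology set \<Rightarrow> ('a \<Rightarrow> complex) topology" where
  "inductive_limit X \<S> = topology_generated_by
     {W. \<exists>T. locally_convex X T \<and> (\<forall>S\<in>\<S>. continuous_map S T (\<lambda>f. f)) \<and> openin T W}"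


section \<open>The p-adic numbers\<close>

definition padic_abs :: "nat \<Rightarrow> rat \<Rightarrow> real" where
  "padic_abs p x = (if x = 0 then 0 else
     real p powi (int (multiplicity (int p) (snd (quotient_of x)))
                - int (multiplicity (int p) (fst (quotient_of x)))))"

text \<open>The field of p-adic numbers is the completion of the rationals: a p-adic number is a class
  of p-adic Cauchy sequences modulo null sequences. As \<open>p\<close> varies inside an adele, the fields
  are carrier sets in one type.\<close>

type_synonym padic = "(nat \<Rightarrow> rat) set"

definition padic_Cauchy :: "nat \<Rightarrow> (nat \<Rightarrow> rat) set" where
  "padic_Cauchy p = {X. \<forall>\<epsilon>>0. \<exists>N. \<forall>m\<ge>N. \<forall>n\<ge>N. padic_abs p (X m - X n) < \<epsilon>}"

definition padic_rel :: "nat \<Rightarrow> ((nat \<Rightarrow> rat) \<times> (nat \<Rightarrow> rat)) set" where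
  "padic_rel p = {(X, Y). X \<in> padic_Cauchy p \<and> Y \<in> padic_Cauchy p \<and>
     (\<lambda>n. padic_abs p (X n - Y n)) \<longlonglongrightarrow> 0}"

definition Qp :: "nat \<Rightarrow> padic set" where
  "Qp p = padic_Cauchy p // padic_rel p"

definition padic_of_rat :: "nat \<Rightarrow> rat \<Rightarrow> padic" where
  "padic_of_rat p r = padic_rel p `` {\<lambda>n. r}"

definition padic_diff :: "nat \<Rightarrow> padic \<Rightarrow> padic \<Rightarrow> padic" where
  "padic_diff p x y = (\<Union>X\<in>x. \<Union>Y\<in>y. padic_rel p `` {\<lambda>n. X n - Y n})"

definition padic_mult :: "nat \<Rightarrow> padic \<Rightarrow> padic \<Rightarrow> padic" where
  "padic_mult p x y = (\<Union>X\<in>x. \<Union>Y\<in>y. padic_rel p `` {\<lambda>n. X n * Y n})"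

definition padic_norm :: "nat \<Rightarrow> padic \<Rightarrow> real" where
  "padic_norm p x = (THE r. \<exists>X\<in>x. (\<lambda>n. padic_abs p (X n)) \<longlonglongrightarrow> r)"

text \<open>The value off the carrier is fixed because the locale \<open>Metric_space\<close> demands
  nonnegativity and symmetry everywhere.\<close>

definition padic_dist :: "nat \<Rightarrow> padic \<Rightarrow> padic \<Rightarrow> real" where
  "padic_dist p x y = (if x \<in> Qp p \<and> y \<in> Qp p then padic_norm p (padic_diff p x y) else 0)"

definition Qp_topology :: "nat \<Rightarrow> padic topology" where
  "Qp_topology p = Metric_space.mtopology (Qp p) (padic_dist p)"

definition Zp :: "nat \<Rightarrow> padic set" where
  "Zp p = {x \<in> Qp p. padic_norm p x \<le> 1}"

text \<open>The fractional part of \<open>x\<close> is the element of \<open>\<int>[1/p] \<inter> [0, 1)\<close> congruent to \<open>x\<close> modulo the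
  p-adic integers.\<close>

definition padic_frac :: "nat \<Rightarrow> padic \<Rightarrow> rat" where
  "padic_frac p x = (THE r. 0 \<le> r \<and> r < 1 \<and> (\<exists>k a. r = of_int a / of_nat p ^ k) \<and>
     padic_diff p x (padic_of_rat p r) \<in> Zp p)"

definition padic_char :: "nat \<Rightarrow> padic \<Rightarrow> complex" where
  "padic_char p x = exp (2 * of_real pi * \<i> * of_rat (padic_frac p x))"

text \<open>The Haar measure with \<open>\<int>\<^sub>p\<close> of measure 1: the Borel measure giving each ball
  \<open>a + p\<^sup>n \<int>\<^sub>p\<close> the measure \<open>p\<^sup>-\<^sup>n\<close>.\<close>

definition padic_haar :: "nat \<Rightarrow> padic measure" where
  "padic_haar p = extend_measure (Qp p) (Qp p \<times> (UNIV :: int set))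
     (\<lambda>(a, n). {x \<in> Qp p. padic_dist p x a \<le> real p powi (- n)})
     (\<lambda>(a, n). ennreal (real p powi (- n)))"

text \<open>Locally constant functions with compact support; only the values on \<open>Qp p\<close> matter.\<close>

definition padic_test :: "nat \<Rightarrow> (padic \<Rightarrow> complex) set" where
  "padic_test p = {f.
     (\<forall>x\<in>Qp p. \<exists>U. openin (Qp_topology p) U \<and> x \<in> U \<and> (\<forall>y\<in>U. f y = f x)) \<and>
     compactin (Qp_topology p) (Qp_topology p closure_of {x \<in> Qp p. f x \<noteq> 0})}"

definition Omega_p :: "nat \<Rightarrow> padic \<Rightarrow> complex" where
  "Omega_p p x = indicator {0..1} (padic_norm p x)"


section \<open>The adeles\<close>

text \<open>An adele is a pair consisting of its real component and its family of p-adic components,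
  a function on the primes (extensional, i.e. \<open>undefined\<close> at non-primes).\<close>

type_synonym fin_adele = "nat \<Rightarrow> padic"
type_synonym adele = "real \<times> fin_adele"

definition fin_adeles :: "fin_adele set" where
  "fin_adeles = {x \<in> \<Pi>\<^sub>E p\<in>{p. prime p}. Qp p. finite {p. prime p \<and> x p \<notin> Zp p}}"

definition adeles :: "adele set" where
  "adeles = UNIV \<times> fin_adeles"

text \<open>The product over all primes of a family almost all of whose members are 1.\<close>

definition prime_prod :: "(nat \<Rightarrow> 'a::comm_monoid_mult) \<Rightarrow> 'a" where
  "prime_prod f = (\<Prod>p | prime p \<and> f p \<noteq> 1. f p)"

text \<open>The measure \<open>dx\<^sub>2 dx\<^sub>3 dx\<^sub>5 \<dots>\<close>: a box \<open>\<Prod>\<^sub>p X\<^sub>p\<close> with \<open>X\<^sub>p = \<int>\<^sub>p\<close> for almost all \<open>p\<close> has as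
  measure the product of the measures of the \<open>X\<^sub>p\<close>.\<close>

definition fin_adele_haar :: "fin_adele measure" where
  "fin_adele_haar = extend_measure fin_adeles
     {X. (\<forall>p. prime p \<longrightarrow> X p \<in> sets (padic_haar p)) \<and> finite {p. prime p \<and> X p \<noteq> Zp p}}
     (\<lambda>X. \<Pi>\<^sub>E p\<in>{p. prime p}. X p)
     (\<lambda>X. \<Prod>p | prime p \<and> X p \<noteq> Zp p. emeasure (padic_haar p) (X p))"

definition adele_haar :: "adele measure" where
  "adele_haar = lborel \<Otimes>\<^sub>M fin_adele_haar"

definition real_char :: "real \<Rightarrow> complex" where
  "real_char t = exp (2 * of_real pi * \<i> * of_real t)"

definition adele_char :: "adele \<Rightarrow> adele \<Rightarrow> complex" where
  "adele_char \<xi> x = real_char (fst \<xi> * fst x) *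
     prime_prod (\<lambda>p. padic_char p (padic_mult p (snd \<xi> p) (snd x p)))"

text \<open>Functions on the adeles are represented by functions vanishing off \<open>adeles\<close>.\<close>

definition adele_fourier :: "(adele \<Rightarrow> complex) \<Rightarrow> adele \<Rightarrow> complex" where
  "adele_fourier \<phi> = (\<lambda>\<xi>. if \<xi> \<in> adeles then
     (LINT x|adele_haar. adele_char \<xi> x * \<phi> x) else 0)"

definition adele_inv_fourier :: "(adele \<Rightarrow> complex) \<Rightarrow> adele \<Rightarrow> complex" where
  "adele_inv_fourier \<psi> = (\<lambda>x. if x \<in> adeles then
     (LINT \<xi>|adele_haar. cnj (adele_char \<xi> x) * \<psi> \<xi>) else 0)"


section \<open>Schwartz functions on the real line\<close>

definition nth_deriv :: "nat \<Rightarrow> (real \<Rightarrow> complex) \<Rightarrow> real \<Rightarrow> complex" where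
  "nth_deriv s = (\<lambda>f t. vector_derivative f (at t)) ^^ s"

definition schwartz :: "(real \<Rightarrow> complex) set" where
  "schwartz = {f. (\<forall>s t. nth_deriv s f differentiable at t) \<and>
     (\<forall>a b. bounded (range (\<lambda>t. of_real (t ^ a) * nth_deriv b f t)))}"

definition schwartz_seminorm :: "nat \<Rightarrow> nat \<Rightarrow> (real \<Rightarrow> complex) \<Rightarrow> real" where
  "schwartz_seminorm a b f = (SUP t. \<bar>t\<bar> ^ a * norm (nth_deriv b f t))"

definition schwartz_topology :: "(real \<Rightarrow> complex) topology" where
  "schwartz_topology = topology_generated_by
     {{g \<in> schwartz. schwartz_seminorm a b (g - f) < \<epsilon>} | a b f \<epsilon>. f \<in> schwartz \<and> \<epsilon> > 0}"

definition real_fourier :: "(real \<Rightarrow> complex) \<Rightarrow> real \<Rightarrow> complex" where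
  "real_fourier \<phi> = (\<lambda>\<xi>. LINT x|lborel. real_char (\<xi> * x) * \<phi> x)"

definition real_lizorkin :: "(real \<Rightarrow> complex) set" where
  "real_lizorkin = real_fourier ` {\<psi> \<in> schwartz. \<forall>s. nth_deriv s \<psi> 0 = 0}"

definition real_lizorkin_topology :: "(real \<Rightarrow> complex) topology" where
  "real_lizorkin_topology = subtopology schwartz_topology real_lizorkin"


section \<open>The adelic Lizorkin spaces\<close>

definition elementary ::
    "(real \<Rightarrow> complex) \<Rightarrow> (nat \<Rightarrow> padic \<Rightarrow> complex) \<Rightarrow> adele \<Rightarrow> complex" where
  "elementary h e = (\<lambda>\<xi>. if \<xi> \<in> adeles then
     h (fst \<xi>) * prime_prod (\<lambda>p. e p (snd \<xi> p)) else 0)"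

definition Psi_elementary :: "nat \<Rightarrow> (adele \<Rightarrow> complex) set" where
  "Psi_elementary m = {\<eta>. \<exists>h e. \<eta> = elementary h e \<and> h \<in> schwartz \<and>
     (\<forall>p. prime p \<longrightarrow> e p \<in> padic_test p) \<and>
     (\<forall>p>m. prime p \<longrightarrow> (\<forall>x\<in>Qp p. e p x = Omega_p p x)) \<and>
     (\<forall>s. \<forall>y\<in>fin_adeles. nth_deriv s (\<lambda>t. \<eta> (t, y)) 0 = 0) \<and>
     (\<forall>s p. prime p \<and> p \<le> m \<longrightarrow>
        (\<forall>t. \<forall>y\<in>fin_adeles. y p = padic_of_rat p 0 \<longrightarrow>
           nth_deriv s (\<lambda>t. \<eta> (t, y)) t = 0))}"

definition Psi_level :: "nat \<Rightarrow> (adele \<Rightarrow> complex) set" where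
  "Psi_level m = cfun.span (Psi_elementary m)"

definition Phi_level :: "nat \<Rightarrow> (adele \<Rightarrow> complex) set" where
  "Phi_level m = adele_fourier ` Psi_level m"

definition Phi :: "(adele \<Rightarrow> complex) set" where
  "Phi = cfun.span (\<Union>m\<in>{m. prime m}. Phi_level m)"

definition mean_zero_products :: "nat \<Rightarrow> (fin_adele \<Rightarrow> complex) set" where
  "mean_zero_products m = {w. \<exists>e.
     w = (\<lambda>y. if y \<in> fin_adeles then prime_prod (\<lambda>p. e p (y p)) else 0) \<and>
     (\<forall>p\<le>m. prime p \<longrightarrow> e p \<in> padic_test p \<and> (LINT x|padic_haar p. e p x) = 0) \<and>
     (\<forall>p>m. prime p \<longrightarrow> (\<forall>x\<in>Qp p. e p x = Omega_p p x))}"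

text \<open>A finite-dimensional space \<open>E\<close> is given by a basis \<open>B\<close>. Then \<open>\<Phi>(\<real>) \<otimes> E\<close> consists of the
  functions \<open>\<Sum>b\<in>B. \<phi> b \<otimes> b\<close> with \<open>\<phi> b \<in> \<Phi>(\<real>)\<close>, and its topology is that of the product
  \<open>\<Phi>(\<real>)\<^sup>B\<close>, transported along the bijection \<open>tensor_sum B\<close>.\<close>

definition tensor_sum ::
    "(fin_adele \<Rightarrow> complex) set \<Rightarrow> ((fin_adele \<Rightarrow> complex) \<Rightarrow> real \<Rightarrow> complex) \<Rightarrow> adele \<Rightarrow> complex" where
  "tensor_sum B \<phi> = (\<lambda>x. \<Sum>b\<in>B. \<phi> b (fst x) * b (snd x))"

definition tensor_topology :: "(fin_adele \<Rightarrow> complex) set \<Rightarrow> (adele \<Rightarrow> complex) topology" where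
  "tensor_topology B = pullback_topology
     (tensor_sum B ` (B \<rightarrow>\<^sub>E real_lizorkin))
     (inv_into (B \<rightarrow>\<^sub>E real_lizorkin) (tensor_sum B))
     (product_topology (\<lambda>_. real_lizorkin_topology) B)"

definition Phi_level_topology :: "nat \<Rightarrow> (adele \<Rightarrow> complex) topology" where
  "Phi_level_topology m = inductive_limit (Phi_level m)
     {tensor_topology B | B. finite B \<and> B \<subseteq> mean_zero_products m \<and> cfun.independent B}"

definition Phi_topology :: "(adele \<Rightarrow> complex) topology" where
  "Phi_topology = inductive_limit Phi {Phi_level_topology m | m. prime m}"

definition Phi_dual :: "((adele \<Rightarrow> complex) \<Rightarrow> complex) set" where
  "Phi_dual = {f \<in> extensional Phi. linear_on Phi (*) f \<and> continuous_map Phi_topology euclidean f}"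


section \<open>The adelic fractional operator\<close>

text \<open>A sequence indexed by the places is a pair of its value at infinity and a function on the
  primes. Since \<open>0 powr z = 0\<close> for every \<open>z\<close>, even \<open>z = 0\<close>, the multiplier is \<open>0\<close> wherever one of
  the components at infinity or at the primes up to \<open>m\<close> is \<open>0\<close>.\<close>

definition multiplier :: "nat \<Rightarrow> complex \<times> (nat \<Rightarrow> complex) \<Rightarrow> adele \<Rightarrow> complex" where
  "multiplier m \<gamma> \<xi> = of_real \<bar>fst \<xi>\<bar> powr fst \<gamma> *
     prime_prod (\<lambda>p. if p \<le> m then of_real (padic_norm p (snd \<xi> p)) powr snd \<gamma> p
                     else Omega_p p (snd \<xi> p))"

definition frac_level ::
    "nat \<Rightarrow> complex \<times> (nat \<Rightarrow> complex) \<Rightarrow> (adele \<Rightarrow> complex) \<Rightarrow> adele \<Rightarrow> complex" where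
  "frac_level m \<gamma> \<zeta> = adele_inv_fourier (\<lambda>\<xi>. multiplier m \<gamma> \<xi> * adele_fourier \<zeta> \<xi>)"

text \<open>The linear extension of the operators on the \<open>Phi_level m\<close> to their span. It exists because
  the sum of these spaces is direct: they are not nested, as the factor \<open>\<Omega>(\<bar>x\<^sub>p\<bar>)\<close> prescribed
  for \<open>p > m\<close> does not have mean zero.\<close>

definition frac_op ::
    "complex \<times> (nat \<Rightarrow> complex) \<Rightarrow> (adele \<Rightarrow> complex) \<Rightarrow> adele \<Rightarrow> complex" where
  "frac_op \<gamma> = (THE T. T \<in> extensional Phi \<and> linear_on Phi cscale T \<and>
     (\<forall>m. prime m \<longrightarrow> (\<forall>\<zeta>\<in>Phi_level m. T \<zeta> = frac_level m \<gamma> \<zeta>)))"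

definition frac_op_dual ::
    "complex \<times> (nat \<Rightarrow> complex) \<Rightarrow> ((adele \<Rightarrow> complex) \<Rightarrow> complex) \<Rightarrow> (adele \<Rightarrow> complex) \<Rightarrow> complex" where
  "frac_op_dual \<gamma> f = (\<lambda>\<zeta>\<in>Phi. f (frac_op \<gamma> \<zeta>))"

end

theory Submission
  imports Defs "HOL-Probability.Probability" "HOL-Number_Theory.Cong"
begin

text \<open>On \<open>\<Psi>\<close> the operator is multiplication by \<open>\<bar>\<xi>\<bar>\<^sup>\<gamma>\<close>, and multiplication by \<open>\<bar>\<xi>\<bar>\<^sup>-\<^sup>\<gamma>\<close> undoes it because every
  \<open>\<psi> \<in> \<Psi>\<close> vanishes where a component of \<open>\<xi>\<close> at a relevant place is zero. Transported by the Fourier transform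
  \<open>F\<close>, which satisfies \<open>F\<^sup>4 = 1\<close> and hence \<open>F\<^sup>-\<^sup>1 = F\<^sup>3\<close>, this gives the invariance of \<open>\<Phi>\<close> and an inverse of
  \<open>D\<^sup>\<gamma>\<close>. At a prime, inversion reduces to that on \<open>\<int>/p\<^sup>2\<^sup>N\<close>; on the real line it is obtained by Gaussian
  regularization.

  Continuity of a linear \<open>D\<close> for an inductive limit topology may be tested on the constituents: the preimage
  topology under \<open>D\<close> of a locally convex topology is again locally convex. On \<open>\<Phi>(\<real>) \<otimes> E\<close> the operator maps
  \<open>\<phi> \<otimes> b\<close> to \<open>D\<phi> \<otimes> Db\<close>, so it suffices that the real operator is continuous on \<open>\<Phi>(\<real>)\<close>; this holds since it
  is bounded by Schwartz seminorms, division by \<open>\<bar>\<xi>\<bar>\<close> being controlled by the flatness at \<open>0\<close>. Duality then turns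
  the inverse of \<open>D\<^sup>\<gamma>\<close> into surjectivity on \<open>\<Phi>'\<close>.\<close>

section \<open>Schwartz functions and tame operators\<close>

text \<open>A single Fourier transform does not preserve the flatness conditions behind
  \<open>\<Psi>\<close>, but its square, a reflection, does. All composites are grouped accordingly:
  \<open>F\<close> leads from \<open>\<Psi>\<close> to \<open>\<Phi>\<close> and from
  \<open>\<Phi>\<close> back to \<open>\<Psi>\<close>, and three further transforms lead from
  \<open>\<Psi>\<close> to \<open>\<Phi>\<close>.

  Real estimates concern operators \<open>h \<mapsto> L h\<close> and not single functions, so that
  the constants come out independent of \<open>h\<close>, as continuity demands.

  The levels are not nested and the operator on their span is a definite description, so it denotes
  something only because the sum of the levels is direct. The measures are specified by values on
  boxes and might degenerate; the integral formulas therefore live in locales, and the degenerate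
  case is settled separately at the end.

  Nothing is known about an admissible topology on a level except that the inclusions of the
  \<open>\<Phi>(\<real>) \<otimes> E\<close> are continuous. Continuity is therefore checked for one
  product \<open>\<phi> \<otimes> b\<close> at a time, with \<open>E\<close> of dimension one, and
  assembled by continuity of addition in the target.\<close>

lemma nth_deriv_0 [simp]: "nth_deriv 0 f = f"
  by (simp add: nth_deriv_def)

lemma nth_deriv_Suc: "nth_deriv (Suc s) f = (\<lambda>t. vector_derivative (nth_deriv s f) (at t))"
  by (simp add: nth_deriv_def)

text \<open>\<open>nth_deriv\<close> iterates the total function \<open>vector_derivative\<close>,
  so it can be evaluated only where differentiability is known; the chain \<open>G\<close> supplies
  the derivatives together with the proof of differentiability.\<close>

lemma nth_deriv_eqI:
  assumes "G 0 = g" "\<And>s t. (G s has_vector_derivative G (Suc s) t) (at t)"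
  shows "nth_deriv s g = G s"
proof (induction s)
  case (Suc s)
  show ?case
    unfolding nth_deriv_Suc Suc using vector_derivative_at[OF assms(2)] by blast
qed (use assms in simp)

lemma nth_deriv_has_vector_derivative:
  assumes "h \<in> schwartz"
  shows "(nth_deriv s h has_vector_derivative nth_deriv (Suc s) h t) (at t)"
  using assms by (simp add: schwartz_def nth_deriv_Suc vector_derivative_works)

text \<open>\<open>schwartz_seminorm\<close> is a supremum of reals, which carries no information on
  an unbounded range; here the boundedness contained in \<open>schwartz\<close> is brought
  in.\<close>

lemma schwartz_seminorm_bdd:
  assumes "h \<in> schwartz"
  shows "bdd_above (range (\<lambda>t. \<bar>t\<bar> ^ a * norm (nth_deriv b h t)))"
proof -
  have "bounded (range (\<lambda>t. of_real (t ^ a) * nth_deriv b h t))"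
    using assms by (simp add: schwartz_def)
  then show ?thesis
    unfolding bounded_iff bdd_above_def
    by (auto simp: norm_mult power_abs norm_power)
qed

lemma schwartz_seminorm_ge:
  assumes "h \<in> schwartz"
  shows "\<bar>t\<bar> ^ a * norm (nth_deriv b h t) \<le> schwartz_seminorm a b h"
  unfolding schwartz_seminorm_def
  using schwartz_seminorm_bdd[OF assms] by (intro cSUP_upper) auto

lemma schwartz_seminorm_nonneg:
  assumes "h \<in> schwartz"
  shows "0 \<le> schwartz_seminorm a b h"
  using order_trans[OF _ schwartz_seminorm_ge[OF assms, where t=0]] by simp

lemma schwartz_seminorm_le:
  assumes "\<And>t. \<bar>t\<bar> ^ a * norm (nth_deriv b h t) \<le> C"
  shows "schwartz_seminorm a b h \<le> C"
  unfolding schwartz_seminorm_def using assms by (intro cSUP_least) auto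

text \<open>Summing over all orders up to \<open>N\<close> makes the norm increasing in
  \<open>N\<close>, so that finitely many bounds of different orders merge into one of the largest
  order.\<close>

definition schwartz_norm :: "nat \<Rightarrow> (real \<Rightarrow> complex) \<Rightarrow> real" where
  "schwartz_norm N h = (\<Sum>a\<le>N. \<Sum>b\<le>N. schwartz_seminorm a b h)"

lemma schwartz_seminorm_le_norm:
  assumes "h \<in> schwartz" "a \<le> N" "b \<le> N"
  shows "schwartz_seminorm a b h \<le> schwartz_norm N h"
proof -
  have "schwartz_seminorm a b h \<le> (\<Sum>b\<le>N. schwartz_seminorm a b h)"
    using assms schwartz_seminorm_nonneg by (intro member_le_sum) auto
  also have "\<dots> \<le> schwartz_norm N h"
    unfolding schwartz_norm_def
    using assms schwartz_seminorm_nonneg by (intro member_le_sum[where i = a]) (auto intro!: sum_nonneg)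
  finally show ?thesis .
qed

lemma schwartz_norm_nonneg: "h \<in> schwartz \<Longrightarrow> 0 \<le> schwartz_norm N h"
  unfolding schwartz_norm_def by (auto intro!: sum_nonneg schwartz_seminorm_nonneg)

lemma schwartz_norm_mono:
  assumes "h \<in> schwartz" "M \<le> N"
  shows "schwartz_norm M h \<le> schwartz_norm N h"
proof -
  have "schwartz_norm M h \<le> (\<Sum>a\<le>M. \<Sum>b\<le>N. schwartz_seminorm a b h)"
    unfolding schwartz_norm_def
    using assms schwartz_seminorm_nonneg by (intro sum_mono sum_mono2) auto
  also have "\<dots> \<le> schwartz_norm N h"
    unfolding schwartz_norm_def
    using assms schwartz_seminorm_nonneg by (intro sum_mono2) (auto intro!: sum_nonneg)
  finally show ?thesis .
qed

text \<open>The constants are chosen before \<open>h\<close> and \<open>t\<close>. This uniformity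
  is what later yields continuity in the Schwartz topology.\<close>

definition dominated :: "(real \<Rightarrow> complex) set \<Rightarrow> ((real \<Rightarrow> complex) \<Rightarrow> real \<Rightarrow> complex) \<Rightarrow> bool" where
  "dominated X L \<longleftrightarrow> (\<exists>C N. \<forall>h\<in>X. \<forall>t. norm (L h t) \<le> C * schwartz_norm N h)"

text \<open>The norms are nonnegative on Schwartz functions, so \<open>C\<close> can be replaced by
  its absolute value; chaining bounds requires the sign.\<close>

lemma dominatedE:
  assumes "dominated X L" "X \<subseteq> schwartz"
  obtains C N where "C \<ge> 0" "\<And>h t. h \<in> X \<Longrightarrow> norm (L h t) \<le> C * schwartz_norm N h"
proof -
  from assms obtain C N where *: "\<And>h t. h \<in> X \<Longrightarrow> norm (L h t) \<le> C * schwartz_norm N h"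
    unfolding dominated_def by metis
  have "norm (L h t) \<le> \<bar>C\<bar> * schwartz_norm N h" if "h \<in> X" for h t
    using *[OF that] assms(2) that schwartz_norm_nonneg[of h N]
    by (smt (verit, best) mult_right_mono subsetD)
  then show ?thesis using that[of "\<bar>C\<bar>"] by auto
qed

lemma dominated_add:
  assumes "dominated X L" "dominated X M" "X \<subseteq> schwartz"
  shows "dominated X (\<lambda>h t. L h t + M h t)"
proof -
  obtain C N where C: "C \<ge> 0" "\<And>h t. h \<in> X \<Longrightarrow> norm (L h t) \<le> C * schwartz_norm N h"
    by (rule dominatedE[OF assms(1,3)]) blast
  obtain D K where D: "D \<ge> 0" "\<And>h t. h \<in> X \<Longrightarrow> norm (M h t) \<le> D * schwartz_norm K h"
    by (rule dominatedE[OF assms(2,3)]) blast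
  have "norm (L h t + M h t) \<le> (C + D) * schwartz_norm (max N K) h" if h: "h \<in> X" for h t
  proof -
    have hs: "h \<in> schwartz" using h assms by auto
    have "norm (L h t + M h t) \<le> C * schwartz_norm N h + D * schwartz_norm K h"
      using C(2)[OF h] D(2)[OF h] by (meson norm_triangle_mono)
    also have "\<dots> \<le> C * schwartz_norm (max N K) h + D * schwartz_norm (max N K) h"
      using C D schwartz_norm_mono[OF hs] by (intro add_mono mult_left_mono) auto
    finally show ?thesis by (simp add: algebra_simps)
  qed
  then show ?thesis unfolding dominated_def by blast
qed

lemma dominated_cmult:
  assumes "dominated X L" "X \<subseteq> schwartz" "\<And>h t. h \<in> X \<Longrightarrow> norm (M h t) \<le> C * norm (L h t)" "C \<ge> 0"
  shows "dominated X M"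
proof -
  obtain D N where D: "D \<ge> 0" "\<And>h t. h \<in> X \<Longrightarrow> norm (L h t) \<le> D * schwartz_norm N h"
    by (rule dominatedE[OF assms(1,2)]) blast
  have "norm (M h t) \<le> (C * D) * schwartz_norm N h" if "h \<in> X" for h t
    using assms(3)[OF that, of t] mult_left_mono[OF D(2)[OF that, of t] assms(4)] by (simp add: mult.assoc)
  then show ?thesis unfolding dominated_def by blast
qed

lemma dominated_nth_deriv:
  assumes "X \<subseteq> schwartz"
  shows "dominated X (\<lambda>h t. of_real t ^ a * nth_deriv b h t)"
proof -
  have "norm (of_real t ^ a * nth_deriv b h t) \<le> 1 * schwartz_norm (max a b) h" if "h \<in> X" for h t
    using schwartz_seminorm_ge[of h t a b] schwartz_seminorm_le_norm[of h a "max a b" b] that assms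
    by (auto simp: norm_mult norm_power)
  then show ?thesis unfolding dominated_def by blast
qed

text \<open>For linear \<open>L\<close> this is continuity into the Schwartz space, phrased by
  seminorms: each seminorm of \<open>L h\<close> is bounded by a multiple of some
  \<open>schwartz_norm N h\<close>.\<close>

definition tame :: "(real \<Rightarrow> complex) set \<Rightarrow> ((real \<Rightarrow> complex) \<Rightarrow> real \<Rightarrow> complex) \<Rightarrow> bool" where
  "tame X L \<longleftrightarrow> (\<forall>h\<in>X. L h \<in> schwartz) \<and>
     (\<forall>a b. dominated X (\<lambda>h t. of_real t ^ a * nth_deriv b (L h) t))"

text \<open>Coinduction: a class of operators that is closed under differentiation and consists of
  rapidly decreasing operators consists of tame operators.\<close>

lemma tame_coinduct:
  assumes "L \<in> P"
    and bd: "\<And>L a. L \<in> P \<Longrightarrow> dominated X (\<lambda>h t. of_real t ^ a * L h t)"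
    and deriv: "\<And>L. L \<in> P \<Longrightarrow> \<exists>L'\<in>P. \<forall>h\<in>X. \<forall>t. (L h has_vector_derivative L' h t) (at t)"
  shows "tame X L"
proof -
  \<comment> \<open>\<open>d\<close> chooses for each member of \<open>P\<close> its derivative in
    \<open>P\<close>. Its iterates stay in \<open>P\<close> and compute all higher derivatives, so
    the decay bound for \<open>P\<close> applies to each of them.\<close>
  obtain d where d: "\<And>L. L \<in> P \<Longrightarrow> d L \<in> P"
    "\<And>L h t. L \<in> P \<Longrightarrow> h \<in> X \<Longrightarrow> (L h has_vector_derivative d L h t) (at t)"
    using bchoice[of P "\<lambda>L L'. L' \<in> P \<and> (\<forall>h\<in>X. \<forall>t. (L h has_vector_derivative L' h t) (at t))"] deriv
    by blast
  have dn: "(d ^^ s) L \<in> P" for s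
    by (induction s) (use d assms in auto)
  have eq: "nth_deriv s (L h) = (d ^^ s) L h" if "h \<in> X" for s h
    by (rule nth_deriv_eqI[where G = "\<lambda>s. (d ^^ s) L h"]) (use d(2)[OF dn that] in auto)
  have dom: "dominated X (\<lambda>h t. of_real t ^ a * nth_deriv b (L h) t)" for a b
    using bd[OF dn[of b], of a] unfolding dominated_def by (auto simp: eq)
  have "L h \<in> schwartz" if h: "h \<in> X" for h
  proof -
    have "nth_deriv s (L h) differentiable at t" for s t
      using d(2)[OF dn h, of s t] by (simp add: eq[OF h] differentiableI_vector)
    moreover have "bounded (range (\<lambda>t. of_real (t ^ a) * nth_deriv b (L h) t))" for a b
      using dom[of a b] h unfolding dominated_def bounded_iff by fastforce
    ultimately show ?thesis by (simp add: schwartz_def)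
  qed
  then show ?thesis using dom by (simp add: tame_def)
qed

lemma tame_seminorm_le:
  assumes "tame X L" "X \<subseteq> schwartz"
  obtains C N where "C \<ge> 0" "\<And>h. h \<in> X \<Longrightarrow> schwartz_seminorm a b (L h) \<le> C * schwartz_norm N h"
proof -
  have "dominated X (\<lambda>h t. of_real t ^ a * nth_deriv b (L h) t)"
    using assms by (simp add: tame_def)
  then obtain C N where C: "C \<ge> 0"
    "\<And>h t. h \<in> X \<Longrightarrow> norm (of_real t ^ a * nth_deriv b (L h) t) \<le> C * schwartz_norm N h"
    by (rule dominatedE[OF _ assms(2)]) blast
  have "schwartz_seminorm a b (L h) \<le> C * schwartz_norm N h" if "h \<in> X" for h
    using C(2)[OF that] by (intro schwartz_seminorm_le) (simp add: norm_mult norm_power)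
  then show ?thesis by (rule that[OF C(1)])
qed

lemma tame_norm_le:
  assumes "tame X L" "X \<subseteq> schwartz"
  obtains C N where "C \<ge> 0" "\<And>h. h \<in> X \<Longrightarrow> schwartz_norm K (L h) \<le> C * schwartz_norm N h"
proof -
  have "\<exists>C N. C \<ge> 0 \<and> (\<forall>h\<in>X. schwartz_seminorm a b (L h) \<le> C * schwartz_norm N h)" for a b
    by (rule tame_seminorm_le[OF assms, of a b]) blast
  then obtain C N where CN: "\<And>a b. C a b \<ge> (0::real)"
    "\<And>a b h. h \<in> X \<Longrightarrow> schwartz_seminorm a b (L h) \<le> C a b * schwartz_norm (N a b) h"
    by metis
  \<comment> \<open>The sum of all the orders serves as a common upper bound for them.\<close>
  define M where "M = (\<Sum>a\<le>K. \<Sum>b\<le>K. N a b)"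
  have NM: "N a b \<le> M" if "a \<le> K" "b \<le> K" for a b
  proof -
    have "N a b \<le> (\<Sum>b\<le>K. N a b)" using that by (intro member_le_sum) auto
    also have "\<dots> \<le> M" unfolding M_def using that by (intro member_le_sum[where i = a]) auto
    finally show ?thesis .
  qed
  have "schwartz_norm K (L h) \<le> (\<Sum>a\<le>K. \<Sum>b\<le>K. C a b) * schwartz_norm M h" if h: "h \<in> X" for h
  proof -
    have hs: "h \<in> schwartz" using h assms by auto
    have "schwartz_norm K (L h) \<le> (\<Sum>a\<le>K. \<Sum>b\<le>K. C a b * schwartz_norm M h)"
      unfolding schwartz_norm_def[of K]
    proof (intro sum_mono)
      fix a b assume "a \<in> {..K}" "b \<in> {..K}"
      then show "schwartz_seminorm a b (L h) \<le> C a b * schwartz_norm M h"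
        using CN(2)[OF h, of a b] mult_left_mono[OF schwartz_norm_mono[OF hs NM] CN(1)] 
        by (meson atMost_iff order_trans)
    qed
    then show ?thesis by (simp add: sum_distrib_right)
  qed
  moreover have "(\<Sum>a\<le>K. \<Sum>b\<le>K. C a b) \<ge> 0" using CN by (intro sum_nonneg) auto
  ultimately show ?thesis by (rule that[rotated])
qed

lemma tame_compose:
  assumes "tame X L" "tame Y M" "X \<subseteq> schwartz" "Y \<subseteq> schwartz" "\<And>h. h \<in> X \<Longrightarrow> L h \<in> Y"
  shows "tame X (\<lambda>h. M (L h))"
  unfolding tame_def
proof (intro conjI ballI allI)
  show "M (L h) \<in> schwartz" if "h \<in> X" for h using that assms by (auto simp: tame_def)
  fix a b
  have "dominated Y (\<lambda>h t. of_real t ^ a * nth_deriv b (M h) t)"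
    using assms by (simp add: tame_def)
  then obtain C K where C: "C \<ge> 0"
    "\<And>h t. h \<in> Y \<Longrightarrow> norm (of_real t ^ a * nth_deriv b (M h) t) \<le> C * schwartz_norm K h"
    by (rule dominatedE[OF _ assms(4)]) blast
  obtain D N where D: "D \<ge> 0" "\<And>h. h \<in> X \<Longrightarrow> schwartz_norm K (L h) \<le> D * schwartz_norm N h"
    by (rule tame_norm_le[OF assms(1,3), of K]) blast
  have "norm (of_real t ^ a * nth_deriv b (M (L h)) t) \<le> (C * D) * schwartz_norm N h" if "h \<in> X" for h t
    using C(2)[OF assms(5)[OF that], of t] mult_left_mono[OF D(2)[OF that] C(1)]
    by (simp add: mult.assoc)
  then show "dominated X (\<lambda>h t. of_real t ^ a * nth_deriv b (M (L h)) t)"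
    unfolding dominated_def by blast
qed

text \<open>Differential operators with polynomial coefficients, the Weyl algebra acting on Schwartz
  functions. Multiplication by \<open>t\<close> is applied from outside only; by the Leibniz rule
  the class is still closed under differentiation, as \<open>tame_coinduct\<close> requires.\<close>

inductive_set poly_diff_ops :: "((real \<Rightarrow> complex) \<Rightarrow> real \<Rightarrow> complex) set" where
  deriv: "nth_deriv s \<in> poly_diff_ops"
| cmult: "L \<in> poly_diff_ops \<Longrightarrow> (\<lambda>h t. c * L h t) \<in> poly_diff_ops"
| times: "L \<in> poly_diff_ops \<Longrightarrow> (\<lambda>h t. of_real t * L h t) \<in> poly_diff_ops"
| add: "L \<in> poly_diff_ops \<Longrightarrow> M \<in> poly_diff_ops \<Longrightarrow> (\<lambda>h t. L h t + M h t) \<in> poly_diff_ops"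

text \<open>Multiplication by \<open>t\<close> raises the outer power by one; keeping
  \<open>a\<close> arbitrary in the induction absorbs it.\<close>

lemma poly_diff_ops_dominated:
  assumes "L \<in> poly_diff_ops"
  shows "dominated schwartz (\<lambda>h t. of_real t ^ a * L h t)"
  using assms
proof (induction arbitrary: a)
  case (deriv s)
  show ?case by (rule dominated_nth_deriv) simp
next
  case (cmult L c)
  show ?case by (rule dominated_cmult[OF cmult.IH[of a], where C = "norm c"]) (auto simp: norm_mult)
next
  case (times L)
  show ?case using times.IH[of "Suc a"] by (simp add: mult_ac)
next
  case (add L M)
  show ?case using dominated_add[OF add.IH[of a]] by (simp add: distrib_left)
qed

lemma poly_diff_ops_deriv:
  assumes "L \<in> poly_diff_ops"
  shows "\<exists>L'\<in>poly_diff_ops. \<forall>h\<in>schwartz. \<forall>t. (L h has_vector_derivative L' h t) (at t)"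
  using assms
proof induction
  case (deriv s)
  show ?case
    by (rule bexI[of _ "nth_deriv (Suc s)"])
      (auto intro: nth_deriv_has_vector_derivative poly_diff_ops.deriv)
next
  case (cmult L c)
  then obtain L' where L': "L' \<in> poly_diff_ops" "\<And>h t. h \<in> schwartz \<Longrightarrow> (L h has_vector_derivative L' h t) (at t)"
    by auto
  show ?case
    by (rule bexI[of _ "\<lambda>h t. c * L' h t"]) (simp_all add: L' poly_diff_ops.cmult has_vector_derivative_mult_right)
next
  case (times L)
  then obtain L' where L': "L' \<in> poly_diff_ops" "\<And>h t. h \<in> schwartz \<Longrightarrow> (L h has_vector_derivative L' h t) (at t)"
    by auto
  show ?case
  proof (rule bexI[of _ "\<lambda>h t. of_real t * L' h t + L h t"])
    show "(\<lambda>h t. of_real t * L' h t + L h t) \<in> poly_diff_ops"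
      by (intro poly_diff_ops.add poly_diff_ops.times L' times)
    show "\<forall>h\<in>schwartz. \<forall>t. ((\<lambda>t. of_real t * L h t) has_vector_derivative of_real t * L' h t + L h t) (at t)"
    proof (intro ballI allI)
      fix h :: "real \<Rightarrow> complex" and t :: real assume "h \<in> schwartz"
      then show "((\<lambda>t. of_real t * L h t) has_vector_derivative of_real t * L' h t + L h t) (at t)"
        using has_vector_derivative_mult[OF has_vector_derivative_of_real[OF DERIV_ident] L'(2)[of h t]]
        by simp
    qed
  qed
next
  case (add L M)
  then obtain L' M' where L': "L' \<in> poly_diff_ops" "\<And>h t. h \<in> schwartz \<Longrightarrow> (L h has_vector_derivative L' h t) (at t)"
    and M': "M' \<in> poly_diff_ops" "\<And>h t. h \<in> schwartz \<Longrightarrow> (M h has_vector_derivative M' h t) (at t)"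
    by auto
  show ?case
    by (rule bexI[of _ "\<lambda>h t. L' h t + M' h t"])
      (simp_all add: L' M' poly_diff_ops.add has_vector_derivative_add)
qed

lemma tame_poly_diff_ops: "L \<in> poly_diff_ops \<Longrightarrow> tame schwartz L"
  by (rule tame_coinduct[where P = poly_diff_ops])
    (simp_all add: poly_diff_ops_dominated poly_diff_ops_deriv)

lemma poly_diff_ops_schwartz: "L \<in> poly_diff_ops \<Longrightarrow> h \<in> schwartz \<Longrightarrow> L h \<in> schwartz"
  using tame_poly_diff_ops by (auto simp: tame_def)

section \<open>The Fourier transform on the real line\<close>

lemma (in pair_sigma_finite) integrable_times_complex:
  fixes f :: "'a \<Rightarrow> complex" and g :: "'b \<Rightarrow> complex"
  assumes "integrable M1 f" "integrable M2 g"
  shows "integrable (M1 \<Otimes>\<^sub>M M2) (\<lambda>z. f (fst z) * g (snd z))"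
proof (rule Fubini_integrable)
  have [measurable]: "f \<in> borel_measurable M1" "g \<in> borel_measurable M2" using assms by auto
  show "(\<lambda>z. f (fst z) * g (snd z)) \<in> borel_measurable (M1 \<Otimes>\<^sub>M M2)" by measurable
  have "integrable M1 (\<lambda>x. norm (f x) * (\<integral>y. norm (g y) \<partial>M2))"
    using assms by (intro integrable_mult_left integrable_norm)
  then show "integrable M1 (\<lambda>x. \<integral>y. norm (f (fst (x, y)) * g (snd (x, y))) \<partial>M2)"
    by (simp add: norm_mult)
  show "AE x in M1. integrable M2 (\<lambda>y. f (fst (x, y)) * g (snd (x, y)))"
    using assms by simp
qed

lemma (in pair_sigma_finite) integral_times_complex:
  fixes f :: "'a \<Rightarrow> complex" and g :: "'b \<Rightarrow> complex"
  assumes "integrable M1 f" "integrable M2 g"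
  shows "(\<integral>z. f (fst z) * g (snd z) \<partial>(M1 \<Otimes>\<^sub>M M2)) = integral\<^sup>L M1 f * integral\<^sup>L M2 g"
  using integral_fst'[OF integrable_times_complex[OF assms]] by simp

section \<open>Integrability of Schwartz functions and smoothness of their transforms\<close>

lemma schwartz_continuous:
  assumes "h \<in> schwartz" shows "continuous_on UNIV h"
  using nth_deriv_has_vector_derivative[OF assms, of 0]
  by (auto intro!: has_vector_derivative_continuous continuous_at_imp_continuous_on)

lemma schwartz_measurable [measurable_dest]: "h \<in> schwartz \<Longrightarrow> h \<in> borel_measurable borel"
  by (rule borel_measurable_continuous_onI[OF schwartz_continuous])

lemma integrable_inverse_1_plus_square': "integrable lborel (\<lambda>t::real. inverse (1 + t\<^sup>2))"
  using integrable_inverse_1_plus_square by (simp add: set_integrable_def)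

text \<open>The seminorms of orders 0 and 2 in \<open>t\<close> add up to a bound for
  \<open>(1 + t^2) * norm (h t)\<close>. The majorant is integrable with integral a multiple of
  \<open>pi\<close>, the constant in \<open>norm_real_fourier_le\<close>.\<close>

lemma schwartz_decay:
  assumes "h \<in> schwartz"
  obtains C where "C \<ge> 0" "\<And>t. norm (h t) \<le> C * inverse (1 + t\<^sup>2)"
proof -
  define C where "C = schwartz_seminorm 0 0 h + schwartz_seminorm 2 0 h"
  have "norm (h t) \<le> C * inverse (1 + t\<^sup>2)" for t
  proof -
    have "(1 + t\<^sup>2) * norm (h t) \<le> C"
      using schwartz_seminorm_ge[OF assms, of t 0 0] schwartz_seminorm_ge[OF assms, of t 2 0]
      by (simp add: C_def algebra_simps)
    moreover have "1 + t\<^sup>2 > 0" by (simp add: add_pos_nonneg)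
    ultimately show ?thesis by (simp add: field_simps)
  qed
  then show ?thesis
    using that[of C] schwartz_seminorm_nonneg[OF assms] by (auto simp: C_def)
qed

lemma schwartz_integrable:
  assumes "h \<in> schwartz" shows "integrable lborel h"
proof -
  obtain C where C: "C \<ge> 0" "\<And>t. norm (h t) \<le> C * inverse (1 + t\<^sup>2)"
    by (rule schwartz_decay[OF assms]) blast
  show ?thesis
  proof (rule Bochner_Integration.integrable_bound)
    show "integrable lborel (\<lambda>t. C * inverse (1 + t\<^sup>2))"
      by (intro integrable_mult_right integrable_inverse_1_plus_square')
    have "norm (h t) \<le> norm (C * inverse (1 + t\<^sup>2))" for t
      using C(2)[of t] by (smt (verit) real_norm_def)
    then show "AE t in lborel. norm (h t) \<le> norm (C * inverse (1 + t\<^sup>2))"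
      by blast
  qed (use schwartz_measurable[OF assms] in simp)
qed

lemma real_char_eq: "real_char t = iexp (2 * pi * t)"
  by (simp add: real_char_def mult_ac)

lemma norm_real_char [simp]: "norm (real_char t) = 1"
  by (simp add: real_char_eq)

lemma real_char_add: "real_char (s + t) = real_char s * real_char t"
  by (simp add: real_char_def algebra_simps exp_add)

lemma cnj_real_char: "cnj (real_char t) = real_char (- t)"
  by (simp add: real_char_def exp_cnj)

lemma real_char_measurable [measurable]: "real_char \<in> borel_measurable borel"
  unfolding real_char_def by (intro borel_measurable_continuous_onI continuous_intros)

lemma integrable_real_char_times:
  assumes "integrable lborel h"
  shows "integrable lborel (\<lambda>x. real_char (\<xi> * x) * h x)"
  by (rule Bochner_Integration.integrable_bound[OF assms])
    (use assms in \<open>auto simp: norm_mult\<close>)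

lemma real_fourier_add:
  assumes "integrable lborel g" "integrable lborel h"
  shows "real_fourier (\<lambda>t. g t + h t) \<xi> = real_fourier g \<xi> + real_fourier h \<xi>"
  using assms by (simp add: real_fourier_def distrib_left integrable_real_char_times)

lemma real_fourier_cmult: "real_fourier (\<lambda>t. c * h t) \<xi> = c * real_fourier h \<xi>"
proof -
  have "(\<lambda>x. real_char (\<xi> * x) * (c * h x)) = (\<lambda>x. c * (real_char (\<xi> * x) * h x))"
    by (simp add: fun_eq_iff)
  then show ?thesis by (simp add: real_fourier_def)
qed

lemma norm_real_fourier_le:
  assumes "integrable lborel h" "\<And>t. norm (h t) \<le> C * inverse (1 + t\<^sup>2)"
  shows "norm (real_fourier h \<xi>) \<le> C * pi"
proof -
  have pi: "(\<integral>t. inverse (1 + t\<^sup>2) \<partial>lborel) = pi"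
    using LBINT_inverse_1_plus_square
    by (simp add: interval_lebesgue_integral_def set_lebesgue_integral_def)
  have "norm (real_fourier h \<xi>) \<le> (\<integral>t. C * inverse (1 + t\<^sup>2) \<partial>lborel)"
    unfolding real_fourier_def
    using assms by (intro Bochner_Integration.integral_norm_bound_integral integrable_mult_right
        integrable_inverse_1_plus_square' integrable_real_char_times) (auto simp: norm_mult)
  then show ?thesis using pi by simp
qed

lemma schwartz_tendsto_0:
  assumes "h \<in> schwartz"
  shows "(h \<longlongrightarrow> 0) at_top" "(h \<longlongrightarrow> 0) at_bot"
proof -
  obtain C where C: "C \<ge> 0" "\<And>t. norm (h t) \<le> C * inverse (1 + t\<^sup>2)"
    by (rule schwartz_decay[OF assms]) blast
  have "((\<lambda>t::real. C * inverse (1 + t\<^sup>2)) \<longlongrightarrow> 0) at_top" by real_asymp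
  then show "(h \<longlongrightarrow> 0) at_top"
    by (rule Lim_null_comparison[rotated]) (use C in auto)
  have "((\<lambda>t::real. C * inverse (1 + t\<^sup>2)) \<longlongrightarrow> 0) at_bot" by real_asymp
  then show "(h \<longlongrightarrow> 0) at_bot"
    by (rule Lim_null_comparison[rotated]) (use C in auto)
qed

lemma real_char_has_vector_derivative:
  "((\<lambda>x. real_char (\<xi> * x)) has_vector_derivative (2 * pi * \<xi>) * \<i> * real_char (\<xi> * x)) (at x)"
proof -
  have "((\<lambda>x. iexp (2 * pi * \<xi> * x)) has_vector_derivative (2 * pi * \<xi>) *\<^sub>R (\<i> * iexp (2 * pi * \<xi> * x))) (at x)"
    by (rule vector_diff_chain_at[of "\<lambda>x. 2 * pi * \<xi> * x", unfolded o_def])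
      (auto intro!: derivative_eq_intros has_vector_derivative_iexp)
  then show ?thesis by (simp add: real_char_eq mult_ac scaleR_conv_of_real)
qed

text \<open>Integration by parts: the derivative of \<open>real_char (\<xi> * x) * h x\<close> has
  integral zero over the line, because this product tends to 0 at both ends.\<close>

lemma real_fourier_nth_deriv_1:
  assumes h: "h \<in> schwartz" "h' \<in> schwartz" and d: "\<And>t. (h has_vector_derivative h' t) (at t)"
  shows "real_fourier h' \<xi> = - 2 * pi * \<i> * \<xi> * real_fourier h \<xi>"
proof -
  let ?e = "\<lambda>x. real_char (\<xi> * x)"
  let ?F = "\<lambda>x. ?e x * h x" and ?f = "\<lambda>x. ?e x * h' x + (2 * pi * \<xi>) * \<i> * ?e x * h x"
  have i: "integrable lborel (\<lambda>x. ?e x * h x)" "integrable lborel (\<lambda>x. ?e x * h' x)"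
    using integrable_real_char_times[OF schwartz_integrable] h by blast+
  then have if': "integrable lborel ?f" by (simp add: mult.assoc)
  have D: "(?F has_vector_derivative ?f x) (at x)" for x
    using has_vector_derivative_mult[OF real_char_has_vector_derivative d, of \<xi> x] by simp
  have ce: "isCont ?e x" for x
    using real_char_has_vector_derivative has_vector_derivative_continuous by blast
  have ch: "isCont h x" "isCont h' x" for x
    using schwartz_continuous[OF h(1)] schwartz_continuous[OF h(2)] by (auto simp: continuous_on_eq_continuous_at)
  have lim: "(?F \<longlongrightarrow> 0) G" if "(h \<longlongrightarrow> 0) G" for G
    using that by (simp add: tendsto_norm_zero_iff[symmetric, where f = ?F] norm_mult tendsto_norm_zero_iff)
  have "(LBINT x=-\<infinity>..\<infinity>. ?f x) = 0 - 0"
  proof (rule interval_integral_FTC_integrable[where F = ?F])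
    show "((?F \<circ> real_of_ereal) \<longlongrightarrow> 0) (at_right (- \<infinity>))"
      using lim[OF schwartz_tendsto_0(2)[OF h(1)]] by (simp add: ereal_tendsto_simps)
    show "((?F \<circ> real_of_ereal) \<longlongrightarrow> 0) (at_left \<infinity>)"
      using lim[OF schwartz_tendsto_0(1)[OF h(1)]] by (simp add: ereal_tendsto_simps)
  qed (use D ce ch if' in \<open>auto simp: set_integrable_def intro!: continuous_intros\<close>)
  then have "(\<integral>x. ?f x \<partial>lborel) = 0"
    by (simp add: interval_lebesgue_integral_def set_lebesgue_integral_def)
  moreover have "(\<integral>x. ?f x \<partial>lborel) = real_fourier h' \<xi> + (2 * pi * \<xi>) * \<i> * real_fourier h \<xi>"
    using i by (simp add: real_fourier_def mult.assoc)
  ultimately show ?thesis by (simp add: algebra_simps eq_neg_iff_add_eq_0)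
qed

text \<open>The first-order Taylor remainder of the character at \<open>u * t\<close> is at most
  \<open>2 * pi^2 * u^2 * t^2\<close>. Integrated against \<open>h\<close> it gives an error
  quadratic in \<open>u\<close>, with the second absolute moment \<open>K\<close> in the
  constant.\<close>

lemma real_fourier_has_vector_derivative:
  assumes h: "h \<in> schwartz"
  shows "(real_fourier h has_vector_derivative
    real_fourier (\<lambda>t. 2 * pi * \<i> * (of_real t * h t)) \<xi>) (at \<xi>)"
proof -
  have "(\<lambda>h t. of_real t * (of_real t * h t)) \<in> poly_diff_ops" "(\<lambda>h t. of_real t * h t) \<in> poly_diff_ops"
    using poly_diff_ops.times[OF poly_diff_ops.times[OF poly_diff_ops.deriv[of 0]]]
       poly_diff_ops.times[OF poly_diff_ops.deriv[of 0]] by simp_all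
  from poly_diff_ops_schwartz[OF this(1) h] poly_diff_ops_schwartz[OF this(2) h]
  have s: "(\<lambda>t. of_real t * h t) \<in> schwartz" "(\<lambda>t. of_real t * (of_real t * h t)) \<in> schwartz"
    by simp_all
  define K where "K = (\<integral>t. norm (of_real t * (of_real t * h t)) \<partial>lborel)"
  let ?D = "real_fourier (\<lambda>t. 2 * pi * \<i> * (of_real t * h t)) \<xi>"
  note int = integrable_real_char_times[OF schwartz_integrable]
  have bound: "norm (real_fourier h (\<xi> + u) - real_fourier h \<xi> - u *\<^sub>R ?D) \<le> 2 * pi\<^sup>2 * u\<^sup>2 * K" for u
  proof -
    let ?g = "\<lambda>t. real_char ((\<xi> + u) * t) * h t - real_char (\<xi> * t) * h t
       - u *\<^sub>R (real_char (\<xi> * t) * (2 * pi * \<i> * (of_real t * h t)))"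
    have iD: "integrable lborel (\<lambda>t. real_char (\<xi> * t) * (2 * pi * \<i> * (of_real t * h t)))"
      using int[OF s(1), of \<xi>] integrable_mult_right[of "2 * pi * \<i>" lborel "\<lambda>t. real_char (\<xi> * t) * (of_real t * h t)"] 
      by (simp add: mult_ac)
    have "real_fourier h (\<xi> + u) - real_fourier h \<xi> - u *\<^sub>R ?D = (\<integral>t. ?g t \<partial>lborel)"
      unfolding real_fourier_def using int[OF h] iD by simp
    also have "norm \<dots> \<le> (\<integral>t. 2 * pi\<^sup>2 * u\<^sup>2 * norm (of_real t * (of_real t * h t)) \<partial>lborel)"
    proof (rule Bochner_Integration.integral_norm_bound_integral)
      show "integrable lborel ?g" using int[OF h] iD by simp
      show "integrable lborel (\<lambda>t. 2 * pi\<^sup>2 * u\<^sup>2 * norm (complex_of_real t * (complex_of_real t * h t)))"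
        using schwartz_integrable[OF s(2)] by (intro integrable_mult_right integrable_norm)
      fix t
      have "?g t = real_char (\<xi> * t) * h t * (iexp (2 * pi * (u * t)) - (\<Sum>k\<le>1. (\<i> * (2 * pi * (u * t)))^k / fact k))"
      proof -
        have "iexp (2 * pi * (u * t)) = real_char (u * t)" by (simp only: real_char_eq)
        then show ?thesis by (simp add: distrib_right real_char_add) (simp add: algebra_simps scaleR_conv_of_real)
      qed
      also have "norm \<dots> \<le> norm (h t) * (\<bar>2 * pi * (u * t)\<bar>^(Suc 1) / fact (Suc 1))"
        using iexp_approx1[of "2 * pi * (u * t)" 1] by (simp add: norm_mult mult_left_mono)
      also have "\<dots> = 2 * pi\<^sup>2 * u\<^sup>2 * norm (of_real t * (of_real t * h t))"
        by (simp add: norm_mult power2_eq_square abs_mult field_simps)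
      finally show "norm (?g t) \<le> 2 * pi\<^sup>2 * u\<^sup>2 * norm (of_real t * (of_real t * h t))" .
    qed
    also have "\<dots> = 2 * pi\<^sup>2 * u\<^sup>2 * K" by (simp add: K_def)
    finally show ?thesis .
  qed
  have "((\<lambda>u. norm (real_fourier h (\<xi> + u) - real_fourier h \<xi> - u *\<^sub>R ?D) / norm u) \<longlongrightarrow> 0) (at 0)"
  proof (rule Lim_null_comparison)
    show "((\<lambda>u. 2 * pi\<^sup>2 * \<bar>u\<bar> * K) \<longlongrightarrow> 0) (at 0)"
      by (auto intro!: tendsto_eq_intros)
    have "norm (norm (real_fourier h (\<xi> + u) - real_fourier h \<xi> - u *\<^sub>R ?D) / norm u) \<le> 2 * pi\<^sup>2 * \<bar>u\<bar> * K"
      if "u \<noteq> 0" for u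
      using bound[of u] that by (simp add: divide_simps power2_eq_square abs_mult_self_eq mult_ac)
    then show "\<forall>\<^sub>F u in at 0. norm (norm (real_fourier h (\<xi> + u) - real_fourier h \<xi> - u *\<^sub>R ?D) / norm u) \<le> 2 * pi\<^sup>2 * \<bar>u\<bar> * K"
      by (auto simp: eventually_at_filter)
  qed
  then show ?thesis
    unfolding has_vector_derivative_def has_derivative_at by (simp add: bounded_linear_scaleR_left)
qed

text \<open>The class for \<open>tame_coinduct\<close> consists of the transforms of
  \<open>poly_diff_ops\<close>. Differentiating a transform multiplies the inner operator by
  \<open>2 * pi * \<i> * t\<close>, and multiplying a transform by its variable differentiates the
  inner operator up to a constant, so both stay in the class.\<close>

lemma tame_real_fourier: "tame schwartz real_fourier"
proof -
  define P where "P = {(\<lambda>h. real_fourier (L h)) | L. L \<in> poly_diff_ops}"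
  have "real_fourier \<in> P"
  proof -
    have "real_fourier = (\<lambda>h. real_fourier (nth_deriv 0 h))" by (simp add: fun_eq_iff)
    then show ?thesis unfolding P_def using poly_diff_ops.deriv[of 0] by blast
  qed
  moreover have "dominated schwartz (\<lambda>h t. of_real t ^ a * real_fourier (L h) t)" if "L \<in> poly_diff_ops" for L a
    using that
  proof (induction a arbitrary: L)
    case 0
    \<comment> \<open>The operator \<open>(1 + t^2) L\<close> belongs to the class as well; its
      bound makes the integrand decay like \<open>1 / (1 + t^2)\<close> with a constant proportional
      to \<open>schwartz_norm N h\<close>.\<close>
    have "dominated schwartz (\<lambda>h t. L h t + of_real t * (of_real t * L h t))"
      using poly_diff_ops_dominated[OF poly_diff_ops.add[OF 0 poly_diff_ops.times[OF poly_diff_ops.times[OF 0]]], of 0]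
      by simp
    then obtain C N where C: "C \<ge> 0"
      "\<And>h t. h \<in> schwartz \<Longrightarrow> norm (L h t + of_real t * (of_real t * L h t)) \<le> C * schwartz_norm N h"
      by (rule dominatedE[OF _ order_refl]) blast
    have "norm (real_fourier (L h) t) \<le> (C * pi) * schwartz_norm N h" if h: "h \<in> schwartz" for h t
    proof -
      have "norm (L h t) \<le> C * schwartz_norm N h * inverse (1 + t\<^sup>2)" for t
      proof -
        have "L h t + of_real t * (of_real t * L h t) = of_real (1 + t\<^sup>2) * L h t"
          by (simp add: algebra_simps power2_eq_square)
        moreover have "norm (of_real (1 + t\<^sup>2) * L h t) = (1 + t\<^sup>2) * norm (L h t)"
          unfolding norm_mult norm_of_real by simp
        ultimately have "(1 + t\<^sup>2) * norm (L h t) \<le> C * schwartz_norm N h"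
          using C(2)[OF h, of t] by simp
        moreover have "1 + t\<^sup>2 > 0" by (simp add: add_pos_nonneg)
        ultimately show ?thesis by (simp add: field_simps)
      qed
      then have "norm (real_fourier (L h) t) \<le> C * schwartz_norm N h * pi"
        by (intro norm_real_fourier_le schwartz_integrable poly_diff_ops_schwartz[OF "0.prems" h])
      then show ?thesis by (simp add: mult_ac)
    qed
    then have "dominated schwartz (\<lambda>h t. real_fourier (L h) t)"
      unfolding dominated_def by blast
    then show ?case by simp
  next
    case (Suc a)
    obtain L' where L': "L' \<in> poly_diff_ops"
      "\<And>h t. h \<in> schwartz \<Longrightarrow> (L h has_vector_derivative L' h t) (at t)"
      using poly_diff_ops_deriv[OF Suc.prems] by blast
    \<comment> \<open>\<open>?c\<close> is the inverse of \<open>- 2 * pi * \<i>\<close>, the factor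
      from \<open>real_fourier_nth_deriv_1\<close>; each power of \<open>t\<close> is paid for by
      one derivative of \<open>L h\<close>.\<close>
    let ?c = "\<i> / (2 * pi)"
    have "dominated schwartz (\<lambda>h t. of_real t ^ a * real_fourier (\<lambda>t. ?c * L' h t) t)"
      by (rule Suc.IH[OF poly_diff_ops.cmult[OF L'(1)]])
    moreover have "of_real t * real_fourier (L h) t = real_fourier (\<lambda>t. ?c * L' h t) t" if "h \<in> schwartz" for h t
      unfolding real_fourier_cmult
      using real_fourier_nth_deriv_1[OF poly_diff_ops_schwartz[OF Suc.prems that]
          poly_diff_ops_schwartz[OF L'(1) that] L'(2)[OF that], of t]
      by (simp add: field_simps)
    ultimately show ?case
      unfolding dominated_def by (simp add: mult.assoc power_Suc2 del: power_Suc)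
  qed
  moreover have "\<exists>L'\<in>P. \<forall>h\<in>schwartz. \<forall>t. (real_fourier (L h) has_vector_derivative L' h t) (at t)"
    if "L \<in> poly_diff_ops" for L
  proof (rule bexI[of _ "\<lambda>h. real_fourier (\<lambda>t. 2 * pi * \<i> * (of_real t * L h t))"])
    show "\<forall>h\<in>schwartz. \<forall>t. (real_fourier (L h) has_vector_derivative
        real_fourier (\<lambda>t. 2 * pi * \<i> * (of_real t * L h t)) t) (at t)"
      using real_fourier_has_vector_derivative[OF poly_diff_ops_schwartz[OF that]] by blast
    show "(\<lambda>h. real_fourier (\<lambda>t. 2 * pi * \<i> * (of_real t * L h t))) \<in> P"
      unfolding P_def using poly_diff_ops.cmult[OF poly_diff_ops.times[OF that], of "2 * pi * \<i>"] by auto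
  qed
  ultimately show ?thesis
    by (intro tame_coinduct[where P = P]) (auto simp: P_def)
qed

lemma real_fourier_schwartz: "h \<in> schwartz \<Longrightarrow> real_fourier h \<in> schwartz"
  using tame_real_fourier by (simp add: tame_def)

section \<open>Fourier inversion on the real line\<close>

lemma real_fourier_gaussian:
  assumes "\<epsilon> > 0"
  shows "(\<integral>x. real_char (x * y) * of_real (exp (- (\<epsilon> * x)\<^sup>2 / 2)) \<partial>lborel)
    = of_real (sqrt (2 * pi) / \<epsilon> * exp (- (2 * pi * y / \<epsilon>)\<^sup>2 / 2))"
proof -
  \<comment> \<open>Rescaling by \<open>1 / \<epsilon>\<close> produces the standard normal density,
    whose characteristic function is known.\<close>
  have "(\<integral>x. real_char (x * y) * of_real (exp (- (\<epsilon> * x)\<^sup>2 / 2)) \<partial>lborel)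
     = \<bar>1 / \<epsilon>\<bar> *\<^sub>R (\<integral>x. real_char ((0 + 1 / \<epsilon> * x) * y) * of_real (exp (- (\<epsilon> * (0 + 1 / \<epsilon> * x))\<^sup>2 / 2)) \<partial>lborel)"
    using assms by (intro lborel_integral_real_affine) simp
  also have "(\<lambda>x. real_char ((0 + 1 / \<epsilon> * x) * y) * of_real (exp (- (\<epsilon> * (0 + 1 / \<epsilon> * x))\<^sup>2 / 2)))
      = (\<lambda>x. of_real (sqrt (2 * pi)) * (std_normal_density x *\<^sub>R iexp ((2 * pi * y / \<epsilon>) * x)))"
    using assms by (auto simp: fun_eq_iff std_normal_density_def real_char_eq scaleR_conv_of_real field_simps)
  also have "(\<integral>x. of_real (sqrt (2 * pi)) * (std_normal_density x *\<^sub>R iexp ((2 * pi * y / \<epsilon>) * x)) \<partial>lborel)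
      = of_real (sqrt (2 * pi)) * (\<integral>x. std_normal_density x *\<^sub>R iexp ((2 * pi * y / \<epsilon>) * x) \<partial>lborel)"
    by (rule integral_mult_right_zero)
  also have "(\<integral>x. std_normal_density x *\<^sub>R iexp ((2 * pi * y / \<epsilon>) * x) \<partial>lborel)
      = char std_normal_distribution (2 * pi * y / \<epsilon>)"
    unfolding char_def by (subst integral_density) auto
  also have "char std_normal_distribution (2 * pi * y / \<epsilon>) = of_real (exp (- (2 * pi * y / \<epsilon>)\<^sup>2 / 2))"
    by (simp add: char_std_normal_distribution)
  finally show ?thesis using assms by (simp add: scaleR_conv_of_real)
qed

lemma integrable_gaussian:
  assumes "\<epsilon> > 0"
  shows "integrable lborel (\<lambda>x. exp (- (\<epsilon> * x)\<^sup>2 / 2) :: real)"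
proof -
  have "integrable lborel (\<lambda>x. sqrt (2 * pi) * std_normal_density (0 + \<epsilon> * x))"
    using assms by (intro integrable_mult_right lborel_integrable_real_affine) auto
  then show ?thesis by (simp add: std_normal_density_def)
qed

text \<open>Fubini applied to \<open>h(y) e\<^sup>2\<^sup>\<pi>\<^sup>i\<^sup>x\<^sup>y\<close> times a Gaussian in \<open>x\<close>.\<close>

lemma real_fourier_times_gaussian:
  assumes h: "integrable lborel h" and e: "\<epsilon> > 0"
  shows "(\<integral>x. real_fourier h x * of_real (exp (- (\<epsilon> * x)\<^sup>2 / 2)) \<partial>lborel)
     = (\<integral>z. std_normal_density z *\<^sub>R h (\<epsilon> / (2 * pi) * z) \<partial>lborel)"
proof -
  let ?g = "\<lambda>x. complex_of_real (exp (- (\<epsilon> * x)\<^sup>2 / 2))"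
  have [measurable]: "h \<in> borel_measurable borel" using h by auto
  have g: "integrable lborel ?g" using integrable_gaussian[OF e] by (intro integrable_of_real)
  have i: "integrable (lborel \<Otimes>\<^sub>M lborel) (\<lambda>z. real_char (fst z * snd z) * (?g (fst z) * h (snd z)))"
    by (rule Bochner_Integration.integrable_bound[OF lborel_pair.integrable_times_complex[OF g h]])
      (auto simp: norm_mult)
  have "(\<integral>x. real_fourier h x * ?g x \<partial>lborel) = (\<integral>x. (\<integral>y. real_char (x * y) * (?g x * h y) \<partial>lborel) \<partial>lborel)"
    unfolding real_fourier_def
    by (intro Bochner_Integration.integral_cong refl)
      (simp add: integral_mult_left_zero[symmetric] mult_ac del: integral_mult_left_zero)
  also have "\<dots> = (\<integral>y. (\<integral>x. real_char (x * y) * (?g x * h y) \<partial>lborel) \<partial>lborel)"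
    using lborel_pair.Fubini_integral[of "\<lambda>x y. real_char (x * y) * (?g x * h y)"] i
    by (simp add: case_prod_beta')
  also have "\<dots> = (\<integral>y. h y * of_real (sqrt (2 * pi) / \<epsilon> * exp (- (2 * pi * y / \<epsilon>)\<^sup>2 / 2)) \<partial>lborel)"
  proof (intro Bochner_Integration.integral_cong refl)
    fix y
    have "(\<integral>x. real_char (x * y) * (?g x * h y) \<partial>lborel) = h y * (\<integral>x. real_char (x * y) * ?g x \<partial>lborel)"
      by (subst integral_mult_right_zero[symmetric]) (simp only: mult_ac)
    then show "(\<integral>x. real_char (x * y) * (?g x * h y) \<partial>lborel)
        = h y * of_real (sqrt (2 * pi) / \<epsilon> * exp (- (2 * pi * y / \<epsilon>)\<^sup>2 / 2))"
      unfolding real_fourier_gaussian[OF e] .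
  qed
  \<comment> \<open>Substituting \<open>y = \<epsilon> / (2 * pi) * z\<close> turns the transformed
    Gaussian into the standard normal density; the Jacobian and the prefactor combine to its
    normalization.\<close>
  also have "\<dots> = \<bar>\<epsilon> / (2 * pi)\<bar> *\<^sub>R (\<integral>z. h (0 + \<epsilon> / (2 * pi) * z) * of_real (sqrt (2 * pi) / \<epsilon> * exp (- (2 * pi * (0 + \<epsilon> / (2 * pi) * z) / \<epsilon>)\<^sup>2 / 2)) \<partial>lborel)"
    using e by (intro lborel_integral_real_affine) simp
  also have "\<dots> = (\<integral>z. (\<epsilon> / (2 * pi)) *\<^sub>R (h (0 + \<epsilon> / (2 * pi) * z) * of_real (sqrt (2 * pi) / \<epsilon> * exp (- (2 * pi * (0 + \<epsilon> / (2 * pi) * z) / \<epsilon>)\<^sup>2 / 2))) \<partial>lborel)"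
    using e by simp
  also have "\<dots> = (\<integral>z. std_normal_density z *\<^sub>R h (\<epsilon> / (2 * pi) * z) \<partial>lborel)"
  proof (intro Bochner_Integration.integral_cong refl)
    fix z
    have s: "sqrt (2 * pi) * sqrt (2 * pi) = 2 * pi" by simp
    have "\<epsilon> / (2 * pi) * (sqrt (2 * pi) / \<epsilon>) = sqrt (2 * pi) / (sqrt (2 * pi) * sqrt (2 * pi))"
      unfolding s using e by simp
    also have "\<dots> = 1 / sqrt (2 * pi)" by (simp add: divide_simps del: real_sqrt_mult_self)
    finally have c: "\<epsilon> / (2 * pi) * (sqrt (2 * pi) / \<epsilon>) = 1 / sqrt (2 * pi)" .
    have z: "2 * pi * (0 + \<epsilon> / (2 * pi) * z) / \<epsilon> = z" using e by simp
    have "(\<epsilon> / (2 * pi)) *\<^sub>R (h (0 + \<epsilon> / (2 * pi) * z) * of_real (sqrt (2 * pi) / \<epsilon> * exp (- z\<^sup>2 / 2)))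
       = h (\<epsilon> / (2 * pi) * z) * of_real ((\<epsilon> / (2 * pi) * (sqrt (2 * pi) / \<epsilon>)) * exp (- z\<^sup>2 / 2))"
      by (simp add: scaleR_conv_of_real)
    then show "(\<epsilon> / (2 * pi)) *\<^sub>R (h (0 + \<epsilon> / (2 * pi) * z) * of_real (sqrt (2 * pi) / \<epsilon> * exp (- (2 * pi * (0 + \<epsilon> / (2 * pi) * z) / \<epsilon>)\<^sup>2 / 2)))
       = std_normal_density z *\<^sub>R h (\<epsilon> / (2 * pi) * z)"
      unfolding z c std_normal_density_def by (simp add: scaleR_conv_of_real)
  qed
  finally show ?thesis .
qed

text \<open>Let \<open>\<epsilon>\<close> tend to 0 in \<open>real_fourier_times_gaussian\<close>.
  On one side the Gaussian factor tends to 1 under the majorant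
  \<open>norm (real_fourier h x)\<close>; the other side averages \<open>h\<close> at ever smaller
  scales with weights of total mass 1 and tends to \<open>h 0\<close>.\<close>

lemma integral_real_fourier:
  assumes h: "integrable lborel h" and c: "continuous_on UNIV h" and b: "\<And>t. norm (h t) \<le> B"
    and F: "integrable lborel (real_fourier h)"
  shows "(\<integral>x. real_fourier h x \<partial>lborel) = h 0"
proof -
  define e where "e n = inverse (real (Suc n))" for n
  have e: "e n > 0" for n by (simp add: e_def)
  have e0: "e \<longlonglongrightarrow> 0" unfolding e_def by (rule LIMSEQ_inverse_real_of_nat)
  have [measurable]: "h \<in> borel_measurable borel" "real_fourier h \<in> borel_measurable borel"
    using h F by auto
  have lim1: "(\<lambda>n. \<integral>x. real_fourier h x * of_real (exp (- (e n * x)\<^sup>2 / 2)) \<partial>lborel) \<longlonglongrightarrow> (\<integral>x. real_fourier h x \<partial>lborel)"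
  proof (rule integral_dominated_convergence[where w = "\<lambda>x. norm (real_fourier h x)"])
    show "AE x in lborel. (\<lambda>n. real_fourier h x * of_real (exp (- (e n * x)\<^sup>2 / 2))) \<longlonglongrightarrow> real_fourier h x"
    proof (rule AE_I2)
      fix x
      have "(\<lambda>n. real_fourier h x * of_real (exp (- (e n * x)\<^sup>2 / 2))) \<longlonglongrightarrow> real_fourier h x * of_real (exp (- (0 * x)\<^sup>2 / 2))"
        by (intro tendsto_intros e0) simp
      then show "(\<lambda>n. real_fourier h x * of_real (exp (- (e n * x)\<^sup>2 / 2))) \<longlonglongrightarrow> real_fourier h x" by simp
    qed
    show "AE x in lborel. norm (real_fourier h x * of_real (exp (- (e n * x)\<^sup>2 / 2))) \<le> norm (real_fourier h x)" for n
      by (auto simp: norm_mult mult_left_le)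
  qed (use F in auto)
  have lim2: "(\<lambda>n. \<integral>z. std_normal_density z *\<^sub>R h (e n / (2 * pi) * z) \<partial>lborel) \<longlonglongrightarrow> (\<integral>z. std_normal_density z *\<^sub>R h 0 \<partial>lborel)"
  proof (rule integral_dominated_convergence[where w = "\<lambda>z. std_normal_density z * B"])
    show "AE z in lborel. (\<lambda>n. std_normal_density z *\<^sub>R h (e n / (2 * pi) * z)) \<longlonglongrightarrow> std_normal_density z *\<^sub>R h 0"
    proof (rule AE_I2)
      fix z
      have "(\<lambda>n. (z / (2 * pi)) * e n) \<longlonglongrightarrow> (z / (2 * pi)) * 0"
        by (intro tendsto_mult_left e0)
      then have "(\<lambda>n. e n / (2 * pi) * z) \<longlonglongrightarrow> 0" by (simp add: mult.commute)
      then have "(\<lambda>n. h (e n / (2 * pi) * z)) \<longlonglongrightarrow> h 0"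
        using c by (intro isCont_tendsto_compose[where g = h]) (simp_all add: continuous_on_eq_continuous_at)
      then show "(\<lambda>n. std_normal_density z *\<^sub>R h (e n / (2 * pi) * z)) \<longlonglongrightarrow> std_normal_density z *\<^sub>R h 0"
        by (intro tendsto_intros)
    qed
    show "AE z in lborel. norm (std_normal_density z *\<^sub>R h (e n / (2 * pi) * z)) \<le> std_normal_density z * B" for n
      using b by (auto intro!: mult_left_mono)
  qed auto
  have "(\<integral>z. std_normal_density z *\<^sub>R h 0 \<partial>lborel) = h 0"
    by (subst integral_scaleR_left) simp_all
  moreover have "(\<integral>x. real_fourier h x \<partial>lborel) = (\<integral>z. std_normal_density z *\<^sub>R h 0 \<partial>lborel)"
    by (rule tendsto_unique[OF sequentially_bot lim1]) (simp only: real_fourier_times_gaussian[OF h e] lim2)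
  ultimately show ?thesis by simp
qed

text \<open>Inversion at 0 for a translate: \<open>k y = h (y - t)\<close> has the transform
  \<open>real_char (t * x) * real_fourier h x\<close>, whose integral is the double transform of
  \<open>h\<close> at \<open>t\<close>.\<close>

theorem real_fourier_fourier:
  assumes "h \<in> schwartz"
  shows "real_fourier (real_fourier h) t = h (- t)"
proof -
  define k where "k = (\<lambda>y. h (- t + 1 * y))"
  have h: "integrable lborel h" by (rule schwartz_integrable[OF assms])
  have Fk: "real_fourier k x = real_char (t * x) * real_fourier h x" for x
  proof -
    have "real_fourier h x = \<bar>1\<bar> *\<^sub>R (\<integral>y. real_char (x * (- t + 1 * y)) * h (- t + 1 * y) \<partial>lborel)"
      unfolding real_fourier_def by (rule lborel_integral_real_affine) simp
    also have "\<dots> = (\<integral>y. real_char (- (t * x)) * (real_char (x * y) * k y) \<partial>lborel)"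
    proof -
      have "real_char (x * (- t + 1 * y)) = real_char (- (t * x)) * real_char (x * y)" for y
        by (simp add: real_char_add[symmetric] algebra_simps)
      then show ?thesis by (simp add: k_def mult.assoc)
    qed
    also have "\<dots> = real_char (- (t * x)) * real_fourier k x"
      by (simp add: real_fourier_def)
    finally show ?thesis
      using real_char_add[of "t * x" "- (t * x)"] by (simp add: real_char_eq[of 0] mult.assoc[symmetric])
  qed
  have "(\<integral>x. real_fourier k x \<partial>lborel) = k 0"
  proof (rule integral_real_fourier)
    show "integrable lborel k" unfolding k_def using h by (intro lborel_integrable_real_affine) auto
    show "continuous_on UNIV k"
      unfolding k_def by (rule continuous_on_compose2[OF schwartz_continuous[OF assms]]) (auto intro!: continuous_intros)
    show "norm (k y) \<le> schwartz_seminorm 0 0 h" for y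
      using schwartz_seminorm_ge[OF assms, of "- t + y" 0 0] by (simp add: k_def)
    have "real_fourier k = (\<lambda>x. real_char (t * x) * real_fourier h x)" using Fk by blast
    then show "integrable lborel (real_fourier k)"
      using integrable_real_char_times[OF schwartz_integrable[OF real_fourier_schwartz[OF assms]], of t] by simp
  qed
  then have "(\<integral>x. real_char (t * x) * real_fourier h x \<partial>lborel) = h (- t)"
    unfolding Fk by (simp add: k_def)
  then show ?thesis unfolding real_fourier_def[of "real_fourier h"] .
qed

section \<open>Schwartz functions flat at the origin\<close>

definition flat_schwartz :: "(real \<Rightarrow> complex) set" where
  "flat_schwartz = {h \<in> schwartz. \<forall>s. nth_deriv s h 0 = 0}"

lemma flat_schwartz_sub: "flat_schwartz \<subseteq> schwartz"
  by (auto simp: flat_schwartz_def)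

text \<open>Induction on \<open>n\<close>: since all derivatives vanish at 0, the mean value
  inequality on \<open>{- \<bar>t\<bar>..\<bar>t\<bar>}\<close> exchanges one order of
  differentiation for one factor \<open>\<bar>t\<bar>\<close>.\<close>

lemma flat_schwartz_bound_nth_deriv:
  assumes "h \<in> flat_schwartz"
  shows "norm (nth_deriv s h t) \<le> \<bar>t\<bar> ^ n * schwartz_seminorm 0 (n + s) h"
proof (induction n arbitrary: s t)
  case 0
  show ?case using schwartz_seminorm_ge[of h t 0 s] assms flat_schwartz_sub by auto
next
  case (Suc n)
  have hs: "h \<in> schwartz" using assms flat_schwartz_sub by auto
  let ?B = "\<bar>t\<bar> ^ n * schwartz_seminorm 0 (Suc n + s) h"
  have "norm (nth_deriv s h t - nth_deriv s h 0) \<le> ?B * norm (t - 0)"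
  proof (rule differentiable_bound)
    show "convex {- \<bar>t\<bar>..\<bar>t\<bar>}" by simp
    show "(nth_deriv s h has_derivative (\<lambda>x. x *\<^sub>R nth_deriv (Suc s) h y)) (at y within {- \<bar>t\<bar>..\<bar>t\<bar>})" for y
      using nth_deriv_has_vector_derivative[OF hs, of s y]
      unfolding has_vector_derivative_def by (rule has_derivative_at_withinI)
    fix y assume y: "y \<in> {- \<bar>t\<bar>..\<bar>t\<bar>}"
    have "norm (nth_deriv (Suc s) h y) \<le> \<bar>y\<bar> ^ n * schwartz_seminorm 0 (n + Suc s) h"
      by (rule Suc.IH)
    also have "\<dots> \<le> ?B"
      using y schwartz_seminorm_nonneg[OF hs] by (auto intro!: mult_right_mono power_mono)
    finally show "onorm (\<lambda>x. x *\<^sub>R nth_deriv (Suc s) h y) \<le> ?B"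
      by (intro onorm_le) (simp add: mult.commute mult_left_mono)
  qed auto
  then show ?case using assms by (simp add: flat_schwartz_def mult_ac)
qed

lemma poly_diff_ops_flat:
  assumes "L \<in> poly_diff_ops" "h \<in> flat_schwartz"
  shows "L h 0 = 0"
  using assms by induction (auto simp: flat_schwartz_def)

text \<open>A property shared by all members of \<open>P\<close>, such as vanishing at 0, passes in
  this way to every derivative of \<open>L h\<close>.\<close>

lemma nth_deriv_closed_class:
  assumes "L \<in> P"
    and deriv: "\<And>L. L \<in> P \<Longrightarrow> \<exists>L'\<in>P. \<forall>h\<in>X. \<forall>t. (L h has_vector_derivative L' h t) (at t)"
  shows "\<exists>L'\<in>P. \<forall>h\<in>X. nth_deriv s (L h) = L' h"
proof (induction s)
  case (Suc s)
  then obtain L' where L': "L' \<in> P" "\<And>h. h \<in> X \<Longrightarrow> nth_deriv s (L h) = L' h" by blast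
  obtain L'' where L'': "L'' \<in> P" "\<And>h t. h \<in> X \<Longrightarrow> (L' h has_vector_derivative L'' h t) (at t)"
    using deriv[OF L'(1)] by blast
  have "nth_deriv (Suc s) (L h) = L'' h" if "h \<in> X" for h
    unfolding nth_deriv_Suc L'(2)[OF that] using vector_derivative_at[OF L''(2)[OF that]] by blast
  then show ?case using L''(1) by blast
qed (use assms(1) in auto)

lemma poly_diff_ops_flat_schwartz:
  assumes "L \<in> poly_diff_ops" "h \<in> flat_schwartz"
  shows "L h \<in> flat_schwartz"
proof -
  have hs: "h \<in> schwartz" using assms flat_schwartz_sub by auto
  have "nth_deriv s (L h) 0 = 0" for s
  proof -
    obtain L' where "L' \<in> poly_diff_ops" "\<forall>h\<in>schwartz. nth_deriv s (L h) = L' h"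
      using nth_deriv_closed_class[where P = poly_diff_ops and X = schwartz and s = s] assms(1) poly_diff_ops_deriv by blast
    then show ?thesis using poly_diff_ops_flat assms(2) hs by auto
  qed
  then show ?thesis using poly_diff_ops_schwartz[OF assms(1) hs] by (simp add: flat_schwartz_def)
qed

section \<open>The Lizorkin space of the real line\<close>

text \<open>With \<open>t * \<bar>t\<bar> powr (z - 2)\<close> in place of a sign times
  \<open>\<bar>t\<bar> powr (z - 1)\<close>, the derivative is again a power of
  \<open>\<bar>t\<bar>\<close> times a polynomial, on both half-lines at once.\<close>

lemma abs_powr_has_vector_derivative:
  fixes z :: complex
  assumes "t \<noteq> 0"
  shows "((\<lambda>t. of_real \<bar>t\<bar> powr z) has_vector_derivative z * of_real t * (of_real \<bar>t\<bar> powr (z - 2))) (at t)"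
proof -
  have e: "of_real \<bar>t\<bar> powr w = exp (w * of_real (ln \<bar>t\<bar>))" if "t \<noteq> 0" for t and w :: complex
    using that by (simp add: powr_def Ln_of_real)
  have ln: "((\<lambda>t. ln \<bar>t\<bar>) has_real_derivative 1 / t) (at t)"
  proof (cases "t > 0")
    case True
    have "((\<lambda>t. ln t) has_real_derivative 1 / t) (at t)"
      using True by (auto intro!: derivative_eq_intros)
    then show ?thesis
      by (rule has_field_derivative_transform_within_open[where S = "{0<..}"]) (use True in auto)
  next
    case False
    then have "((\<lambda>t. ln (- t)) has_real_derivative 1 / t) (at t)"
      using assms by (auto intro!: derivative_eq_intros)
    then show ?thesis
      by (rule has_field_derivative_transform_within_open[where S = "{..<0}"]) (use False assms in auto)
  qed
  have "((\<lambda>t. z * of_real (ln \<bar>t\<bar>)) has_vector_derivative z * of_real (1 / t)) (at t)"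
    by (intro has_vector_derivative_mult_right has_vector_derivative_of_real ln)
  from field_vector_diff_chain_at[OF this DERIV_exp]
  have "((\<lambda>t. exp (z * of_real (ln \<bar>t\<bar>))) has_vector_derivative z * of_real (1 / t) * exp (z * of_real (ln \<bar>t\<bar>))) (at t)"
    by (simp add: o_def)
  moreover have "z * of_real (1 / t) * exp (z * of_real (ln \<bar>t\<bar>)) = z * of_real t * (of_real \<bar>t\<bar> powr (z - 2))"
  proof -
    have "exp (2 * complex_of_real (ln \<bar>t\<bar>)) = of_real t * of_real t"
    proof -
      have "exp (complex_of_real (ln \<bar>t\<bar>)) = of_real \<bar>t\<bar>"
        using assms by (simp add: exp_of_real)
      then show ?thesis unfolding mult_2 exp_add by (simp flip: of_real_mult)
    qed
    then have "exp (z * of_real (ln \<bar>t\<bar>)) = of_real t * of_real t * exp ((z - 2) * of_real (ln \<bar>t\<bar>))"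
      using exp_add[of "2 * complex_of_real (ln \<bar>t\<bar>)" "(z - 2) * of_real (ln \<bar>t\<bar>)"]
      by (simp add: algebra_simps)
    then show ?thesis unfolding e[OF assms] using assms by simp
  qed
  ultimately have "((\<lambda>t. exp (z * of_real (ln \<bar>t\<bar>))) has_vector_derivative z * of_real t * (of_real \<bar>t\<bar> powr (z - 2))) (at t)"
    by simp
  then show ?thesis
    by (rule has_vector_derivative_transform_within_open[where S = "- {0}"]) (use assms e in auto)
qed

lemma norm_abs_powr: "t \<noteq> 0 \<Longrightarrow> norm (of_real \<bar>t\<bar> powr z :: complex) = \<bar>t\<bar> powr Re z"
  by (subst norm_powr_real_powr) auto

text \<open>The order \<open>n\<close> is at least \<open>\<bar>Re z\<bar>\<close>. For
  \<open>\<bar>t\<bar> \<le> 1\<close>, flatness of order \<open>n\<close> outweighs a negative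
  power; for larger \<open>\<bar>t\<bar>\<close>, the seminorm with weight
  \<open>\<bar>t\<bar> ^ n\<close> outweighs a positive one.\<close>

lemma dominated_abs_powr:
  assumes "L \<in> poly_diff_ops"
  shows "dominated flat_schwartz (\<lambda>h t. of_real \<bar>t\<bar> powr z * L h t)"
proof -
  define n where "n = nat \<lceil>\<bar>Re z\<bar>\<rceil>"
  have n: "\<bar>Re z\<bar> \<le> n" unfolding n_def by linarith
  obtain C N where C: "C \<ge> 0" "\<And>h. h \<in> schwartz \<Longrightarrow> schwartz_seminorm 0 n (L h) \<le> C * schwartz_norm N h"
    by (rule tame_seminorm_le[OF tame_poly_diff_ops[OF assms] order_refl, of 0 n]) blast
  obtain D M where D: "D \<ge> 0" "\<And>h. h \<in> schwartz \<Longrightarrow> schwartz_seminorm n 0 (L h) \<le> D * schwartz_norm M h"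
    by (rule tame_seminorm_le[OF tame_poly_diff_ops[OF assms] order_refl, of n 0]) blast
  have "norm (of_real \<bar>t\<bar> powr z * L h t) \<le> (C + D) * schwartz_norm (max N M) h" if h: "h \<in> flat_schwartz" for h t
  proof -
    have hs: "h \<in> schwartz" using h flat_schwartz_sub by auto
    note Lf = poly_diff_ops_flat_schwartz[OF assms h] note Ls = subsetD[OF flat_schwartz_sub Lf]
    have nn: "0 \<le> schwartz_seminorm 0 n (L h)" "0 \<le> schwartz_seminorm n 0 (L h)"
      using schwartz_seminorm_nonneg[OF Ls] by auto
    have "norm (of_real \<bar>t\<bar> powr z * L h t) \<le> schwartz_seminorm 0 n (L h) + schwartz_seminorm n 0 (L h)"
    proof (cases "t = 0")
      case False
      have eq: "norm (of_real \<bar>t\<bar> powr z * L h t) = \<bar>t\<bar> powr Re z * norm (L h t)"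
        by (simp add: norm_mult norm_abs_powr False)
      show ?thesis
      proof (cases "\<bar>t\<bar> \<le> 1")
        case True
        have "\<bar>t\<bar> powr Re z \<le> \<bar>t\<bar> powr (- n)"
          using n True False by (intro powr_mono') auto
        moreover have "norm (L h t) \<le> \<bar>t\<bar> ^ n * schwartz_seminorm 0 n (L h)"
          using flat_schwartz_bound_nth_deriv[OF Lf, of 0 t n] by simp
        ultimately have "\<bar>t\<bar> powr Re z * norm (L h t) \<le> \<bar>t\<bar> powr (- n) * (\<bar>t\<bar> ^ n * schwartz_seminorm 0 n (L h))"
          by (intro mult_mono) auto
        also have "\<dots> = schwartz_seminorm 0 n (L h)"
          using False by (simp add: powr_minus powr_realpow)
        finally show ?thesis using eq nn by linarith
      next
        case big: False
        have "\<bar>t\<bar> powr Re z \<le> \<bar>t\<bar> powr n"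
          using n big by (intro powr_mono) auto
        then have "\<bar>t\<bar> powr Re z * norm (L h t) \<le> \<bar>t\<bar> ^ n * norm (L h t)"
          using False by (intro mult_right_mono) (auto simp: powr_realpow)
        also have "\<dots> \<le> schwartz_seminorm n 0 (L h)"
          using schwartz_seminorm_ge[OF Ls, of t n 0] by simp
        finally show ?thesis using eq nn by linarith
      qed
    qed (use nn in auto)
    also have "\<dots> \<le> C * schwartz_norm (max N M) h + D * schwartz_norm (max N M) h"
      using C(2)[OF hs] D(2)[OF hs] mult_left_mono[OF schwartz_norm_mono[OF hs, of N "max N M"] C(1)]
        mult_left_mono[OF schwartz_norm_mono[OF hs, of M "max N M"] D(1)] by simp
    finally show ?thesis by (simp add: distrib_right)
  qed
  then show ?thesis unfolding dominated_def by blast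
qed

text \<open>By the Leibniz rule the new operator is \<open>z t L + t^2 L'\<close>, and the exponent
  drops by 2. The rule is available off the origin only; at the origin flatness takes over.\<close>

lemma abs_powr_op_has_vector_derivative:
  assumes L: "L \<in> poly_diff_ops"
  shows "\<exists>M\<in>poly_diff_ops. \<forall>h\<in>flat_schwartz. \<forall>t.
    ((\<lambda>t. of_real \<bar>t\<bar> powr z * L h t) has_vector_derivative of_real \<bar>t\<bar> powr (z - 2) * M h t) (at t)"
proof -
  obtain L' where L': "L' \<in> poly_diff_ops" "\<And>h t. h \<in> schwartz \<Longrightarrow> (L h has_vector_derivative L' h t) (at t)"
    using poly_diff_ops_deriv[OF L] by blast
  let ?M = "\<lambda>h t. z * (of_real t * L h t) + of_real t * (of_real t * L' h t)"
  have M: "?M \<in> poly_diff_ops"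
    using L L'(1) by (intro poly_diff_ops.add poly_diff_ops.cmult poly_diff_ops.times)
  obtain C N where C: "C \<ge> 0"
    "\<And>h t. h \<in> flat_schwartz \<Longrightarrow> norm (of_real \<bar>t\<bar> powr (z - 2) * L h t) \<le> C * schwartz_norm N h"
    by (rule dominatedE[OF dominated_abs_powr[OF L, of "z - 2"] flat_schwartz_sub]) blast
  have sq: "(of_real \<bar>t\<bar> :: complex) powr z = of_real t * (of_real t * (of_real \<bar>t\<bar> powr (z - 2)))" for t :: real
  proof (cases "t = 0")
    case False
    have "(of_real \<bar>t\<bar> :: complex) powr z = of_real \<bar>t\<bar> powr ((z - 2) + 2)" by simp
    also have "\<dots> = of_real \<bar>t\<bar> powr (z - 2) * of_real \<bar>t\<bar> powr 2" by (rule powr_add)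
    also have "(of_real \<bar>t\<bar> :: complex) powr 2 = of_real \<bar>t\<bar> ^ 2"
      using powr_nat'[of "complex_of_real \<bar>t\<bar>" 2] by simp
    finally show ?thesis by (simp add: power2_eq_square flip: of_real_mult)
  qed auto
  have "((\<lambda>t. of_real \<bar>t\<bar> powr z * L h t) has_vector_derivative of_real \<bar>t\<bar> powr (z - 2) * ?M h t) (at t)"
    if h: "h \<in> flat_schwartz" for h t
  proof (cases "t = 0")
    case False
    have hs: "h \<in> schwartz" using h flat_schwartz_sub by auto
    have "of_real \<bar>t\<bar> powr z * L' h t + z * of_real t * (of_real \<bar>t\<bar> powr (z - 2)) * L h t
        = of_real \<bar>t\<bar> powr (z - 2) * ?M h t"
      by (subst sq) (simp add: algebra_simps)
    with has_vector_derivative_mult[OF abs_powr_has_vector_derivative[OF False] L'(2)[OF hs], of z]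
    show ?thesis by simp
  next
    case True
    \<comment> \<open>At 0 the claimed derivative is 0, since \<open>0 powr w = 0\<close>. Splitting
      \<open>t^2\<close> off \<open>\<bar>t\<bar> powr z\<close> leaves a bounded function, so
      \<open>?f\<close> is quadratically small.\<close>
    let ?f = "\<lambda>t. of_real \<bar>t\<bar> powr z * L h t"
    have b: "norm (?f u) \<le> u\<^sup>2 * (C * schwartz_norm N h)" for u
    proof -
      have "norm (?f u) = u\<^sup>2 * norm (of_real \<bar>u\<bar> powr (z - 2) * L h u)"
        by (subst sq) (simp add: norm_mult power2_eq_square mult_ac abs_mult_self_eq)
      then show ?thesis using C(2)[OF h, of u] by (simp add: mult_left_mono)
    qed
    have "((\<lambda>u. norm (?f (0 + u) - ?f 0 - u *\<^sub>R 0) / norm u) \<longlongrightarrow> 0) (at 0)"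
    proof (rule Lim_null_comparison)
      show "((\<lambda>u. \<bar>u\<bar> * (C * schwartz_norm N h)) \<longlongrightarrow> 0) (at 0)"
        by (auto intro!: tendsto_eq_intros)
      have "norm (norm (?f (0 + u) - ?f 0 - u *\<^sub>R 0) / norm u) \<le> \<bar>u\<bar> * (C * schwartz_norm N h)"
        if "u \<noteq> 0" for u
        using b[of u] that by (simp add: divide_simps power2_eq_square abs_mult_self_eq mult_ac)
      then show "\<forall>\<^sub>F u in at 0. norm (norm (?f (0 + u) - ?f 0 - u *\<^sub>R 0) / norm u) \<le> \<bar>u\<bar> * (C * schwartz_norm N h)"
        by (auto simp: eventually_at_filter)
    qed
    then have "(?f has_vector_derivative 0) (at 0)"
      unfolding has_vector_derivative_def has_derivative_at by (simp add: bounded_linear_scaleR_left)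
    then show ?thesis using True by simp
  qed
  then show ?thesis using M by (intro bexI[of _ ?M] ballI allI)
qed

text \<open>The exponent ranges over all complex numbers because every differentiation lowers it by
  2.\<close>

definition abs_powr_ops :: "((real \<Rightarrow> complex) \<Rightarrow> real \<Rightarrow> complex) set" where
  "abs_powr_ops = {(\<lambda>h t. of_real \<bar>t\<bar> powr z * L h t) | z L. L \<in> poly_diff_ops}"

lemma abs_powr_ops_deriv:
  "L \<in> abs_powr_ops \<Longrightarrow> \<exists>L'\<in>abs_powr_ops. \<forall>h\<in>flat_schwartz. \<forall>t. (L h has_vector_derivative L' h t) (at t)"
proof -
  assume "L \<in> abs_powr_ops"
  then obtain z M where M: "L = (\<lambda>h t. of_real \<bar>t\<bar> powr z * M h t)" "M \<in> poly_diff_ops"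
    by (auto simp: abs_powr_ops_def)
  obtain M' where M': "M' \<in> poly_diff_ops" "\<forall>h\<in>flat_schwartz. \<forall>t.
      ((\<lambda>t. of_real \<bar>t\<bar> powr z * M h t) has_vector_derivative of_real \<bar>t\<bar> powr (z - 2) * M' h t) (at t)"
    using abs_powr_op_has_vector_derivative[OF M(2), of z] by blast
  have "(\<lambda>h t. of_real \<bar>t\<bar> powr (z - 2) * M' h t) \<in> abs_powr_ops"
    using M'(1) by (auto simp: abs_powr_ops_def)
  then show ?thesis using M'(2) unfolding M(1)
    by (intro bexI[of _ "\<lambda>h t. of_real \<bar>t\<bar> powr (z - 2) * M' h t"])
qed

lemma abs_powr_in_ops: "(\<lambda>h t. of_real \<bar>t\<bar> powr z * h t) \<in> abs_powr_ops"
  unfolding abs_powr_ops_def using poly_diff_ops.deriv[of 0]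
  by (intro CollectI exI[of _ z] exI[of _ "nth_deriv 0"]) simp

lemma tame_abs_powr: "tame flat_schwartz (\<lambda>h t. of_real \<bar>t\<bar> powr z * h t)"
proof (rule tame_coinduct[where P = abs_powr_ops])
  fix L a assume "L \<in> abs_powr_ops"
  then obtain z M where M: "L = (\<lambda>h t. of_real \<bar>t\<bar> powr z * M h t)" "M \<in> poly_diff_ops"
    by (auto simp: abs_powr_ops_def)
  have "(\<lambda>h t. of_real t ^ a * M h t) \<in> poly_diff_ops"
    by (induction a) (use M(2) poly_diff_ops.times in \<open>auto simp: mult.assoc\<close>)
  from dominated_abs_powr[OF this, of z]
  show "dominated flat_schwartz (\<lambda>h t. of_real t ^ a * L h t)" by (simp add: M(1) mult_ac)
qed (use abs_powr_in_ops abs_powr_ops_deriv in auto)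

text \<open>Every derivative is again some \<open>\<bar>t\<bar> powr w\<close> times a member of
  \<open>poly_diff_ops\<close>, and so it vanishes at 0 by the convention
  \<open>0 powr w = 0\<close>.\<close>

lemma abs_powr_flat:
  assumes "h \<in> flat_schwartz"
  shows "(\<lambda>t. of_real \<bar>t\<bar> powr z * h t) \<in> flat_schwartz"
proof -
  have "nth_deriv s (\<lambda>t. of_real \<bar>t\<bar> powr z * h t) 0 = 0" for s
  proof -
    obtain L where "L \<in> abs_powr_ops" "nth_deriv s (\<lambda>t. of_real \<bar>t\<bar> powr z * h t) = L h"
      using nth_deriv_closed_class[OF abs_powr_in_ops[of z] abs_powr_ops_deriv] assms by blast
    then show ?thesis by (auto simp: abs_powr_ops_def)
  qed
  then show ?thesis using tame_abs_powr assms by (auto simp: tame_def flat_schwartz_def)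
qed

text \<open>That the reflection is a Schwartz function is read off from
  \<open>real_fourier_fourier\<close>; the derivatives at 0 are computed directly.\<close>

lemma reflect_flat:
  assumes "h \<in> flat_schwartz"
  shows "(\<lambda>t. h (- t)) \<in> flat_schwartz"
proof -
  have hs: "h \<in> schwartz" using assms flat_schwartz_sub by auto
  have "nth_deriv s (\<lambda>t. h (- t)) = (\<lambda>t. (-1) ^ s * nth_deriv s h (- t))" for s
  proof (rule nth_deriv_eqI[where G = "\<lambda>s t. (-1) ^ s * nth_deriv s h (- t)"])
    show "((\<lambda>t. (- 1) ^ s * nth_deriv s h (- t)) has_vector_derivative (- 1) ^ Suc s * nth_deriv (Suc s) h (- t)) (at t)" for s t
    proof -
      have "((nth_deriv s h \<circ> uminus) has_vector_derivative (- 1) *\<^sub>R nth_deriv (Suc s) h (- t)) (at t)"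
        by (rule vector_diff_chain_at) (auto intro!: derivative_eq_intros nth_deriv_has_vector_derivative[OF hs])
      from has_vector_derivative_mult_right[OF this, of "(-1) ^ s"] show ?thesis by (simp add: o_def)
    qed
  qed simp
  moreover have "real_fourier (real_fourier h) = (\<lambda>t. h (- t))"
    using real_fourier_fourier[OF hs] by blast
  ultimately show ?thesis
    using real_fourier_schwartz[OF real_fourier_schwartz[OF hs]] assms by (simp add: flat_schwartz_def)
qed

lemma real_fourier_fourier_flat:
  "h \<in> flat_schwartz \<Longrightarrow> real_fourier (real_fourier h) \<in> flat_schwartz"
  using reflect_flat real_fourier_fourier flat_schwartz_sub by (metis (no_types, lifting) ext subsetD)

section \<open>The fractional operator on the real line\<close>

lemma real_lizorkin_eq: "real_lizorkin = real_fourier ` flat_schwartz"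
  by (simp add: real_lizorkin_def flat_schwartz_def)

lemma real_lizorkin_sub: "real_lizorkin \<subseteq> schwartz"
  using real_fourier_schwartz flat_schwartz_sub by (auto simp: real_lizorkin_eq)

lemma real_fourier_lizorkin: "h \<in> real_lizorkin \<Longrightarrow> real_fourier h \<in> flat_schwartz"
  using real_fourier_fourier_flat by (auto simp: real_lizorkin_eq)

text \<open>The component at infinity of the fractional operator. The inverse transform is written
  as the third power of \<open>real_fourier\<close>, so that its tameness follows from
  \<open>tame_real_fourier\<close>.\<close>

definition real_frac :: "complex \<Rightarrow> (real \<Rightarrow> complex) \<Rightarrow> real \<Rightarrow> complex" where
  "real_frac z h = real_fourier (real_fourier (real_fourier (\<lambda>t. of_real \<bar>t\<bar> powr z * real_fourier h t)))"

text \<open>Two of the three outer transforms compose to a reflection and preserve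
  \<open>flat_schwartz\<close>; the remaining one leads into \<open>real_lizorkin\<close>.\<close>

lemma real_frac_lizorkin:
  assumes "h \<in> real_lizorkin"
  shows "real_frac z h \<in> real_lizorkin"
  unfolding real_frac_def real_lizorkin_eq
  using real_fourier_fourier_flat[OF abs_powr_flat[OF real_fourier_lizorkin[OF assms], of z]]
    real_fourier_fourier real_lizorkin_eq by (metis image_eqI real_fourier_fourier_flat)

lemma tame_subset: "tame Y L \<Longrightarrow> X \<subseteq> Y \<Longrightarrow> tame X L"
  unfolding tame_def dominated_def by (meson subsetD)

lemma tame_real_frac: "tame real_lizorkin (real_frac z)"
proof -
  have 1: "tame real_lizorkin real_fourier"
    using tame_real_fourier real_lizorkin_sub by (rule tame_subset)
  have 2: "tame real_lizorkin (\<lambda>h t. of_real \<bar>t\<bar> powr z * real_fourier h t)"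
    using tame_compose[OF 1 tame_abs_powr real_lizorkin_sub flat_schwartz_sub real_fourier_lizorkin] .
  have s: "(\<lambda>t. of_real \<bar>t\<bar> powr z * real_fourier h t) \<in> schwartz" if "h \<in> real_lizorkin" for h
    using abs_powr_flat real_fourier_lizorkin that flat_schwartz_sub by blast
  have 3: "tame real_lizorkin (\<lambda>h. real_fourier (\<lambda>t. of_real \<bar>t\<bar> powr z * real_fourier h t))"
    using tame_compose[OF 2 tame_real_fourier real_lizorkin_sub order_refl s] .
  have 4: "tame real_lizorkin (\<lambda>h. real_fourier (real_fourier (\<lambda>t. of_real \<bar>t\<bar> powr z * real_fourier h t)))"
    using tame_compose[OF 3 tame_real_fourier real_lizorkin_sub order_refl real_fourier_schwartz[OF s]] .
  show ?thesis unfolding real_frac_def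
    using tame_compose[OF 4 tame_real_fourier real_lizorkin_sub order_refl real_fourier_schwartz[OF real_fourier_schwartz[OF s]]] .
qed

lemma nth_deriv_lincomb:
  assumes "g \<in> schwartz" "h \<in> schwartz"
  shows "nth_deriv s (\<lambda>t. g t + c * h t) = (\<lambda>t. nth_deriv s g t + c * nth_deriv s h t)"
  by (rule nth_deriv_eqI[where G = "\<lambda>s t. nth_deriv s g t + c * nth_deriv s h t"])
    (auto intro!: has_vector_derivative_add has_vector_derivative_mult_right nth_deriv_has_vector_derivative assms)

lemma schwartz_lincomb:
  assumes "g \<in> schwartz" "h \<in> schwartz"
  shows "(\<lambda>t. g t + c * h t) \<in> schwartz"
proof -
  have "nth_deriv s (\<lambda>t. g t + c * h t) differentiable at t" for s t
    unfolding nth_deriv_lincomb[OF assms] using assms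
    by (auto simp: schwartz_def intro!: derivative_intros)
  moreover have "bounded (range (\<lambda>t. of_real (t ^ a) * nth_deriv b (\<lambda>t. g t + c * h t) t))" for a b
  proof -
    have "norm (of_real (t ^ a) * nth_deriv b (\<lambda>t. g t + c * h t) t) \<le> schwartz_seminorm a b g + norm c * schwartz_seminorm a b h" for t
    proof -
      have "norm (of_real (t ^ a) * nth_deriv b (\<lambda>t. g t + c * h t) t) = \<bar>t\<bar> ^ a * norm (nth_deriv b g t + c * nth_deriv b h t)"
        by (simp add: nth_deriv_lincomb[OF assms] norm_mult norm_power)
      also have "\<dots> \<le> \<bar>t\<bar> ^ a * (norm (nth_deriv b g t) + norm c * norm (nth_deriv b h t))"
        by (intro mult_left_mono) (auto intro: norm_triangle_le simp: norm_mult)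
      also have "\<dots> = \<bar>t\<bar> ^ a * norm (nth_deriv b g t) + norm c * (\<bar>t\<bar> ^ a * norm (nth_deriv b h t))"
        by (simp add: algebra_simps)
      also have "\<dots> \<le> schwartz_seminorm a b g + norm c * schwartz_seminorm a b h"
        using schwartz_seminorm_ge[OF assms(1), of t a b] schwartz_seminorm_ge[OF assms(2), of t a b]
        by (intro add_mono mult_left_mono) auto
      finally show ?thesis .
    qed
    then show ?thesis unfolding bounded_iff by blast
  qed
  ultimately show ?thesis unfolding schwartz_def by blast
qed

lemma schwartz_diff: "g \<in> schwartz \<Longrightarrow> h \<in> schwartz \<Longrightarrow> g - h \<in> schwartz"
  using schwartz_lincomb[of g h "-1"] by (simp add: fun_diff_def)

lemma flat_schwartz_lincomb:
  assumes "g \<in> flat_schwartz" "h \<in> flat_schwartz"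
  shows "(\<lambda>t. g t + c * h t) \<in> flat_schwartz"
  using assms schwartz_lincomb by (auto simp: flat_schwartz_def nth_deriv_lincomb)

lemma real_fourier_lincomb:
  assumes "g \<in> schwartz" "h \<in> schwartz"
  shows "real_fourier (\<lambda>t. g t + c * h t) = (\<lambda>t. real_fourier g t + c * real_fourier h t)"
proof
  fix \<xi>
  have "integrable lborel (\<lambda>t. c * h t)" using schwartz_integrable[OF assms(2)] by simp
  from real_fourier_add[OF schwartz_integrable[OF assms(1)] this, of \<xi>]
  show "real_fourier (\<lambda>t. g t + c * h t) \<xi> = real_fourier g \<xi> + c * real_fourier h \<xi>"
    by (simp add: real_fourier_cmult)
qed

lemma real_lizorkin_lincomb:
  assumes "g \<in> real_lizorkin" "h \<in> real_lizorkin"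
  shows "(\<lambda>t. g t + c * h t) \<in> real_lizorkin"
proof -
  obtain g' h' where g': "g' \<in> flat_schwartz" "g = real_fourier g'"
    and h': "h' \<in> flat_schwartz" "h = real_fourier h'"
    using assms by (auto simp: real_lizorkin_eq)
  have "(\<lambda>t. g t + c * h t) = real_fourier (\<lambda>t. g' t + c * h' t)"
    unfolding g'(2) h'(2) using real_fourier_lincomb[of g' h' c] flat_schwartz_sub g'(1) h'(1)
    by (simp add: subset_iff)
  then show ?thesis
    using flat_schwartz_lincomb[OF g'(1) h'(1), of c] by (auto simp: real_lizorkin_eq)
qed

lemma real_frac_lincomb:
  assumes "g \<in> real_lizorkin" "h \<in> real_lizorkin"
  shows "real_frac z (\<lambda>t. g t + c * h t) = (\<lambda>t. real_frac z g t + c * real_frac z h t)"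
proof -
  let ?m = "\<lambda>f t. of_real \<bar>t\<bar> powr z * f t :: complex"
  have s: "?m (real_fourier f) \<in> schwartz" if "f \<in> real_lizorkin" for f
    using abs_powr_flat real_fourier_lizorkin that flat_schwartz_sub by blast
  have "?m (real_fourier (\<lambda>t. g t + c * h t)) = (\<lambda>t. ?m (real_fourier g) t + c * ?m (real_fourier h) t)"
    using assms real_lizorkin_sub by (subst real_fourier_lincomb) (auto simp: fun_eq_iff algebra_simps)
  then show ?thesis
    unfolding real_frac_def using s assms by (simp add: real_fourier_lincomb real_fourier_schwartz)
qed

section \<open>Continuity of tame operators in the Schwartz topology\<close>

lemma schwartz_seminorm_triangle:
  assumes "g \<in> schwartz" "h \<in> schwartz"
  shows "schwartz_seminorm a b (g + h) \<le> schwartz_seminorm a b g + schwartz_seminorm a b h"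
proof (rule schwartz_seminorm_le)
  fix t
  have "nth_deriv b (g + h) t = nth_deriv b g t + nth_deriv b h t"
    using nth_deriv_lincomb[OF assms, of b 1] by (simp add: plus_fun_def)
  then have "\<bar>t\<bar> ^ a * norm (nth_deriv b (g + h) t) \<le> \<bar>t\<bar> ^ a * norm (nth_deriv b g t) + \<bar>t\<bar> ^ a * norm (nth_deriv b h t)"
    by (simp add: distrib_left[symmetric] mult_left_mono norm_triangle_ineq)
  then show "\<bar>t\<bar> ^ a * norm (nth_deriv b (g + h) t) \<le> schwartz_seminorm a b g + schwartz_seminorm a b h"
    using schwartz_seminorm_ge[OF assms(1), of t a b] schwartz_seminorm_ge[OF assms(2), of t a b] by linarith
qed

lemma topspace_schwartz_topology [simp]: "topspace schwartz_topology = schwartz"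
proof -
  have "h \<in> {g \<in> schwartz. schwartz_seminorm 0 0 (g - h) < schwartz_seminorm 0 0 (h - h) + 1}" if "h \<in> schwartz" for h
    using that by simp
  moreover have "schwartz_seminorm 0 0 (h - h) + 1 > 0" if "h \<in> schwartz" for h
    using schwartz_seminorm_nonneg[OF schwartz_diff[OF that that], of 0 0] by simp
  ultimately show ?thesis
    unfolding schwartz_topology_def topology_generated_by_topspace by blast
qed

lemma topspace_real_lizorkin_topology [simp]: "topspace real_lizorkin_topology = real_lizorkin"
  using real_lizorkin_sub by (auto simp: real_lizorkin_topology_def)

text \<open>Since \<open>L\<close> respects differences, its behaviour near \<open>g0\<close> is
  that of \<open>L (g - g0)\<close>, which the tame bound controls. The generating balls have
  arbitrary centres \<open>f\<close>; the triangle inequality uses up the slack left by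
  \<open>L g0 - f\<close>.\<close>

lemma tame_imp_continuous:
  assumes L: "tame X L" and X: "X \<subseteq> schwartz" and LX: "L ` X \<subseteq> X"
    and diff: "\<And>g h. g \<in> X \<Longrightarrow> h \<in> X \<Longrightarrow> g - h \<in> X \<and> L (g - h) = L g - L h"
  shows "continuous_map (subtopology schwartz_topology X) (subtopology schwartz_topology X) L"
proof -
  have top: "topspace (subtopology schwartz_topology X) = X" using X by auto
  have Ls: "L g \<in> schwartz" if "g \<in> X" for g using that LX X by auto
  let ?S = "{{g \<in> schwartz. schwartz_seminorm a b (g - f) < \<epsilon>} | a b f \<epsilon>. f \<in> schwartz \<and> \<epsilon> > 0}"
  have "\<Union> ?S = schwartz"
    using topspace_schwartz_topology unfolding schwartz_topology_def topology_generated_by_topspace .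
  then have *: "L ` topspace (subtopology schwartz_topology X) \<subseteq> \<Union> ?S"
    using Ls top by auto
  have "continuous_map (subtopology schwartz_topology X) (topology_generated_by ?S) L"
  proof (rule continuous_on_generated_topo[OF _ *])
    fix U assume "U \<in> ?S"
    then obtain a b f \<epsilon> where U: "U = {g \<in> schwartz. schwartz_seminorm a b (g - f) < \<epsilon>}" and f: "f \<in> schwartz"
      by blast
    obtain C N where C: "C \<ge> 0" "\<And>h. h \<in> X \<Longrightarrow> schwartz_seminorm a b (L h) \<le> C * schwartz_norm N h"
      by (rule tame_seminorm_le[OF L X, of a b]) blast
    show "openin (subtopology schwartz_topology X) (L -` U \<inter> topspace (subtopology schwartz_topology X))"
    proof (subst openin_subopen, intro ballI)
      fix g0 assume "g0 \<in> L -` U \<inter> topspace (subtopology schwartz_topology X)"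
      then have g0: "g0 \<in> X" "schwartz_seminorm a b (L g0 - f) < \<epsilon>" using top U by auto
      \<comment> \<open>\<open>schwartz_norm N\<close> sums \<open>(N + 1)^2\<close> seminorms, each
        below \<open>\<delta>\<close> on the neighbourhood; the added 1 keeps the denominator
        positive when \<open>C = 0\<close>.\<close>
      define \<delta> where "\<delta> = (\<epsilon> - schwartz_seminorm a b (L g0 - f)) / (C * (real (Suc N) * real (Suc N)) + 1)"
      have d0: "C * (real (Suc N) * real (Suc N)) + 1 > 0"
        using C(1) by (intro add_nonneg_pos mult_nonneg_nonneg) auto
      have \<delta>: "\<delta> > 0" "C * (real (Suc N) * real (Suc N)) * \<delta> < \<epsilon> - schwartz_seminorm a b (L g0 - f)"
      proof -
        show 1: "\<delta> > 0" using d0 g0 by (simp add: \<delta>_def)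
        have "(C * (real (Suc N) * real (Suc N)) + 1) * \<delta> = \<epsilon> - schwartz_seminorm a b (L g0 - f)"
          unfolding \<delta>_def using d0 by simp
        then show "C * (real (Suc N) * real (Suc N)) * \<delta> < \<epsilon> - schwartz_seminorm a b (L g0 - f)"
          using 1 by (simp add: distrib_right)
      qed
      define W where "W i j = {g \<in> schwartz. schwartz_seminorm i j (g - g0) < \<delta>}" for i j
      define V where "V = (\<Inter>i\<in>{..N}. \<Inter>j\<in>{..N}. W i j)"
      have "openin schwartz_topology (W i j)" for i j
        unfolding W_def schwartz_topology_def using \<delta>(1) g0(1) X
        by (intro topology_generated_by_Basis) blast
      then have V: "openin schwartz_topology V"
        unfolding V_def by (intro openin_INT2) auto
      have "g0 \<in> V"
      proof -
        have "schwartz_seminorm i j (g0 - g0) = 0" for i j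
        proof -
          have "nth_deriv j (\<lambda>t. g0 t + (-1) * g0 t) = (\<lambda>t. nth_deriv j g0 t + (-1) * nth_deriv j g0 t)"
            by (rule nth_deriv_lincomb) (use g0 X in auto)
          then have "nth_deriv j (\<lambda>_. 0) = (\<lambda>t. 0 :: complex)" by simp
          then show ?thesis by (simp add: schwartz_seminorm_def zero_fun_def)
        qed
        then show ?thesis using \<delta>(1) g0(1) X by (auto simp: V_def W_def)
      qed
      moreover have "V \<inter> X \<subseteq> L -` U \<inter> topspace (subtopology schwartz_topology X)"
      proof
        fix g assume g: "g \<in> V \<inter> X"
        have dX: "g - g0 \<in> X" "L (g - g0) = L g - L g0" using diff g g0(1) by auto
        have "schwartz_norm N (g - g0) \<le> (\<Sum>i\<le>N. \<Sum>j\<le>N. \<delta>)"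
          unfolding schwartz_norm_def using g by (intro sum_mono) (auto simp: V_def W_def intro: less_imp_le)
        also have "\<dots> = (real (Suc N) * real (Suc N)) * \<delta>" by simp
        finally have "schwartz_seminorm a b (L (g - g0)) \<le> C * ((real (Suc N) * real (Suc N)) * \<delta>)"
          using C(2)[OF dX(1)] mult_left_mono[OF _ C(1)] by (meson order_trans)
        moreover have "schwartz_seminorm a b (L g - f) \<le> schwartz_seminorm a b (L (g - g0)) + schwartz_seminorm a b (L g0 - f)"
        proof -
          have eq: "L g - f = L (g - g0) + (L g0 - f)" by (simp add: dX)
          show ?thesis
            unfolding eq by (rule schwartz_seminorm_triangle) (use Ls dX(1) g0(1) f schwartz_diff in auto)
        qed
        ultimately have "schwartz_seminorm a b (L g - f) < \<epsilon>"
          using \<delta>(2) by (simp add: mult.assoc)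
        then show "g \<in> L -` U \<inter> topspace (subtopology schwartz_topology X)"
          using g top Ls by (auto simp: U)
      qed
      ultimately show "\<exists>T. openin (subtopology schwartz_topology X) T \<and> g0 \<in> T \<and> T \<subseteq> L -` U \<inter> topspace (subtopology schwartz_topology X)"
        using V g0(1) by (intro exI[of _ "V \<inter> X"]) (auto simp: openin_subtopology)
    qed
  qed
  then have "continuous_map (subtopology schwartz_topology X) schwartz_topology L"
    by (simp only: schwartz_topology_def)
  then show ?thesis
    using LX top by (auto simp: continuous_map_in_subtopology)
qed

lemma continuous_real_frac: "continuous_map real_lizorkin_topology real_lizorkin_topology (real_frac z)"
  unfolding real_lizorkin_topology_def
proof (rule tame_imp_continuous[OF tame_real_frac real_lizorkin_sub])
  show "real_frac z ` real_lizorkin \<subseteq> real_lizorkin" using real_frac_lizorkin by auto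
  fix g h assume "g \<in> real_lizorkin" "h \<in> real_lizorkin"
  then show "g - h \<in> real_lizorkin \<and> real_frac z (g - h) = real_frac z g - real_frac z h"
    using real_lizorkin_lincomb[of g h "-1"] real_frac_lincomb[of g h z "-1"] by (simp add: fun_diff_def)
qed

section \<open>The p-adic numbers\<close>

locale prime_place =
  fixes p :: nat
  assumes prime: "prime p"
begin

abbreviation pw :: "int \<Rightarrow> real" where "pw k \<equiv> real p powi k"

lemma p_gt_1: "1 < real p" and p_pos: "0 < real p" and p_nz: "p \<noteq> 0"
  using prime_gt_1_nat[OF prime] by auto

lemma prime_int: "prime (int p)"
  using prime by simp

declare power_int_of_nat [simp del]

lemma pw_mono_iff: "pw j \<le> pw k \<longleftrightarrow> j \<le> k" and pw_strict_mono_iff: "pw j < pw k \<longleftrightarrow> j < k"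
  using p_gt_1 power_int_strict_increasing power_int_increasing
  by (metis less_le_not_le linorder_not_less nle_le order_less_imp_le)+

lemma pw_pos [simp]: "0 < pw k"
  using p_pos by simp

lemma pw_add: "pw (j + k) = pw j * pw k"
  using p_nz by (simp add: power_int_add)

lemma pw_cancel [simp]: "pw k * pw (- k) = 1" "pw (- k) * pw k = 1"
  using p_nz by (simp_all add: power_int_minus)

lemma p_ne_1 [simp]: "p \<noteq> Suc 0"
  using p_gt_1 by simp

abbreviation val :: "int \<Rightarrow> nat" where "val n \<equiv> multiplicity (int p) n"

lemma val_mult: "a \<noteq> 0 \<Longrightarrow> b \<noteq> 0 \<Longrightarrow> val (a * b) = val a + val b"
  using prime_int by (intro prime_elem_multiplicity_mult_distrib) auto

text \<open>Frees the computation from the reduced fraction of \<open>quotient_of\<close>: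
  cross-multiplying two representations gives \<open>a * d = n * b\<close>, and valuations
  add.\<close>

lemma padic_abs_frac:
  assumes "a \<noteq> 0" "b \<noteq> 0"
  shows "padic_abs p (of_int a / of_int b) = pw (int (val b) - int (val a))"
proof -
  let ?x = "of_int a / of_int b :: rat"
  obtain n d where q: "quotient_of ?x = (n, d)" by force
  have d: "d > 0" by (rule quotient_of_denom_pos[OF q])
  have x: "?x = of_int n / of_int d" by (rule quotient_of_div[OF q])
  have x0: "?x \<noteq> 0" using assms by simp
  with x have n: "n \<noteq> 0" by auto
  have "of_int (a * d) = (of_int (n * b) :: rat)"
    using x assms d by (simp add: field_simps)
  then have "a * d = n * b" by (simp only: of_int_eq_iff)
  then have "val a + val d = val n + val b"
    using val_mult assms d n by (metis less_irrefl)
  then show ?thesis using x0 by (simp add: padic_abs_def q) (smt (verit) of_nat_add)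
qed

lemma rat_frac: obtains a b where "b \<noteq> 0" "x = of_int a / (of_int b :: rat)"
  by (metis less_irrefl quotient_of_denom_pos quotient_of_div surj_pair)

lemma padic_abs_0 [simp]: "padic_abs p 0 = 0"
  by (simp add: padic_abs_def)

lemma padic_abs_pos: "x \<noteq> 0 \<Longrightarrow> 0 < padic_abs p x"
  by (simp add: padic_abs_def)

lemma padic_abs_nonneg [simp]: "0 \<le> padic_abs p x"
  using padic_abs_pos[of x] by (cases "x = 0") auto

lemma padic_abs_pw: "x \<noteq> 0 \<Longrightarrow> \<exists>k. padic_abs p x = pw k"
  by (auto simp: padic_abs_def)

lemma padic_abs_mult: "padic_abs p (x * y) = padic_abs p x * padic_abs p y"
proof (cases "x = 0 \<or> y = 0")
  case False
  obtain a b where ab: "b \<noteq> 0" "x = of_int a / of_int b" by (rule rat_frac)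
  obtain c d where cd: "d \<noteq> 0" "y = of_int c / of_int d" by (rule rat_frac)
  have nz: "a \<noteq> 0" "c \<noteq> 0" using False ab cd by auto
  have "x * y = of_int (a * c) / of_int (b * d)" using ab cd by simp
  then have "padic_abs p (x * y) = pw (int (val (b * d)) - int (val (a * c)))"
    using ab cd nz padic_abs_frac[of "a * c" "b * d"] by simp
  also have "\<dots> = pw ((int (val b) - int (val a)) + (int (val d) - int (val c)))"
    using ab cd nz by (simp add: val_mult algebra_simps)
  also have "\<dots> = padic_abs p x * padic_abs p y"
    unfolding pw_add using ab cd nz by (simp add: padic_abs_frac)
  finally show ?thesis .
qed auto

lemma padic_abs_of_int_le: "padic_abs p (of_int a) \<le> pw (- int n) \<longleftrightarrow> int p ^ n dvd a"
proof (cases "a = 0")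
  case False
  then have "padic_abs p (of_int a) = pw (- int (val a))"
    using padic_abs_frac[of a 1] by simp
  then show ?thesis
    using False power_dvd_iff_le_multiplicity[of a "int p" n] prime_int pw_mono_iff by auto
qed (auto simp: less_imp_le)

lemma padic_abs_of_int_le_1 [simp]: "padic_abs p (of_int a) \<le> 1"
  using padic_abs_of_int_le[of a 0] by simp

lemma padic_abs_power: "padic_abs p (of_nat p ^ k) = pw (- int k)"
proof -
  have "val (int p ^ k) = k"
    using prime_int by (simp add: multiplicity_same_power not_prime_unit)
  then show ?thesis using padic_abs_frac[of "int p ^ k" 1] p_nz by simp
qed

lemma padic_abs_1 [simp]: "padic_abs p 1 = 1"
  using padic_abs_power[of 0] by simp

lemma padic_abs_minus [simp]: "padic_abs p (- x) = padic_abs p x"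
proof -
  have "padic_abs p (- 1) * padic_abs p (- 1) = 1"
    using padic_abs_mult[of "-1" "-1"] by simp
  then have "padic_abs p (- 1) = 1"
    by (metis abs_of_nonneg padic_abs_nonneg real_sqrt_abs2 real_sqrt_one)
  then show ?thesis using padic_abs_mult[of "-1" x] by simp
qed

lemma padic_abs_diff_commute: "padic_abs p (x - y) = padic_abs p (y - x)"
  using padic_abs_minus[of "x - y"] by simp

lemma padic_abs_inverse: "padic_abs p (inverse x) = inverse (padic_abs p x)"
proof (cases "x = 0")
  case False
  then have "padic_abs p x * padic_abs p (inverse x) = 1"
    using padic_abs_mult[of x "inverse x"] by simp
  then show ?thesis by (simp add: inverse_unique)
qed auto

lemma padic_abs_divide_power: "padic_abs p (x / of_nat p ^ k) = padic_abs p x * pw (int k)"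
  by (simp add: divide_inverse padic_abs_mult padic_abs_inverse padic_abs_power power_int_minus)

text \<open>In the reduced fraction \<open>n / d\<close> the bound says
  \<open>val d \<le> val n\<close>; if \<open>p\<close> divided \<open>d\<close> it would also
  divide \<open>n\<close>, against coprimality.\<close>

lemma padic_integral_frac:
  assumes "padic_abs p x \<le> 1"
  obtains a b where "\<not> int p dvd b" "x = of_int a / of_int b"
proof (cases "x = 0")
  case True
  then show ?thesis using that[of 1 0] prime_int by (simp add: not_prime_unit)
next
  case False
  obtain n d where q: "quotient_of x = (n, d)" by force
  have d: "d > 0" by (rule quotient_of_denom_pos[OF q])
  have x: "x = of_int n / of_int d" by (rule quotient_of_div[OF q])
  have cop: "coprime n d" by (rule quotient_of_coprime[OF q])
  have n: "n \<noteq> 0" using x False by auto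
  have "pw (int (val d) - int (val n)) \<le> pw 0"
    using assms padic_abs_frac[of n d] n d x by simp
  then have le: "val d \<le> val n" unfolding pw_mono_iff by simp
  have "\<not> int p dvd d"
  proof
    assume dvd: "int p dvd d"
    then have "int p ^ 1 dvd d" by simp
    then have "1 \<le> val d"
      using power_dvd_iff_le_multiplicity[of d "int p" 1] d prime_int by (auto simp: not_prime_unit)
    then have "int p ^ 1 dvd n"
      using le power_dvd_iff_le_multiplicity[of n "int p" 1] n prime_int by auto
    then have "int p dvd 1" using cop dvd by (metis coprime_def power_one_right)
    then show False using prime_int by (simp add: not_prime_unit)
  qed
  then show ?thesis using that x by blast
qed

lemma padic_abs_frac_le_1:
  assumes "\<not> int p dvd b"
  shows "padic_abs p (of_int a / of_int b) = padic_abs p (of_int a)"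
proof (cases "a = 0")
  case False
  have "b \<noteq> 0" using assms by auto
  moreover have "val b = 0" using assms by (simp add: not_dvd_imp_multiplicity_0)
  ultimately show ?thesis using False padic_abs_frac[of a b] padic_abs_frac[of a 1] by simp
qed auto

text \<open>Dividing by the larger summand reduces the claim to \<open>1 + z\<close> with
  \<open>z\<close> integral. Then \<open>z = a / b\<close> with \<open>b\<close> prime to
  \<open>p\<close>, and \<open>1 + z = (b + a) / b\<close> is integral too.\<close>

lemma padic_abs_add: "padic_abs p (x + y) \<le> max (padic_abs p x) (padic_abs p y)"
proof -
  have *: "padic_abs p (x + y) \<le> padic_abs p x" if le: "padic_abs p y \<le> padic_abs p x" for x y
  proof (cases "x = 0")
    case True
    then have "padic_abs p y \<le> 0" using le by simp
    then have "y = 0" using padic_abs_pos[of y] by force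
    then show ?thesis using True by simp
  next
    case False
    define z where "z = y / x"
    have "padic_abs p y = padic_abs p x * padic_abs p z"
      using False padic_abs_mult[of x z] by (simp add: z_def)
    then have "padic_abs p z \<le> 1" using le padic_abs_pos[OF False] by simp
    then obtain a b where ab: "\<not> int p dvd b" "z = of_int a / of_int b" by (rule padic_integral_frac)
    have "b \<noteq> 0" using ab by auto
    then have "1 + z = of_int (b + a) / of_int b" using ab by (simp add: field_simps)
    then have "padic_abs p (1 + z) \<le> 1"
      using padic_abs_frac_le_1[OF ab(1), of "b + a"] padic_abs_of_int_le_1[of "b + a"] by metis
    moreover have "x + y = x * (1 + z)" using False by (simp add: z_def field_simps)
    ultimately show ?thesis
      by (simp add: padic_abs_mult mult_left_le)
  qed
  show ?thesis using *[of y x] *[of x y] by (cases "padic_abs p y \<le> padic_abs p x") (auto simp: add.commute max_def)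
qed

lemma padic_abs_diff: "padic_abs p (x - y) \<le> max (padic_abs p x) (padic_abs p y)"
  using padic_abs_add[of x "- y"] by simp

lemma padic_abs_triangle: "padic_abs p (x - z) \<le> max (padic_abs p (x - y)) (padic_abs p (y - z))"
  using padic_abs_add[of "x - y" "y - z"] by simp

lemma padic_abs_abs_diff: "\<bar>padic_abs p x - padic_abs p y\<bar> \<le> padic_abs p (x - y)"
proof -
  have "padic_abs p x \<le> max (padic_abs p (x - y)) (padic_abs p y)"
    using padic_abs_add[of "x - y" y] by simp
  moreover have "padic_abs p y \<le> max (padic_abs p (x - y)) (padic_abs p x)"
    using padic_abs_add[of "y - x" x] padic_abs_diff_commute[of x y] by simp
  ultimately show ?thesis
    using padic_abs_nonneg[of x] padic_abs_nonneg[of y] padic_abs_nonneg[of "x - y"] by linarith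
qed

text \<open>Values are powers of \<open>p\<close>, so no value lies strictly between two consecutive
  ones. Limits give strict bounds, and this turns them back into weak ones.\<close>

lemma padic_abs_less_pw: "padic_abs p x < pw (k + 1) \<Longrightarrow> padic_abs p x \<le> pw k"
  using padic_abs_pw[of x] pw_mono_iff pw_strict_mono_iff by (cases "x = 0") (auto simp: less_imp_le)

text \<open>Residues modulo \<open>p\<^sup>M\<^sup>+\<^sup>N\<close> enumerate \<open>p\<^sup>-\<^sup>M \<int>\<^sub>p / p\<^sup>N \<int>\<^sub>p\<close>.\<close>

lemma rat_residue:
  assumes "padic_abs p r \<le> pw (int M)"
  shows "\<exists>k<p ^ (M + N). padic_abs p (r - of_nat k / of_nat p ^ M) \<le> pw (- int N)"
proof -
  have "padic_abs p (r * of_nat p ^ M) = padic_abs p r * pw (- int M)"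
    by (simp add: padic_abs_mult padic_abs_power)
  also have "\<dots> \<le> pw (int M) * pw (- int M)" using assms by (intro mult_right_mono) auto
  also have "\<dots> = 1" by simp
  finally obtain a b where ab: "\<not> int p dvd b" "r * of_nat p ^ M = of_int a / of_int b"
    by (rule padic_integral_frac)
  have b0: "b \<noteq> 0" using ab by auto
  have "coprime (int p) b" using ab(1) prime_int by (simp add: prime_imp_coprime)
  then have "coprime b (int p ^ (M + N))" by (simp add: ac_simps)
  \<comment> \<open>The denominator \<open>b\<close> is prime to \<open>p\<close>, so division by it
    is multiplication by \<open>c\<close> modulo the prime power; \<open>k\<close> is the residue of
    \<open>a / b\<close>.\<close>
  then obtain c where c: "[b * c = 1] (mod int p ^ (M + N))"
    using cong_solve_coprime_int by blast
  define k where "k = nat ((a * c) mod int p ^ (M + N))"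
  have P: "int p ^ (M + N) > 0" using p_nz by simp
  have k: "int k = (a * c) mod int p ^ (M + N)" using P by (simp add: k_def)
  have "int k < int (p ^ (M + N))" using k P by simp
  then have klt: "k < p ^ (M + N)" by linarith
  have "[b * int k = b * (a * c)] (mod int p ^ (M + N))"
    unfolding k by (intro cong_mult cong_refl) (simp add: cong_def)
  also have "b * (a * c) = a * (b * c)" by simp
  also have "[a * (b * c) = a * 1] (mod int p ^ (M + N))" by (intro cong_mult cong_refl c)
  finally have "int p ^ (M + N) dvd (a - b * int k)"
    using cong_iff_dvd_diff cong_sym by (metis mult.right_neutral)
  then have le: "padic_abs p (of_int (a - b * int k)) \<le> pw (- int (M + N))"
    by (simp only: padic_abs_of_int_le)
  have "r - of_nat k / of_nat p ^ M = (of_int (a - b * int k) / of_int b) / of_nat p ^ M"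
    using ab(2) b0 p_nz by (simp add: field_simps)
  then have "padic_abs p (r - of_nat k / of_nat p ^ M) = padic_abs p (of_int (a - b * int k)) * pw (int M)"
    by (simp only: padic_abs_divide_power padic_abs_frac_le_1[OF ab(1)])
  also have "\<dots> \<le> pw (- int (M + N)) * pw (int M)" using le by (intro mult_right_mono) auto
  also have "\<dots> = pw (- int N)" unfolding pw_add[symmetric] by simp
  finally show ?thesis using klt by blast
qed

lemma rat_residue_unique:
  assumes "padic_abs p (of_nat k / of_nat p ^ M - of_nat l / of_nat p ^ M) \<le> pw (- int N)"
  shows "[k = l] (mod p ^ (M + N))"
proof -
  have "of_nat k / of_nat p ^ M - of_nat l / of_nat p ^ M = (of_int (int k - int l) :: rat) / of_nat p ^ M"
    by (simp add: diff_divide_distrib)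
  then have "padic_abs p (of_int (int k - int l)) * pw (int M) \<le> pw (- int N)"
    using assms by (simp only: padic_abs_divide_power)
  then have "padic_abs p (of_int (int k - int l)) * pw (int M) * pw (- int M) \<le> pw (- int N) * pw (- int M)"
    by (intro mult_right_mono) auto
  then have "padic_abs p (of_int (int k - int l)) \<le> pw (- int (M + N))"
    unfolding mult.assoc pw_cancel pw_add[symmetric] by (simp add: algebra_simps)
  then have "int (p ^ (M + N)) dvd int k - int l"
    by (simp only: padic_abs_of_int_le of_nat_power)
  then show ?thesis by (simp only: cong_int_iff[symmetric] cong_iff_dvd_diff)
qed

end

section \<open>The completion: p-adic numbers as classes of Cauchy sequences\<close>

context prime_place
begin

lemma pw_tendsto_0: "(\<lambda>n. pw (- int n)) \<longlonglongrightarrow> 0"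
  using LIMSEQ_realpow_zero[of "inverse (real p)"] p_gt_1
  by (simp add: power_int_minus power_int_of_nat power_inverse inverse_less_1_iff)

lemma exists_pw_less: "\<epsilon> > 0 \<Longrightarrow> \<exists>N. pw (- int N) < \<epsilon>"
  using order_tendstoD(2)[OF pw_tendsto_0, of \<epsilon>] by (auto simp: eventually_sequentially)

lemma exists_pw_ge: "\<exists>N. B \<le> pw (int N)"
proof -
  obtain N where "B < real p ^ N" using real_arch_pow[OF p_gt_1] by blast
  then show ?thesis by (intro exI[of _ N]) (simp add: power_int_of_nat)
qed

text \<open>Radii may be restricted to powers of \<open>p\<close>. By the ultrametric inequality a
  bound \<open>pw k\<close> survives sums unchanged, so no \<epsilon> has to be split.\<close>

lemma padic_Cauchy_pw:
  "X \<in> padic_Cauchy p \<longleftrightarrow> (\<forall>k. \<exists>N. \<forall>m\<ge>N. \<forall>n\<ge>N. padic_abs p (X m - X n) \<le> pw k)"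
proof
  assume X: "X \<in> padic_Cauchy p"
  show "\<forall>k. \<exists>N. \<forall>m\<ge>N. \<forall>n\<ge>N. padic_abs p (X m - X n) \<le> pw k"
  proof
    fix k
    have "\<forall>\<epsilon>>0. \<exists>N. \<forall>m\<ge>N. \<forall>n\<ge>N. padic_abs p (X m - X n) < \<epsilon>"
      using X by (simp add: padic_Cauchy_def)
    from this[rule_format, OF pw_pos[of k]]
    obtain N where "\<forall>m\<ge>N. \<forall>n\<ge>N. padic_abs p (X m - X n) < pw k" by blast
    then show "\<exists>N. \<forall>m\<ge>N. \<forall>n\<ge>N. padic_abs p (X m - X n) \<le> pw k"
      by (intro exI[of _ N]) (simp add: less_imp_le)
  qed
next
  assume *: "\<forall>k. \<exists>N. \<forall>m\<ge>N. \<forall>n\<ge>N. padic_abs p (X m - X n) \<le> pw k"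
  show "X \<in> padic_Cauchy p"
    unfolding padic_Cauchy_def
  proof (intro CollectI allI impI)
    fix \<epsilon> :: real assume "\<epsilon> > 0"
    then obtain K where "pw (- int K) < \<epsilon>" using exists_pw_less by blast
    then show "\<exists>N. \<forall>m\<ge>N. \<forall>n\<ge>N. padic_abs p (X m - X n) < \<epsilon>"
      using *[rule_format, of "- int K"] order_le_less_trans by blast
  qed
qed

lemma padic_Cauchy_const [simp]: "(\<lambda>_. r) \<in> padic_Cauchy p"
  by (simp add: padic_Cauchy_pw less_imp_le)

lemma padic_Cauchy_diff:
  assumes "X \<in> padic_Cauchy p" "Y \<in> padic_Cauchy p"
  shows "(\<lambda>n. X n - Y n) \<in> padic_Cauchy p"
  unfolding padic_Cauchy_pw
proof
  fix k
  obtain M N where "\<forall>m\<ge>M. \<forall>n\<ge>M. padic_abs p (X m - X n) \<le> pw k" "\<forall>m\<ge>N. \<forall>n\<ge>N. padic_abs p (Y m - Y n) \<le> pw k"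
    using assms unfolding padic_Cauchy_pw by meson
  moreover have "padic_abs p ((X m - Y m) - (X n - Y n)) \<le> max (padic_abs p (X m - X n)) (padic_abs p (Y m - Y n))" for m n
    using padic_abs_diff[of "X m - X n" "Y m - Y n"] by (simp add: algebra_simps)
  ultimately show "\<exists>N. \<forall>m\<ge>N. \<forall>n\<ge>N. padic_abs p ((X m - Y m) - (X n - Y n)) \<le> pw k"
    by (intro exI[of _ "max M N"]) (meson max.bounded_iff order_trans max.boundedI)
qed

lemma padic_Cauchy_minus: "X \<in> padic_Cauchy p \<Longrightarrow> (\<lambda>n. - X n) \<in> padic_Cauchy p"
  using padic_Cauchy_diff[of "\<lambda>_. 0" X] by simp

lemma padic_Cauchy_bounded:
  assumes "X \<in> padic_Cauchy p"
  shows "\<exists>B. \<forall>n. padic_abs p (X n) \<le> pw (int B)"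
proof -
  obtain N where N: "\<forall>m\<ge>N. \<forall>n\<ge>N. padic_abs p (X m - X n) \<le> pw 0"
    using assms unfolding padic_Cauchy_pw by blast
  obtain B where B: "Max ((\<lambda>n. padic_abs p (X n)) ` {..N}) + 1 \<le> pw (int B)"
    using exists_pw_ge by blast
  have le: "padic_abs p (X n) \<le> Max ((\<lambda>n. padic_abs p (X n)) ` {..N})" if "n \<le> N" for n
    using that by (intro Max_ge) auto
  have "padic_abs p (X n) \<le> pw (int B)" for n
  proof (cases "n \<le> N")
    case True then show ?thesis using le[of n] B by linarith
  next
    case False
    then have "padic_abs p (X n - X N) \<le> 1" using N by simp
    moreover have "padic_abs p (X n) \<le> max (padic_abs p (X n - X N)) (padic_abs p (X N))"
      using padic_abs_add[of "X n - X N" "X N"] by simp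
    moreover have "padic_abs p (X N) \<le> Max ((\<lambda>n. padic_abs p (X n)) ` {..N})" by (rule le) simp
    ultimately show ?thesis using B padic_abs_nonneg[of "X N"] by linarith
  qed
  then show ?thesis by blast
qed

lemma padic_abs_mult_diff:
  "padic_abs p (x * y - x' * y') \<le> max (padic_abs p x * padic_abs p (y - y')) (padic_abs p y' * padic_abs p (x - x'))"
proof -
  have "x * y - x' * y' = x * (y - y') + y' * (x - x')" by (simp add: algebra_simps)
  then show ?thesis using padic_abs_add[of "x * (y - y')" "y' * (x - x')"] by (simp add: padic_abs_mult)
qed

lemma padic_Cauchy_mult:
  assumes "X \<in> padic_Cauchy p" "Y \<in> padic_Cauchy p"
  shows "(\<lambda>n. X n * Y n) \<in> padic_Cauchy p"
  unfolding padic_Cauchy_pw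
proof
  fix k
  obtain A B where A: "\<forall>n. padic_abs p (X n) \<le> pw (int A)" and B: "\<forall>n. padic_abs p (Y n) \<le> pw (int B)"
    using assms padic_Cauchy_bounded by meson
  obtain M N where M: "\<forall>m\<ge>M. \<forall>n\<ge>M. padic_abs p (X m - X n) \<le> pw (k - int B)"
    and N: "\<forall>m\<ge>N. \<forall>n\<ge>N. padic_abs p (Y m - Y n) \<le> pw (k - int A)"
    using assms unfolding padic_Cauchy_pw by meson
  have "padic_abs p (X m * Y m - X n * Y n) \<le> pw k" if "m \<ge> max M N" "n \<ge> max M N" for m n
  proof -
    have "padic_abs p (X m) * padic_abs p (Y m - Y n) \<le> pw (int A) * pw (k - int A)"
      using A N that by (intro mult_mono) auto
    moreover have "padic_abs p (Y n) * padic_abs p (X m - X n) \<le> pw (int B) * pw (k - int B)"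
      using B M that by (intro mult_mono) auto
    ultimately show ?thesis
      unfolding pw_add[symmetric] using padic_abs_mult_diff[of "X m" "Y m" "X n" "Y n"] by simp
  qed
  then show "\<exists>N. \<forall>m\<ge>N. \<forall>n\<ge>N. padic_abs p (X m * Y m - X n * Y n) \<le> pw k" by blast
qed

lemma padic_rel_iff:
  "(X, Y) \<in> padic_rel p \<longleftrightarrow> X \<in> padic_Cauchy p \<and> Y \<in> padic_Cauchy p \<and>
     (\<forall>k. eventually (\<lambda>n. padic_abs p (X n - Y n) \<le> pw k) sequentially)"
proof -
  have "(\<lambda>n. padic_abs p (X n - Y n)) \<longlonglongrightarrow> 0 \<longleftrightarrow> (\<forall>k. eventually (\<lambda>n. padic_abs p (X n - Y n) \<le> pw k) sequentially)"
    (is "?l \<longleftrightarrow> ?r")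
  proof
    assume ?l
    then show ?r using order_tendstoD(2)[OF _ pw_pos] by (fast elim: eventually_mono intro: less_imp_le)
  next
    assume r: ?r
    show ?l
    proof (rule order_tendstoI)
      fix a :: real assume "a < 0"
      then show "eventually (\<lambda>n. a < padic_abs p (X n - Y n)) sequentially"
        by (intro always_eventually) (meson less_le_trans padic_abs_nonneg)
    next
      fix a :: real assume "0 < a"
      then obtain N where N: "pw (- int N) < a" using exists_pw_less by blast
      have "eventually (\<lambda>n. padic_abs p (X n - Y n) \<le> pw (- int N)) sequentially" using r by blast
      then show "eventually (\<lambda>n. padic_abs p (X n - Y n) < a) sequentially"
        by eventually_elim (use N in linarith)
    qed
  qed
  then show ?thesis by (simp add: padic_rel_def)
qed

lemma equiv_padic_rel: "equiv (padic_Cauchy p) (padic_rel p)"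
proof (rule equivI)
  show "padic_rel p \<subseteq> padic_Cauchy p \<times> padic_Cauchy p" by (auto simp: padic_rel_def)
  show "refl_on (padic_Cauchy p) (padic_rel p)"
    by (auto simp: refl_on_def padic_rel_iff less_imp_le)
  show "sym (padic_rel p)"
    by (rule symI) (auto simp: padic_rel_iff padic_abs_diff_commute)
  show "trans (padic_rel p)"
  proof (rule transI)
    fix X Y Z assume 1: "(X, Y) \<in> padic_rel p" and 2: "(Y, Z) \<in> padic_rel p"
    have "eventually (\<lambda>n. padic_abs p (X n - Z n) \<le> pw k) sequentially" for k
    proof -
      have "eventually (\<lambda>n. padic_abs p (X n - Y n) \<le> pw k) sequentially"
        "eventually (\<lambda>n. padic_abs p (Y n - Z n) \<le> pw k) sequentially"
        using 1 2 by (auto simp: padic_rel_iff)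
      then show ?thesis
        by eventually_elim (use padic_abs_triangle in \<open>metis max.boundedI order_trans\<close>)
    qed
    then show "(X, Z) \<in> padic_rel p" using 1 2 by (simp add: padic_rel_iff)
  qed
qed

definition cls :: "(nat \<Rightarrow> rat) \<Rightarrow> padic" where
  "cls X = padic_rel p `` {X}"

lemma cls_eq_iff:
  "X \<in> padic_Cauchy p \<Longrightarrow> Y \<in> padic_Cauchy p \<Longrightarrow> cls X = cls Y \<longleftrightarrow> (X, Y) \<in> padic_rel p"
  unfolding cls_def by (rule eq_equiv_class_iff[OF equiv_padic_rel])

lemma cls_in_Qp: "X \<in> padic_Cauchy p \<Longrightarrow> cls X \<in> Qp p"
  unfolding cls_def Qp_def by (rule quotientI)

lemma QpE: assumes "x \<in> Qp p" obtains X where "X \<in> padic_Cauchy p" "x = cls X"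
  using assms unfolding Qp_def cls_def by (rule quotientE)

lemma in_cls: "Y \<in> cls X \<longleftrightarrow> (X, Y) \<in> padic_rel p"
  by (simp add: cls_def)

lemma self_in_cls: "X \<in> padic_Cauchy p \<Longrightarrow> X \<in> cls X"
  unfolding cls_def by (rule equiv_class_self[OF equiv_padic_rel])

lemma padic_of_rat_cls: "padic_of_rat p r = cls (\<lambda>_. r)"
  by (simp add: padic_of_rat_def cls_def)

text \<open>The defining union runs over all representatives; it collapses to one class because all
  of them yield the same class.\<close>

lemma padic_diff_cls:
  assumes X: "X \<in> padic_Cauchy p" and Y: "Y \<in> padic_Cauchy p"
  shows "padic_diff p (cls X) (cls Y) = cls (\<lambda>n. X n - Y n)"
proof -
  have "cls (\<lambda>n. X' n - Y' n) = cls (\<lambda>n. X n - Y n)" if "X' \<in> cls X" "Y' \<in> cls Y" for X' Y'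
  proof -
    have *: "(X, X') \<in> padic_rel p" "(Y, Y') \<in> padic_rel p" using that by (auto simp: in_cls)
    then have C: "X' \<in> padic_Cauchy p" "Y' \<in> padic_Cauchy p" by (auto simp: padic_rel_iff)
    have "eventually (\<lambda>n. padic_abs p ((X n - Y n) - (X' n - Y' n)) \<le> pw k) sequentially" for k
    proof -
      have "eventually (\<lambda>n. padic_abs p (X n - X' n) \<le> pw k) sequentially"
        "eventually (\<lambda>n. padic_abs p (Y n - Y' n) \<le> pw k) sequentially"
        using * by (auto simp: padic_rel_iff)
      then show ?thesis
      proof eventually_elim
        case (elim n)
        then show ?case
          using padic_abs_diff[of "X n - X' n" "Y n - Y' n"] by (simp add: algebra_simps)
      qed
    qed
    then have "((\<lambda>n. X n - Y n), (\<lambda>n. X' n - Y' n)) \<in> padic_rel p"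
      using X Y C by (simp add: padic_rel_iff padic_Cauchy_diff)
    then show ?thesis using cls_eq_iff X Y C padic_Cauchy_diff by metis
  qed
  then show ?thesis
    unfolding padic_diff_def cls_def[symmetric] using self_in_cls[OF X] self_in_cls[OF Y] by blast
qed

lemma padic_mult_cls:
  assumes X: "X \<in> padic_Cauchy p" and Y: "Y \<in> padic_Cauchy p"
  shows "padic_mult p (cls X) (cls Y) = cls (\<lambda>n. X n * Y n)"
proof -
  have "cls (\<lambda>n. X' n * Y' n) = cls (\<lambda>n. X n * Y n)" if "X' \<in> cls X" "Y' \<in> cls Y" for X' Y'
  proof -
    have *: "(X, X') \<in> padic_rel p" "(Y, Y') \<in> padic_rel p" using that by (auto simp: in_cls)
    then have C: "X' \<in> padic_Cauchy p" "Y' \<in> padic_Cauchy p" by (auto simp: padic_rel_iff)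
    obtain A B where A: "\<forall>n. padic_abs p (X n) \<le> pw (int A)" and B: "\<forall>n. padic_abs p (Y' n) \<le> pw (int B)"
      using X C padic_Cauchy_bounded by meson
    have "eventually (\<lambda>n. padic_abs p (X n * Y n - X' n * Y' n) \<le> pw k) sequentially" for k
    proof -
      have "eventually (\<lambda>n. padic_abs p (X n - X' n) \<le> pw (k - int B)) sequentially"
        "eventually (\<lambda>n. padic_abs p (Y n - Y' n) \<le> pw (k - int A)) sequentially"
        using * by (auto simp: padic_rel_iff)
      then show ?thesis
      proof eventually_elim
        case (elim n)
        have "padic_abs p (X n) * padic_abs p (Y n - Y' n) \<le> pw (int A) * pw (k - int A)"
          using A elim by (intro mult_mono) auto
        moreover have "padic_abs p (Y' n) * padic_abs p (X n - X' n) \<le> pw (int B) * pw (k - int B)"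
          using B elim by (intro mult_mono) auto
        ultimately show ?case
          unfolding pw_add[symmetric] using padic_abs_mult_diff[of "X n" "Y n" "X' n" "Y' n"] by simp
      qed
    qed
    then have "((\<lambda>n. X n * Y n), (\<lambda>n. X' n * Y' n)) \<in> padic_rel p"
      using X Y C by (simp add: padic_rel_iff padic_Cauchy_mult)
    then show ?thesis using cls_eq_iff X Y C padic_Cauchy_mult by metis
  qed
  then show ?thesis
    unfolding padic_mult_def cls_def[symmetric] using self_in_cls[OF X] self_in_cls[OF Y] by blast
qed

text \<open>The reverse triangle inequality gives both convergence and independence of the
  representative, so the definite description in \<open>padic_norm\<close> denotes the
  limit.\<close>

lemma tendsto_padic_norm:
  assumes X: "X \<in> padic_Cauchy p"
  shows "(\<lambda>n. padic_abs p (X n)) \<longlonglongrightarrow> padic_norm p (cls X)"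
proof -
  have "Cauchy (\<lambda>n. padic_abs p (X n))"
  proof (rule metric_CauchyI)
    fix e :: real assume "e > 0"
    then obtain N where "\<forall>m\<ge>N. \<forall>n\<ge>N. padic_abs p (X m - X n) < e"
      using X by (auto simp: padic_Cauchy_def)
    then show "\<exists>M. \<forall>m\<ge>M. \<forall>n\<ge>M. dist (padic_abs p (X m)) (padic_abs p (X n)) < e"
      using padic_abs_abs_diff by (metis dist_real_def order_le_less_trans)
  qed
  then obtain r where r: "(\<lambda>n. padic_abs p (X n)) \<longlonglongrightarrow> r"
    using Cauchy_convergent_iff convergent_def by blast
  have "s = r" if Y: "Y \<in> cls X" and s: "(\<lambda>n. padic_abs p (Y n)) \<longlonglongrightarrow> s" for Y s
  proof -
    have "(\<lambda>n. padic_abs p (X n - Y n)) \<longlonglongrightarrow> 0" using Y by (simp add: in_cls padic_rel_def)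
    then have "(\<lambda>n. padic_abs p (X n) - padic_abs p (Y n)) \<longlonglongrightarrow> 0"
      by (rule Lim_null_comparison[rotated]) (auto simp: padic_abs_abs_diff)
    moreover have "(\<lambda>n. padic_abs p (X n) - padic_abs p (Y n)) \<longlonglongrightarrow> r - s"
      using r s by (rule tendsto_diff)
    ultimately show ?thesis using LIMSEQ_unique by fastforce
  qed
  then have "padic_norm p (cls X) = r"
    unfolding padic_norm_def using r self_in_cls[OF X] by (intro the_equality) blast+
  then show ?thesis using r by simp
qed

text \<open>A limit at most \<open>pw k\<close> forces the terms eventually below
  \<open>pw (k + 1)\<close>, hence by discreteness to at most \<open>pw k\<close>. Norm bounds thus
  become eventual bounds on any representative.\<close>

lemma padic_norm_cls_le:
  assumes X: "X \<in> padic_Cauchy p"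
  shows "padic_norm p (cls X) \<le> pw k \<longleftrightarrow> eventually (\<lambda>n. padic_abs p (X n) \<le> pw k) sequentially"
proof
  assume "padic_norm p (cls X) \<le> pw k"
  also have "pw k < pw (k + 1)" by (simp add: pw_strict_mono_iff)
  finally have "eventually (\<lambda>n. padic_abs p (X n) < pw (k + 1)) sequentially"
    by (rule order_tendstoD(2)[OF tendsto_padic_norm[OF X]])
  then show "eventually (\<lambda>n. padic_abs p (X n) \<le> pw k) sequentially"
    by eventually_elim (rule padic_abs_less_pw)
next
  assume "eventually (\<lambda>n. padic_abs p (X n) \<le> pw k) sequentially"
  then show "padic_norm p (cls X) \<le> pw k"
    by (intro tendsto_upperbound[OF tendsto_padic_norm[OF X]]) auto
qed

abbreviation D :: "padic \<Rightarrow> padic \<Rightarrow> real" where "D x y \<equiv> padic_norm p (padic_diff p x y)"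

abbreviation rat_in :: "rat \<Rightarrow> padic" where "rat_in \<equiv> padic_of_rat p"

text \<open>The additive structure is expressed through \<open>padic_diff\<close> alone, hence
  negation as a difference from zero.\<close>

abbreviation neg :: "padic \<Rightarrow> padic" where "neg x \<equiv> padic_diff p (padic_of_rat p 0) x"

lemma rat_in_Qp [simp]: "rat_in r \<in> Qp p"
  by (simp add: padic_of_rat_cls cls_in_Qp)

lemma padic_diff_Qp [simp]: "x \<in> Qp p \<Longrightarrow> y \<in> Qp p \<Longrightarrow> padic_diff p x y \<in> Qp p"
  by (auto elim!: QpE simp: padic_diff_cls cls_in_Qp padic_Cauchy_diff)

lemma padic_mult_Qp [simp]: "x \<in> Qp p \<Longrightarrow> y \<in> Qp p \<Longrightarrow> padic_mult p x y \<in> Qp p"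
  by (auto elim!: QpE simp: padic_mult_cls cls_in_Qp padic_Cauchy_mult)

lemma padic_norm_rat [simp]: "padic_norm p (rat_in r) = padic_abs p r"
  using tendsto_padic_norm[of "\<lambda>_. r"] by (simp add: padic_of_rat_cls LIMSEQ_const_iff)

lemma padic_norm_nonneg [simp]: "x \<in> Qp p \<Longrightarrow> 0 \<le> padic_norm p x"
  by (elim QpE) (auto intro!: tendsto_lowerbound[OF tendsto_padic_norm] always_eventually)

lemma padic_norm_eq_0: assumes "x \<in> Qp p" shows "padic_norm p x = 0 \<longleftrightarrow> x = rat_in 0"
proof
  assume 0: "padic_norm p x = 0"
  obtain X where X: "X \<in> padic_Cauchy p" "x = cls X" using assms by (rule QpE)
  have "eventually (\<lambda>n. padic_abs p (X n - 0) \<le> pw k) sequentially" for k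
    using padic_norm_cls_le[OF X(1), of k] 0 X(2) by (simp add: less_imp_le)
  then have "(X, \<lambda>_. 0) \<in> padic_rel p" using X(1) by (simp add: padic_rel_iff)
  then show "x = rat_in 0" using cls_eq_iff X by (simp add: padic_of_rat_cls)
qed simp

lemma padic_diff_eq_0: assumes "x \<in> Qp p" "y \<in> Qp p" shows "padic_diff p x y = rat_in 0 \<longleftrightarrow> x = y"
  using assms by (elim QpE) (simp add: padic_diff_cls padic_of_rat_cls cls_eq_iff padic_Cauchy_diff padic_rel_iff)

lemma D_eq_0: "x \<in> Qp p \<Longrightarrow> y \<in> Qp p \<Longrightarrow> D x y = 0 \<longleftrightarrow> x = y"
  by (simp add: padic_norm_eq_0 padic_diff_eq_0)

lemma D_commute: assumes "x \<in> Qp p" "y \<in> Qp p" shows "D x y = D y x"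
proof -
  obtain X Y where "X \<in> padic_Cauchy p" "x = cls X" "Y \<in> padic_Cauchy p" "y = cls Y"
    using assms by (elim QpE) blast
  then show ?thesis
    using tendsto_padic_norm[of "\<lambda>n. X n - Y n"] tendsto_padic_norm[of "\<lambda>n. Y n - X n"] LIMSEQ_unique
    by (simp add: padic_diff_cls padic_Cauchy_diff padic_abs_diff_commute)
qed

lemma D_ultra: assumes "x \<in> Qp p" "y \<in> Qp p" "z \<in> Qp p" shows "D x z \<le> max (D x y) (D y z)"
proof -
  obtain X Y Z where "X \<in> padic_Cauchy p" "x = cls X" "Y \<in> padic_Cauchy p" "y = cls Y" "Z \<in> padic_Cauchy p" "z = cls Z"
    using assms by (elim QpE) blast
  then show ?thesis
    using tendsto_le[OF sequentially_bot tendsto_max[OF tendsto_padic_norm tendsto_padic_norm] tendsto_padic_norm,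
      of "\<lambda>n. X n - Y n" "\<lambda>n. Y n - Z n" "\<lambda>n. X n - Z n"]
    by (simp add: padic_diff_cls padic_Cauchy_diff padic_abs_triangle)
qed

lemma D_ultra_le: "x \<in> Qp p \<Longrightarrow> y \<in> Qp p \<Longrightarrow> z \<in> Qp p \<Longrightarrow> D x y \<le> c \<Longrightarrow> D y z \<le> c \<Longrightarrow> D x z \<le> c"
  using D_ultra[of x y z] by auto

lemma norm_eq_D: assumes "x \<in> Qp p" shows "padic_norm p x = D x (rat_in 0)"
  using assms by (elim QpE) (simp add: padic_diff_cls padic_of_rat_cls)

lemma padic_norm_mult: assumes "x \<in> Qp p" "y \<in> Qp p"
  shows "padic_norm p (padic_mult p x y) = padic_norm p x * padic_norm p y"
proof -
  obtain X Y where XY: "X \<in> padic_Cauchy p" "x = cls X" "Y \<in> padic_Cauchy p" "y = cls Y"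
    using assms by (elim QpE) blast
  have "(\<lambda>n. padic_abs p (X n * Y n)) \<longlonglongrightarrow> padic_norm p x * padic_norm p y"
    unfolding padic_abs_mult XY(2,4) by (intro tendsto_mult tendsto_padic_norm XY)
  then show ?thesis
    using tendsto_padic_norm[of "\<lambda>n. X n * Y n"] LIMSEQ_unique XY by (simp add: padic_mult_cls padic_Cauchy_mult)
qed

lemma D_mult:
  assumes "x \<in> Qp p" "y \<in> Qp p" "x' \<in> Qp p" "y' \<in> Qp p"
  shows "D (padic_mult p x y) (padic_mult p x' y') \<le> max (padic_norm p x * D y y') (padic_norm p y' * D x x')"
proof -
  obtain X Y where XY: "X \<in> padic_Cauchy p" "x = cls X" "Y \<in> padic_Cauchy p" "y = cls Y"
    using assms by (elim QpE) blast
  obtain X' Y' where XY': "X' \<in> padic_Cauchy p" "x' = cls X'" "Y' \<in> padic_Cauchy p" "y' = cls Y'"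
    using assms by (elim QpE) blast
  have "padic_norm p (cls (\<lambda>n. X n * Y n - X' n * Y' n)) \<le>
     max (padic_norm p (cls X) * padic_norm p (cls (\<lambda>n. Y n - Y' n)))
         (padic_norm p (cls Y') * padic_norm p (cls (\<lambda>n. X n - X' n)))"
  proof (rule tendsto_le[OF sequentially_bot])
    show "(\<lambda>n. max (padic_abs p (X n) * padic_abs p (Y n - Y' n)) (padic_abs p (Y' n) * padic_abs p (X n - X' n)))
      \<longlonglongrightarrow> max (padic_norm p (cls X) * padic_norm p (cls (\<lambda>n. Y n - Y' n)))
         (padic_norm p (cls Y') * padic_norm p (cls (\<lambda>n. X n - X' n)))"
      by (intro tendsto_max tendsto_mult tendsto_padic_norm padic_Cauchy_diff XY XY')
    show "(\<lambda>n. padic_abs p (X n * Y n - X' n * Y' n)) \<longlonglongrightarrow> padic_norm p (cls (\<lambda>n. X n * Y n - X' n * Y' n))"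
      by (intro tendsto_padic_norm padic_Cauchy_diff padic_Cauchy_mult XY XY')
  qed (simp add: padic_abs_mult_diff)
  then show ?thesis using XY XY' by (simp add: padic_mult_cls padic_diff_cls padic_Cauchy_mult)
qed

lemma padic_diff_rat [simp]: "padic_diff p (rat_in r) (rat_in s) = rat_in (r - s)"
  by (simp add: padic_of_rat_cls padic_diff_cls)

lemma padic_mult_rat [simp]: "padic_mult p (rat_in r) (rat_in s) = rat_in (r * s)"
  by (simp add: padic_of_rat_cls padic_mult_cls)

lemma padic_mult_commute: "x \<in> Qp p \<Longrightarrow> y \<in> Qp p \<Longrightarrow> padic_mult p x y = padic_mult p y x"
  by (elim QpE) (simp add: padic_mult_cls mult.commute)

lemma neg_neg [simp]: "x \<in> Qp p \<Longrightarrow> neg (neg x) = x"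
  by (elim QpE) (simp add: padic_diff_cls padic_of_rat_cls padic_Cauchy_minus padic_Cauchy_diff)

lemma D_neg [simp]: assumes "x \<in> Qp p" "y \<in> Qp p" shows "D (neg x) (neg y) = D x y"
proof -
  obtain X Y where XY: "X \<in> padic_Cauchy p" "x = cls X" "Y \<in> padic_Cauchy p" "y = cls Y"
    using assms by (elim QpE) blast
  then have "padic_diff p (neg x) (neg y) = padic_diff p y x"
    by (simp add: padic_diff_cls padic_of_rat_cls padic_Cauchy_minus padic_Cauchy_diff)
  then show ?thesis using D_commute assms by simp
qed

lemma padic_norm_neg [simp]: "x \<in> Qp p \<Longrightarrow> padic_norm p (neg x) = padic_norm p x"
  using norm_eq_D[of x] D_commute[of x "rat_in 0"] by simp

lemma padic_mult_neg: "x \<in> Qp p \<Longrightarrow> y \<in> Qp p \<Longrightarrow> padic_mult p x (neg y) = neg (padic_mult p x y)"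
  by (elim QpE) (simp add: padic_diff_cls padic_of_rat_cls padic_Cauchy_minus padic_Cauchy_diff padic_mult_cls padic_Cauchy_mult)

text \<open>Distributivity over a sum of rationals, put as an estimate because classes carry
  differences only. It is the source of the multiplicativity of the character.\<close>

lemma D_mult_add:
  assumes "\<xi> \<in> Qp p"
  shows "D (padic_mult p \<xi> (rat_in (r + s))) (rat_in (u + v))
    \<le> max (D (padic_mult p \<xi> (rat_in r)) (rat_in u)) (D (padic_mult p \<xi> (rat_in s)) (rat_in v))"
proof -
  obtain X where X: "X \<in> padic_Cauchy p" "\<xi> = cls X" using assms by (rule QpE)
  have C: "(\<lambda>n. X n * r - u) \<in> padic_Cauchy p" for r u
    using X by (intro padic_Cauchy_diff padic_Cauchy_mult) auto
  have "padic_norm p (cls (\<lambda>n. X n * (r + s) - (u + v))) \<le>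
     max (padic_norm p (cls (\<lambda>n. X n * r - u))) (padic_norm p (cls (\<lambda>n. X n * s - v)))"
  proof (rule tendsto_le[OF sequentially_bot tendsto_max[OF tendsto_padic_norm tendsto_padic_norm] tendsto_padic_norm, OF C C C])
    show "eventually (\<lambda>n. padic_abs p (X n * (r + s) - (u + v)) \<le> max (padic_abs p (X n * r - u)) (padic_abs p (X n * s - v))) sequentially"
      using padic_abs_add[of "X _ * r - u" "X _ * s - v"] by (simp add: algebra_simps)
  qed
  then show ?thesis using X by (simp add: padic_of_rat_cls padic_mult_cls padic_diff_cls padic_Cauchy_mult)
qed

lemma padic_rat_approx:
  assumes "x \<in> Qp p"
  shows "\<exists>r. D x (rat_in r) \<le> pw k"
proof -
  obtain X where X: "X \<in> padic_Cauchy p" "x = cls X" using assms by (rule QpE)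
  obtain N where N: "\<forall>m\<ge>N. \<forall>n\<ge>N. padic_abs p (X m - X n) \<le> pw k"
    using X unfolding padic_Cauchy_pw by blast
  have "eventually (\<lambda>n. padic_abs p (X n - X N) \<le> pw k) sequentially"
    using N by (intro eventually_sequentiallyI[of N]) auto
  then have "D x (rat_in (X N)) \<le> pw k"
    using X by (simp add: padic_of_rat_cls padic_diff_cls padic_norm_cls_le padic_Cauchy_diff)
  then show ?thesis by blast
qed

lemma padic_norm_le_of_D:
  assumes "x \<in> Qp p" "y \<in> Qp p" "D x y \<le> c" "padic_norm p y \<le> c"
  shows "padic_norm p x \<le> c"
  using D_ultra[of x y "rat_in 0"] assms norm_eq_D by (metis max.bounded_iff order_trans rat_in_Qp)

text \<open>For \<open>k < p ^ (M + N)\<close> these points represent the ball of radius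
  \<open>p ^ M\<close> about 0 modulo the ball of radius \<open>p powi (- N)\<close>; they are the
  sample points for locally constant functions.\<close>

definition pt :: "nat \<Rightarrow> nat \<Rightarrow> padic" where "pt M k = rat_in (of_nat k / of_nat p ^ M)"

lemma pt_Qp [simp]: "pt M k \<in> Qp p"
  by (simp add: pt_def)

lemma norm_pt: "padic_norm p (pt M k) \<le> pw (int M)"
proof -
  have "padic_norm p (pt M k) = padic_abs p (of_int (int k)) * pw (int M)"
    by (simp add: pt_def padic_abs_divide_power)
  also have "\<dots> \<le> 1 * pw (int M)" by (intro mult_right_mono padic_abs_of_int_le_1) simp
  finally show ?thesis by simp
qed

lemma pt_approx:
  assumes "x \<in> Qp p" "padic_norm p x \<le> pw (int M)"
  shows "\<exists>k<p ^ (M + N). D x (pt M k) \<le> pw (- int N)"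
proof -
  obtain r where r: "D x (rat_in r) \<le> pw (- int N)" using padic_rat_approx[OF assms(1)] by blast
  have "pw (- int N) \<le> pw (int M)" by (simp add: pw_mono_iff)
  then have "padic_norm p (rat_in r) \<le> pw (int M)"
    by - (rule padic_norm_le_of_D[of "rat_in r" x], use assms r D_commute[of x "rat_in r"] in auto)
  then obtain k where k: "k < p ^ (M + N)" "padic_abs p (r - of_nat k / of_nat p ^ M) \<le> pw (- int N)"
    using rat_residue[of r M N] by auto
  have "D x (pt M k) \<le> pw (- int N)"
    by (rule D_ultra_le[of x "rat_in r" "pt M k"]) (use assms r k(2) in \<open>auto simp: pt_def\<close>)
  then show ?thesis using k(1) by blast
qed

lemma pt_unique: "D (pt M k) (pt M l) \<le> pw (- int N) \<Longrightarrow> [k = l] (mod p ^ (M + N))"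
  using rat_residue_unique[of k M l N] by (simp add: pt_def)

lemma pt_cong:
  assumes "[k = l] (mod p ^ (M + N))"
  shows "D (pt M k) (pt M l) \<le> pw (- int N)"
proof -
  have "int (p ^ (M + N)) dvd int k - int l"
    using assms by (simp only: cong_int_iff[symmetric] cong_iff_dvd_diff)
  then have "padic_abs p (of_int (int k - int l)) \<le> pw (- int (M + N))"
    by (simp only: padic_abs_of_int_le of_nat_power)
  then have "padic_abs p (of_int (int k - int l)) * pw (int M) \<le> pw (- int (M + N)) * pw (int M)"
    by (intro mult_right_mono) auto
  also have "\<dots> = pw (- int N)" unfolding pw_add[symmetric] by simp
  finally have "padic_abs p (of_int (int k - int l) / of_nat p ^ M) \<le> pw (- int N)"
    by (simp only: padic_abs_divide_power)
  then show ?thesis by (simp add: pt_def diff_divide_distrib)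
qed

end

section \<open>Additive characters and test functions\<close>

definition rat_char :: "rat \<Rightarrow> complex" where
  "rat_char r = exp (2 * of_real pi * \<i> * of_rat r)"

lemma rat_char_add: "rat_char (r + s) = rat_char r * rat_char s"
  by (simp add: rat_char_def of_rat_add distrib_left exp_add)

lemma rat_char_eq_1_iff: "rat_char r = 1 \<longleftrightarrow> r \<in> \<int>"
proof -
  have "of_rat r = complex_of_real (of_rat r)" by (cases r) (simp add: of_rat_rat)
  then have "rat_char r = exp (\<i> * of_real (2 * pi * of_rat r))" by (simp add: rat_char_def mult_ac)
  then have "rat_char r = 1 \<longleftrightarrow> (\<exists>n::int. 2 * pi * of_rat r = of_int (2 * n) * pi)"
    by (simp add: exp_eq_1)
  also have "\<dots> \<longleftrightarrow> (\<exists>n::int. (of_rat r :: real) = of_rat (of_int n))" by simp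
  also have "\<dots> \<longleftrightarrow> r \<in> \<int>" unfolding of_rat_eq_iff by (auto elim: Ints_cases)
  finally show ?thesis .
qed

lemma rat_char_Ints [simp]: "r \<in> \<int> \<Longrightarrow> rat_char r = 1"
  by (simp add: rat_char_eq_1_iff)

lemma cnj_rat_char: "cnj (rat_char r) = rat_char (- r)"
proof -
  have "of_rat r = complex_of_real (of_rat r)" by (cases r) (simp add: of_rat_rat)
  then show ?thesis by (simp add: rat_char_def exp_cnj of_rat_minus)
qed

lemma rat_char_power: "rat_char r ^ n = rat_char (of_nat n * r)"
  by (induction n) (simp_all add: rat_char_add distrib_right)

definition padic_fourier :: "nat \<Rightarrow> (padic \<Rightarrow> complex) \<Rightarrow> padic \<Rightarrow> complex" where
  "padic_fourier p e \<xi> = (LINT x|padic_haar p. padic_char p (padic_mult p \<xi> x) * e x)"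

section \<open>The fractional part and the p-adic character\<close>

context prime_place
begin

text \<open>This computes the kernel of the map from \<open>Z[1/p]\<close> to p-adic numbers modulo
  p-adic integers. It makes fractional parts unique and lets characters be read off from
  approximations.\<close>

lemma padic_abs_le_1_Ints:
  assumes "padic_abs p (of_int c / of_nat p ^ K) \<le> 1"
  shows "of_int c / of_nat p ^ K \<in> (\<int> :: rat set)"
proof -
  have "padic_abs p (of_int c) * pw (int K) * pw (- int K) \<le> 1 * pw (- int K)"
    using assms unfolding padic_abs_divide_power by (intro mult_right_mono) auto
  then have "int p ^ K dvd c" by (simp add: mult.assoc padic_abs_of_int_le)
  then obtain d where "c = int p ^ K * d" by blast
  then have "of_int c / of_nat p ^ K = (of_int d :: rat)" using p_nz by simp
  then show ?thesis by simp
qed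

lemma padic_abs_diff_le_1_Ints:
  assumes "padic_abs p (of_int a / of_nat p ^ k - of_int b / of_nat p ^ l) \<le> 1"
  shows "of_int a / of_nat p ^ k - of_int b / of_nat p ^ l \<in> (\<int> :: rat set)"
proof -
  have "of_int a / of_nat p ^ k - of_int b / of_nat p ^ l = (of_int (a * int p ^ l - b * int p ^ k) / of_nat p ^ (k + l) :: rat)"
    using p_nz by (simp add: field_simps power_add)
  then show ?thesis using padic_abs_le_1_Ints assms by metis
qed

lemma Zp_iff: "x \<in> Zp p \<longleftrightarrow> x \<in> Qp p \<and> padic_norm p x \<le> 1"
  by (simp add: Zp_def)

text \<open>A point \<open>pt M k\<close> at distance at most 1 gives existence, and
  \<open>k < p ^ M\<close> puts it into \<open>[0, 1)\<close>. Two candidates differ by an integer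
  strictly between -1 and 1, so the definite description denotes.\<close>

lemma padic_frac:
  assumes x: "x \<in> Qp p"
  obtains a k where "padic_frac p x = of_int a / of_nat p ^ k" "D x (rat_in (of_int a / of_nat p ^ k)) \<le> 1"
    "0 \<le> padic_frac p x"
proof -
  let ?P = "\<lambda>r. 0 \<le> r \<and> r < 1 \<and> (\<exists>k a. r = of_int a / of_nat p ^ k) \<and> padic_diff p x (rat_in r) \<in> Zp p"
  obtain M where M: "padic_norm p x \<le> pw (int M)" using exists_pw_ge by blast
  obtain k where k: "k < p ^ (M + 0)" "D x (pt M k) \<le> pw (- int 0)" using pt_approx[OF x M] by blast
  have "of_nat k < (of_nat (p ^ M) :: rat)" using k(1) by (simp only: of_nat_less_iff add_0_right)
  then have "0 \<le> (of_int (int k) / of_nat p ^ M :: rat)" "of_int (int k) / of_nat p ^ M < (1 :: rat)"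
    using p_nz by simp_all
  moreover have "padic_diff p x (rat_in (of_int (int k) / of_nat p ^ M)) \<in> Zp p"
    using k(2) x by (simp add: pt_def Zp_iff)
  ultimately have "?P (of_int (int k) / of_nat p ^ M)" by blast
  moreover have "r = s" if r: "?P r" and s: "?P s" for r s
  proof -
    have "D (rat_in r) (rat_in s) \<le> 1"
      by (rule D_ultra_le[of _ x]) (use r s x D_commute in \<open>auto simp: Zp_iff\<close>)
    then have "r - s \<in> \<int>" using padic_abs_diff_le_1_Ints r s by auto
    then obtain n where "r - s = of_int n" by (auto elim: Ints_cases)
    moreover from this have "of_int n < (1::rat)" "of_int n > (-1::rat)" using r s by linarith+
    then have "n = 0" by linarith
    ultimately show ?thesis by simp
  qed
  ultimately have "?P (padic_frac p x)"
    unfolding padic_frac_def by (intro theI[of ?P]) blast+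
  then show ?thesis using that by (auto simp: Zp_iff)
qed

text \<open>Any element of \<open>Z[1/p]\<close> within distance 1 will do, reduced to
  \<open>[0, 1)\<close> or not: it differs from the fractional part by an integer, which
  \<open>rat_char\<close> ignores.\<close>

lemma padic_char_eq:
  assumes x: "x \<in> Qp p" and D: "D x (rat_in (of_int a / of_nat p ^ k)) \<le> 1"
  shows "padic_char p x = rat_char (of_int a / of_nat p ^ k)"
proof -
  obtain b l where b: "padic_frac p x = of_int b / of_nat p ^ l" "D x (rat_in (of_int b / of_nat p ^ l)) \<le> 1"
    using padic_frac[OF x] .
  let ?r = "of_int a / of_nat p ^ k :: rat" and ?s = "of_int b / of_nat p ^ l :: rat"
  have "D (rat_in ?s) (rat_in ?r) \<le> 1"
    by (rule D_ultra_le[of _ x]) (use b D x D_commute in auto)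
  then have "?s - ?r \<in> \<int>" using padic_abs_diff_le_1_Ints by simp
  then have "rat_char ?s = rat_char ?r" using rat_char_add[of ?r "?s - ?r"] by simp
  then show ?thesis by (simp add: padic_char_def rat_char_def b(1))
qed

lemma padic_char_rat_char:
  assumes x: "x \<in> Qp p"
  obtains a k where "D x (rat_in (of_int a / of_nat p ^ k)) \<le> 1" "padic_char p x = rat_char (of_int a / of_nat p ^ k)"
  using padic_frac[OF x] padic_char_eq[OF x] by metis

lemma padic_char_integral: "x \<in> Qp p \<Longrightarrow> padic_norm p x \<le> 1 \<Longrightarrow> padic_char p x = 1"
  using padic_char_eq[of x 0 0] by (simp add: norm_eq_D)

text \<open>Converse of \<open>padic_char_integral\<close>. Nontriviality of the character off the
  integers is what forces transforms to have bounded support.\<close>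

lemma padic_char_eq_1:
  assumes x: "x \<in> Qp p" and 1: "padic_char p x = 1"
  shows "padic_norm p x \<le> 1"
proof -
  obtain a k where a: "D x (rat_in (of_int a / of_nat p ^ k)) \<le> 1" "padic_char p x = rat_char (of_int a / of_nat p ^ k)"
    using padic_char_rat_char[OF x] .
  then have "of_int a / of_nat p ^ k \<in> (\<int> :: rat set)" using 1 by (simp add: rat_char_eq_1_iff)
  then obtain n where n: "of_int a / of_nat p ^ k = (of_int n :: rat)" by (auto elim: Ints_cases)
  show ?thesis
    by (rule padic_norm_le_of_D[OF x rat_in_Qp a(1)]) (simp add: n)
qed

lemma padic_char_cong:
  assumes "x \<in> Qp p" "y \<in> Qp p" "D x y \<le> 1"
  shows "padic_char p x = padic_char p y"
proof -
  obtain a k where a: "D y (rat_in (of_int a / of_nat p ^ k)) \<le> 1" "padic_char p y = rat_char (of_int a / of_nat p ^ k)"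
    using padic_char_rat_char[OF assms(2)] .
  have "D x (rat_in (of_int a / of_nat p ^ k)) \<le> 1"
    by (rule D_ultra_le[OF assms(1,2) rat_in_Qp assms(3) a(1)])
  then show ?thesis using padic_char_eq[OF assms(1)] a(2) by simp
qed

lemma padic_char_neg:
  assumes "x \<in> Qp p"
  shows "padic_char p (neg x) = cnj (padic_char p x)"
proof -
  obtain a k where a: "D x (rat_in (of_int a / of_nat p ^ k)) \<le> 1" "padic_char p x = rat_char (of_int a / of_nat p ^ k)"
    using padic_char_rat_char[OF assms] .
  have "D (neg x) (rat_in (of_int (- a) / of_nat p ^ k)) = D (neg x) (neg (rat_in (of_int a / of_nat p ^ k)))"
    by simp
  also have "\<dots> \<le> 1" using a(1) D_neg[OF assms rat_in_Qp] by metis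
  finally have "padic_char p (neg x) = rat_char (of_int (- a) / of_nat p ^ k)"
    using assms by (intro padic_char_eq) auto
  then show ?thesis by (simp add: a(2) cnj_rat_char)
qed

text \<open>Multiplicativity along rational translations, the form in which
  \<open>fourier_supp\<close> shifts the summation by \<open>p ^ N\<close>.\<close>

lemma padic_char_mult_add:
  assumes "\<xi> \<in> Qp p"
  shows "padic_char p (padic_mult p \<xi> (rat_in (r + s))) = padic_char p (padic_mult p \<xi> (rat_in r)) * padic_char p (padic_mult p \<xi> (rat_in s))"
proof -
  have Q: "padic_mult p \<xi> (rat_in t) \<in> Qp p" for t using assms by simp
  obtain a k where a: "D (padic_mult p \<xi> (rat_in r)) (rat_in (of_int a / of_nat p ^ k)) \<le> 1"
    "padic_char p (padic_mult p \<xi> (rat_in r)) = rat_char (of_int a / of_nat p ^ k)"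
    using padic_char_rat_char[OF Q] .
  obtain b l where b: "D (padic_mult p \<xi> (rat_in s)) (rat_in (of_int b / of_nat p ^ l)) \<le> 1"
    "padic_char p (padic_mult p \<xi> (rat_in s)) = rat_char (of_int b / of_nat p ^ l)"
    using padic_char_rat_char[OF Q] .
  let ?c = "a * int p ^ l + b * int p ^ k"
  have sum: "of_int a / of_nat p ^ k + of_int b / of_nat p ^ l = (of_int ?c / of_nat p ^ (k + l) :: rat)"
    using p_nz by (simp add: field_simps power_add)
  have "D (padic_mult p \<xi> (rat_in (r + s))) (rat_in (of_int ?c / of_nat p ^ (k + l))) \<le> 1"
    using D_mult_add[OF assms, of r s "of_int a / of_nat p ^ k" "of_int b / of_nat p ^ l"] a(1) b(1)
    unfolding sum by linarith
  then have "padic_char p (padic_mult p \<xi> (rat_in (r + s))) = rat_char (of_int ?c / of_nat p ^ (k + l))"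
    by (rule padic_char_eq[OF Q])
  then show ?thesis unfolding a(2) b(2) sum[symmetric] rat_char_add .
qed

section \<open>Metric topology and test functions\<close>

lemma padic_dist_eq: "x \<in> Qp p \<Longrightarrow> y \<in> Qp p \<Longrightarrow> padic_dist p x y = D x y"
  by (simp add: padic_dist_def)

lemma Metric_space_Qp: "Metric_space (Qp p) (padic_dist p)"
proof
  show "0 \<le> padic_dist p x y" for x y by (simp add: padic_dist_def)
  show "padic_dist p x y = padic_dist p y x" for x y by (auto simp: padic_dist_def D_commute)
  show "padic_dist p x y = 0 \<longleftrightarrow> x = y" if "x \<in> Qp p" "y \<in> Qp p" for x y
    using that by (simp add: padic_dist_eq D_eq_0)
  show "padic_dist p x z \<le> padic_dist p x y + padic_dist p y z" if xyz: "x \<in> Qp p" "y \<in> Qp p" "z \<in> Qp p" for x y z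
    unfolding padic_dist_eq[OF xyz(1,3)] padic_dist_eq[OF xyz(1,2)] padic_dist_eq[OF xyz(2,3)]
    using D_ultra[OF xyz] padic_norm_nonneg[OF padic_diff_Qp[OF xyz(1,2)]] padic_norm_nonneg[OF padic_diff_Qp[OF xyz(2,3)]]
    by linarith
qed

interpretation Q: Metric_space "Qp p" "padic_dist p" by (rule Metric_space_Qp)

text \<open>Diagonal argument: rationals \<open>r n\<close> within \<open>pw (- int n)\<close> of
  the \<open>n\<close>-th term form a p-adic Cauchy sequence, and its class is the limit.\<close>

lemma mcomplete_Qp: "Q.mcomplete"
  unfolding Q.mcomplete_def
proof (intro allI impI)
  fix \<sigma> assume "Q.MCauchy \<sigma>"
  then have \<sigma>: "\<And>n. \<sigma> n \<in> Qp p" and C: "\<And>\<epsilon>. \<epsilon> > 0 \<Longrightarrow> \<exists>N. \<forall>m n. N \<le> m \<longrightarrow> N \<le> n \<longrightarrow> padic_dist p (\<sigma> m) (\<sigma> n) < \<epsilon>"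
    by (auto simp: Q.MCauchy_def)
  have "\<forall>n. \<exists>r. D (\<sigma> n) (rat_in r) \<le> pw (- int n)" using padic_rat_approx[OF \<sigma>] by blast
  then obtain r where r: "\<And>n. D (\<sigma> n) (rat_in (r n)) \<le> pw (- int n)"
    using choice[of "\<lambda>n r. D (\<sigma> n) (rat_in r) \<le> pw (- int n)"] by blast
  have near: "\<exists>N. \<forall>n\<ge>N. D (\<sigma> n) (rat_in (r n)) \<le> pw k" for k
  proof (intro exI allI impI)
    fix n assume "n \<ge> nat (- k)"
    then have "pw (- int n) \<le> pw k" by (subst pw_mono_iff) simp
    then show "D (\<sigma> n) (rat_in (r n)) \<le> pw k" using r[of n] by linarith
  qed
  have rC: "\<exists>N. \<forall>m\<ge>N. \<forall>n\<ge>N. padic_abs p (r m - r n) \<le> pw k" for k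
  proof -
    obtain N where N: "\<forall>n\<ge>N. D (\<sigma> n) (rat_in (r n)) \<le> pw k" using near by blast
    obtain M where M: "\<forall>m n. M \<le> m \<longrightarrow> M \<le> n \<longrightarrow> padic_dist p (\<sigma> m) (\<sigma> n) < pw k" using C[OF pw_pos[of k]] by blast
    have "padic_abs p (r m - r n) \<le> pw k" if mn: "m \<ge> max M N" "n \<ge> max M N" for m n
    proof -
      have "D (\<sigma> m) (\<sigma> n) \<le> pw k" using M mn \<sigma> by (simp add: padic_dist_eq less_imp_le)
      then have "D (rat_in (r m)) (\<sigma> n) \<le> pw k"
        by - (rule D_ultra_le[of _ "\<sigma> m"], use N mn \<sigma> D_commute[of "rat_in (r m)" "\<sigma> m"] in auto)
      then have "D (rat_in (r m)) (rat_in (r n)) \<le> pw k"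
        by - (rule D_ultra_le[of _ "\<sigma> n"], use N mn \<sigma> in auto)
      then show ?thesis by simp
    qed
    then show ?thesis by blast
  qed
  then have rCau: "r \<in> padic_Cauchy p" by (simp add: padic_Cauchy_pw)
  have "\<exists>N. \<forall>n\<ge>N. padic_dist p (\<sigma> n) (cls r) < \<epsilon>" if "\<epsilon> > 0" for \<epsilon>
  proof -
    obtain K where K: "pw (- int K) < \<epsilon>" using exists_pw_less \<open>\<epsilon> > 0\<close> by blast
    let ?k = "- int K"
    obtain N where N: "\<forall>n\<ge>N. D (\<sigma> n) (rat_in (r n)) \<le> pw ?k" using near by blast
    obtain M where M: "\<forall>m\<ge>M. \<forall>n\<ge>M. padic_abs p (r m - r n) \<le> pw ?k" using rC by blast
    have "padic_dist p (\<sigma> n) (cls r) < \<epsilon>" if n: "n \<ge> max M N" for n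
    proof -
      have "padic_norm p (cls (\<lambda>m. r n - r m)) \<le> pw ?k"
        using M n rCau by (subst padic_norm_cls_le) (auto intro!: padic_Cauchy_diff eventually_sequentiallyI[of M])
      then have "D (rat_in (r n)) (cls r) \<le> pw ?k"
        using rCau by (simp add: padic_of_rat_cls padic_diff_cls)
      then have "D (\<sigma> n) (cls r) \<le> pw ?k"
        by - (rule D_ultra_le[of _ "rat_in (r n)"], use N n \<sigma> rCau in \<open>auto simp: cls_in_Qp\<close>)
      then show ?thesis using K \<sigma> rCau by (simp add: padic_dist_eq cls_in_Qp)
    qed
    then show ?thesis by blast
  qed
  then have "limitin Q.mtopology \<sigma> (cls r) sequentially"
    unfolding Q.limit_metric_sequentially using \<sigma> rCau by (simp add: cls_in_Qp)
  then show "\<exists>x. limitin Q.mtopology \<sigma> x sequentially" by blast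
qed

text \<open>The residues \<open>pt M k\<close> form a finite net. Together with
  \<open>mcomplete_Qp\<close> this gives the compactness of supports in
  \<open>lev_imp_padic_test\<close>.\<close>

lemma mtotally_bounded_Qp_ball: "Q.mtotally_bounded {x \<in> Qp p. padic_norm p x \<le> pw (int M)}"
  unfolding Q.mtotally_bounded_def
proof (intro allI impI)
  fix \<epsilon> :: real assume "\<epsilon> > 0"
  then obtain N where N: "pw (- int N) < \<epsilon>" using exists_pw_less by blast
  show "\<exists>K. finite K \<and> K \<subseteq> {x \<in> Qp p. padic_norm p x \<le> pw (int M)} \<and> {x \<in> Qp p. padic_norm p x \<le> pw (int M)} \<subseteq> (\<Union>x\<in>K. Q.mball x \<epsilon>)"
  proof (intro exI[of _ "pt M ` {..<p ^ (M + N)}"] conjI subsetI)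
    fix x assume "x \<in> {x \<in> Qp p. padic_norm p x \<le> pw (int M)}"
    then have x: "x \<in> Qp p" "padic_norm p x \<le> pw (int M)" by auto
    then obtain k where "k < p ^ (M + N)" "D x (pt M k) \<le> pw (- int N)" using pt_approx by blast
    then show "x \<in> (\<Union>x\<in>pt M ` {..<p ^ (M + N)}. Q.mball x \<epsilon>)"
      using x N by (auto intro!: bexI[of _ k] simp: D_commute[of "pt M k"] padic_dist_eq)
  qed (use norm_pt in auto)
qed

text \<open>A function of level \<open>N\<close> lives on \<open>p\<^sup>-\<^sup>N \<int>\<^sub>p / p\<^sup>N \<int>\<^sub>p\<close>, a cyclic group of order \<open>p\<^sup>2\<^sup>N\<close>.\<close>

definition lev :: "nat \<Rightarrow> (padic \<Rightarrow> complex) \<Rightarrow> bool" where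
  "lev N e \<longleftrightarrow> (\<forall>x\<in>Qp p. e x \<noteq> 0 \<longrightarrow> padic_norm p x \<le> pw (int N)) \<and>
     (\<forall>x\<in>Qp p. \<forall>y\<in>Qp p. D x y \<le> pw (- int N) \<longrightarrow> e x = e y)"

lemma lev_supp: "lev N e \<Longrightarrow> x \<in> Qp p \<Longrightarrow> e x \<noteq> 0 \<Longrightarrow> padic_norm p x \<le> pw (int N)"
  and lev_const: "lev N e \<Longrightarrow> x \<in> Qp p \<Longrightarrow> y \<in> Qp p \<Longrightarrow> D x y \<le> pw (- int N) \<Longrightarrow> e x = e y"
  by (auto simp: lev_def)

lemma lev_mono: "lev N e \<Longrightarrow> N \<le> M \<Longrightarrow> lev M e"
proof -
  assume N: "lev N e" "N \<le> M"
  then have "pw (int N) \<le> pw (int M)" "pw (- int M) \<le> pw (- int N)" by (simp_all add: pw_mono_iff)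
  then show ?thesis using N(1) unfolding lev_def by (blast intro: order_trans)
qed

lemma lev_imp_padic_test:
  assumes "lev N e" shows "e \<in> padic_test p"
  unfolding padic_test_def mem_Collect_eq Qp_topology_def
proof (intro conjI ballI)
  fix x assume x: "x \<in> Qp p"
  show "\<exists>U. openin Q.mtopology U \<and> x \<in> U \<and> (\<forall>y\<in>U. e y = e x)"
    using x lev_const[OF assms x]
    by (intro exI[of _ "Q.mball x (pw (- int N))"]) (force simp: padic_dist_eq)
next
  let ?S = "{x \<in> Qp p. e x \<noteq> 0}"
  have "Q.mtotally_bounded ?S"
    by (rule Q.mtotally_bounded_subset[OF mtotally_bounded_Qp_ball[of N]]) (use lev_supp[OF assms] in auto)
  then show "compactin Q.mtopology (Q.mtopology closure_of ?S)"
    by (simp add: Q.mtotally_bounded_eq_compact_closure_of[OF mcomplete_Qp])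
qed

text \<open>Around each point there is a radius on which \<open>e\<close> is constant; compactness
  selects finitely many, and \<open>N\<close> is the largest exponent. By the ultrametric
  inequality, points at distance at most \<open>pw (- int N)\<close> share a ball of the
  cover.\<close>

lemma padic_test_imp_lev:
  assumes "e \<in> padic_test p" shows "\<exists>N. lev N e"
proof -
  let ?K = "Q.mtopology closure_of {x \<in> Qp p. e x \<noteq> 0}"
  have K: "compactin Q.mtopology ?K" and loc: "\<And>x. x \<in> Qp p \<Longrightarrow> \<exists>U. openin Q.mtopology U \<and> x \<in> U \<and> (\<forall>y\<in>U. e y = e x)"
    using assms by (auto simp: padic_test_def Qp_topology_def)
  have sub: "{x \<in> Qp p. e x \<noteq> 0} \<subseteq> ?K" by (rule closure_of_subset) auto
  have "\<exists>N. padic_norm p x \<le> pw (int N) \<and> (\<forall>y\<in>Qp p. D x y \<le> pw (- int N) \<longrightarrow> e y = e x)" if x: "x \<in> Qp p" for x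
  proof -
    obtain U where "openin Q.mtopology U" "x \<in> U" "\<forall>y\<in>U. e y = e x" using loc[OF x] by blast
    then obtain r where r: "r > 0" "Q.mball x r \<subseteq> U" by (meson Q.openin_mtopology)
    obtain A where A: "pw (- int A) < r" using exists_pw_less r(1) by blast
    obtain B where B: "padic_norm p x \<le> pw (int B)" using exists_pw_ge by blast
    have m: "pw (int B) \<le> pw (int (max A B))" "pw (- int (max A B)) \<le> pw (- int A)" by (simp_all add: pw_mono_iff)
    show ?thesis
    proof (intro exI[of _ "max A B"] conjI ballI impI)
      show "padic_norm p x \<le> pw (int (max A B))" using B m by linarith
      fix y assume y: "y \<in> Qp p" "D x y \<le> pw (- int (max A B))"
      then have "y \<in> Q.mball x r" using x m A by (simp add: padic_dist_eq)
      then show "e y = e x" using r \<open>\<forall>y\<in>U. e y = e x\<close> by blast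
    qed
  qed
  then obtain n where n: "\<And>x. x \<in> Qp p \<Longrightarrow> padic_norm p x \<le> pw (int (n x))"
    "\<And>x y. x \<in> Qp p \<Longrightarrow> y \<in> Qp p \<Longrightarrow> D x y \<le> pw (- int (n x)) \<Longrightarrow> e y = e x" by metis
  have KQ: "?K \<subseteq> Qp p" by (metis Q.topspace_mtopology closure_of_subset_topspace)
  let ?B = "\<lambda>x. Q.mball x (pw (- int (n x)))"
  have "x \<in> ?B x" if "x \<in> ?K" for x using that KQ by auto
  then have cK: "?K \<subseteq> \<Union> (?B ` ?K)" by blast
  obtain \<F> where \<F>: "finite \<F>" "\<F> \<subseteq> ?B ` ?K" "?K \<subseteq> \<Union>\<F>"
    using compactinD[OF K _ cK] by auto
  then obtain F where F: "finite F" "F \<subseteq> ?K" "?K \<subseteq> (\<Union>x\<in>F. ?B x)"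
    using finite_subset_image[OF \<F>(1,2)] by blast
  define N where "N = Max (insert 0 (n ` F))"
  have nN: "n x \<le> N" if "x \<in> F" for x using F(1) that by (simp add: N_def)
  have cov: "\<exists>f\<in>F. f \<in> Qp p \<and> D f x \<le> pw (- int (n f))" if xK: "x \<in> ?K" for x
  proof -
    obtain f where f: "f \<in> F" "x \<in> Q.mball f (pw (- int (n f)))" using F(3) xK by blast
    then have "f \<in> Qp p" "x \<in> Qp p" "padic_dist p f x < pw (- int (n f))" by auto
    then show ?thesis using f(1) by (intro bexI[of _ f] conjI) (simp_all add: padic_dist_eq less_imp_le)
  qed
  have step: "e x = e y" if xy: "x \<in> Qp p" "y \<in> Qp p" "D x y \<le> pw (- int N)" "x \<in> ?K" for x y
  proof -
    obtain f where f: "f \<in> F" "f \<in> Qp p" "D f x \<le> pw (- int (n f))" using cov xy by blast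
    have "pw (- int N) \<le> pw (- int (n f))" using nN[OF f(1)] by (simp add: pw_mono_iff)
    then have "D f y \<le> pw (- int (n f))" by - (rule D_ultra_le[of f x y], use f xy in auto)
    then show ?thesis using n(2)[OF f(2) xy(1) f(3)] n(2)[OF f(2) xy(2)] by simp
  qed
  have "lev N e"
    unfolding lev_def
  proof (intro conjI ballI impI)
    fix x assume x: "x \<in> Qp p" "e x \<noteq> 0"
    then obtain f where f: "f \<in> F" "f \<in> Qp p" "D f x \<le> pw (- int (n f))" using cov sub by blast
    have "pw (- int (n f)) \<le> pw (int N)" "pw (int (n f)) \<le> pw (int N)" using nN[OF f(1)] by (simp_all add: pw_mono_iff)
    then show "padic_norm p x \<le> pw (int N)"
      by - (rule padic_norm_le_of_D[of x f], use n(1)[OF f(2)] f x D_commute[of x f] in auto)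
  next
    fix x y assume xy: "x \<in> Qp p" "y \<in> Qp p" "D x y \<le> pw (- int N)"
    show "e x = e y"
    \<comment> \<open>The covering argument needs one of the points in \<open>?K\<close>; off
      \<open>?K\<close> the function vanishes.\<close>
    proof (cases "x \<in> ?K \<or> y \<in> ?K")
      case True
      then show ?thesis using step[of x y] step[of y x] xy D_commute[of x y] by auto
    next
      case False
      then have "e x = 0" "e y = 0" using sub xy by blast+
      then show ?thesis by simp
    qed
  qed
  then show ?thesis by blast
qed

lemma Omega_p_eq: "x \<in> Qp p \<Longrightarrow> Omega_p p x = (if padic_norm p x \<le> 1 then 1 else 0)"
  by (simp add: Omega_p_def indicator_def)

lemma lev_Omega: "lev 0 (Omega_p p)"
proof -
  have "padic_norm p x \<le> 1 \<longleftrightarrow> padic_norm p y \<le> 1" if "x \<in> Qp p" "y \<in> Qp p" "D x y \<le> 1" for x y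
    using that padic_norm_le_of_D[of x y 1] padic_norm_le_of_D[of y x 1] D_commute[of x y] by auto
  then have "Omega_p p x = Omega_p p y" if "x \<in> Qp p" "y \<in> Qp p" "D x y \<le> 1" for x y
    using that by (simp only: Omega_p_eq)
  moreover have "padic_norm p x \<le> 1" if "x \<in> Qp p" "Omega_p p x \<noteq> 0" for x
    using that by (simp add: Omega_p_eq split: if_splits)
  moreover have "pw (int 0) = 1" "pw (- int 0) = 1" by simp_all
  ultimately show ?thesis unfolding lev_def by presburger
qed

lemma lev_cong: "(\<And>x. x \<in> Qp p \<Longrightarrow> e x = f x) \<Longrightarrow> lev N e \<longleftrightarrow> lev N f"
  by (simp add: lev_def)

lemma lev_0_at: "lev N e \<Longrightarrow> x \<in> Qp p \<Longrightarrow> padic_norm p x \<le> pw (- int N) \<Longrightarrow> e x = e (rat_in 0)"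
  using lev_const[of N e x "rat_in 0"] by (simp add: norm_eq_D)

text \<open>\<open>e\<close> vanishes on the ball of radius \<open>pw (- int N)\<close> about 0, and
  outside it the norm is constant on balls of that radius. So the singularity of the power never
  meets the support.\<close>

lemma lev_norm_powr:
  assumes "lev N e" "e (rat_in 0) = 0"
  shows "lev N (\<lambda>x. of_real (padic_norm p x) powr z * e x)"
  unfolding lev_def
proof (intro conjI ballI impI)
  show "padic_norm p x \<le> pw (int N)" if "x \<in> Qp p" "of_real (padic_norm p x) powr z * e x \<noteq> 0" for x
    using that lev_supp[OF assms(1)] by auto
  fix x y assume xy: "x \<in> Qp p" "y \<in> Qp p" "D x y \<le> pw (- int N)"
  have e: "e x = e y" by (rule lev_const[OF assms(1) xy])
  show "of_real (padic_norm p x) powr z * e x = of_real (padic_norm p y) powr z * e y"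
  proof (cases "e x = 0")
    case False
    then have x: "\<not> padic_norm p x \<le> pw (- int N)" "\<not> padic_norm p y \<le> pw (- int N)"
      using lev_0_at[OF assms(1)] assms(2) xy e by auto
    have "padic_norm p x \<le> padic_norm p y" by (rule padic_norm_le_of_D[of x y]) (use x xy in auto)
    moreover have "padic_norm p y \<le> padic_norm p x" by (rule padic_norm_le_of_D[of y x]) (use x xy D_commute[of x y] in auto)
    ultimately show ?thesis using e by simp
  qed (use e in simp)
qed

definition pball :: "nat \<Rightarrow> nat \<Rightarrow> padic set" where
  "pball N j = {x \<in> Qp p. padic_dist p x (pt N j) \<le> pw (- int N)}"

text \<open>The balls around the residues are disjoint and cover the support. Integrals of functions
  of finite level become finite sums in this way.\<close>

lemma lev_expand:
  assumes "lev N e" "x \<in> Qp p"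
  shows "e x = (\<Sum>j<p ^ (N + N). e (pt N j) * indicator (pball N j) x)"
proof (cases "padic_norm p x \<le> pw (int N)")
  case True
  obtain k where k: "k < p ^ (N + N)" "D x (pt N k) \<le> pw (- int N)" using pt_approx[OF assms(2) True] by blast
  have "j = k" if "j < p ^ (N + N)" "D x (pt N j) \<le> pw (- int N)" for j
  proof -
    have "D (pt N j) (pt N k) \<le> pw (- int N)"
      by (rule D_ultra_le[of _ x]) (use that k assms(2) D_commute[of "pt N j" x] in auto)
    then have "[j = k] (mod p ^ (N + N))" by (rule pt_unique)
    then show ?thesis using that k by (simp add: cong_def)
  qed
  then have "x \<in> pball N j \<longleftrightarrow> j = k" if "j < p ^ (N + N)" for j
    using that k(2) assms(2) unfolding pball_def mem_Collect_eq padic_dist_eq[OF assms(2) pt_Qp] by blast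
  then have "(\<Sum>j<p ^ (N + N). e (pt N j) * indicator (pball N j) x) = (\<Sum>j<p ^ (N + N). if j = k then e (pt N k) else 0)"
    by (intro sum.cong) (auto simp: indicator_def)
  then show ?thesis using k lev_const[OF assms(1,2) _ k(2)] by simp
next
  case False
  have "x \<notin> pball N j" for j
  proof
    assume "x \<in> pball N j"
    then have "D x (pt N j) \<le> pw (- int N)"
      using padic_dist_eq[OF assms(2) pt_Qp[of N j]] by (simp add: pball_def)
    moreover have "pw (- int N) \<le> pw (int N)" by (simp add: pw_mono_iff)
    ultimately have "padic_norm p x \<le> pw (int N)"
      by - (rule padic_norm_le_of_D[of x "pt N j"], use norm_pt assms(2) in auto)
    then show False using False by simp
  qed
  then show ?thesis using False lev_supp[OF assms] by auto
qed

end

section \<open>The p-adic Fourier transform\<close>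

lemma
  assumes "A \<in> sets M" "emeasure M A = ennreal m" "0 \<le> m"
  shows integrable_cmult_indicator: "integrable M (\<lambda>x. c * indicator A x :: complex)"
    and integral_cmult_indicator: "(\<integral>x. c * indicator A x \<partial>M) = c * of_real m"
proof -
  have eq: "(\<lambda>x. c * indicator A x) = (\<lambda>x. indicat_real A x *\<^sub>R c)"
    by (auto simp: indicator_def fun_eq_iff)
  have i: "integrable M (indicat_real A)"
    using assms by (intro integrable_real_indicator) auto
  show "integrable M (\<lambda>x. c * indicator A x :: complex)"
    unfolding eq using i by simp
  have "measure M A = m" using assms by (simp add: measure_def)
  moreover have "A \<inter> space M = A" using sets.sets_into_space[OF assms(1)] by auto
  ultimately have "(\<integral>x. indicat_real A x \<partial>M) = m" by simp
  then show "(\<integral>x. c * indicator A x \<partial>M) = c * of_real m"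
    unfolding eq using i by (subst integral_scaleR_left) (auto simp: scaleR_conv_of_real)
qed

lemma sum_shift_periodic:
  fixes f :: "nat \<Rightarrow> 'a::ab_group_add"
  assumes "\<And>j. f (j + n) = f j"
  shows "(\<Sum>j<n. f (j + s)) = (\<Sum>j<n. f j)"
proof (induction s)
  case (Suc s)
  have "(\<Sum>j<n. f (j + Suc s)) = (\<Sum>j<Suc n. f (j + s)) - f s"
    by (simp only: sum.lessThan_Suc_shift) simp
  also have "\<dots> = (\<Sum>j<n. f (j + s))"
    using assms[of s] by (simp add: add.commute)
  finally show ?case using Suc by simp
qed simp

context prime_place
begin

lemma padic_haar_generator:
  "(\<lambda>(a, n). {x \<in> Qp p. padic_dist p x a \<le> real p powi (- n)}) ` (Qp p \<times> UNIV) \<subseteq> Pow (Qp p)"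
  by auto

lemma space_padic_haar [simp]: "space (padic_haar p) = Qp p"
  unfolding padic_haar_def by (rule space_extend_measure[OF padic_haar_generator])

lemma sets_padic_haar_ball:
  "a \<in> Qp p \<Longrightarrow> {x \<in> Qp p. padic_dist p x a \<le> pw (- n)} \<in> sets (padic_haar p)"
  unfolding padic_haar_def sets_extend_measure[OF padic_haar_generator] by (rule sigma_sets.Basic) auto

lemma sets_pball [simp]: "pball N j \<in> sets (padic_haar p)"
  unfolding pball_def by (rule sets_padic_haar_ball) simp

lemma Zp_eq_pball: "Zp p = pball 0 0"
  by (auto simp: Zp_def pball_def pt_def padic_dist_eq norm_eq_D)

lemma sets_Zp [simp]: "Zp p \<in> sets (padic_haar p)"
  by (simp add: Zp_eq_pball)

text \<open>For \<open>padic_norm p \<xi> \<le> pw (int M)\<close>, points at distance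
  \<open>pw (- int M)\<close> have products with \<open>\<xi>\<close> at distance at most 1, which
  the character does not distinguish.\<close>

lemma lev_char:
  assumes e: "lev N e" and \<xi>: "\<xi> \<in> Qp p" "padic_norm p \<xi> \<le> pw (int M)" and NM: "N \<le> M"
  shows "lev M (\<lambda>x. padic_char p (padic_mult p \<xi> x) * e x)"
  unfolding lev_def
proof (intro conjI ballI impI)
  note eM = lev_mono[OF e NM]
  show "padic_norm p x \<le> pw (int M)" if "x \<in> Qp p" "padic_char p (padic_mult p \<xi> x) * e x \<noteq> 0" for x
    using lev_supp[OF eM] that by auto
  fix x y assume xy: "x \<in> Qp p" "y \<in> Qp p" "D x y \<le> pw (- int M)"
  have "padic_norm p \<xi> * D x y \<le> pw (int M) * pw (- int M)"
    using \<xi> xy by (intro mult_mono) auto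
  moreover have "D \<xi> \<xi> = 0" using \<xi> by (simp add: D_eq_0)
  ultimately have "D (padic_mult p \<xi> x) (padic_mult p \<xi> y) \<le> 1"
    using D_mult[OF \<xi>(1) xy(1) \<xi>(1) xy(2)] by simp
  then have "padic_char p (padic_mult p \<xi> x) = padic_char p (padic_mult p \<xi> y)"
    using \<xi> xy by (intro padic_char_cong) auto
  then show "padic_char p (padic_mult p \<xi> x) * e x = padic_char p (padic_mult p \<xi> y) * e y"
    using lev_const[OF eM xy] by simp
qed

lemma padic_char_pt:
  "padic_char p (padic_mult p (pt N k) (pt N j)) = rat_char (of_nat (k * j) / of_nat p ^ (N + N))"
  using padic_char_eq[of "padic_mult p (pt N k) (pt N j)" "int (k * j)" "N + N"]
  by (simp add: pt_def power_add)

text \<open>Orthogonality of characters: a geometric sum over a root of unity of order dividing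
  \<open>p ^ M\<close>.\<close>

lemma rat_char_power_sum:
  "(\<Sum>j<p ^ M. rat_char (of_nat (n * j) / of_nat p ^ M)) = (if p ^ M dvd n then of_nat (p ^ M) else 0)"
proof -
  let ?z = "rat_char (of_nat n / of_nat p ^ M)"
  have pow: "rat_char (of_nat (n * j) / of_nat p ^ M) = ?z ^ j" for j
    by (simp add: rat_char_power mult.commute)
  have "?z = 1 \<longleftrightarrow> p ^ M dvd n"
  proof
    assume "?z = 1"
    then have "of_nat n / of_nat p ^ M \<in> (\<int> :: rat set)" by (simp add: rat_char_eq_1_iff)
    then obtain c where "of_nat n / of_nat p ^ M = (of_int c :: rat)" by (auto elim: Ints_cases)
    then have "of_int (int n) = (of_int (c * int p ^ M) :: rat)" using p_nz by (simp add: field_simps)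
    then have "int n = c * int p ^ M" by (simp only: of_int_eq_iff)
    then have "int (p ^ M) dvd int n" by simp
    then show "p ^ M dvd n" by (simp only: of_nat_dvd_iff)
  next
    assume "p ^ M dvd n"
    then obtain c where "n = p ^ M * c" by blast
    then have "of_nat n / of_nat p ^ M = (of_nat c :: rat)" using p_nz by simp
    then show "?z = 1" by simp
  qed
  moreover have "?z ^ (p ^ M) = 1"
    using p_nz by (simp add: rat_char_power)
  moreover have "(\<Sum>j<p ^ M. ?z ^ j) = (if ?z = 1 then of_nat (p ^ M) else (?z ^ (p ^ M) - 1) / (?z - 1))"
    using geometric_sum[of ?z "p ^ M"] by simp
  ultimately show ?thesis unfolding pow by simp
qed

end

text \<open>The values of \<open>padic_haar\<close> on balls are assumed here; the lemma
  \<open>haar_place\<close> in \<open>adelic_haar\<close> discharges the assumption for every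
  prime.\<close>

locale haar_place = prime_place +
  assumes haar_ball: "a \<in> Qp p \<Longrightarrow>
    emeasure (padic_haar p) {x \<in> Qp p. padic_dist p x a \<le> real p powi (- n)} = ennreal (real p powi (- n))"
begin

lemma emeasure_pball: "emeasure (padic_haar p) (pball N j) = ennreal (pw (- int N))"
  unfolding pball_def by (rule haar_ball) simp

lemma emeasure_Zp: "emeasure (padic_haar p) (Zp p) = 1"
  by (simp add: Zp_eq_pball emeasure_pball)

lemma lev_integral:
  assumes "lev N e"
  shows "integral\<^sup>L (padic_haar p) e = of_real (pw (- int N)) * (\<Sum>j<p ^ (N + N). e (pt N j))"
proof -
  note 1 = integrable_cmult_indicator[OF sets_pball emeasure_pball less_imp_le[OF pw_pos]]
    and 2 = integral_cmult_indicator[OF sets_pball emeasure_pball less_imp_le[OF pw_pos]]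
  let ?f = "\<lambda>x. \<Sum>j<p ^ (N + N). e (pt N j) * indicator (pball N j) x"
  have eq: "e x = ?f x" if "x \<in> space (padic_haar p)" for x
    using lev_expand[OF assms] that by simp
  have "integral\<^sup>L (padic_haar p) e = integral\<^sup>L (padic_haar p) ?f"
    by (rule Bochner_Integration.integral_cong[OF refl eq])
  also have "\<dots> = (\<Sum>j<p ^ (N + N). e (pt N j) * of_real (pw (- int N)))"
    by (subst Bochner_Integration.integral_sum) (simp_all only: 1 2)
  finally show "integral\<^sup>L (padic_haar p) e = of_real (pw (- int N)) * (\<Sum>j<p ^ (N + N). e (pt N j))"
    by (simp add: sum_distrib_left mult.commute)
qed

lemma fourier_eq_sum:
  assumes "lev N e" "\<xi> \<in> Qp p" "padic_norm p \<xi> \<le> pw (int M)" "N \<le> M"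
  shows "padic_fourier p e \<xi> = of_real (pw (- int M)) *
    (\<Sum>j<p ^ (M + M). padic_char p (padic_mult p \<xi> (pt M j)) * e (pt M j))"
  unfolding padic_fourier_def by (rule lev_integral[OF lev_char[OF assms]])

text \<open>Translation by \<open>p ^ N\<close> leaves \<open>e\<close> invariant and multiplies the
  character by a constant \<open>?c\<close>. The sum is thus equal to \<open>?c\<close> times
  itself, and \<open>?c \<noteq> 1\<close> because \<open>\<xi> p^N\<close> is not integral.\<close>

lemma fourier_supp:
  assumes e: "lev N e" and \<xi>: "\<xi> \<in> Qp p" and big: "\<not> padic_norm p \<xi> \<le> pw (int N)"
  shows "padic_fourier p e \<xi> = 0"
proof -
  obtain M0 where "padic_norm p \<xi> \<le> pw (int M0)" using exists_pw_ge by blast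
  moreover have "pw (int M0) \<le> pw (int (max M0 N))" by (simp add: pw_mono_iff)
  ultimately obtain M where M: "padic_norm p \<xi> \<le> pw (int M)" "N \<le> M"
    by (metis max.cobounded2 order_trans)
  define f where "f j = padic_char p (padic_mult p \<xi> (pt M j)) * e (pt M j)" for j
  let ?c = "padic_char p (padic_mult p \<xi> (rat_in (of_nat p ^ N)))"
  have per: "f (j + p ^ (M + M)) = f j" for j
    unfolding f_def using pt_cong[of "j + p ^ (M + M)" j M M]
    by (intro lev_const[OF lev_char[OF e \<xi> M]]) (auto simp: cong_def)
  \<comment> \<open>Sample points are multiples of \<open>1 / p ^ M\<close>, so adding
    \<open>p ^ (M + N)\<close> to the index adds \<open>p ^ N\<close> to the point.\<close>
  have shift: "f (j + p ^ (M + N)) = ?c * f j" for j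
  proof -
    have pt: "pt M (j + p ^ (M + N)) = rat_in (of_nat j / of_nat p ^ M + of_nat p ^ N)"
      using p_nz by (simp add: pt_def power_add add_divide_distrib)
    have "D (pt M (j + p ^ (M + N))) (pt M j) = pw (- int N)"
      unfolding pt by (simp add: pt_def padic_abs_power)
    then have "e (pt M (j + p ^ (M + N))) = e (pt M j)"
      by (intro lev_const[OF e]) auto
    then show ?thesis
      unfolding f_def pt padic_char_mult_add[OF \<xi>] by (simp add: pt_def)
  qed
  have "?c \<noteq> 1"
  proof
    assume "?c = 1"
    then have "padic_norm p (padic_mult p \<xi> (rat_in (of_nat p ^ N))) \<le> 1"
      using \<xi> by (intro padic_char_eq_1) auto
    then have "padic_norm p \<xi> * pw (- int N) \<le> 1"
      using \<xi> by (simp add: padic_norm_mult padic_abs_power)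
    then have "padic_norm p \<xi> * pw (- int N) * pw (int N) \<le> 1 * pw (int N)"
      by (intro mult_right_mono) auto
    then show False using big by (simp add: mult.assoc)
  qed
  moreover have "(\<Sum>j<p ^ (M + M). f j) = ?c * (\<Sum>j<p ^ (M + M). f j)"
    using sum_shift_periodic[of f "p ^ (M + M)" "p ^ (M + N)", OF per] by (simp add: shift sum_distrib_left)
  ultimately have "(\<Sum>j<p ^ (M + M). f j) = 0" by simp
  then show ?thesis using fourier_eq_sum[OF e \<xi> M] by (simp add: f_def)
qed

text \<open>Bounded support and local constancy exchange roles with the same \<open>N\<close>: the
  finite group behind level \<open>N\<close> is its own dual.\<close>

lemma lev_fourier:
  assumes e: "lev N e"
  shows "lev N (padic_fourier p e)"
  unfolding lev_def
proof (intro conjI ballI impI)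
  show "padic_norm p \<xi> \<le> pw (int N)" if "\<xi> \<in> Qp p" "padic_fourier p e \<xi> \<noteq> 0" for \<xi>
    using fourier_supp[OF e] that by blast
  fix \<xi> \<eta> assume xy: "\<xi> \<in> Qp p" "\<eta> \<in> Qp p" "D \<xi> \<eta> \<le> pw (- int N)"
  have le: "pw (- int N) \<le> pw (int N)" by (simp add: pw_mono_iff)
  have iff: "padic_norm p \<xi> \<le> pw (int N) \<longleftrightarrow> padic_norm p \<eta> \<le> pw (int N)"
    using padic_norm_le_of_D[OF xy(1,2)] padic_norm_le_of_D[OF xy(2,1)] xy(3) le D_commute[OF xy(1,2)] by auto
  show "padic_fourier p e \<xi> = padic_fourier p e \<eta>"
  proof (cases "padic_norm p \<xi> \<le> pw (int N)")
    case True
    have "padic_char p (padic_mult p \<xi> (pt N j)) = padic_char p (padic_mult p \<eta> (pt N j))" for j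
    proof (rule padic_char_cong)
      have "padic_norm p (pt N j) * D \<xi> \<eta> \<le> pw (int N) * pw (- int N)"
        using xy norm_pt by (intro mult_mono) auto
      moreover have "D (pt N j) (pt N j) = 0" by (simp add: D_eq_0)
      ultimately show "D (padic_mult p \<xi> (pt N j)) (padic_mult p \<eta> (pt N j)) \<le> 1"
        using D_mult[OF xy(1) pt_Qp[of N j] xy(2) pt_Qp[of N j]] by simp
    qed (use xy in auto)
    then show ?thesis
      using fourier_eq_sum[OF e xy(1) True order_refl] fourier_eq_sum[OF e xy(2) _ order_refl] iff True by simp
  next
    case False
    then show ?thesis using fourier_supp[OF e] xy iff by simp
  qed
qed

text \<open>Sampling at \<open>pt N k\<close> gives a discrete transform of length
  \<open>q = p ^ (N + N)\<close>, applied twice. Orthogonality leaves only the index congruent to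
  \<open>- k\<close>, with the factor \<open>q\<close> that cancels the two normalizations
  \<open>pw (- int N)\<close>.\<close>

lemma fourier_fourier:
  assumes e: "lev N e" and x: "x \<in> Qp p"
  shows "padic_fourier p (padic_fourier p e) x = e (neg x)"
proof (cases "padic_norm p x \<le> pw (int N)")
  case False
  then have "padic_fourier p (padic_fourier p e) x = 0" using fourier_supp[OF lev_fourier[OF e] x] by simp
  moreover have "e (neg x) = 0" using lev_supp[OF e, of "neg x"] False x by auto
  ultimately show ?thesis by simp
next
  case True
  define q where "q = p ^ (N + N)"
  have q0: "q > 0" using p_nz by (simp add: q_def)
  have qq: "of_real (pw (- int N)) * (of_real (pw (- int N)) * of_nat q) = (1 :: complex)"
  proof -
    have "real q = pw (int N) * pw (int N)" by (simp add: q_def power_int_of_nat power_add)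
    then have "pw (- int N) * (pw (- int N) * real q) = (pw (- int N) * pw (int N)) * (pw (- int N) * pw (int N))"
      by (simp only: mult_ac)
    then have "pw (- int N) * (pw (- int N) * real q) = 1" by simp
    then show ?thesis by (metis of_real_1 of_real_mult of_real_of_nat_eq)
  qed
  obtain k where k: "k < p ^ (N + N)" "D x (pt N k) \<le> pw (- int N)" using pt_approx[OF x True] by blast
  have Fpt: "padic_fourier p f (pt N k) = of_real (pw (- int N)) * (\<Sum>j<q. rat_char (of_nat (k * j) / of_nat p ^ (N + N)) * f (pt N j))"
    if "lev N f" for f k
    using fourier_eq_sum[OF that pt_Qp norm_pt order_refl] by (simp add: padic_char_pt q_def)
  have "padic_fourier p (padic_fourier p e) x = padic_fourier p (padic_fourier p e) (pt N k)"
    by (rule lev_const[OF lev_fourier[OF lev_fourier[OF e]] x pt_Qp k(2)])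
  also have "\<dots> = of_real (pw (- int N)) * (\<Sum>j<q. rat_char (of_nat (k * j) / of_nat p ^ (N + N)) *
      (of_real (pw (- int N)) * (\<Sum>l<q. rat_char (of_nat (j * l) / of_nat p ^ (N + N)) * e (pt N l))))"
    by (simp only: Fpt[OF lev_fourier[OF e]] Fpt[OF e])
  also have "\<dots> = of_real (pw (- int N)) * (of_real (pw (- int N)) *
      (\<Sum>j<q. \<Sum>l<q. rat_char (of_nat ((k + l) * j) / of_nat p ^ (N + N)) * e (pt N l)))"
  proof -
    have "rat_char (of_nat (k * j) / of_nat p ^ (N + N)) * rat_char (of_nat (j * l) / of_nat p ^ (N + N))
       = rat_char (of_nat ((k + l) * j) / of_nat p ^ (N + N))" for j l
      unfolding rat_char_add[symmetric] by (simp add: add_divide_distrib[symmetric] algebra_simps)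
    then have "rat_char (of_nat (k * j) / of_nat p ^ (N + N)) *
      (of_real (pw (- int N)) * (\<Sum>l<q. rat_char (of_nat (j * l) / of_nat p ^ (N + N)) * e (pt N l)))
      = of_real (pw (- int N)) * (\<Sum>l<q. rat_char (of_nat ((k + l) * j) / of_nat p ^ (N + N)) * e (pt N l))" for j
      unfolding mult.left_commute[of "rat_char _" "of_real _"]
      by (simp only: sum_distrib_left mult.assoc[symmetric])
    then show ?thesis by (simp only: sum_distrib_left)
  qed
  also have "(\<Sum>j<q. \<Sum>l<q. rat_char (of_nat ((k + l) * j) / of_nat p ^ (N + N)) * e (pt N l))
      = (\<Sum>l<q. (\<Sum>j<q. rat_char (of_nat ((k + l) * j) / of_nat p ^ (N + N))) * e (pt N l))"
    by (subst sum.swap) (simp only: sum_distrib_right)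
  also have "\<dots> = (\<Sum>l<q. (if q dvd k + l then of_nat q else 0) * e (pt N l))"
    by (simp only: q_def rat_char_power_sum)
  \<comment> \<open>The index is the residue of \<open>- k\<close>; the outer \<open>mod\<close>
    yields 0 when \<open>q\<close> divides \<open>k\<close>. For this index \<open>pt N l\<close>
    lies within \<open>pw (- int N)\<close> of \<open>neg x\<close>.\<close>
  also have "\<dots> = (\<Sum>l<q. if l = (q - k mod q) mod q then of_nat q * e (neg x) else 0)"
  proof (intro sum.cong refl)
    fix l assume l: "l \<in> {..<q}"
    have iff: "q dvd k + l \<longleftrightarrow> l = (q - k mod q) mod q"
    proof -
      have "q dvd k + l \<longleftrightarrow> q dvd k mod q + l" by (simp add: dvd_eq_mod_eq_0 mod_add_left_eq)
      also have "\<dots> \<longleftrightarrow> l = (q - k mod q) mod q"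
      proof (cases "k mod q = 0")
        case True
        then show ?thesis using l by (auto simp: nat_dvd_not_less dvd_eq_mod_eq_0)
      next
        case False
        have kq: "k mod q < q" using q0 by simp
        have "q dvd k mod q + l \<longleftrightarrow> k mod q + l = q"
        proof
          assume "q dvd k mod q + l"
          then obtain c where c: "k mod q + l = q * c" by blast
          have "l < q" using l by simp
          then have "k mod q + l < q * 2" using kq by linarith
          moreover have "q * 0 < k mod q + l" using False by simp
          ultimately have "q * 0 < q * c" "q * c < q * 2" unfolding c by blast+
          then have "0 < c" "c < 2" unfolding nat_mult_less_cancel_disj by auto
          then have "c = 1" by auto
          then show "k mod q + l = q" using c by simp
        qed simp
        then show ?thesis using False kq l by auto
      qed
      finally show ?thesis .
    qed
    have "e (pt N l) = e (neg x)" if "q dvd k + l"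
    proof -
      have "int q dvd int (k + l)" using that by (simp only: of_nat_dvd_iff)
      then have "padic_abs p (of_int (int (k + l))) \<le> pw (- int (N + N))"
        by (simp only: padic_abs_of_int_le q_def of_nat_power)
      then have "padic_abs p (of_int (int (k + l))) * pw (int N) \<le> pw (- int (N + N)) * pw (int N)"
        by (intro mult_right_mono) auto
      also have "\<dots> = pw (- int N)" unfolding pw_add[symmetric] by simp
      finally have "padic_abs p (of_int (int (k + l)) / of_nat p ^ N) \<le> pw (- int N)"
        by (simp only: padic_abs_divide_power)
      moreover have "D (pt N l) (neg (pt N k)) = padic_abs p (of_int (int (k + l)) / of_nat p ^ N)"
        by (simp add: pt_def add_divide_distrib add.commute)
      ultimately have 1: "D (pt N l) (neg (pt N k)) \<le> pw (- int N)" by simp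
      have "D (neg (pt N k)) (neg x) \<le> pw (- int N)"
        using k(2) x D_commute[OF x pt_Qp[of N k]] by simp
      then have "D (pt N l) (neg x) \<le> pw (- int N)"
        using D_ultra_le[OF _ _ _ 1] x by simp
      then show ?thesis using x by (intro lev_const[OF e]) auto
    qed
    then show "(if q dvd k + l then of_nat q else 0) * e (pt N l) = (if l = (q - k mod q) mod q then of_nat q * e (neg x) else 0)"
      using iff by auto
  qed
  also have "\<dots> = of_nat q * e (neg x)" using q0 by simp
  also have "of_real (pw (- int N)) * (of_real (pw (- int N)) * (of_nat q * e (neg x))) = e (neg x)"
    using qq by (simp only: mult.assoc[symmetric] mult_1)
  finally show ?thesis .
qed

lemma fourier_cong: "(\<And>x. x \<in> Qp p \<Longrightarrow> e x = f x) \<Longrightarrow> padic_fourier p e \<xi> = padic_fourier p f \<xi>"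
  unfolding padic_fourier_def by (rule Bochner_Integration.integral_cong) auto

lemma fourier_4:
  assumes "lev N e" "x \<in> Qp p"
  shows "padic_fourier p (padic_fourier p (padic_fourier p (padic_fourier p e))) x = e x"
  using fourier_fourier[OF lev_fourier[OF lev_fourier[OF assms(1)]] assms(2)]
    fourier_fourier[OF assms(1), of "neg x"] assms(2) by simp

lemma padic_mult_0: "x \<in> Qp p \<Longrightarrow> padic_mult p (rat_in 0) x = rat_in 0"
  using padic_norm_mult[of "rat_in 0" x] padic_norm_eq_0[of "padic_mult p (rat_in 0) x"] by simp

lemma fourier_at_0: "padic_fourier p e (rat_in 0) = integral\<^sup>L (padic_haar p) e"
  unfolding padic_fourier_def
  by (rule Bochner_Integration.integral_cong) (auto simp: padic_mult_0 padic_char_integral)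

text \<open>With \<open>integral_fourier_3\<close> this matches the two descriptions of a level:
  mean zero for the factors of \<open>\<Phi>\<close> and vanishing at 0 for those of
  \<open>\<Psi>\<close>, exchanged by the inverse transform.\<close>

lemma fourier_3_at_0:
  assumes "lev N e"
  shows "padic_fourier p (padic_fourier p (padic_fourier p e)) (rat_in 0) = integral\<^sup>L (padic_haar p) e"
  using fourier_fourier[OF lev_fourier[OF assms], of "rat_in 0"] by (simp add: fourier_at_0)

lemma integral_fourier_3:
  assumes "lev N e"
  shows "integral\<^sup>L (padic_haar p) (padic_fourier p (padic_fourier p (padic_fourier p e))) = e (rat_in 0)"
  using fourier_4[OF assms, of "rat_in 0"] by (simp add: fourier_at_0)

text \<open>At level 0 there is one sample point, so the transform is 1 on the unit ball and 0
  elsewhere. Because of this self-duality, transforms of adelic products differ from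
  \<open>Omega_p\<close> at finitely many primes only.\<close>

lemma fourier_Omega:
  assumes "\<xi> \<in> Qp p"
  shows "padic_fourier p (Omega_p p) \<xi> = Omega_p p \<xi>"
proof (cases "padic_norm p \<xi> \<le> 1")
  case True
  have "padic_fourier p (Omega_p p) \<xi> = Omega_p p (rat_in 0)"
    using fourier_eq_sum[OF lev_Omega assms, of 0] True
      padic_char_integral[of "padic_mult p \<xi> (rat_in 0)"] assms
    by (simp add: pt_def padic_norm_mult)
  then show ?thesis using True assms by (simp add: Omega_p_eq)
next
  case False
  then show ?thesis using fourier_supp[OF lev_Omega assms] assms by (simp add: Omega_p_eq)
qed

end

section \<open>The Haar measure of the finite adeles\<close>

text \<open>\<open>extend_measure\<close> returns a measure with the prescribed values if there is
  one, and otherwise falls back on the zero measure.\<close>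

lemma extend_measure_cases:
  assumes "G ` I \<subseteq> Pow \<Omega>"
  shows "(\<forall>A. emeasure (extend_measure \<Omega> I G \<mu>) A = 0) \<or> (\<forall>i\<in>I. emeasure (extend_measure \<Omega> I G \<mu>) (G i) = \<mu> i)"
proof (cases "\<exists>\<mu>'. (\<forall>i\<in>I. \<mu>' (G i) = \<mu> i) \<and> measure_space \<Omega> (sigma_sets \<Omega> (G ` I)) \<mu>'")
  case True
  then obtain \<mu>' where \<mu>': "\<And>i. i \<in> I \<Longrightarrow> \<mu>' (G i) = \<mu> i" "measure_space \<Omega> (sigma_sets \<Omega> (G ` I)) \<mu>'"
    by blast
  have "emeasure (extend_measure \<Omega> I G \<mu>) (G i) = \<mu> i" if "i \<in> I" for i
    by (rule emeasure_extend_measure[where \<mu>' = \<mu>' and I = I and G = G and \<Omega> = \<Omega> and \<mu> = \<mu>])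
      (use \<mu>'(1) assms in \<open>simp_all\<close>, use \<mu>'(2) that in \<open>auto simp: sets_extend_measure[OF assms] measure_space_def\<close>)
  then show ?thesis by blast
next
  case False
  then have "extend_measure \<Omega> I G \<mu> = sigma \<Omega> (G ` I)"
    unfolding extend_measure_def by (simp only: if_False simp_thms)
  then show ?thesis by (simp add: emeasure_sigma)
qed

definition haar_box :: "(nat \<Rightarrow> padic set) \<Rightarrow> bool" where
  "haar_box X \<longleftrightarrow> (\<forall>p. prime p \<longrightarrow> X p \<in> sets (padic_haar p)) \<and> finite {p. prime p \<and> X p \<noteq> Zp p}"

abbreviation adele_box :: "(nat \<Rightarrow> padic set) \<Rightarrow> fin_adele set" where
  "adele_box X \<equiv> \<Pi>\<^sub>E p\<in>{p. prime p}. X p"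

lemma box_fin_adeles:
  assumes "haar_box X" shows "adele_box X \<subseteq> fin_adeles"
proof
  fix y assume y: "y \<in> adele_box X"
  have "X p \<subseteq> Qp p" if "prime p" for p
    using sets.sets_into_space[of "X p" "padic_haar p"] prime_place.space_padic_haar[OF prime_place.intro[OF that]]
      assms that by (auto simp: haar_box_def)
  then have "y \<in> (\<Pi>\<^sub>E p\<in>{p. prime p}. Qp p)" using y unfolding PiE_iff mem_Collect_eq by blast
  moreover have "{p. prime p \<and> y p \<notin> Zp p} \<subseteq> {p. prime p \<and> X p \<noteq> Zp p}" using y by auto
  then have "finite {p. prime p \<and> y p \<notin> Zp p}" using assms finite_subset by (auto simp: haar_box_def)
  ultimately show "y \<in> fin_adeles" by (simp add: fin_adeles_def)
qed

lemma fin_adele_haar_eq: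
  "fin_adele_haar = extend_measure fin_adeles (Collect haar_box) adele_box
     (\<lambda>X. \<Prod>p | prime p \<and> X p \<noteq> Zp p. emeasure (padic_haar p) (X p))"
proof -
  have "Collect haar_box = {X. (\<forall>p. prime p \<longrightarrow> X p \<in> sets (padic_haar p)) \<and> finite {p. prime p \<and> X p \<noteq> Zp p}}"
    by (auto simp: haar_box_def)
  then show ?thesis by (simp only: fin_adele_haar_def)
qed

lemma box_Pow: "adele_box ` Collect haar_box \<subseteq> Pow fin_adeles"
  using box_fin_adeles by auto

lemma space_fin_adele_haar [simp]: "space fin_adele_haar = fin_adeles"
  unfolding fin_adele_haar_eq by (rule space_extend_measure[OF box_Pow])

lemma sets_box: "haar_box X \<Longrightarrow> adele_box X \<in> sets fin_adele_haar"
  unfolding fin_adele_haar_eq sets_extend_measure[OF box_Pow] by (rule sigma_sets.Basic) auto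

text \<open>The measures are specified by their values on boxes. No existence proof is needed: if there
  is no such measure, \<open>extend_measure\<close> yields the zero measure, and then \<open>Phi\<close> is trivial.\<close>

locale adelic_haar =
  assumes emeasure_box: "haar_box X \<Longrightarrow>
    emeasure fin_adele_haar (adele_box X) = (\<Prod>p | prime p \<and> X p \<noteq> Zp p. emeasure (padic_haar p) (X p))"

lemma fin_adele_haar_cases:
  "(\<forall>A. emeasure fin_adele_haar A = 0) \<or> adelic_haar"
  using extend_measure_cases[OF box_Pow, of "\<lambda>X. \<Prod>p | prime p \<and> X p \<noteq> Zp p. emeasure (padic_haar p) (X p)"]
  unfolding fin_adele_haar_eq[symmetric] adelic_haar_def by auto

context adelic_haar
begin

text \<open>If the measure at \<open>p\<close> were zero, all boxes with a ball of radius
  \<open>1 / p\<close> at \<open>p\<close> and integers elsewhere would be null. But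
  \<open>p\<close> of them cover the box of integral adeles, which has measure 1.\<close>

lemma haar_place:
  assumes p: "prime p" shows "haar_place p"
proof -
  interpret prime_place p by (rule prime_place.intro[OF p])
  have "\<not> (\<forall>A. emeasure (padic_haar p) A = 0)"
  proof
    assume 0: "\<forall>A. emeasure (padic_haar p) A = 0"
    let ?B = "\<lambda>j. {x \<in> Qp p. padic_dist p x (pt 0 j) \<le> pw (- 1)}"
    let ?X = "\<lambda>j q. if q = p then ?B j else Zp q"
    \<comment> \<open>The product defining the measure of a box omits primes with factor
      \<open>Zp p\<close>. The supposed value 0 at \<open>p\<close> enters because
      \<open>?B j\<close> is a different set: \<open>pt 0 (j + 1)\<close> is integral and lies
      outside.\<close>
    have neq: "?B j \<noteq> Zp p" for j
    proof -
      have "pt 0 (j + 1) \<in> Zp p" using norm_pt[of 0 "j + 1"] by (simp add: Zp_iff)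
      moreover have "padic_dist p (pt 0 (j + 1)) (pt 0 j) = 1"
        by (simp add: padic_dist_eq) (simp add: pt_def)
      moreover have "pw (- 1) < 1" using pw_strict_mono_iff[of "-1" 0] by simp
      ultimately have "pt 0 (j + 1) \<notin> ?B j" by auto
      then show ?thesis using \<open>pt 0 (j + 1) \<in> Zp p\<close> by blast
    qed
    have supp: "{q. prime q \<and> ?X j q \<noteq> Zp q} = {p}" for j using neq p by auto
    have hb: "haar_box (?X j)" for j
      using supp[of j] sets_padic_haar_ball[of "pt 0 j" 1] prime_place.sets_Zp[OF prime_place.intro]
      by (auto simp: haar_box_def)
    have hZ: "haar_box Zp" using prime_place.sets_Zp[OF prime_place.intro] by (auto simp: haar_box_def)
    have "emeasure fin_adele_haar (adele_box (?X j)) = 0" for j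
      unfolding emeasure_box[OF hb] supp using 0 by simp
    \<comment> \<open>An empty product, hence 1 whatever the local measures are.\<close>
    moreover have "emeasure fin_adele_haar (adele_box Zp) = 1"
      unfolding emeasure_box[OF hZ] by simp
    moreover have "adele_box Zp \<subseteq> (\<Union>j\<in>{..<p}. adele_box (?X j))"
    proof
      fix y assume y: "y \<in> adele_box Zp"
      then have "y p \<in> Zp p" using p by auto
      then have "y p \<in> Qp p" "padic_norm p (y p) \<le> pw (int 0)" by (simp_all add: Zp_iff)
      then obtain j where j: "j < p ^ (0 + 1)" "D (y p) (pt 0 j) \<le> pw (- int 1)" using pt_approx by blast
      then have "y \<in> adele_box (?X j)"
        using y \<open>y p \<in> Qp p\<close> by (auto simp: PiE_iff padic_dist_eq)
      then show "y \<in> (\<Union>j\<in>{..<p}. adele_box (?X j))" using j by auto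
    qed
    then have "emeasure fin_adele_haar (adele_box Zp) \<le> emeasure fin_adele_haar (\<Union>j\<in>{..<p}. adele_box (?X j))"
      using sets_box[OF hb] by (intro emeasure_mono sets.finite_UN) auto
    moreover have "\<dots> \<le> (\<Sum>j\<in>{..<p}. emeasure fin_adele_haar (adele_box (?X j)))"
      using sets_box[OF hb] by (intro emeasure_subadditive_finite) auto
    ultimately show False by simp
  qed
  then have "\<forall>i\<in>Qp p \<times> UNIV. emeasure (padic_haar p) ((\<lambda>(a, n). {x \<in> Qp p. padic_dist p x a \<le> real p powi (- n)}) i)
      = (\<lambda>(a, n). ennreal (real p powi (- n))) i"
    using extend_measure_cases[OF padic_haar_generator, of "\<lambda>(a, n). ennreal (real p powi (- n))"]
    unfolding padic_haar_def by blast
  then show ?thesis by unfold_locales auto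
qed

text \<open>Boxes with the ball of radius \<open>p ^ n\<close> at the primes up to \<open>n\<close>
  and \<open>Zp p\<close> at the others exhaust \<open>fin_adeles\<close>, because a finite adele
  has only finitely many non-integral components.\<close>

lemma sigma_finite_fin_adele_haar: "sigma_finite_measure fin_adele_haar"
proof
  \<comment> \<open>The double minus matches the generating balls of \<open>padic_haar\<close>,
    whose radius is \<open>p powi (- n)\<close>.\<close>
  let ?X = "\<lambda>n p. if p \<le> n then {x \<in> Qp p. padic_dist p x (padic_of_rat p 0) \<le> real p powi (- (- int n))} else Zp p"
  have supp: "{p. prime p \<and> ?X n p \<noteq> Zp p} \<subseteq> {..n}" for n by auto
  have X: "?X n p \<in> sets (padic_haar p)" "emeasure (padic_haar p) (?X n p) < \<infinity>" if "prime p" for n p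
  proof -
    interpret haar_place p by (rule haar_place[OF that])
    show "?X n p \<in> sets (padic_haar p)" using sets_padic_haar_ball[of "padic_of_rat p 0" "- int n"] by simp
    show "emeasure (padic_haar p) (?X n p) < \<infinity>"
      using haar_ball[of "padic_of_rat p 0" "- int n"] emeasure_Zp by simp
  qed
  have hb: "haar_box (?X n)" for n
    using X(1) finite_subset[OF supp] by (simp add: haar_box_def)
  show "\<exists>A. countable A \<and> A \<subseteq> sets fin_adele_haar \<and> \<Union> A = space fin_adele_haar \<and> (\<forall>a\<in>A. emeasure fin_adele_haar a \<noteq> \<infinity>)"
  proof (intro exI[of _ "range (\<lambda>n. adele_box (?X n))"] conjI ballI)
    show "range (\<lambda>n. adele_box (?X n)) \<subseteq> sets fin_adele_haar" using sets_box[OF hb] by auto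
    show "\<Union> (range (\<lambda>n. adele_box (?X n))) = space fin_adele_haar"
    proof
      show "\<Union> (range (\<lambda>n. adele_box (?X n))) \<subseteq> space fin_adele_haar" using box_fin_adeles[OF hb] by auto
      show "space fin_adele_haar \<subseteq> \<Union> (range (\<lambda>n. adele_box (?X n)))"
      proof
        fix y assume "y \<in> space fin_adele_haar"
        then have y: "y \<in> (\<Pi>\<^sub>E p\<in>{p. prime p}. Qp p)" and fin: "finite {p. prime p \<and> y p \<notin> Zp p}"
          by (auto simp: fin_adeles_def)
        let ?T = "{p. prime p \<and> y p \<notin> Zp p}"
        have "\<exists>B. padic_norm p (y p) \<le> real p powi int B" if "prime p" for p
          using prime_place.exists_pw_ge[OF prime_place.intro[OF that]] by blast
        then obtain B where B: "\<And>p. prime p \<Longrightarrow> padic_norm p (y p) \<le> real p powi int (B p)" by metis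
        \<comment> \<open>\<open>n\<close> bounds the primes with non-integral component as well as
          the exponents of their norms; at any other prime up to \<open>n\<close> the larger ball
          still contains \<open>Zp p\<close>.\<close>
        define n where "n = Max (insert 0 (?T \<union> B ` ?T))"
        have n: "p \<le> n" "B p \<le> n" if "p \<in> ?T" for p
          using fin that by (auto simp: n_def)
        have "y p \<in> ?X n p" if p: "prime p" for p
        proof -
          interpret prime_place p by (rule prime_place.intro[OF p])
          have yQ: "y p \<in> Qp p" using y p by auto
          show ?thesis
          proof (cases "p \<in> ?T")
            case True
            have "pw (int (B p)) \<le> pw (int n)" using n(2)[OF True] by (simp add: pw_mono_iff)
            then show ?thesis using n(1)[OF True] yQ B[OF p] by (simp add: padic_dist_eq norm_eq_D[symmetric])
          next
            case False
            then have Z: "y p \<in> Zp p" using p by simp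
            have "pw 0 \<le> pw (int n)" by (simp add: pw_mono_iff del: power_int_0_right)
            then show ?thesis using Z yQ by (auto simp: Zp_iff padic_dist_eq norm_eq_D[symmetric])
          qed
        qed
        then have "y \<in> adele_box (?X n)" using y by (auto simp: PiE_iff)
        then show "y \<in> \<Union> (range (\<lambda>n. adele_box (?X n)))" by blast
      qed
    qed
    fix a assume "a \<in> range (\<lambda>n. adele_box (?X n))"
    then obtain n where a: "a = adele_box (?X n)" by blast
    have "emeasure fin_adele_haar a < \<infinity>"
      unfolding a emeasure_box[OF hb] using X(2) finite_subset[OF supp]
      by (auto simp: less_top[symmetric] ennreal_prod_eq_top)
    then show "emeasure fin_adele_haar a \<noteq> \<infinity>" by simp
  qed auto
qed

end

section \<open>Products over the primes and integrals of product functions\<close>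

lemma prime_prod_eq:
  assumes "finite S" "\<And>p. p \<in> S \<Longrightarrow> prime p" "\<And>p. prime p \<Longrightarrow> p \<notin> S \<Longrightarrow> f p = 1"
  shows "prime_prod f = (\<Prod>p\<in>S. f p)"
  unfolding prime_prod_def using assms by (intro prod.mono_neutral_left) auto

lemma prime_prod_mult:
  assumes "finite {p. prime p \<and> f p \<noteq> 1}" "finite {p. prime p \<and> g p \<noteq> 1}"
  shows "prime_prod (\<lambda>p. f p * g p) = prime_prod f * prime_prod g"
proof -
  let ?S = "{p. prime p \<and> f p \<noteq> 1} \<union> {p. prime p \<and> g p \<noteq> 1}"
  have S: "finite ?S" "\<And>p. p \<in> ?S \<Longrightarrow> prime p" using assms by auto
  have "prime_prod (\<lambda>p. f p * g p) = (\<Prod>p\<in>?S. f p * g p)" "prime_prod f = (\<Prod>p\<in>?S. f p)" "prime_prod g = (\<Prod>p\<in>?S. g p)"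
    by (rule prime_prod_eq[OF S]; auto)+
  then show ?thesis by (simp add: prod.distrib)
qed

lemma prime_prod_cong: "(\<And>p. prime p \<Longrightarrow> f p = g p) \<Longrightarrow> prime_prod f = prime_prod g"
  unfolding prime_prod_def by (intro prod.cong) auto

lemma fin_adele_component: "y \<in> fin_adeles \<Longrightarrow> prime p \<Longrightarrow> y p \<in> Qp p"
  and fin_adele_finite: "y \<in> fin_adeles \<Longrightarrow> finite {p. prime p \<and> y p \<notin> Zp p}"
  by (auto simp: fin_adeles_def)

text \<open>The exceptional set \<open>S\<close> is a parameter, because twisting by the character
  of an adele enlarges it by the primes where that adele is not integral.\<close>

definition test_family :: "nat set \<Rightarrow> (nat \<Rightarrow> padic \<Rightarrow> complex) \<Rightarrow> bool" where
  "test_family S e \<longleftrightarrow> finite S \<and> (\<forall>p\<in>S. prime p) \<and> (\<forall>p. prime p \<longrightarrow> e p \<in> padic_test p) \<and>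
     (\<forall>p. prime p \<longrightarrow> p \<notin> S \<longrightarrow> (\<forall>x\<in>Qp p. e p x = Omega_p p x))"

lemma Omega_p_Zp: "prime p \<Longrightarrow> x \<in> Qp p \<Longrightarrow> Omega_p p x = (if x \<in> Zp p then 1 else 0)"
  using prime_place.Omega_p_eq[OF prime_place.intro] prime_place.Zp_iff[OF prime_place.intro] by metis

lemma test_family_support:
  assumes "test_family S e" "y \<in> fin_adeles"
  shows "finite {p. prime p \<and> e p (y p) \<noteq> 1}"
proof (rule finite_subset)
  show "{p. prime p \<and> e p (y p) \<noteq> 1} \<subseteq> S \<union> {p. prime p \<and> y p \<notin> Zp p}"
    using assms fin_adele_component[OF assms(2)] by (auto simp: test_family_def Omega_p_Zp)
  show "finite (S \<union> {p. prime p \<and> y p \<notin> Zp p})"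
    using assms fin_adele_finite by (auto simp: test_family_def)
qed

text \<open>Outside \<open>S\<close> every factor is 0 or 1 according to integrality, so these
  factors multiply to a single truth value.\<close>

lemma prime_prod_test_family:
  assumes S: "test_family S e" and y: "y \<in> fin_adeles"
  shows "prime_prod (\<lambda>p. e p (y p)) =
    (\<Prod>p\<in>S. e p (y p)) * of_bool (\<forall>p. prime p \<longrightarrow> p \<notin> S \<longrightarrow> y p \<in> Zp p)"
proof -
  let ?T = "S \<union> {p. prime p \<and> y p \<notin> Zp p}"
  have fin: "finite S" "finite ?T" using S fin_adele_finite[OF y] by (auto simp: test_family_def)
  have e: "e p (y p) = (if y p \<in> Zp p then 1 else 0)" if "prime p" "p \<notin> S" for p
    using S fin_adele_component[OF y that(1)] that by (auto simp: test_family_def Omega_p_Zp)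
  have "prime_prod (\<lambda>p. e p (y p)) = (\<Prod>p\<in>?T. e p (y p))"
    by (rule prime_prod_eq) (use fin S e in \<open>auto simp: test_family_def\<close>)
  also have "\<dots> = (\<Prod>p\<in>S. e p (y p)) * (\<Prod>p\<in>?T - S. e p (y p))"
    using fin by (subst prod.subset_diff[of S ?T]) (auto simp: mult.commute)
  also have "(\<Prod>p\<in>?T - S. e p (y p)) = of_bool (\<forall>p. prime p \<longrightarrow> p \<notin> S \<longrightarrow> y p \<in> Zp p)"
  proof (cases "\<forall>p. prime p \<longrightarrow> p \<notin> S \<longrightarrow> y p \<in> Zp p")
    case True
    then have "?T - S = {}" by auto
    then have "(\<Prod>p\<in>?T - S. e p (y p)) = 1" by (simp only: prod.empty)
    moreover have "of_bool (\<forall>p. prime p \<longrightarrow> p \<notin> S \<longrightarrow> y p \<in> Zp p) = (1 :: complex)" using True by simp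
    ultimately show ?thesis by (rule trans[OF _ sym])
  next
    case False
    then obtain p where "prime p" "p \<notin> S" "y p \<notin> Zp p" by blast
    then have "p \<in> ?T - S" "e p (y p) = 0" using e by auto
    then have "(\<Prod>p\<in>?T - S. e p (y p)) = 0" using fin by (intro prod_zero) auto
    then show ?thesis using False by simp
  qed
  finally show ?thesis .
qed

context adelic_haar
begin

text \<open>Expanding each factor over its balls and multiplying out the finite product over
  \<open>S\<close> writes the function as a finite combination of indicators of boxes; summing back
  in each prime separately factors the integral.\<close>

lemma
  assumes fam: "test_family S e"
  shows integrable_fin_elementary: "integrable fin_adele_haar (\<lambda>y. prime_prod (\<lambda>p. e p (y p)))"
    and integral_fin_elementary: "(\<integral>y. prime_prod (\<lambda>p. e p (y p)) \<partial>fin_adele_haar) = (\<Prod>p\<in>S. integral\<^sup>L (padic_haar p) (e p))"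
proof -
  have S: "finite S" "\<And>p. p \<in> S \<Longrightarrow> prime p" using fam by (auto simp: test_family_def)
  have "\<exists>N. prime_place.lev p N (e p)" if "p \<in> S" for p
    using fam S(2)[OF that] prime_place.padic_test_imp_lev[OF prime_place.intro] by (auto simp: test_family_def)
  then obtain N where N: "\<And>p. p \<in> S \<Longrightarrow> prime_place.lev p (N p) (e p)" by metis
  let ?J = "\<Pi>\<^sub>E p\<in>S. {..<p ^ (N p + N p)}"
  define X where "X j p = (if p \<in> S then prime_place.pball p (N p) (j p) else Zp p)" for j p
  define c where "c j = (\<Prod>p\<in>S. e p (prime_place.pt p (N p) (j p)))" for j
  \<comment> \<open>All boxes have the same measure \<open>r\<close>, since the balls chosen at a
    given prime have equal radius and \<open>Zp p\<close> has measure 1.\<close>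
  define r where "r = (\<Prod>p\<in>S. real p powi (- int (N p)))"
  have r0: "0 \<le> r" unfolding r_def by (intro prod_nonneg) auto
  have fJ: "finite ?J" using S by (intro finite_PiE) auto
  have expand: "prime_prod (\<lambda>p. e p (y p)) = (\<Sum>j\<in>?J. c j * indicator (adele_box (X j)) y)" if y: "y \<in> fin_adeles" for y
  proof -
    have "(\<Prod>p\<in>S. e p (y p)) = (\<Prod>p\<in>S. \<Sum>i<p ^ (N p + N p). e p (prime_place.pt p (N p) i) * indicator (prime_place.pball p (N p) i) (y p))"
      using prime_place.lev_expand[OF prime_place.intro N] S(2) fin_adele_component[OF y] by (intro prod.cong refl) blast
    also have "\<dots> = (\<Sum>j\<in>?J. \<Prod>p\<in>S. e p (prime_place.pt p (N p) (j p)) * indicator (prime_place.pball p (N p) (j p)) (y p))"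
      by (rule prod_sum_PiE) (use S in auto)
    finally have 1: "(\<Prod>p\<in>S. e p (y p)) = (\<Sum>j\<in>?J. c j * (\<Prod>p\<in>S. indicator (prime_place.pball p (N p) (j p)) (y p)))"
      by (simp add: prod.distrib c_def)
    have "(\<Prod>p\<in>S. indicator (prime_place.pball p (N p) (j p)) (y p)) * of_bool (\<forall>p. prime p \<longrightarrow> p \<notin> S \<longrightarrow> y p \<in> Zp p)
        = (indicator (adele_box (X j)) y :: complex)" for j
    proof -
      have "(\<Prod>p\<in>S. indicator (prime_place.pball p (N p) (j p)) (y p)) = (of_bool (\<forall>p\<in>S. y p \<in> prime_place.pball p (N p) (j p)) :: complex)"
        using S(1) by (induction rule: finite_induct) (auto simp: indicator_def)
      moreover have "y \<in> adele_box (X j) \<longleftrightarrow> (\<forall>p. prime p \<longrightarrow> y p \<in> X j p)"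
        using y by (auto simp: fin_adeles_def PiE_iff)
      moreover have "\<dots> \<longleftrightarrow> (\<forall>p\<in>S. y p \<in> prime_place.pball p (N p) (j p)) \<and> (\<forall>p. prime p \<longrightarrow> p \<notin> S \<longrightarrow> y p \<in> Zp p)"
        using S(2) by (auto simp: X_def)
      ultimately show ?thesis by (auto simp: indicator_def)
    qed
    then show ?thesis
      unfolding prime_prod_test_family[OF fam y] 1 by (simp add: sum_distrib_right mult.assoc)
  qed
  have supp: "{p. prime p \<and> X j p \<noteq> Zp p} \<subseteq> S" for j by (auto simp: X_def)
  have hb: "haar_box (X j)" for j
    unfolding haar_box_def
  proof (intro conjI allI impI)
    show "X j p \<in> sets (padic_haar p)" if "prime p" for p
      using prime_place.sets_pball[OF prime_place.intro[OF that]] prime_place.sets_Zp[OF prime_place.intro[OF that]]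
      by (simp add: X_def)
    show "finite {p. prime p \<and> X j p \<noteq> Zp p}" using supp S(1) by (rule finite_subset)
  qed
  have em: "emeasure fin_adele_haar (adele_box (X j)) = ennreal r" for j
  proof -
    have "emeasure fin_adele_haar (adele_box (X j)) = (\<Prod>p\<in>S. emeasure (padic_haar p) (X j p))"
      unfolding emeasure_box[OF hb]
    proof (rule prod.mono_neutral_left)
      show "\<forall>p\<in>S - {p. prime p \<and> X j p \<noteq> Zp p}. emeasure (padic_haar p) (X j p) = 1"
        using S(2) haar_place.emeasure_Zp[OF haar_place] by auto
    qed (use supp S in auto)
    also have "\<dots> = (\<Prod>p\<in>S. ennreal (real p powi (- int (N p))))"
      using haar_place.emeasure_pball[OF haar_place] S(2) by (intro prod.cong) (auto simp: X_def)
    also have "\<dots> = ennreal r" unfolding r_def by (rule prod_ennreal) auto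
    finally show ?thesis .
  qed
  let ?f = "\<lambda>y. \<Sum>j\<in>?J. c j * indicator (adele_box (X j)) y"
  note 1 = integrable_cmult_indicator[OF sets_box[OF hb] em r0] and 2 = integral_cmult_indicator[OF sets_box[OF hb] em r0]
  have eq: "prime_prod (\<lambda>p. e p (y p)) = ?f y" if "y \<in> space fin_adele_haar" for y
    using expand that by simp
  have "integrable fin_adele_haar ?f" by (intro Bochner_Integration.integrable_sum 1)
  then show "integrable fin_adele_haar (\<lambda>y. prime_prod (\<lambda>p. e p (y p)))"
    using Bochner_Integration.integrable_cong[OF refl, of fin_adele_haar "\<lambda>y. prime_prod (\<lambda>p. e p (y p))" ?f] eq by blast
  have "(\<integral>y. prime_prod (\<lambda>p. e p (y p)) \<partial>fin_adele_haar) = (\<integral>y. ?f y \<partial>fin_adele_haar)"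
    by (rule Bochner_Integration.integral_cong[OF refl eq])
  also have "\<dots> = (\<Sum>j\<in>?J. c j * of_real r)"
    by (subst Bochner_Integration.integral_sum) (simp_all only: 1 2)
  also have "\<dots> = (\<Sum>j\<in>?J. \<Prod>p\<in>S. of_real (real p powi (- int (N p))) * e p (prime_place.pt p (N p) (j p)))"
    by (simp add: c_def r_def prod.distrib mult.commute)
  also have "\<dots> = (\<Prod>p\<in>S. \<Sum>i<p ^ (N p + N p). of_real (real p powi (- int (N p))) * e p (prime_place.pt p (N p) i))"
    by (rule prod_sum_PiE[symmetric]) (use S in auto)
  also have "\<dots> = (\<Prod>p\<in>S. integral\<^sup>L (padic_haar p) (e p))"
    using haar_place.lev_integral[OF haar_place N] S(2)
    by (intro prod.cong refl) (simp add: sum_distrib_left)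
  finally show "(\<integral>y. prime_prod (\<lambda>p. e p (y p)) \<partial>fin_adele_haar) = (\<Prod>p\<in>S. integral\<^sup>L (padic_haar p) (e p))" .
qed

end

section \<open>The adelic Fourier transform\<close>

text \<open>Unlike \<open>cfun.span_induct_alt\<close>, the step also knows that the tail lies in
  the span; additivity of the transform needs this for integrability.\<close>

lemma span_lincomb_induct:
  assumes "\<phi> \<in> cfun.span V" "P 0"
    and "\<And>c \<psi> \<phi>. \<psi> \<in> V \<Longrightarrow> \<phi> \<in> cfun.span V \<Longrightarrow> P \<phi> \<Longrightarrow> P (cscale c \<psi> + \<phi>)"
  shows "P \<phi>"
proof -
  have "\<phi> \<in> cfun.span V \<and> P \<phi>"
  proof (rule cfun.span_induct_alt[OF assms(1), where h = "\<lambda>\<phi>. \<phi> \<in> cfun.span V \<and> P \<phi>"])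
    show "0 \<in> cfun.span V \<and> P 0" using assms(2) cfun.span_zero by blast
    show "cscale c \<psi> + \<phi> \<in> cfun.span V \<and> P (cscale c \<psi> + \<phi>)"
      if "\<psi> \<in> V" "\<phi> \<in> cfun.span V \<and> P \<phi>" for c \<psi> \<phi>
      using that assms(3) cfun.span_add[OF cfun.span_scale[OF cfun.span_base]] by blast
  qed
  then show ?thesis ..
qed

lemma adeles_iff: "x \<in> adeles \<longleftrightarrow> snd x \<in> fin_adeles"
  by (cases x) (simp add: adeles_def)

lemma elementary_cong:
  assumes "\<And>t. h t = h' t" "\<And>p x. prime p \<Longrightarrow> x \<in> Qp p \<Longrightarrow> e p x = e' p x"
  shows "elementary h e = elementary h' e'"
  unfolding elementary_def
  using assms fin_adele_component by (auto simp: fun_eq_iff adeles_iff intro!: prime_prod_cong)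

lemma fin_adele_neg:
  assumes y: "y \<in> fin_adeles"
  shows "(\<lambda>p. if prime p then padic_diff p (padic_of_rat p 0) (y p) else undefined) \<in> fin_adeles" (is "?n \<in> _")
proof -
  have Q: "padic_diff p (padic_of_rat p 0) (y p) \<in> Qp p"
    and Z: "padic_diff p (padic_of_rat p 0) (y p) \<in> Zp p \<longleftrightarrow> y p \<in> Zp p" if "prime p" for p
  proof -
    interpret prime_place p by (rule prime_place.intro[OF that])
    show "padic_diff p (padic_of_rat p 0) (y p) \<in> Qp p" using fin_adele_component[OF y that] by simp
    then show "padic_diff p (padic_of_rat p 0) (y p) \<in> Zp p \<longleftrightarrow> y p \<in> Zp p"
      using fin_adele_component[OF y that] by (simp add: Zp_iff)
  qed
  have "{p. prime p \<and> ?n p \<notin> Zp p} = {p. prime p \<and> y p \<notin> Zp p}" using Z by auto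
  then show ?thesis using Q fin_adele_finite[OF y] by (auto simp: fin_adeles_def)
qed

definition adele_neg :: "adele \<Rightarrow> adele" where
  "adele_neg x = (- fst x, \<lambda>p. if prime p then padic_diff p (padic_of_rat p 0) (snd x p) else undefined)"

lemma adele_neg_adeles: "x \<in> adeles \<Longrightarrow> adele_neg x \<in> adeles"
  using fin_adele_neg by (simp add: adeles_iff adele_neg_def)

lemma cnj_prime_prod: "cnj (prime_prod f) = prime_prod (\<lambda>p. cnj (f p))"
  by (simp add: prime_prod_def complex_cnj_cancel_iff[of _ 1, simplified])

text \<open>It turns the inverse transform at \<open>x\<close> into the transform at
  \<open>- x\<close>.\<close>

lemma cnj_adele_char:
  assumes "\<xi> \<in> adeles" "x \<in> adeles"
  shows "cnj (adele_char \<xi> x) = adele_char (adele_neg x) \<xi>"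
proof -
  have "cnj (padic_char p (padic_mult p (snd \<xi> p) (snd x p)))
      = padic_char p (padic_mult p (padic_diff p (padic_of_rat p 0) (snd x p)) (snd \<xi> p))" if p: "prime p" for p
  proof -
    interpret prime_place p by (rule prime_place.intro[OF p])
    have Q: "snd \<xi> p \<in> Qp p" "snd x p \<in> Qp p"
      using assms fin_adele_component[OF _ p] by (auto simp: adeles_iff)
    have "cnj (padic_char p (padic_mult p (snd \<xi> p) (snd x p))) = padic_char p (padic_mult p (snd \<xi> p) (neg (snd x p)))"
      using Q by (simp add: padic_mult_neg padic_char_neg)
    then show ?thesis using padic_mult_commute[of "snd \<xi> p" "neg (snd x p)"] Q by simp
  qed
  then show ?thesis
    by (auto simp: adele_char_def cnj_real_char cnj_prime_prod adele_neg_def mult.commute intro!: prime_prod_cong)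
qed

lemma adele_inv_fourier_eq:
  assumes "x \<in> adeles"
  shows "adele_inv_fourier \<psi> x = adele_fourier \<psi> (adele_neg x)"
proof -
  have "space adele_haar = adeles"
    by (simp add: adele_haar_def space_pair_measure adeles_def)
  then show ?thesis
    using assms adele_neg_adeles[OF assms] cnj_adele_char[OF _ assms]
    by (auto simp: adele_inv_fourier_def adele_fourier_def intro!: Bochner_Integration.integral_cong)
qed

lemma test_family_lev:
  assumes "test_family S e" "prime p" obtains N where "prime_place.lev p N (e p)"
proof -
  have "e p \<in> padic_test p" using assms by (simp add: test_family_def)
  then show ?thesis using prime_place.padic_test_imp_lev[OF prime_place.intro[OF assms(2)]] that by blast
qed

context adelic_haar
begin

lemma integral_elementary_aux:
  fixes h :: "real \<Rightarrow> complex"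
  assumes h: "integrable lborel h" and fam: "test_family S e"
  shows "integrable adele_haar (elementary h e) \<and>
    integral\<^sup>L adele_haar (elementary h e) = integral\<^sup>L lborel h * (\<Prod>p\<in>S. integral\<^sup>L (padic_haar p) (e p))"
proof -
  interpret F: sigma_finite_measure fin_adele_haar by (rule sigma_finite_fin_adele_haar)
  interpret P: pair_sigma_finite lborel fin_adele_haar by unfold_locales
  let ?g = "\<lambda>y. prime_prod (\<lambda>p. e p (y p))"
  have eq: "elementary h e z = h (fst z) * ?g (snd z)" if "z \<in> space adele_haar" for z
    using that by (auto simp: elementary_def adele_haar_def space_pair_measure adeles_def)
  note g = integrable_fin_elementary[OF fam]
  have "integrable adele_haar (\<lambda>z. h (fst z) * ?g (snd z))"
    unfolding adele_haar_def by (rule P.integrable_times_complex[OF h g])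
  moreover have "integral\<^sup>L adele_haar (\<lambda>z. h (fst z) * ?g (snd z)) = integral\<^sup>L lborel h * (\<Prod>p\<in>S. integral\<^sup>L (padic_haar p) (e p))"
    unfolding adele_haar_def P.integral_times_complex[OF h g] integral_fin_elementary[OF fam] ..
  ultimately show ?thesis
    using Bochner_Integration.integrable_cong[OF refl, of adele_haar "elementary h e" "\<lambda>z. h (fst z) * ?g (snd z)"]
      Bochner_Integration.integral_cong[OF refl, of adele_haar "elementary h e" "\<lambda>z. h (fst z) * ?g (snd z)"] eq
    by metis
qed

text \<open>The character is absorbed place by place: the twisted factors \<open>e'\<close> again
  form a test family, over \<open>S\<close> enlarged by the primes where \<open>\<xi>\<close> is not
  integral. At the remaining primes the local transform is 1 because \<open>Omega_p\<close> is
  self-dual.\<close>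

lemma
  assumes h: "h \<in> schwartz" and fam: "test_family S e"
  shows integrable_char_elementary: "\<xi> \<in> adeles \<Longrightarrow> integrable adele_haar (\<lambda>x. adele_char \<xi> x * elementary h e x)"
    and adele_fourier_elementary:
      "adele_fourier (elementary h e) = elementary (real_fourier h) (\<lambda>p. padic_fourier p (e p))"
proof -
  have *: "integrable adele_haar (\<lambda>x. adele_char \<xi> x * elementary h e x) \<and>
    (LINT x|adele_haar. adele_char \<xi> x * elementary h e x) = real_fourier h (fst \<xi>) * prime_prod (\<lambda>p. padic_fourier p (e p) (snd \<xi> p))"
    if \<xi>: "\<xi> \<in> adeles" for \<xi>
  proof -
    define y where "y = snd \<xi>"
    have y: "y \<in> fin_adeles" using \<xi> by (simp add: y_def adeles_iff)
    let ?S = "S \<union> {p. prime p \<and> y p \<notin> Zp p}"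
    define e' where "e' p x = padic_char p (padic_mult p (y p) x) * e p x" for p x
    have char1: "padic_char p (padic_mult p (y p) x) = 1" if "prime p" "y p \<in> Zp p" "x \<in> Zp p" for p x
    proof -
      interpret prime_place p by (rule prime_place.intro[OF that(1)])
      show ?thesis using that by (intro padic_char_integral) (auto simp: Zp_iff padic_norm_mult mult_le_one)
    qed
    have fam': "test_family ?S e'"
      unfolding test_family_def
    proof (intro conjI allI impI ballI)
      show "finite ?S" using fam fin_adele_finite[OF y] by (auto simp: test_family_def)
      show "prime p" if "p \<in> ?S" for p using that fam by (auto simp: test_family_def)
    next
      fix p :: nat assume p: "prime p"
      interpret prime_place p by (rule prime_place.intro[OF p])
      have yQ: "y p \<in> Qp p" by (rule fin_adele_component[OF y p])
      obtain N where N: "lev N (e p)" using test_family_lev[OF fam p] .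
      obtain M0 where "padic_norm p (y p) \<le> pw (int M0)" using exists_pw_ge by blast
      moreover have "pw (int M0) \<le> pw (int (max M0 N))" by (simp add: pw_mono_iff)
      ultimately have "lev (max M0 N) (\<lambda>x. padic_char p (padic_mult p (y p) x) * e p x)"
        by (intro lev_char[OF N yQ]) auto
      then show "e' p \<in> padic_test p" unfolding e'_def[abs_def] by (rule lev_imp_padic_test)
      fix x assume "p \<notin> ?S" and x: "x \<in> Qp p"
      then have "y p \<in> Zp p" "e p x = Omega_p p x" using fam p by (auto simp: test_family_def)
      then show "e' p x = Omega_p p x"
        using char1[OF p] x p by (simp add: e'_def Omega_p_Zp)
    qed
    have S': "finite ?S" "\<And>p. p \<in> ?S \<Longrightarrow> prime p" using fam' unfolding test_family_def by blast+
    have eq: "adele_char \<xi> x * elementary h e x = elementary (\<lambda>t. real_char (fst \<xi> * t) * h t) e' x" for x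
    proof (cases "x \<in> adeles")
      case True
      then have z: "snd x \<in> fin_adeles" by (simp add: adeles_iff)
      have "{p. prime p \<and> padic_char p (padic_mult p (y p) (snd x p)) \<noteq> 1} \<subseteq>
          {p. prime p \<and> y p \<notin> Zp p} \<union> {p. prime p \<and> snd x p \<notin> Zp p}"
        using char1 by blast
      then have "finite {p. prime p \<and> padic_char p (padic_mult p (y p) (snd x p)) \<noteq> 1}"
        by (rule finite_subset) (use fin_adele_finite y z in auto)
      then have "prime_prod (\<lambda>p. e' p (snd x p)) = prime_prod (\<lambda>p. padic_char p (padic_mult p (y p) (snd x p))) * prime_prod (\<lambda>p. e p (snd x p))"
        unfolding e'_def by (rule prime_prod_mult) (rule test_family_support[OF fam z])
      then show ?thesis using True by (simp add: elementary_def adele_char_def y_def)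
    qed (simp add: elementary_def)
    have i: "integrable lborel (\<lambda>t. real_char (fst \<xi> * t) * h t)"
      by (rule integrable_real_char_times[OF schwartz_integrable[OF h]])
    have "(\<Prod>p\<in>?S. integral\<^sup>L (padic_haar p) (e' p)) = (\<Prod>p\<in>?S. padic_fourier p (e p) (y p))"
      by (simp add: padic_fourier_def e'_def[abs_def])
    also have "\<dots> = prime_prod (\<lambda>p. padic_fourier p (e p) (y p))"
    proof (rule prime_prod_eq[OF S', symmetric])
      fix p assume p: "prime p" and pS: "p \<notin> ?S"
      interpret haar_place p by (rule haar_place[OF p])
      have yQ: "y p \<in> Qp p" by (rule fin_adele_component[OF y p])
      have "padic_fourier p (e p) (y p) = padic_fourier p (Omega_p p) (y p)"
        by (rule fourier_cong) (use fam p pS in \<open>auto simp: test_family_def\<close>)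
      then show "padic_fourier p (e p) (y p) = 1"
        using fourier_Omega[OF yQ] p pS yQ by (simp add: Omega_p_Zp)
    qed
    finally show ?thesis
      using integral_elementary_aux[OF i fam'] unfolding eq real_fourier_def y_def by simp
  qed
  show "\<xi> \<in> adeles \<Longrightarrow> integrable adele_haar (\<lambda>x. adele_char \<xi> x * elementary h e x)" using * by blast
  show "adele_fourier (elementary h e) = elementary (real_fourier h) (\<lambda>p. padic_fourier p (e p))"
    using * by (auto simp: adele_fourier_def elementary_def fun_eq_iff)
qed

lemma test_family_fourier:
  assumes fam: "test_family S e"
  shows "test_family S (\<lambda>p. padic_fourier p (e p))"
  unfolding test_family_def
proof (intro conjI allI impI ballI)
  show "finite S" "\<And>p. p \<in> S \<Longrightarrow> prime p" using fam by (auto simp: test_family_def)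
  fix p :: nat assume p: "prime p"
  interpret haar_place p by (rule haar_place[OF p])
  obtain N where N: "lev N (e p)" using test_family_lev[OF fam p] .
  show "padic_fourier p (e p) \<in> padic_test p" by (rule lev_imp_padic_test[OF lev_fourier[OF N]])
  fix x assume "p \<notin> S" and x: "x \<in> Qp p"
  then have "padic_fourier p (e p) x = padic_fourier p (Omega_p p) x"
    using fam p by (intro fourier_cong) (auto simp: test_family_def)
  then show "padic_fourier p (e p) x = Omega_p p x" using fourier_Omega[OF x] by simp
qed

text \<open>The common domain, containing all levels and stable under the transform, on which
  integrability makes \<open>adele_fourier\<close> linear. Each generator has its own exceptional
  set \<open>S\<close>.\<close>

definition schwartz_bruhat :: "(adele \<Rightarrow> complex) set" where
  "schwartz_bruhat = cfun.span {elementary h e | h e S. h \<in> schwartz \<and> test_family S e}"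

lemma elementary_schwartz_bruhat:
  "h \<in> schwartz \<Longrightarrow> test_family S e \<Longrightarrow> elementary h e \<in> schwartz_bruhat"
  unfolding schwartz_bruhat_def by (intro cfun.span_base) blast

lemma integrable_char_schwartz_bruhat:
  assumes "\<phi> \<in> schwartz_bruhat" "\<xi> \<in> adeles"
  shows "integrable adele_haar (\<lambda>x. adele_char \<xi> x * \<phi> x)"
  using assms(1) unfolding schwartz_bruhat_def
proof (induction rule: cfun.span_induct_alt)
  case base
  show ?case by simp
next
  case (step c \<phi> \<psi>)
  then have "integrable adele_haar (\<lambda>x. adele_char \<xi> x * \<phi> x)"
    using integrable_char_elementary[OF _ _ assms(2)] by blast
  then have "integrable adele_haar (\<lambda>x. c * (adele_char \<xi> x * \<phi> x) + adele_char \<xi> x * \<psi> x)"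
    using step.IH by (intro Bochner_Integration.integrable_add integrable_mult_right)
  then show ?case by (simp add: cscale_def distrib_left mult_ac)
qed

lemma adele_fourier_add:
  assumes "\<phi> \<in> schwartz_bruhat" "\<psi> \<in> schwartz_bruhat"
  shows "adele_fourier (\<phi> + \<psi>) = adele_fourier \<phi> + adele_fourier \<psi>"
  using integrable_char_schwartz_bruhat[OF assms(1)] integrable_char_schwartz_bruhat[OF assms(2)]
  by (simp add: fun_eq_iff adele_fourier_def distrib_left)

end

lemma adele_fourier_cscale: "adele_fourier (cscale c \<phi>) = cscale c (adele_fourier \<phi>)"
proof -
  have "(\<lambda>x. adele_char \<xi> x * cscale c \<phi> x) = (\<lambda>x. c * (adele_char \<xi> x * \<phi> x))" for \<xi>
    by (simp add: fun_eq_iff cscale_def)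
  then have "(LINT x|adele_haar. adele_char \<xi> x * cscale c \<phi> x) = c * (LINT x|adele_haar. adele_char \<xi> x * \<phi> x)" for \<xi>
    by (simp only: integral_mult_right_zero)
  then show ?thesis by (simp only: adele_fourier_def) (simp add: cscale_def fun_eq_iff)
qed

lemma adele_fourier_0 [simp]: "adele_fourier 0 = 0"
  by (simp add: adele_fourier_def fun_eq_iff)

context adelic_haar
begin

lemma subspace_schwartz_bruhat: "cfun.subspace schwartz_bruhat"
  unfolding schwartz_bruhat_def by (rule cfun.subspace_span)

lemma adele_fourier_lincomb:
  assumes "\<phi> \<in> schwartz_bruhat" "\<psi> \<in> schwartz_bruhat"
  shows "adele_fourier (cscale c \<phi> + \<psi>) = cscale c (adele_fourier \<phi>) + adele_fourier \<psi>"
  using adele_fourier_add[of "cscale c \<phi>" \<psi>] assms cfun.subspace_scale[OF subspace_schwartz_bruhat]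
  by (simp add: adele_fourier_cscale)

lemma adele_fourier_span:
  assumes V: "V \<subseteq> schwartz_bruhat" and \<phi>: "\<phi> \<in> cfun.span V"
    and W: "cfun.subspace W" "\<And>\<psi>. \<psi> \<in> V \<Longrightarrow> adele_fourier \<psi> \<in> W"
  shows "adele_fourier \<phi> \<in> W"
proof (rule span_lincomb_induct[OF \<phi>, where P = "\<lambda>\<phi>. adele_fourier \<phi> \<in> W"])
  show "adele_fourier 0 \<in> W" unfolding adele_fourier_0 by (rule cfun.subspace_0[OF W(1)])
  fix c \<psi> \<phi> assume *: "\<psi> \<in> V" "\<phi> \<in> cfun.span V" "adele_fourier \<phi> \<in> W"
  have "\<psi> \<in> schwartz_bruhat" "\<phi> \<in> schwartz_bruhat"
    using * V cfun.span_minimal[OF V subspace_schwartz_bruhat] by auto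
  from adele_fourier_lincomb[OF this]
  show "adele_fourier (cscale c \<psi> + \<phi>) \<in> W"
    using cfun.subspace_add[OF W(1) cfun.subspace_scale[OF W(1) W(2)[OF *(1)], of c] *(3)] by (simp only:)
qed

lemma adele_fourier_schwartz_bruhat:
  assumes "\<phi> \<in> schwartz_bruhat" shows "adele_fourier \<phi> \<in> schwartz_bruhat"
proof (rule adele_fourier_span[of "{elementary h e | h e S. h \<in> schwartz \<and> test_family S e}"])
  show "{elementary h e | h e S. h \<in> schwartz \<and> test_family S e} \<subseteq> schwartz_bruhat"
    using elementary_schwartz_bruhat by blast
  show "\<phi> \<in> cfun.span {elementary h e | h e S. h \<in> schwartz \<and> test_family S e}"
    using assms by (simp add: schwartz_bruhat_def)
  show "adele_fourier \<psi> \<in> schwartz_bruhat" if "\<psi> \<in> {elementary h e | h e S. h \<in> schwartz \<and> test_family S e}" for \<psi>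
    using that elementary_schwartz_bruhat[OF real_fourier_schwartz test_family_fourier]
    by (auto simp: adele_fourier_elementary)
qed (rule subspace_schwartz_bruhat)

lemma adele_fourier_2_elementary:
  assumes "h \<in> schwartz" "test_family S e"
  shows "adele_fourier (adele_fourier (elementary h e)) =
    elementary (real_fourier (real_fourier h)) (\<lambda>p. padic_fourier p (padic_fourier p (e p)))"
  unfolding adele_fourier_elementary[OF assms]
    adele_fourier_elementary[OF real_fourier_schwartz[OF assms(1)] test_family_fourier[OF assms(2)]] ..

lemma adele_fourier_3_elementary:
  assumes "h \<in> schwartz" "test_family S e"
  shows "adele_fourier (adele_fourier (adele_fourier (elementary h e))) =
    elementary (real_fourier (real_fourier (real_fourier h)))
      (\<lambda>p. padic_fourier p (padic_fourier p (padic_fourier p (e p))))"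
  unfolding adele_fourier_2_elementary[OF assms]
  by (rule adele_fourier_elementary[OF real_fourier_schwartz[OF real_fourier_schwartz[OF assms(1)]]
      test_family_fourier[OF test_family_fourier[OF assms(2)]]])

lemma adele_fourier_4_elementary:
  assumes h: "h \<in> schwartz" and e: "test_family S e"
  shows "adele_fourier (adele_fourier (adele_fourier (adele_fourier (elementary h e)))) = elementary h e"
proof -
  have "adele_fourier (adele_fourier (adele_fourier (adele_fourier (elementary h e)))) =
    elementary (real_fourier (real_fourier (real_fourier (real_fourier h))))
      (\<lambda>p. padic_fourier p (padic_fourier p (padic_fourier p (padic_fourier p (e p)))))"
    unfolding adele_fourier_2_elementary[OF assms]
    by (rule adele_fourier_2_elementary[OF real_fourier_schwartz[OF real_fourier_schwartz[OF h]]
        test_family_fourier[OF test_family_fourier[OF e]]])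
  also have "\<dots> = elementary h e"
  proof (rule elementary_cong)
    show "real_fourier (real_fourier (real_fourier (real_fourier h))) t = h t" for t
      using real_fourier_fourier[OF real_fourier_schwartz[OF real_fourier_schwartz[OF h]], of t]
        real_fourier_fourier[OF h, of "- t"] by simp
    show "padic_fourier p (padic_fourier p (padic_fourier p (padic_fourier p (e p)))) x = e p x"
      if "prime p" "x \<in> Qp p" for p x
      using test_family_lev[OF e that(1)] haar_place.fourier_4[OF haar_place[OF that(1)] _ that(2)] by metis
  qed
  finally show ?thesis .
qed

text \<open>Both sides are the transform at \<open>- x\<close>: the left by conjugating the
  character, the right because two transforms make a reflection in every factor.\<close>

lemma adele_inv_fourier_elementary:
  assumes h: "h \<in> schwartz" and e: "test_family S e"
  shows "adele_inv_fourier (elementary h e) = adele_fourier (adele_fourier (adele_fourier (elementary h e)))"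
proof
  fix x
  show "adele_inv_fourier (elementary h e) x = adele_fourier (adele_fourier (adele_fourier (elementary h e))) x"
  proof (cases "x \<in> adeles")
    case True
    have y: "snd x \<in> fin_adeles" using True by (simp add: adeles_iff)
    have p: "padic_fourier p (e p) (padic_diff p (padic_of_rat p 0) (snd x p)) =
        padic_fourier p (padic_fourier p (padic_fourier p (e p))) (snd x p)" if p: "prime p" for p
    proof -
      interpret haar_place p by (rule haar_place[OF p])
      obtain N where "lev N (e p)" using test_family_lev[OF e p] .
      then show ?thesis using fourier_fourier[OF lev_fourier fin_adele_component[OF y p]] by simp
    qed
    have "adele_inv_fourier (elementary h e) x = real_fourier h (- fst x) *
        prime_prod (\<lambda>p. padic_fourier p (e p) (snd (adele_neg x) p))"
      using adele_neg_adeles[OF True]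
      unfolding adele_inv_fourier_eq[OF True] adele_fourier_elementary[OF h e]
      by (simp add: elementary_def) (simp add: adele_neg_def)
    also have "prime_prod (\<lambda>p. padic_fourier p (e p) (snd (adele_neg x) p)) =
        prime_prod (\<lambda>p. padic_fourier p (padic_fourier p (padic_fourier p (e p))) (snd x p))"
      by (rule prime_prod_cong) (simp add: adele_neg_def p)
    also have "real_fourier h (- fst x) = real_fourier (real_fourier (real_fourier h)) (fst x)"
      by (rule real_fourier_fourier[OF real_fourier_schwartz[OF h], symmetric])
    finally show ?thesis
      using True unfolding adele_fourier_3_elementary[OF h e] by (simp add: elementary_def[of "real_fourier _"])
  next
    case False
    then show ?thesis by (simp add: adele_inv_fourier_def adele_fourier_def)
  qed
qed

lemma adele_fourier_4:
  assumes "\<phi> \<in> schwartz_bruhat"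
  shows "adele_fourier (adele_fourier (adele_fourier (adele_fourier \<phi>))) = \<phi>" (is "?F \<phi> = \<phi>")
proof (rule span_lincomb_induct[OF assms[unfolded schwartz_bruhat_def], where P = "\<lambda>\<phi>. ?F \<phi> = \<phi>"])
  show "?F 0 = 0" unfolding adele_fourier_0 ..
  fix c \<psi> \<phi>
  assume "\<psi> \<in> {elementary h e | h e S. h \<in> schwartz \<and> test_family S e}"
  then obtain h e S where \<psi>: "\<psi> = elementary h e" "h \<in> schwartz" "test_family S e" by blast
  assume "\<phi> \<in> cfun.span {elementary h e | h e S. h \<in> schwartz \<and> test_family S e}" and IH: "?F \<phi> = \<phi>"
  then have K: "\<psi> \<in> schwartz_bruhat" "\<phi> \<in> schwartz_bruhat"
    using elementary_schwartz_bruhat[OF \<psi>(2,3)] \<psi>(1) by (simp_all only: schwartz_bruhat_def)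
  have "?F \<psi> = \<psi>" unfolding \<psi>(1) by (rule adele_fourier_4_elementary[OF \<psi>(2,3)])
  then show "?F (cscale c \<psi> + \<phi>) = cscale c \<psi> + \<phi>"
    using K IH by (simp only: adele_fourier_lincomb adele_fourier_schwartz_bruhat)
qed

lemma adele_inv_fourier_eq_3:
  assumes "\<phi> \<in> schwartz_bruhat"
  shows "adele_inv_fourier \<phi> = adele_fourier (adele_fourier (adele_fourier \<phi>))" (is "_ = ?F \<phi>")
proof (rule span_lincomb_induct[OF assms[unfolded schwartz_bruhat_def], where P = "\<lambda>\<phi>. adele_inv_fourier \<phi> = ?F \<phi>"])
  have inv: "adele_inv_fourier \<phi> = (\<lambda>x. if x \<in> adeles then adele_fourier \<phi> (adele_neg x) else 0)" for \<phi>
    by (auto simp: fun_eq_iff adele_inv_fourier_eq) (simp add: adele_inv_fourier_def)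
  show "adele_inv_fourier 0 = ?F 0" unfolding inv adele_fourier_0 by (simp add: fun_eq_iff)
  fix c \<psi> \<phi>
  assume "\<psi> \<in> {elementary h e | h e S. h \<in> schwartz \<and> test_family S e}"
  then obtain h e S where \<psi>: "\<psi> = elementary h e" "h \<in> schwartz" "test_family S e" by blast
  assume "\<phi> \<in> cfun.span {elementary h e | h e S. h \<in> schwartz \<and> test_family S e}"
    and IH: "adele_inv_fourier \<phi> = ?F \<phi>"
  then have K: "\<psi> \<in> schwartz_bruhat" "\<phi> \<in> schwartz_bruhat"
    using elementary_schwartz_bruhat[OF \<psi>(2,3)] \<psi>(1) by (simp_all only: schwartz_bruhat_def)
  have "adele_inv_fourier (cscale c \<psi> + \<phi>) = cscale c (adele_inv_fourier \<psi>) + adele_inv_fourier \<phi>"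
    unfolding inv adele_fourier_lincomb[OF K] by (auto simp: fun_eq_iff cscale_def)
  moreover have "adele_inv_fourier \<psi> = ?F \<psi>"
    unfolding \<psi>(1) by (rule adele_inv_fourier_elementary[OF \<psi>(2,3)])
  ultimately show "adele_inv_fourier (cscale c \<psi> + \<phi>) = ?F (cscale c \<psi> + \<phi>)"
    using K IH by (simp only: adele_fourier_lincomb adele_fourier_schwartz_bruhat)
qed

end

section \<open>The levels\<close>

definition primes_le :: "nat \<Rightarrow> nat set" where
  "primes_le m = {p. prime p \<and> p \<le> m}"

lemma primes_le: "finite (primes_le m)" "p \<in> primes_le m \<longleftrightarrow> prime p \<and> p \<le> m"
  by (auto simp: primes_le_def)

text \<open>The elementary functions of level \<open>m\<close>, with the vanishing conditions imposed factor by factor.\<close>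

definition flat_elementary :: "nat \<Rightarrow> (adele \<Rightarrow> complex) set" where
  "flat_elementary m = {elementary h e | h e. h \<in> flat_schwartz \<and> test_family (primes_le m) e \<and>
     (\<forall>p\<in>primes_le m. e p (padic_of_rat p 0) = 0)}"

lemma nth_deriv_cmult:
  assumes "h \<in> schwartz"
  shows "nth_deriv s (\<lambda>t. h t * c) = (\<lambda>t. nth_deriv s h t * c)"
  by (rule nth_deriv_eqI[where G = "\<lambda>s t. nth_deriv s h t * c"])
    (auto intro!: has_vector_derivative_mult_left nth_deriv_has_vector_derivative assms)

lemma nth_deriv_zero: "nth_deriv s (\<lambda>_. 0) t = 0"
  by (subst nth_deriv_eqI[where G = "\<lambda>_ _. 0"]) auto

lemma flat_schwartz_zero: "(\<lambda>_. 0) \<in> flat_schwartz"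
  by (simp add: flat_schwartz_def schwartz_def nth_deriv_zero[abs_def] bounded_iff exI[of _ 0])

lemma fin_adele_update_0:
  assumes y: "y \<in> fin_adeles" and p: "prime p"
  shows "y(p := padic_of_rat p 0) \<in> fin_adeles"
proof -
  interpret prime_place p by (rule prime_place.intro[OF p])
  have "{q. prime q \<and> (y(p := padic_of_rat p 0)) q \<notin> Zp q} \<subseteq> {q. prime q \<and> y q \<notin> Zp q}"
    by (auto simp: Zp_iff)
  then have "finite {q. prime q \<and> (y(p := padic_of_rat p 0)) q \<notin> Zp q}"
    using fin_adele_finite[OF y] finite_subset by blast
  moreover have "y(p := padic_of_rat p 0) \<in> (\<Pi>\<^sub>E p\<in>{p. prime p}. Qp p)"
    using y p by (auto simp: fin_adeles_def PiE_iff extensional_def)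
  ultimately show ?thesis by (simp add: fin_adeles_def)
qed

text \<open>The definition imposes vanishing on the product. If the product is not identically zero,
  a point where it is nonzero allows the other factors to be divided out, which gives the conditions
  factor by factor.\<close>

lemma Psi_elementary_eq: "Psi_elementary m = flat_elementary m"
proof (intro subset_antisym subsetI)
  fix \<eta> assume "\<eta> \<in> Psi_elementary m"
  then obtain h e where *: "\<eta> = elementary h e \<and> h \<in> schwartz \<and>
     (\<forall>p. prime p \<longrightarrow> e p \<in> padic_test p) \<and>
     (\<forall>p>m. prime p \<longrightarrow> (\<forall>x\<in>Qp p. e p x = Omega_p p x)) \<and>
     (\<forall>s. \<forall>y\<in>fin_adeles. nth_deriv s (\<lambda>t. \<eta> (t, y)) 0 = 0) \<and>
     (\<forall>s p. prime p \<and> p \<le> m \<longrightarrow> (\<forall>t. \<forall>y\<in>fin_adeles. y p = padic_of_rat p 0 \<longrightarrow>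
        nth_deriv s (\<lambda>t. \<eta> (t, y)) t = 0))"
    unfolding Psi_elementary_def mem_Collect_eq by (elim exE)
  then have \<eta>: "\<eta> = elementary h e" "h \<in> schwartz" "\<forall>p. prime p \<longrightarrow> e p \<in> padic_test p"
    "\<forall>p>m. prime p \<longrightarrow> (\<forall>x\<in>Qp p. e p x = Omega_p p x)"
    and flat: "\<forall>s. \<forall>y\<in>fin_adeles. nth_deriv s (\<lambda>t. \<eta> (t, y)) 0 = 0"
    and van: "\<forall>s p. prime p \<and> p \<le> m \<longrightarrow> (\<forall>t. \<forall>y\<in>fin_adeles. y p = padic_of_rat p 0 \<longrightarrow>
        nth_deriv s (\<lambda>t. \<eta> (t, y)) t = 0)"
    by - (elim conjE, assumption)+
  have fam: "test_family (primes_le m) e"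
    unfolding test_family_def using \<eta>(3,4) by (auto simp: primes_le not_le)
  show "\<eta> \<in> flat_elementary m"
  proof (cases "\<exists>t y. y \<in> fin_adeles \<and> \<eta> (t, y) \<noteq> 0")
    case True
    then obtain t0 y0 where y0: "y0 \<in> fin_adeles" and nz: "\<eta> (t0, y0) \<noteq> 0" by blast
    have eta: "\<eta> (t, y) = h t * prime_prod (\<lambda>p. e p (y p))" if "y \<in> fin_adeles" for t y
      using that by (simp add: \<eta>(1) elementary_def adeles_iff)
    let ?c = "prime_prod (\<lambda>p. e p (y0 p))"
    have c: "?c \<noteq> 0" "h t0 \<noteq> 0" using nz eta[OF y0] by auto
    have "nth_deriv s h 0 = 0" for s
      using flat[rule_format, OF y0, of s] c by (simp add: eta[OF y0] nth_deriv_cmult[OF \<eta>(2)])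
    then have h: "h \<in> flat_schwartz" using \<eta>(2) by (simp add: flat_schwartz_def)
    have supp: "(\<forall>p\<in>primes_le m. e p (y p) \<noteq> 0) \<and> (\<forall>p. prime p \<longrightarrow> p \<notin> primes_le m \<longrightarrow> y p \<in> Zp p)
        \<longleftrightarrow> prime_prod (\<lambda>p. e p (y p)) \<noteq> 0" if "y \<in> fin_adeles" for y
      unfolding prime_prod_test_family[OF fam that] using primes_le(1)[of m] by (auto simp: prod_zero_iff)
    have "e p (padic_of_rat p 0) = 0" if pm: "p \<in> primes_le m" for p
    proof (rule ccontr)
      assume e0: "e p (padic_of_rat p 0) \<noteq> 0"
      \<comment> \<open>Changing the component at \<open>p\<close> alone leaves the other factors
        nonzero, so a nonzero value of \<open>e p\<close> at 0 would contradict the vanishing of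
        \<open>\<eta>\<close> at this point.\<close>
      let ?y = "y0(p := padic_of_rat p 0)"
      have p: "prime p" "p \<le> m" using pm by (auto simp: primes_le)
      have y: "?y \<in> fin_adeles" by (rule fin_adele_update_0[OF y0 p(1)])
      have "nth_deriv 0 (\<lambda>t. \<eta> (t, ?y)) t0 = 0" by (rule van[rule_format, OF conjI[OF p] y]) simp
      then have "prime_prod (\<lambda>q. e q (?y q)) = 0" using c(2) by (simp add: eta[OF y])
      moreover have "prime_prod (\<lambda>q. e q (?y q)) \<noteq> 0"
        unfolding supp[OF y, symmetric] using supp[OF y0] c(1) e0 pm by (auto simp del: fun_upd_apply simp: fun_upd_def)
      ultimately show False by blast
    qed
    then show ?thesis using \<eta>(1) h fam unfolding flat_elementary_def by blast
  next
    case False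
    \<comment> \<open>For the zero function nothing follows about the given factors, so it is
      rewritten with zero factors at infinity and up to \<open>m\<close>.\<close>
    have "elementary h e = elementary (\<lambda>_. 0) (\<lambda>p. if p \<le> m then \<lambda>_. 0 else e p)"
    proof
      fix x
      have "elementary h e x = 0"
        using False \<eta>(1) by (cases x) (auto simp: elementary_def adeles_iff)
      then show "elementary h e x = elementary (\<lambda>_. 0) (\<lambda>p. if p \<le> m then \<lambda>_. 0 else e p) x"
        by (simp add: elementary_def)
    qed
    moreover have "test_family (primes_le m) (\<lambda>p. if p \<le> m then \<lambda>_. 0 else e p)"
      unfolding test_family_def
    proof (intro conjI allI impI ballI)
      fix p :: nat assume p: "prime p"
      interpret prime_place p by (rule prime_place.intro[OF p])
      have "lev 0 (\<lambda>_. 0)" by (simp add: lev_def)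
      then show "(if p \<le> m then \<lambda>_. 0 else e p) \<in> padic_test p"
        using lev_imp_padic_test \<eta>(3) p by simp
    qed (use fam in \<open>auto simp: test_family_def primes_le\<close>)
    ultimately show ?thesis
      unfolding flat_elementary_def \<eta>(1) using flat_schwartz_zero
      by (intro CollectI exI[of _ "\<lambda>_. 0"] exI[of _ "\<lambda>p. if p \<le> m then \<lambda>_. 0 else e p"]) (simp add: primes_le)
  qed
next
  fix \<eta> assume "\<eta> \<in> flat_elementary m"
  then obtain h e where \<eta>: "\<eta> = elementary h e" "h \<in> flat_schwartz" "test_family (primes_le m) e"
    "\<And>p. p \<in> primes_le m \<Longrightarrow> e p (padic_of_rat p 0) = 0" by (auto simp: flat_elementary_def)
  have hs: "h \<in> schwartz" "\<And>s. nth_deriv s h 0 = 0" using \<eta>(2) by (auto simp: flat_schwartz_def)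
  have eta: "(\<lambda>t. \<eta> (t, y)) = (\<lambda>t. h t * prime_prod (\<lambda>p. e p (y p)))" if "y \<in> fin_adeles" for y
    using that by (simp add: \<eta>(1) elementary_def adeles_iff)
  show "\<eta> \<in> Psi_elementary m"
    unfolding Psi_elementary_def mem_Collect_eq
  proof (intro exI[of _ h] exI[of _ e] conjI allI impI ballI)
    show "\<eta> = elementary h e" "h \<in> schwartz" by fact+
    show "e p \<in> padic_test p" if "prime p" for p using \<eta>(3) that by (simp add: test_family_def)
    show "e p x = Omega_p p x" if "p > m" "prime p" "x \<in> Qp p" for p x
      using \<eta>(3) that unfolding test_family_def by (simp add: primes_le)
    show "nth_deriv s (\<lambda>t. \<eta> (t, y)) 0 = 0" if "y \<in> fin_adeles" for s y
      unfolding eta[OF that] nth_deriv_cmult[OF hs(1)] using hs(2) by simp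
    show "nth_deriv s (\<lambda>t. \<eta> (t, y)) t = 0" if "prime p \<and> p \<le> m" "y \<in> fin_adeles" "y p = padic_of_rat p 0" for s p t y
    proof -
      have "prime_prod (\<lambda>p. e p (y p)) = 0"
        unfolding prime_prod_test_family[OF \<eta>(3) that(2)]
      proof -
        have "p \<in> primes_le m" using that(1) by (simp add: primes_le)
        then have "(\<Prod>p\<in>primes_le m. e p (y p)) = 0"
          using \<eta>(4)[of p] that(3) by (intro prod_zero[OF primes_le(1)] bexI[of _ p]) simp_all
        then show "(\<Prod>p\<in>primes_le m. e p (y p)) * of_bool (\<forall>p. prime p \<longrightarrow> p \<notin> primes_le m \<longrightarrow> y p \<in> Zp p) = 0"
          by simp
      qed
      then show ?thesis unfolding eta[OF that(2)] by (simp add: nth_deriv_zero)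
    qed
  qed
qed

section \<open>Support of the levels and the multiplier\<close>

lemma Psi_level_eq: "Psi_level m = cfun.span (flat_elementary m)"
  by (simp add: Psi_level_def Psi_elementary_eq)

text \<open>The set on which the multipliers for \<open>\<gamma>\<close> and its negative are
  mutually inverse; elements of \<open>Psi_level m\<close> vanish off it, which makes multiplication
  by the multiplier reversible on them.\<close>

definition multiplier_support :: "nat \<Rightarrow> adele set" where
  "multiplier_support m = {\<xi> \<in> adeles. fst \<xi> \<noteq> 0 \<and> (\<forall>p\<in>primes_le m. snd \<xi> p \<noteq> padic_of_rat p 0) \<and>
     (\<forall>p. prime p \<longrightarrow> p \<notin> primes_le m \<longrightarrow> snd \<xi> p \<in> Zp p)}"

lemma flat_elementary_support:
  assumes "\<eta> \<in> flat_elementary m" "\<eta> \<xi> \<noteq> 0"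
  shows "\<xi> \<in> multiplier_support m"
proof -
  obtain h e where \<eta>: "\<eta> = elementary h e" "h \<in> flat_schwartz" "test_family (primes_le m) e"
    "\<And>p. p \<in> primes_le m \<Longrightarrow> e p (padic_of_rat p 0) = 0" using assms(1) by (auto simp: flat_elementary_def)
  have \<xi>: "\<xi> \<in> adeles" using assms(2) by (auto simp: \<eta>(1) elementary_def split: if_splits)
  then have y: "snd \<xi> \<in> fin_adeles" by (simp add: adeles_iff)
  have nz: "h (fst \<xi>) \<noteq> 0" "prime_prod (\<lambda>p. e p (snd \<xi> p)) \<noteq> 0"
    using assms(2) \<xi> by (auto simp: \<eta>(1) elementary_def)
  have "h 0 = 0" using \<eta>(2) flat_schwartz_def nth_deriv_0 by (metis (mono_tags, lifting) mem_Collect_eq)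
  then have "fst \<xi> \<noteq> 0" using nz by metis
  moreover have "(\<forall>p\<in>primes_le m. e p (snd \<xi> p) \<noteq> 0) \<and> (\<forall>p. prime p \<longrightarrow> p \<notin> primes_le m \<longrightarrow> snd \<xi> p \<in> Zp p)"
    using nz(2) primes_le(1)[of m] unfolding prime_prod_test_family[OF \<eta>(3) y] by (auto simp: prod_zero_iff)
  moreover from this have "\<forall>p\<in>primes_le m. snd \<xi> p \<noteq> padic_of_rat p 0" using \<eta>(4) by metis
  ultimately show ?thesis using \<xi> by (simp add: multiplier_support_def)
qed

lemma Psi_level_support:
  assumes "\<psi> \<in> Psi_level m" "\<xi> \<notin> multiplier_support m"
  shows "\<psi> \<xi> = 0"
proof (rule span_lincomb_induct[OF assms(1)[unfolded Psi_level_eq], where P = "\<lambda>\<psi>. \<psi> \<xi> = 0"])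
  fix c and \<psi> \<phi> :: "adele \<Rightarrow> complex"
  assume "\<psi> \<in> flat_elementary m" "\<phi> \<xi> = 0"
  then show "(cscale c \<psi> + \<phi>) \<xi> = 0"
    using flat_elementary_support[of \<psi> m \<xi>] assms(2) by (auto simp: cscale_def)
qed simp

lemma multiplier_eq:
  assumes "\<xi> \<in> multiplier_support m"
  shows "multiplier m \<gamma> \<xi> = of_real \<bar>fst \<xi>\<bar> powr fst \<gamma> * (\<Prod>p\<in>primes_le m. of_real (padic_norm p (snd \<xi> p)) powr snd \<gamma> p)"
proof -
  have "Omega_p p (snd \<xi> p) = 1" if "prime p" "p \<notin> primes_le m" for p
    using assms that fin_adele_component[of "snd \<xi>" p] by (auto simp: multiplier_support_def adeles_iff Omega_p_Zp)
  then have "prime_prod (\<lambda>p. if p \<le> m then of_real (padic_norm p (snd \<xi> p)) powr snd \<gamma> p else Omega_p p (snd \<xi> p))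
      = (\<Prod>p\<in>primes_le m. if p \<le> m then of_real (padic_norm p (snd \<xi> p)) powr snd \<gamma> p else Omega_p p (snd \<xi> p))"
    by (intro prime_prod_eq) (auto simp: primes_le)
  also have "\<dots> = (\<Prod>p\<in>primes_le m. of_real (padic_norm p (snd \<xi> p)) powr snd \<gamma> p)"
    by (intro prod.cong) (auto simp: primes_le)
  finally show ?thesis by (simp add: multiplier_def)
qed

definition neg_exponent :: "complex \<times> (nat \<Rightarrow> complex) \<Rightarrow> complex \<times> (nat \<Rightarrow> complex)" where
  "neg_exponent \<gamma> = (- fst \<gamma>, \<lambda>p. - snd \<gamma> p)"

lemma multiplier_neg_exponent:
  assumes "\<xi> \<in> multiplier_support m"
  shows "multiplier m (neg_exponent \<gamma>) \<xi> * multiplier m \<gamma> \<xi> = 1"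
proof -
  have cancel: "z powr (- s) * z powr s = 1" if "z \<noteq> 0" for z s :: complex
    using that by (simp add: powr_minus)
  have "padic_norm p (snd \<xi> p) \<noteq> 0" if p: "p \<in> primes_le m" for p
  proof -
    interpret prime_place p using p by (intro prime_place.intro) (simp add: primes_le)
    show ?thesis
      using assms p fin_adele_component[of "snd \<xi>" p] prime
      by (auto simp: multiplier_support_def adeles_iff padic_norm_eq_0)
  qed
  then have "(\<Prod>p\<in>primes_le m. of_real (padic_norm p (snd \<xi> p)) powr (- snd \<gamma> p) *
      of_real (padic_norm p (snd \<xi> p)) powr snd \<gamma> p) = (1 :: complex)"
    by (intro prod.neutral ballI cancel) auto
  moreover have "of_real \<bar>fst \<xi>\<bar> powr (- fst \<gamma>) * of_real \<bar>fst \<xi>\<bar> powr fst \<gamma> = (1 :: complex)"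
    using assms by (intro cancel) (auto simp: multiplier_support_def)
  ultimately show ?thesis
    unfolding multiplier_eq[OF assms] neg_exponent_def fst_conv snd_conv prod.distrib
    by (metis (no_types, lifting) mult.assoc mult.left_commute mult_1)
qed

definition mult_op :: "nat \<Rightarrow> complex \<times> (nat \<Rightarrow> complex) \<Rightarrow> (adele \<Rightarrow> complex) \<Rightarrow> adele \<Rightarrow> complex" where
  "mult_op m \<gamma> \<psi> = (\<lambda>\<xi>. multiplier m \<gamma> \<xi> * \<psi> \<xi>)"

lemma mult_op_lincomb: "mult_op m \<gamma> (cscale c \<psi> + \<phi>) = cscale c (mult_op m \<gamma> \<psi>) + mult_op m \<gamma> \<phi>"
  by (simp add: mult_op_def fun_eq_iff cscale_def algebra_simps)

lemma mult_op_cancel: "\<psi> \<in> Psi_level m \<Longrightarrow> mult_op m (neg_exponent \<gamma>) (mult_op m \<gamma> \<psi>) = \<psi>"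
  using Psi_level_support[of \<psi> m] multiplier_neg_exponent[of _ m \<gamma>]
  by (fastforce simp: mult_op_def fun_eq_iff mult.assoc[symmetric])

text \<open>The multiplier splits over the places. At primes above \<open>m\<close> its factor
  \<open>Omega_p\<close> meets another \<open>Omega_p\<close> and is absorbed, being
  idempotent.\<close>

lemma mult_op_elementary:
  assumes fam: "test_family (primes_le m) e"
  shows "mult_op m \<gamma> (elementary h e) = elementary (\<lambda>t. of_real \<bar>t\<bar> powr fst \<gamma> * h t)
    (\<lambda>p x. if p \<le> m then of_real (padic_norm p x) powr snd \<gamma> p * e p x else e p x)"
proof
  fix \<xi> :: adele
  let ?m = "\<lambda>p. if p \<le> m then of_real (padic_norm p (snd \<xi> p)) powr snd \<gamma> p else Omega_p p (snd \<xi> p)"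
  show "mult_op m \<gamma> (elementary h e) \<xi> = elementary (\<lambda>t. of_real \<bar>t\<bar> powr fst \<gamma> * h t)
    (\<lambda>p x. if p \<le> m then of_real (padic_norm p x) powr snd \<gamma> p * e p x else e p x) \<xi>"
  proof (cases "\<xi> \<in> adeles")
    case True
    then have y: "snd \<xi> \<in> fin_adeles" by (simp add: adeles_iff)
    have "{p. prime p \<and> ?m p \<noteq> 1} \<subseteq> primes_le m \<union> {p. prime p \<and> snd \<xi> p \<notin> Zp p}"
      using fin_adele_component[OF y] by (auto simp: primes_le Omega_p_Zp)
    then have "finite {p. prime p \<and> ?m p \<noteq> 1}"
      by (rule finite_subset) (use fin_adele_finite[OF y] primes_le(1) in auto)
    then have "prime_prod (\<lambda>p. ?m p * e p (snd \<xi> p)) = prime_prod ?m * prime_prod (\<lambda>p. e p (snd \<xi> p))"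
      by (rule prime_prod_mult) (rule test_family_support[OF fam y])
    moreover have "prime_prod (\<lambda>p. ?m p * e p (snd \<xi> p)) =
      prime_prod (\<lambda>p. if p \<le> m then of_real (padic_norm p (snd \<xi> p)) powr snd \<gamma> p * e p (snd \<xi> p) else e p (snd \<xi> p))"
    proof (rule prime_prod_cong)
      fix p :: nat assume p: "prime p"
      have "Omega_p p (snd \<xi> p) * e p (snd \<xi> p) = e p (snd \<xi> p)" if "\<not> p \<le> m"
      proof -
        have "e p (snd \<xi> p) = Omega_p p (snd \<xi> p)"
          using fam p that fin_adele_component[OF y p] unfolding test_family_def by (simp add: primes_le)
        then show ?thesis using fin_adele_component[OF y p] p by (simp add: Omega_p_Zp)
      qed
      then show "?m p * e p (snd \<xi> p) = (if p \<le> m then of_real (padic_norm p (snd \<xi> p)) powr snd \<gamma> p * e p (snd \<xi> p) else e p (snd \<xi> p))"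
        by simp
    qed
    ultimately show ?thesis using True by (simp add: mult_op_def elementary_def multiplier_def)
  qed (simp add: mult_op_def elementary_def)
qed

lemma test_family_mult:
  assumes fam: "test_family (primes_le m) e" and 0: "\<And>p. p \<in> primes_le m \<Longrightarrow> e p (padic_of_rat p 0) = 0"
  shows "test_family (primes_le m) (\<lambda>p x. if p \<le> m then of_real (padic_norm p x) powr snd \<gamma> p * e p x else e p x)"
  unfolding test_family_def
proof (intro conjI allI impI ballI)
  fix p :: nat assume p: "prime p"
  show "(\<lambda>x. if p \<le> m then of_real (padic_norm p x) powr snd \<gamma> p * e p x else e p x) \<in> padic_test p"
  proof (cases "p \<le> m")
    case True
    interpret prime_place p by (rule prime_place.intro[OF p])
    obtain N where N: "lev N (e p)" using test_family_lev[OF fam p] .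
    show ?thesis using True lev_imp_padic_test[OF lev_norm_powr[OF N]] 0[of p] p by (simp add: primes_le)
  next
    case False
    then show ?thesis using fam p by (simp add: test_family_def)
  qed
next
  fix p x assume "prime p" "p \<notin> primes_le m" "x \<in> Qp p"
  then show "(if p \<le> m then of_real (padic_norm p x) powr snd \<gamma> p * e p x else e p x) = Omega_p p x"
    using fam unfolding test_family_def by (simp add: primes_le)
qed (auto simp: primes_le)

lemma mult_op_flat_elementary:
  assumes "\<eta> \<in> flat_elementary m"
  shows "mult_op m \<gamma> \<eta> \<in> flat_elementary m"
proof -
  obtain h e where \<eta>: "\<eta> = elementary h e" "h \<in> flat_schwartz" "test_family (primes_le m) e"
    "\<And>p. p \<in> primes_le m \<Longrightarrow> e p (padic_of_rat p 0) = 0" using assms(1) by (auto simp: flat_elementary_def)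
  let ?e = "\<lambda>p x. if p \<le> m then of_real (padic_norm p x) powr snd \<gamma> p * e p x else e p x"
  show ?thesis
    unfolding \<eta>(1) mult_op_elementary[OF \<eta>(3)] flat_elementary_def mem_Collect_eq
    using abs_powr_flat[OF \<eta>(2)] test_family_mult[OF \<eta>(3,4)] \<eta>(4)
    by (intro exI[of _ "\<lambda>t. of_real \<bar>t\<bar> powr fst \<gamma> * h t"] exI[of _ ?e]) simp
qed

lemma mult_op_Psi_level:
  assumes "\<psi> \<in> Psi_level m"
  shows "mult_op m \<gamma> \<psi> \<in> Psi_level m"
proof (rule span_lincomb_induct[OF assms[unfolded Psi_level_eq], where P = "\<lambda>\<psi>. mult_op m \<gamma> \<psi> \<in> Psi_level m"])
  have "mult_op m \<gamma> 0 = 0" by (simp add: mult_op_def fun_eq_iff)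
  then show "mult_op m \<gamma> 0 \<in> Psi_level m" by (simp add: Psi_level_eq cfun.span_zero)
  fix c and \<psi> \<phi> :: "adele \<Rightarrow> complex"
  assume "\<psi> \<in> flat_elementary m" "mult_op m \<gamma> \<phi> \<in> Psi_level m"
  then show "mult_op m \<gamma> (cscale c \<psi> + \<phi>) \<in> Psi_level m"
    unfolding mult_op_lincomb Psi_level_eq
    by (intro cfun.span_add cfun.span_scale) (auto intro: cfun.span_base mult_op_flat_elementary)
qed

section \<open>The operator on one level and the directness of the sum of levels\<close>

context adelic_haar
begin

lemma flat_elementary_schwartz_bruhat: "flat_elementary m \<subseteq> schwartz_bruhat"
  using elementary_schwartz_bruhat flat_schwartz_sub unfolding flat_elementary_def by blast

lemma Psi_level_schwartz_bruhat: "Psi_level m \<subseteq> schwartz_bruhat"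
  unfolding Psi_level_eq by (rule cfun.span_minimal[OF flat_elementary_schwartz_bruhat subspace_schwartz_bruhat])

lemma subspace_Psi_level: "cfun.subspace (Psi_level m)"
  unfolding Psi_level_def by (rule cfun.subspace_span)

text \<open>Two transforms reflect every factor, and a reflection respects conditions at the
  origin.\<close>

lemma fourier_2_flat_elementary:
  assumes "\<eta> \<in> flat_elementary m"
  shows "adele_fourier (adele_fourier \<eta>) \<in> flat_elementary m"
proof -
  obtain h e where \<eta>: "\<eta> = elementary h e" "h \<in> flat_schwartz" "test_family (primes_le m) e"
    "\<And>p. p \<in> primes_le m \<Longrightarrow> e p (padic_of_rat p 0) = 0" using assms(1) by (auto simp: flat_elementary_def)
  have hs: "h \<in> schwartz" using \<eta>(2) flat_schwartz_sub by auto
  have "padic_fourier p (padic_fourier p (e p)) (padic_of_rat p 0) = 0" if pm: "p \<in> primes_le m" for p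
  proof -
    have p: "prime p" using pm by (simp add: primes_le)
    interpret haar_place p by (rule haar_place[OF p])
    obtain N where N: "lev N (e p)" using test_family_lev[OF \<eta>(3) p] .
    show ?thesis using fourier_fourier[OF N rat_in_Qp] \<eta>(4)[OF pm] by simp
  qed
  then show ?thesis
    unfolding \<eta>(1) adele_fourier_2_elementary[OF hs \<eta>(3)] flat_elementary_def
    using real_fourier_fourier_flat[OF \<eta>(2)] test_family_fourier[OF test_family_fourier[OF \<eta>(3)]] by blast
qed

lemma fourier_2_Psi_level:
  assumes "\<psi> \<in> Psi_level m"
  shows "adele_fourier (adele_fourier \<psi>) \<in> Psi_level m"
proof (rule span_lincomb_induct[OF assms[unfolded Psi_level_eq], where P = "\<lambda>\<psi>. adele_fourier (adele_fourier \<psi>) \<in> Psi_level m"])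
  show "adele_fourier (adele_fourier 0) \<in> Psi_level m" by (simp only: adele_fourier_0 Psi_level_eq cfun.span_zero)
  fix c and \<psi> \<phi> :: "adele \<Rightarrow> complex"
  assume *: "\<psi> \<in> flat_elementary m" "\<phi> \<in> cfun.span (flat_elementary m)"
    "adele_fourier (adele_fourier \<phi>) \<in> Psi_level m"
  have K: "\<psi> \<in> schwartz_bruhat" "\<phi> \<in> schwartz_bruhat"
    using * flat_elementary_schwartz_bruhat Psi_level_schwartz_bruhat Psi_level_eq by auto
  have "adele_fourier (adele_fourier (cscale c \<psi> + \<phi>)) = cscale c (adele_fourier (adele_fourier \<psi>)) + adele_fourier (adele_fourier \<phi>)"
    using K by (simp only: adele_fourier_lincomb adele_fourier_schwartz_bruhat)
  moreover have "adele_fourier (adele_fourier \<psi>) \<in> Psi_level m"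
    unfolding Psi_level_eq by (rule cfun.span_base[OF fourier_2_flat_elementary[OF *(1)]])
  ultimately show "adele_fourier (adele_fourier (cscale c \<psi> + \<phi>)) \<in> Psi_level m"
    using *(3) subspace_Psi_level by (simp only: cfun.subspace_add cfun.subspace_scale)
qed

lemma Phi_level_schwartz_bruhat: "Phi_level m \<subseteq> schwartz_bruhat"
  using Psi_level_schwartz_bruhat adele_fourier_schwartz_bruhat by (auto simp: Phi_level_def)

lemma subspace_Phi_level: "cfun.subspace (Phi_level m)"
proof (rule cfun.subspaceI)
  show "0 \<in> Phi_level m"
    unfolding Phi_level_def using adele_fourier_0 cfun.subspace_0[OF subspace_Psi_level] by (metis imageI)
  show "cscale c x \<in> Phi_level m" if x: "x \<in> Phi_level m" for c x
  proof -
    obtain \<psi> where "\<psi> \<in> Psi_level m" "x = adele_fourier \<psi>" using x unfolding Phi_level_def by blast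
    then have "cscale c x = adele_fourier (cscale c \<psi>)" "cscale c \<psi> \<in> Psi_level m"
      using cfun.subspace_scale[OF subspace_Psi_level] by (simp_all add: adele_fourier_cscale)
    then show ?thesis by (auto simp: Phi_level_def)
  qed
  show "x + y \<in> Phi_level m" if xy: "x \<in> Phi_level m" "y \<in> Phi_level m" for x y
  proof -
    obtain \<psi> where 1: "\<psi> \<in> Psi_level m" "x = adele_fourier \<psi>" using xy unfolding Phi_level_def by blast
    obtain \<phi> where 2: "\<phi> \<in> Psi_level m" "y = adele_fourier \<phi>" using xy unfolding Phi_level_def by blast
    have "adele_fourier (\<psi> + \<phi>) = x + y"
      unfolding 1(2) 2(2) using 1(1) 2(1) Psi_level_schwartz_bruhat by (intro adele_fourier_add) auto
    moreover have "\<psi> + \<phi> \<in> Psi_level m" using 1 2 cfun.subspace_add[OF subspace_Psi_level] by blast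
    ultimately show ?thesis unfolding Phi_level_def by (metis imageI)
  qed
qed

lemma frac_level_eq:
  assumes "\<psi> \<in> Psi_level m"
  shows "frac_level m \<gamma> (adele_fourier \<psi>) =
    adele_fourier (adele_fourier (adele_fourier (mult_op m \<gamma> (adele_fourier (adele_fourier \<psi>)))))"
proof -
  have "mult_op m \<gamma> (adele_fourier (adele_fourier \<psi>)) \<in> schwartz_bruhat"
    using mult_op_Psi_level[OF fourier_2_Psi_level[OF assms]] Psi_level_schwartz_bruhat by blast
  from adele_inv_fourier_eq_3[OF this] show ?thesis by (simp add: frac_level_def mult_op_def)
qed

lemma frac_level_eq':
  assumes "\<zeta> \<in> Phi_level m"
  shows "frac_level m \<gamma> \<zeta> = adele_fourier (adele_fourier (adele_fourier (mult_op m \<gamma> (adele_fourier \<zeta>))))"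
proof -
  obtain \<psi> where \<psi>: "\<psi> \<in> Psi_level m" "\<zeta> = adele_fourier \<psi>" using assms unfolding Phi_level_def by blast
  show ?thesis unfolding \<psi>(2) by (rule frac_level_eq[OF \<psi>(1)])
qed

text \<open>An element of \<open>Phi_level m\<close> is already one transform of
  \<open>Psi_level m\<close>, so the two together are a reflection.\<close>

lemma fourier_Phi_level: "\<zeta> \<in> Phi_level m \<Longrightarrow> adele_fourier \<zeta> \<in> Psi_level m"
  using fourier_2_Psi_level by (auto simp: Phi_level_def)

lemma frac_level_Phi_level:
  assumes "\<zeta> \<in> Phi_level m"
  shows "frac_level m \<gamma> \<zeta> \<in> Phi_level m"
  unfolding frac_level_eq'[OF assms] Phi_level_def
  by (intro imageI fourier_2_Psi_level mult_op_Psi_level fourier_Phi_level assms)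

lemma frac_level_lincomb:
  assumes "\<zeta> \<in> Phi_level m" "\<theta> \<in> Phi_level m"
  shows "frac_level m \<gamma> (cscale c \<zeta> + \<theta>) = cscale c (frac_level m \<gamma> \<zeta>) + frac_level m \<gamma> \<theta>"
proof -
  have K: "\<zeta> \<in> schwartz_bruhat" "\<theta> \<in> schwartz_bruhat" using assms Phi_level_schwartz_bruhat by auto
  have M: "mult_op m \<gamma> (adele_fourier \<zeta>) \<in> schwartz_bruhat" "mult_op m \<gamma> (adele_fourier \<theta>) \<in> schwartz_bruhat"
    using mult_op_Psi_level[OF fourier_Phi_level] assms Psi_level_schwartz_bruhat by blast+
  have "cscale c \<zeta> + \<theta> \<in> Phi_level m"
    using assms subspace_Phi_level by (simp only: cfun.subspace_add cfun.subspace_scale)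
  from frac_level_eq'[OF this, of \<gamma>] show ?thesis
    unfolding frac_level_eq'[OF assms(1)] frac_level_eq'[OF assms(2)]
    using K M by (simp only: adele_fourier_lincomb adele_fourier_schwartz_bruhat mult_op_lincomb)
qed

text \<open>Transforming \<open>frac_level m \<gamma> \<zeta>\<close> once more completes four
  transforms and exposes the product with the multiplier, which the negated exponents
  cancel.\<close>

lemma frac_level_cancel:
  assumes "\<zeta> \<in> Phi_level m"
  shows "frac_level m (neg_exponent \<gamma>) (frac_level m \<gamma> \<zeta>) = \<zeta>"
proof -
  let ?\<chi> = "adele_fourier \<zeta>"
  have \<chi>: "?\<chi> \<in> Psi_level m" "mult_op m \<gamma> ?\<chi> \<in> schwartz_bruhat"
    using fourier_Phi_level[OF assms] mult_op_Psi_level Psi_level_schwartz_bruhat by blast+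
  have "adele_fourier (frac_level m \<gamma> \<zeta>) = mult_op m \<gamma> ?\<chi>"
    unfolding frac_level_eq'[OF assms] by (rule adele_fourier_4[OF \<chi>(2)])
  then show ?thesis
    unfolding frac_level_eq'[OF frac_level_Phi_level[OF assms]]
    using mult_op_cancel[OF \<chi>(1), of \<gamma>] adele_fourier_4[OF subsetD[OF Phi_level_schwartz_bruhat assms]] by simp
qed

text \<open>Setting the components at the primes above \<open>m\<close> to zero kills all levels above \<open>m\<close> and
  determines an element of level \<open>m\<close>; hence the sum of the levels is direct.\<close>

definition truncate_above :: "nat \<Rightarrow> adele \<Rightarrow> adele" where
  "truncate_above m \<xi> = (fst \<xi>, \<lambda>p. if prime p \<and> m < p then padic_of_rat p 0 else snd \<xi> p)"

lemma truncate_adeles: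
  assumes "\<xi> \<in> adeles" shows "truncate_above m \<xi> \<in> adeles"
proof -
  have y: "snd \<xi> \<in> fin_adeles" using assms by (simp add: adeles_iff)
  have Q: "padic_of_rat p 0 \<in> Qp p" and Z: "padic_of_rat p 0 \<in> Zp p" if "prime p" for p
    using prime_place.rat_in_Qp[OF prime_place.intro[OF that]] prime_place.Zp_iff[OF prime_place.intro[OF that]]
      prime_place.padic_norm_rat[OF prime_place.intro[OF that], of 0] prime_place.padic_abs_0[OF prime_place.intro[OF that]]
    by auto
  have "{p. prime p \<and> snd (truncate_above m \<xi>) p \<notin> Zp p} \<subseteq> {p. prime p \<and> snd \<xi> p \<notin> Zp p}"
    using Z by (auto simp: truncate_above_def)
  then have "finite {p. prime p \<and> snd (truncate_above m \<xi>) p \<notin> Zp p}"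
    using fin_adele_finite[OF y] finite_subset by blast
  then show ?thesis
    using y Q by (auto simp: adeles_iff fin_adeles_def truncate_above_def PiE_iff extensional_def)
qed

text \<open>Level \<open>n\<close> demands vanishing where the component at the prime
  \<open>n\<close> itself is 0; as \<open>n\<close> exceeds \<open>m\<close>, truncation produces
  such a point.\<close>

lemma truncate_kill:
  assumes "\<psi> \<in> Psi_level n" "prime n" "m < n"
  shows "\<psi> (truncate_above m \<xi>) = 0"
proof (rule Psi_level_support[OF assms(1)])
  show "truncate_above m \<xi> \<notin> multiplier_support n"
    using assms(2,3) primes_le(2)[of n n] by (auto simp: multiplier_support_def truncate_above_def)
qed

text \<open>At the primes above \<open>m\<close> the factors are \<open>Omega_p\<close>, constant on
  the integers, so an integral component may be replaced by 0.\<close>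

lemma truncate_determines:
  assumes "\<psi> \<in> Psi_level m"
  shows "\<psi> \<xi> = (if \<xi> \<in> adeles \<and> (\<forall>p. prime p \<longrightarrow> p \<notin> primes_le m \<longrightarrow> snd \<xi> p \<in> Zp p) then \<psi> (truncate_above m \<xi>) else 0)"
    (is "\<psi> \<xi> = (if ?P then _ else 0)")
proof (cases ?P)
  case False
  then have "\<xi> \<notin> multiplier_support m" by (auto simp: multiplier_support_def)
  then have "\<psi> \<xi> = 0" by (rule Psi_level_support[OF assms])
  then show ?thesis unfolding if_not_P[OF False] .
next
  case True
  have "\<psi> \<xi> = \<psi> (truncate_above m \<xi>)"
  proof (rule span_lincomb_induct[OF assms[unfolded Psi_level_eq], where P = "\<lambda>\<psi>. \<psi> \<xi> = \<psi> (truncate_above m \<xi>)"])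
    fix c and \<psi> \<phi> :: "adele \<Rightarrow> complex"
  assume "\<psi> \<in> flat_elementary m" and IH: "\<phi> \<xi> = \<phi> (truncate_above m \<xi>)"
    then obtain h e where \<psi>: "\<psi> = elementary h e" "test_family (primes_le m) e" by (auto simp: flat_elementary_def)
    have a: "\<xi> \<in> adeles" "truncate_above m \<xi> \<in> adeles" using True truncate_adeles by auto
    then have y: "snd \<xi> \<in> fin_adeles" "snd (truncate_above m \<xi>) \<in> fin_adeles" by (simp_all add: adeles_iff)
    have "prime_prod (\<lambda>p. e p (snd \<xi> p)) = prime_prod (\<lambda>p. e p (snd (truncate_above m \<xi>) p))"
    proof (rule prime_prod_cong)
      fix p :: nat assume p: "prime p"
      show "e p (snd \<xi> p) = e p (snd (truncate_above m \<xi>) p)"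
      proof (cases "m < p")
        case False
        then show ?thesis by (simp add: truncate_above_def)
      next
        case mp: True
        interpret prime_place p by (rule prime_place.intro[OF p])
        have "\<And>x. x \<in> Qp p \<Longrightarrow> e p x = Omega_p p x"
          using \<psi>(2) p mp unfolding test_family_def by (simp add: primes_le)
        moreover have "snd \<xi> p \<in> Zp p" using True p mp by (simp add: primes_le)
        ultimately show ?thesis using p mp by (simp add: truncate_above_def Zp_iff Omega_p_eq)
      qed
    qed
    moreover have "fst (truncate_above m \<xi>) = fst \<xi>" by (simp add: truncate_above_def)
    ultimately have "\<psi> \<xi> = \<psi> (truncate_above m \<xi>)" using a by (simp add: \<psi>(1) elementary_def)
    then show "(cscale c \<psi> + \<phi>) \<xi> = (cscale c \<psi> + \<phi>) (truncate_above m \<xi>)" using IH by (simp add: cscale_def)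
  qed simp
  then show ?thesis unfolding if_P[OF True] .
qed

text \<open>Induction from the smallest level upwards: after truncation above \<open>m\<close>, the
  lower summands vanish by induction and the higher ones by \<open>truncate_kill\<close>, which
  isolates \<open>v m\<close>.\<close>

lemma Psi_levels_independent:
  assumes J: "finite J" "\<And>m. m \<in> J \<Longrightarrow> prime m" and v: "\<And>m. m \<in> J \<Longrightarrow> v m \<in> Psi_level m"
    and sum: "(\<Sum>m\<in>J. v m) = 0" and m: "m \<in> J"
  shows "v m = 0"
  using m
proof (induction m rule: less_induct)
  case (less m)
  have "v m \<xi> = 0" for \<xi>
  proof -
    have "(\<Sum>n\<in>J. v n (truncate_above m \<xi>)) = (\<Sum>n\<in>J. v n) (truncate_above m \<xi>)"
      using J(1) by (induction rule: finite_induct) auto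
    also have "\<dots> = 0" unfolding sum by simp
    finally have "(\<Sum>n\<in>J. v n (truncate_above m \<xi>)) = 0" .
    moreover have "v n (truncate_above m \<xi>) = 0" if "n \<in> J" "n \<noteq> m" for n
    proof (cases "n < m")
      case True
      then show ?thesis using less.IH that by simp
    next
      case False
      then show ?thesis using truncate_kill[OF v J(2)] that by simp
    qed
    then have "(\<Sum>n\<in>J. v n (truncate_above m \<xi>)) = v m (truncate_above m \<xi>)"
      using J(1) less.prems by (subst sum.remove[of J m]) auto
    ultimately have "v m (truncate_above m \<xi>) = 0" by simp
    then show ?thesis by (subst truncate_determines[OF v[OF less.prems]]) simp
  qed
  then show ?case by (simp add: fun_eq_iff)
qed

end

section \<open>The fractional operator\<close>

context adelic_haar
begin

lemma adele_fourier_sum: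
  assumes "finite J" "\<And>m. m \<in> J \<Longrightarrow> u m \<in> schwartz_bruhat"
  shows "(\<Sum>m\<in>J. u m) \<in> schwartz_bruhat \<and> adele_fourier (\<Sum>m\<in>J. u m) = (\<Sum>m\<in>J. adele_fourier (u m))"
  using assms
proof (induction rule: finite_induct)
  case empty
  have "(0 :: adele \<Rightarrow> complex) \<in> schwartz_bruhat" by (rule cfun.subspace_0[OF subspace_schwartz_bruhat])
  then show ?case unfolding sum.empty using adele_fourier_0 by blast
next
  case (insert m J)
  then have u: "u m \<in> schwartz_bruhat" and IH: "(\<Sum>m\<in>J. u m) \<in> schwartz_bruhat"
    "adele_fourier (\<Sum>m\<in>J. u m) = (\<Sum>m\<in>J. adele_fourier (u m))" by blast+
  show ?case
    unfolding sum.insert[OF insert(1,2)] adele_fourier_add[OF u IH(1)] IH(2)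
    using cfun.subspace_add[OF subspace_schwartz_bruhat u IH(1)] by blast
qed

text \<open>Independence is carried over from \<open>\<Psi>\<close>, since four transforms make the
  identity and the transform is therefore injective.\<close>

lemma Phi_levels_independent:
  assumes J: "finite J" "\<And>m. m \<in> J \<Longrightarrow> prime m" and v: "\<And>m. m \<in> J \<Longrightarrow> v m \<in> Phi_level m"
    and sum: "(\<Sum>m\<in>J. v m) = 0" and m: "m \<in> J"
  shows "v m = 0"
proof -
  have "\<forall>m\<in>J. \<exists>u. u \<in> Psi_level m \<and> v m = adele_fourier u" using v unfolding Phi_level_def by blast
  then obtain u where u: "\<And>m. m \<in> J \<Longrightarrow> u m \<in> Psi_level m" "\<And>m. m \<in> J \<Longrightarrow> v m = adele_fourier (u m)"
    by (metis (no_types))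
  have uS: "u m \<in> schwartz_bruhat" if "m \<in> J" for m using u(1)[OF that] Psi_level_schwartz_bruhat by blast
  note S = adele_fourier_sum[of J u, OF J(1) uS]
  have "adele_fourier (\<Sum>m\<in>J. u m) = 0"
    using S sum u(2) by (simp cong: sum.cong)
  then have "(\<Sum>m\<in>J. u m) = 0"
    using adele_fourier_4[OF conjunct1[OF S]] by simp
  then have "u m = 0" using Psi_levels_independent[OF J u(1) _ m] by blast
  then show ?thesis using u(2)[OF m] by simp
qed

text \<open>\<open>v\<close> is total and zero off \<open>J\<close>, so that uniqueness can be
  stated as \<open>v = w\<close> although the index sets of two decompositions may differ.\<close>

definition level_decomp :: "(adele \<Rightarrow> complex) \<Rightarrow> nat set \<Rightarrow> (nat \<Rightarrow> adele \<Rightarrow> complex) \<Rightarrow> bool" where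
  "level_decomp \<zeta> J v \<longleftrightarrow> finite J \<and> (\<forall>m\<in>J. prime m) \<and> (\<forall>m. v m \<in> Phi_level m) \<and>
     (\<forall>m. m \<notin> J \<longrightarrow> v m = 0) \<and> \<zeta> = (\<Sum>m\<in>J. v m)"

lemma zero_Phi_level: "0 \<in> Phi_level m"
  by (rule cfun.subspace_0[OF subspace_Phi_level])

lemma level_decomp_mono:
  assumes "level_decomp \<zeta> J v" "finite K" "J \<subseteq> K" "\<And>m. m \<in> K \<Longrightarrow> prime m"
  shows "level_decomp \<zeta> K v"
proof -
  have "(\<Sum>m\<in>J. v m) = (\<Sum>m\<in>K. v m)"
    by (rule sum.mono_neutral_left) (use assms in \<open>auto simp: level_decomp_def\<close>)
  then show ?thesis using assms unfolding level_decomp_def by blast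
qed

lemma level_decomp_lincomb:
  assumes \<zeta>: "level_decomp \<zeta> J v" and \<theta>: "level_decomp \<theta> K w"
  shows "level_decomp (cscale c \<zeta> + \<theta>) (J \<union> K) (\<lambda>m. cscale c (v m) + w m)"
proof -
  have JK: "finite (J \<union> K)" "\<And>m. m \<in> J \<union> K \<Longrightarrow> prime m"
    using \<zeta> \<theta> by (auto simp: level_decomp_def)
  have d: "level_decomp \<zeta> (J \<union> K) v" "level_decomp \<theta> (J \<union> K) w"
    using level_decomp_mono[OF \<zeta> JK(1) _ JK(2)] level_decomp_mono[OF \<theta> JK(1) _ JK(2)] by blast+
  have 0: "cscale c 0 + 0 = (0 :: adele \<Rightarrow> complex)" by (simp add: fun_eq_iff cscale_def)
  have "cscale c (v m) + w m \<in> Phi_level m" for m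
    using d by (intro cfun.subspace_add[OF subspace_Phi_level] cfun.subspace_scale[OF subspace_Phi_level])
      (auto simp: level_decomp_def)
  moreover have "cscale c \<zeta> + \<theta> = (\<Sum>m\<in>J \<union> K. cscale c (v m) + w m)"
    using d by (simp add: level_decomp_def sum.distrib cfun.scale_sum_right)
  moreover have "cscale c (v m) + w m = 0" if "m \<notin> J \<union> K" for m
  proof -
    have "v m = 0" "w m = 0" using d that unfolding level_decomp_def by blast+
    then show ?thesis using 0 by simp
  qed
  ultimately show ?thesis using JK unfolding level_decomp_def by blast
qed

lemma level_decomp_single:
  assumes "prime m" "\<zeta> \<in> Phi_level m"
  shows "level_decomp \<zeta> {m} (\<lambda>n. if n = m then \<zeta> else 0)"
  using assms zero_Phi_level by (simp add: level_decomp_def)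

lemma level_decomp_exists:
  assumes "\<zeta> \<in> Phi" shows "\<exists>J v. level_decomp \<zeta> J v"
proof (rule span_lincomb_induct[OF assms[unfolded Phi_def], where P = "\<lambda>\<zeta>. \<exists>J v. level_decomp \<zeta> J v"])
  have "level_decomp 0 {} (\<lambda>_. 0)" using zero_Phi_level by (simp add: level_decomp_def)
  then show "\<exists>J v. level_decomp 0 J v" by blast
  fix c and \<psi> \<phi> :: "adele \<Rightarrow> complex"
  assume "\<psi> \<in> (\<Union>m\<in>{m. prime m}. Phi_level m)" "\<exists>J v. level_decomp \<phi> J v"
  then show "\<exists>J v. level_decomp (cscale c \<psi> + \<phi>) J v"
    using level_decomp_single level_decomp_lincomb by blast
qed

lemma level_decomp_unique:
  assumes v: "level_decomp \<zeta> J v" and w: "level_decomp \<zeta> K w"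
  shows "v = w"
proof
  fix m
  have d: "level_decomp (cscale (- 1) \<zeta> + \<zeta>) (J \<union> K) (\<lambda>m. cscale (- 1) (v m) + w m)" (is "level_decomp _ ?L ?u")
    by (rule level_decomp_lincomb[OF v w])
  have z: "cscale (- 1) \<zeta> + \<zeta> = 0" by (simp add: cscale_def fun_eq_iff)
  have "?u m = 0"
  proof (cases "m \<in> ?L")
    case True
    then show ?thesis
      using d z by (intro Phi_levels_independent[of ?L ?u]) (simp_all add: level_decomp_def)
  next
    case False
    then show ?thesis using d unfolding level_decomp_def by blast
  qed
  then show "v m = w m" by (simp add: cscale_def fun_eq_iff)
qed

lemma frac_level_0: "frac_level m \<gamma> 0 = 0"
proof -
  have z: "cscale 0 0 + 0 = (0 :: adele \<Rightarrow> complex)" "cscale 0 x + x = x" for x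
    by (simp_all add: fun_eq_iff cscale_def)
  have "cscale 1 x + x = x \<Longrightarrow> x = 0" for x :: "adele \<Rightarrow> complex" by (simp add: fun_eq_iff cscale_def)
  moreover have "cscale 1 0 + 0 = (0 :: adele \<Rightarrow> complex)" by (simp add: fun_eq_iff cscale_def)
  ultimately show ?thesis using frac_level_lincomb[OF zero_Phi_level zero_Phi_level, of m \<gamma> 1] by simp
qed

text \<open>The explicit operator that will witness the definite description \<open>frac_op\<close>;
  it is well defined by \<open>level_decomp_unique\<close>.\<close>

definition frac_sum :: "complex \<times> (nat \<Rightarrow> complex) \<Rightarrow> (adele \<Rightarrow> complex) \<Rightarrow> adele \<Rightarrow> complex" where
  "frac_sum \<gamma> = (\<lambda>\<zeta>\<in>Phi. THE \<theta>. \<exists>J v. level_decomp \<zeta> J v \<and> \<theta> = (\<Sum>m\<in>J. frac_level m \<gamma> (v m)))"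

lemma frac_sum_eq:
  assumes \<zeta>: "\<zeta> \<in> Phi" and v: "level_decomp \<zeta> J v"
  shows "frac_sum \<gamma> \<zeta> = (\<Sum>m\<in>J. frac_level m \<gamma> (v m))"
proof -
  have "(THE \<theta>. \<exists>J v. level_decomp \<zeta> J v \<and> \<theta> = (\<Sum>m\<in>J. frac_level m \<gamma> (v m))) = (\<Sum>m\<in>J. frac_level m \<gamma> (v m))"
  proof (rule the_equality)
    fix \<theta> assume "\<exists>J v. level_decomp \<zeta> J v \<and> \<theta> = (\<Sum>m\<in>J. frac_level m \<gamma> (v m))"
    then obtain K w where w: "level_decomp \<zeta> K w" "\<theta> = (\<Sum>m\<in>K. frac_level m \<gamma> (w m))" by blast
    have wv: "w = v" by (rule level_decomp_unique[OF w(1) v])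
    have "(\<Sum>m\<in>K. frac_level m \<gamma> (v m)) = (\<Sum>m\<in>J \<union> K. frac_level m \<gamma> (v m))"
      using w(1) v by (intro sum.mono_neutral_left) (auto simp: level_decomp_def wv frac_level_0)
    moreover have "(\<Sum>m\<in>J. frac_level m \<gamma> (v m)) = (\<Sum>m\<in>J \<union> K. frac_level m \<gamma> (v m))"
      using w(1) v by (intro sum.mono_neutral_left) (auto simp: level_decomp_def frac_level_0)
    ultimately show "\<theta> = (\<Sum>m\<in>J. frac_level m \<gamma> (v m))" using w(2) wv by simp
  qed (use v in blast)
  then show ?thesis using \<zeta> by (simp add: frac_sum_def)
qed

lemma subspace_Phi: "cfun.subspace Phi"
  unfolding Phi_def by (rule cfun.subspace_span)

lemma Phi_level_sub_Phi: "prime m \<Longrightarrow> Phi_level m \<subseteq> Phi"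
  unfolding Phi_def by (intro subsetI cfun.span_base UN_I CollectI)

lemma frac_sum_lincomb:
  assumes "\<zeta> \<in> Phi" "\<theta> \<in> Phi"
  shows "frac_sum \<gamma> (cscale c \<zeta> + \<theta>) = cscale c (frac_sum \<gamma> \<zeta>) + frac_sum \<gamma> \<theta>"
proof -
  obtain J v where v: "level_decomp \<zeta> J v" using level_decomp_exists[OF assms(1)] by blast
  obtain K w where w: "level_decomp \<theta> K w" using level_decomp_exists[OF assms(2)] by blast
  have JK: "finite (J \<union> K)" "\<And>m. m \<in> J \<union> K \<Longrightarrow> prime m"
    using v w by (auto simp: level_decomp_def)
  have d: "level_decomp \<zeta> (J \<union> K) v" "level_decomp \<theta> (J \<union> K) w"
    using level_decomp_mono[OF v JK(1) _ JK(2)] level_decomp_mono[OF w JK(1) _ JK(2)] by blast+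
  have "cscale c \<zeta> + \<theta> \<in> Phi"
    by (intro cfun.subspace_add[OF subspace_Phi] cfun.subspace_scale[OF subspace_Phi] assms)
  from frac_sum_eq[OF this level_decomp_lincomb[OF v w], of \<gamma>]
  have "frac_sum \<gamma> (cscale c \<zeta> + \<theta>) = (\<Sum>m\<in>J \<union> K. frac_level m \<gamma> (cscale c (v m) + w m))" .
  also have "\<dots> = (\<Sum>m\<in>J \<union> K. cscale c (frac_level m \<gamma> (v m)) + frac_level m \<gamma> (w m))"
    using v w by (intro sum.cong refl frac_level_lincomb) (auto simp: level_decomp_def)
  also have "\<dots> = cscale c (frac_sum \<gamma> \<zeta>) + frac_sum \<gamma> \<theta>"
    unfolding frac_sum_eq[OF assms(1) d(1)] frac_sum_eq[OF assms(2) d(2)]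
    by (simp add: sum.distrib cfun.scale_sum_right)
  finally show ?thesis .
qed

lemma frac_sum_level:
  assumes "prime m" "\<zeta> \<in> Phi_level m"
  shows "frac_sum \<gamma> \<zeta> = frac_level m \<gamma> \<zeta>"
proof -
  have "\<zeta> \<in> Phi" using Phi_level_sub_Phi assms by blast
  from frac_sum_eq[OF this level_decomp_single[OF assms], of \<gamma>] show ?thesis by simp
qed

end

lemma linear_onI:
  assumes "\<And>c f g. f \<in> X \<Longrightarrow> g \<in> X \<Longrightarrow> T (cscale c f + g) = cscale c (T f) + T g" "0 \<in> X"
  shows "linear_on X cscale T"
proof -
  have 1: "cscale 1 f = f" "cscale c f + 0 = cscale c f" for c and f :: "'b \<Rightarrow> complex"
    by (simp_all add: cscale_def fun_eq_iff)
  have 2: "cscale 1 f = f" "cscale c f + 0 = cscale c f" for c and f :: "'a \<Rightarrow> complex"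
    by (simp_all add: cscale_def fun_eq_iff)
  have add: "T (f + g) = T f + T g" if "f \<in> X" "g \<in> X" for f g
    using assms(1)[OF that, of 1] by (simp only: 1 2)
  have "T 0 = T 0 + T 0" using add[OF assms(2,2)] by simp
  then have 0: "T 0 = 0" by simp
  have "T (cscale c f) = cscale c (T f)" if "f \<in> X" for c f
    using assms(1)[OF that assms(2), of c] by (simp only: 0 1 2)
  then show ?thesis using add by (simp add: linear_on_def)
qed

lemma linear_on_lincomb:
  assumes "linear_on X cscale T" "cfun.subspace X" "f \<in> X" "g \<in> X"
  shows "T (cscale c f + g) = cscale c (T f) + T g"
  using assms cfun.subspace_scale[OF assms(2,3), of c] unfolding linear_on_def by simp

lemma linear_on_span_unique:
  assumes T: "linear_on (cfun.span V) cscale T" and T': "linear_on (cfun.span V) cscale T'"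
    and eq: "\<And>f. f \<in> V \<Longrightarrow> T f = T' f" and f: "f \<in> cfun.span V"
  shows "T f = T' f"
proof (rule span_lincomb_induct[OF f, where P = "\<lambda>f. T f = T' f"])
  have 0: "S 0 = 0" if "linear_on (cfun.span V) cscale S" for S :: "('a \<Rightarrow> complex) \<Rightarrow> 'b \<Rightarrow> complex"
  proof -
    have "S (0 + 0) = S 0 + S 0" using that cfun.span_zero unfolding linear_on_def by blast
    then show ?thesis by simp
  qed
  show "T 0 = T' 0" using 0[OF T] 0[OF T'] by simp
  fix c \<psi> \<phi> assume *: "\<psi> \<in> V" "\<phi> \<in> cfun.span V" "T \<phi> = T' \<phi>"
  show "T (cscale c \<psi> + \<phi>) = T' (cscale c \<psi> + \<phi>)"
    unfolding linear_on_lincomb[OF T cfun.subspace_span cfun.span_base[OF *(1)] *(2)]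
      linear_on_lincomb[OF T' cfun.subspace_span cfun.span_base[OF *(1)] *(2)] *(3) eq[OF *(1)] ..
qed

text \<open>Uniqueness is automatic: the levels span \<open>Phi\<close>, and extensionality fixes
  the values elsewhere. Stated outside the locale so that it also serves the case of a degenerate
  measure.\<close>

lemma frac_op_eqI:
  assumes "T \<in> extensional Phi" "linear_on Phi cscale T"
    "\<And>m \<zeta>. prime m \<Longrightarrow> \<zeta> \<in> Phi_level m \<Longrightarrow> T \<zeta> = frac_level m \<gamma> \<zeta>"
  shows "frac_op \<gamma> = T"
  unfolding frac_op_def
proof (rule the_equality)
  fix S assume S: "S \<in> extensional Phi \<and> linear_on Phi cscale S \<and> (\<forall>m. prime m \<longrightarrow> (\<forall>\<zeta>\<in>Phi_level m. S \<zeta> = frac_level m \<gamma> \<zeta>))"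
  have "S \<zeta> = T \<zeta>" if "\<zeta> \<in> Phi" for \<zeta>
  proof (rule linear_on_span_unique[where T = S and T' = T and f = \<zeta> and V = "\<Union>m\<in>{m. prime m}. Phi_level m"])
    show "S f = T f" if "f \<in> (\<Union>m\<in>{m. prime m}. Phi_level m)" for f
      using that S assms(3) by auto
  qed (use S assms(2) that in \<open>auto simp: Phi_def\<close>)
  then show "S = T" using S assms(1) by (intro extensionalityI[of S Phi T]) auto
qed (use assms in auto)

context adelic_haar
begin

lemma frac_op_eq: "frac_op \<gamma> = frac_sum \<gamma>"
proof (rule frac_op_eqI)
  show "frac_sum \<gamma> \<in> extensional Phi" by (simp add: frac_sum_def)
  show "linear_on Phi cscale (frac_sum \<gamma>)"
    by (rule linear_onI[OF frac_sum_lincomb cfun.subspace_0[OF subspace_Phi]])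
qed (rule frac_sum_level)

lemma frac_op_lincomb:
  "\<zeta> \<in> Phi \<Longrightarrow> \<theta> \<in> Phi \<Longrightarrow> frac_op \<gamma> (cscale c \<zeta> + \<theta>) = cscale c (frac_op \<gamma> \<zeta>) + frac_op \<gamma> \<theta>"
  unfolding frac_op_eq by (rule frac_sum_lincomb)

lemma frac_op_level: "prime m \<Longrightarrow> \<zeta> \<in> Phi_level m \<Longrightarrow> frac_op \<gamma> \<zeta> = frac_level m \<gamma> \<zeta>"
  unfolding frac_op_eq by (rule frac_sum_level)

lemma frac_op_0: "frac_op \<gamma> 0 = 0"
  using frac_op_level[OF two_is_prime_nat zero_Phi_level] frac_level_0 by simp

lemma frac_op_Phi:
  assumes "\<zeta> \<in> Phi" shows "frac_op \<gamma> \<zeta> \<in> Phi"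
proof (rule span_lincomb_induct[OF assms[unfolded Phi_def], where P = "\<lambda>\<zeta>. frac_op \<gamma> \<zeta> \<in> Phi"])
  show "frac_op \<gamma> 0 \<in> Phi" unfolding frac_op_0 by (rule cfun.subspace_0[OF subspace_Phi])
  fix c and \<psi> \<phi> :: "adele \<Rightarrow> complex"
  assume \<psi>: "\<psi> \<in> (\<Union>m\<in>{m. prime m}. Phi_level m)" and \<phi>: "\<phi> \<in> cfun.span (\<Union>m\<in>{m. prime m}. Phi_level m)"
    and IH: "frac_op \<gamma> \<phi> \<in> Phi"
  obtain m where m: "prime m" "\<psi> \<in> Phi_level m" using \<psi> by blast
  have P: "\<psi> \<in> Phi" "\<phi> \<in> Phi" using Phi_level_sub_Phi[OF m(1)] m(2) \<phi> by (auto simp: Phi_def)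
  have "frac_op \<gamma> \<psi> \<in> Phi"
    using frac_op_level[OF m, of \<gamma>] frac_level_Phi_level[OF m(2), of \<gamma>] Phi_level_sub_Phi[OF m(1)] by auto
  then show "frac_op \<gamma> (cscale c \<psi> + \<phi>) \<in> Phi"
    unfolding frac_op_lincomb[OF P]
    by (intro cfun.subspace_add[OF subspace_Phi] cfun.subspace_scale[OF subspace_Phi] IH)
qed

lemma frac_op_cancel:
  assumes "\<zeta> \<in> Phi" shows "frac_op (neg_exponent \<gamma>) (frac_op \<gamma> \<zeta>) = \<zeta>"
proof (rule span_lincomb_induct[OF assms[unfolded Phi_def], where P = "\<lambda>\<zeta>. frac_op (neg_exponent \<gamma>) (frac_op \<gamma> \<zeta>) = \<zeta>"])
  show "frac_op (neg_exponent \<gamma>) (frac_op \<gamma> 0) = 0" unfolding frac_op_0 ..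
  fix c and \<psi> \<phi> :: "adele \<Rightarrow> complex"
  assume \<psi>: "\<psi> \<in> (\<Union>m\<in>{m. prime m}. Phi_level m)" and \<phi>: "\<phi> \<in> cfun.span (\<Union>m\<in>{m. prime m}. Phi_level m)"
    and IH: "frac_op (neg_exponent \<gamma>) (frac_op \<gamma> \<phi>) = \<phi>"
  obtain m where m: "prime m" "\<psi> \<in> Phi_level m" using \<psi> by blast
  have P: "\<psi> \<in> Phi" "\<phi> \<in> Phi" using Phi_level_sub_Phi[OF m(1)] m(2) \<phi> by (auto simp: Phi_def)
  have "frac_op (neg_exponent \<gamma>) (frac_op \<gamma> \<psi>) = \<psi>"
    unfolding frac_op_level[OF m] frac_op_level[OF m(1) frac_level_Phi_level[OF m(2)]]
    by (rule frac_level_cancel[OF m(2)])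
  then show "frac_op (neg_exponent \<gamma>) (frac_op \<gamma> (cscale c \<psi> + \<phi>)) = cscale c \<psi> + \<phi>"
    unfolding frac_op_lincomb[OF P] frac_op_lincomb[OF frac_op_Phi[OF P(1)] frac_op_Phi[OF P(2)]] IH by simp
qed

end

section \<open>Continuity and duality\<close>

text \<open>\<open>L\<close> intertwines sums and multiples, so continuity of the operations pulls
  back; convex neighbourhoods pull back because preimages of convex sets under linear maps are
  convex.\<close>

lemma locally_convex_pullback:
  assumes X: "cfun.subspace X" and LX: "L ` X \<subseteq> X"
    and lin: "\<And>c f g. f \<in> X \<Longrightarrow> g \<in> X \<Longrightarrow> L (cscale c f + g) = cscale c (L f) + L g"
    and T: "locally_convex X T"
  shows "locally_convex X (pullback_topology X L T)"
proof -
  let ?P = "pullback_topology X L T"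
  have topT: "topspace T = X" using T by (simp add: locally_convex_def)
  have top: "topspace ?P = X" using LX topT by (auto simp: topspace_pullback_topology)
  have contL: "continuous_map ?P T L" by (intro continuous_map_pullback[of T T id, simplified])
  have add: "L (f + g) = L f + L g" if "f \<in> X" "g \<in> X" for f g
    using lin[OF that, of 1] by (simp add: cscale_def)
  have 0: "L 0 = 0" using add[of 0 0] cfun.subspace_0[OF X] by simp
  have scale: "L (cscale c f) = cscale c (L f)" if "f \<in> X" for c f
    using lin[OF that cfun.subspace_0[OF X], of c] by (simp add: 0)
  have "continuous_map (prod_topology ?P ?P) ?P (\<lambda>(f, g). f + g)"
  proof (rule continuous_map_pullback')
    have "continuous_map (prod_topology ?P ?P) (prod_topology T T) (\<lambda>z. (L (fst z), L (snd z)))"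
      by (intro continuous_map_pairedI continuous_map_compose[OF continuous_map_fst contL, unfolded o_def]
        continuous_map_compose[OF continuous_map_snd contL, unfolded o_def])
    then have "continuous_map (prod_topology ?P ?P) T ((\<lambda>(f, g). f + g) \<circ> (\<lambda>z. (L (fst z), L (snd z))))"
      by (rule continuous_map_compose) (use T in \<open>simp add: locally_convex_def\<close>)
    then show "continuous_map (prod_topology ?P ?P) T (L \<circ> (\<lambda>(f, g). f + g))"
      by (rule continuous_map_eq) (use top add in auto)
    show "topspace (prod_topology ?P ?P) \<subseteq> (\<lambda>(f, g). f + g) -` X"
      using top cfun.subspace_add[OF X] by auto
  qed
  moreover have "continuous_map (prod_topology euclidean ?P) ?P (\<lambda>(c, f). cscale c f)"
  proof (rule continuous_map_pullback')
    have "continuous_map (prod_topology euclidean ?P) (prod_topology euclidean T) (\<lambda>z. (fst z, L (snd z)))"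
      by (intro continuous_map_pairedI continuous_map_fst
        continuous_map_compose[OF continuous_map_snd contL, unfolded o_def])
    then have "continuous_map (prod_topology euclidean ?P) T ((\<lambda>(c, f). cscale c f) \<circ> (\<lambda>z. (fst z, L (snd z))))"
      by (rule continuous_map_compose) (use T in \<open>simp add: locally_convex_def\<close>)
    then show "continuous_map (prod_topology euclidean ?P) T (L \<circ> (\<lambda>(c, f). cscale c f))"
      by (rule continuous_map_eq) (use top scale in auto)
    show "topspace (prod_topology euclidean ?P) \<subseteq> (\<lambda>(c, f). cscale c f) -` X"
      using top cfun.subspace_scale[OF X] by auto
  qed
  moreover have "\<exists>V. openin ?P V \<and> 0 \<in> V \<and> V \<subseteq> U \<and> (\<forall>f\<in>V. \<forall>g\<in>V. \<forall>t\<in>{0..1::real}.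
      cscale (of_real t) f + cscale (of_real (1 - t)) g \<in> V)" if U: "openin ?P U" "0 \<in> U" for U
  proof -
    obtain U' where U': "openin T U'" "U = L -` U' \<inter> X"
      using U(1) by (auto simp: openin_pullback_topology)
    have "0 \<in> U'" using U(2) U'(2) 0 by auto
    moreover have "\<forall>U. openin T U \<and> 0 \<in> U \<longrightarrow> (\<exists>V. openin T V \<and> 0 \<in> V \<and> V \<subseteq> U \<and>
        (\<forall>f\<in>V. \<forall>g\<in>V. \<forall>t\<in>{0..1::real}. cscale (of_real t) f + cscale (of_real (1 - t)) g \<in> V))"
      using T unfolding locally_convex_def by (elim conjE)
    ultimately obtain V where V: "openin T V" "0 \<in> V" "V \<subseteq> U'"
      "\<forall>f\<in>V. \<forall>g\<in>V. \<forall>t\<in>{0..1::real}. cscale (of_real t) f + cscale (of_real (1 - t)) g \<in> V"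
      using U'(1) by meson
    have "cscale (of_real t) f + cscale (of_real (1 - t)) g \<in> L -` V \<inter> X"
      if "f \<in> L -` V \<inter> X" "g \<in> L -` V \<inter> X" "t \<in> {0..1::real}" for f g t
    proof -
      have "L (cscale (of_real t) f + cscale (of_real (1 - t)) g) = cscale (of_real t) (L f) + cscale (of_real (1 - t)) (L g)"
        using that cfun.subspace_scale[OF X] by (simp add: lin scale)
      then show ?thesis
        using that V(4) cfun.subspace_add[OF X] cfun.subspace_scale[OF X] by simp
    qed
    moreover have "openin ?P (L -` V \<inter> X)" using V(1) by (auto simp: openin_pullback_topology)
    moreover have "0 \<in> L -` V \<inter> X" using V(2) 0 cfun.subspace_0[OF X] by simp
    moreover have "L -` V \<inter> X \<subseteq> U" using V(3) U'(2) by auto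
    ultimately show ?thesis by (intro exI[of _ "L -` V \<inter> X"]) blast
  qed
  ultimately show ?thesis using top unfolding locally_convex_def by blast
qed

lemma inductive_limit_continuous:
  assumes X: "cfun.subspace X" and LX: "L ` X \<subseteq> X"
    and lin: "\<And>c f g. f \<in> X \<Longrightarrow> g \<in> X \<Longrightarrow> L (cscale c f + g) = cscale c (L f) + L g"
    and cont: "\<And>T S. locally_convex X T \<Longrightarrow> (\<And>S. S \<in> \<S> \<Longrightarrow> continuous_map S T (\<lambda>f. f)) \<Longrightarrow> S \<in> \<S> \<Longrightarrow> continuous_map S T L"
  shows "continuous_map (inductive_limit X \<S>) (inductive_limit X \<S>) L"
proof -
  let ?G = "{W. \<exists>T. locally_convex X T \<and> (\<forall>S\<in>\<S>. continuous_map S T (\<lambda>f. f)) \<and> openin T W}"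
  have GX: "W \<subseteq> X" if "W \<in> ?G" for W
    using that openin_subset unfolding locally_convex_def by fastforce
  have XG: "X \<in> ?G" if "W \<in> ?G" for W
  proof -
    obtain T where T: "locally_convex X T" "\<forall>S\<in>\<S>. continuous_map S T (\<lambda>f. f)" using \<open>W \<in> ?G\<close> by blast
    have "openin T X" using T(1) openin_topspace[of T] by (simp add: locally_convex_def)
    then show ?thesis using T by blast
  qed
  have "continuous_map (topology_generated_by ?G) (topology_generated_by ?G) L"
  proof (rule continuous_on_generated_topo)
    fix W assume W: "W \<in> ?G"
    then obtain T where T: "locally_convex X T" "\<And>S. S \<in> \<S> \<Longrightarrow> continuous_map S T (\<lambda>f. f)" "openin T W" by blast
    have top: "topspace (topology_generated_by ?G) = X"
      using GX XG[OF W] unfolding topology_generated_by_topspace by blast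
    have topT: "topspace T = X" using T by (simp add: locally_convex_def)
    \<comment> \<open>Preimages of generators are again generators: \<open>cont\<close> says exactly
      that the pullback of \<open>T\<close> along \<open>L\<close> admits the constituents.\<close>
    have "L -` W \<inter> X \<in> ?G"
    proof (intro CollectI exI[of _ "pullback_topology X L T"] conjI ballI)
      show "locally_convex X (pullback_topology X L T)" by (rule locally_convex_pullback[OF X LX lin T(1)])
      show "openin (pullback_topology X L T) (L -` W \<inter> X)"
        using T(3) by (auto simp: openin_pullback_topology)
      fix S assume S: "S \<in> \<S>"
      show "continuous_map S (pullback_topology X L T) (\<lambda>f. f)"
      proof (rule continuous_map_pullback')
        show "continuous_map S T (L \<circ> (\<lambda>f. f))" using cont[OF T(1,2) S] by (simp add: o_def)
        show "topspace S \<subseteq> (\<lambda>f. f) -` X"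
          using continuous_map_image_subset_topspace[OF T(2)[OF S]] topT by auto
      qed
    qed
    then show "openin (topology_generated_by ?G) (L -` W \<inter> topspace (topology_generated_by ?G))"
      unfolding top by (rule topology_generated_by_Basis)
  next
    show "L ` topspace (topology_generated_by ?G) \<subseteq> \<Union> ?G"
      unfolding topology_generated_by_topspace
    proof (intro subsetI)
      fix y assume "y \<in> L ` \<Union> ?G"
      then obtain x where x: "x \<in> \<Union> ?G" "y = L x" by (rule imageE)
      then obtain W where W: "W \<in> ?G" "x \<in> W" by (elim UnionE)
      have "y \<in> X" using GX[OF W(1)] W(2) LX x(2) by auto
      then show "y \<in> \<Union> ?G" using XG[OF W(1)] by (rule UnionI[rotated])
    qed
  qed
  then show ?thesis by (simp only: inductive_limit_def)
qed

lemma topspace_inductive_limit: "topspace (inductive_limit X \<S>) \<subseteq> X"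
proof -
  have "W \<subseteq> X" if "locally_convex X T" "openin T W" for W T
    using that openin_subset unfolding locally_convex_def by fastforce
  then show ?thesis
    unfolding inductive_limit_def topology_generated_by_topspace by (intro Union_least) (elim CollectE exE conjE)
qed

lemma continuous_map_sum_locally_convex:
  assumes X: "cfun.subspace X" and T: "locally_convex X T" and "finite B"
    and "\<And>b. b \<in> B \<Longrightarrow> continuous_map S T (g b)"
  shows "continuous_map S T (\<lambda>x. \<Sum>b\<in>B. g b x)"
  using assms(3,4)
proof (induction rule: finite_induct)
  case empty
  have "0 \<in> topspace T" using T cfun.subspace_0[OF X] by (simp add: locally_convex_def)
  then have "continuous_map S T (\<lambda>x. 0)" unfolding continuous_map_const by blast
  then show ?case unfolding sum.empty .
next
  case (insert b B)
  have "continuous_map S (prod_topology T T) (\<lambda>x. (g b x, \<Sum>b\<in>B. g b x))"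
    using insert by (intro continuous_map_pairedI) auto
  then have "continuous_map S T ((\<lambda>(f, g). f + g) \<circ> (\<lambda>x. (g b x, \<Sum>b\<in>B. g b x)))"
    by (rule continuous_map_compose) (use T in \<open>simp add: locally_convex_def\<close>)
  then show ?case unfolding sum.insert[OF insert(1,2)] by (simp only: o_def prod.case)
qed

section \<open>Continuity of the fractional operator on the levels\<close>

context adelic_haar
begin

lemma mean_zero_productsE:
  assumes "w \<in> mean_zero_products m"
  obtains e where "w = (\<lambda>y. if y \<in> fin_adeles then prime_prod (\<lambda>p. e p (y p)) else 0)"
    "test_family (primes_le m) e" "\<And>p. p \<in> primes_le m \<Longrightarrow> (LINT x|padic_haar p. e p x) = 0"
proof -
  obtain e where e: "w = (\<lambda>y. if y \<in> fin_adeles then prime_prod (\<lambda>p. e p (y p)) else 0)"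
    "\<forall>p\<le>m. prime p \<longrightarrow> e p \<in> padic_test p \<and> (LINT x|padic_haar p. e p x) = 0"
    "\<forall>p>m. prime p \<longrightarrow> (\<forall>x\<in>Qp p. e p x = Omega_p p x)"
    using assms unfolding mean_zero_products_def by blast
  have "e p \<in> padic_test p" if p: "prime p" for p
  proof (cases "p \<le> m")
    case True
    then show ?thesis using e(2) p by blast
  next
    case False
    interpret prime_place p by (rule prime_place.intro[OF p])
    have "lev 0 (e p)" using lev_Omega lev_cong[of "e p" "Omega_p p" 0] e(3) p False by auto
    then show ?thesis by (rule lev_imp_padic_test)
  qed
  then have "test_family (primes_le m) e"
    unfolding test_family_def using e(3) by (auto simp: primes_le not_le)
  moreover have "(LINT x|padic_haar p. e p x) = 0" if "p \<in> primes_le m" for p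
    using e(2) that by (simp add: primes_le)
  ultimately show ?thesis using e(1) that by blast
qed

lemma elementary_eq_tensor:
  "(\<lambda>x. \<phi> (fst x) * (if snd x \<in> fin_adeles then prime_prod (\<lambda>p. e p (snd x p)) else 0)) = elementary \<phi> e"
  by (simp add: fun_eq_iff elementary_def adeles_def)

text \<open>At each prime up to \<open>m\<close> the factor \<open>e p\<close> goes to three
  transforms of the multiplied transform; mean zero of \<open>e p\<close> is the vanishing at 0 that
  the multiplication needs, and it is restored afterwards. The function \<open>b'\<close> serves all
  \<open>\<phi>\<close> at once, so the dependence on \<open>\<phi>\<close> is
  \<open>real_frac\<close> alone.\<close>

lemma frac_level_tensor:
  assumes b: "b \<in> mean_zero_products m"
  obtains b' where "b' \<in> mean_zero_products m"
    "\<And>\<phi>. \<phi> \<in> real_lizorkin \<Longrightarrow> (\<lambda>x. \<phi> (fst x) * b (snd x)) \<in> Phi_level m"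
    "\<And>\<phi>. \<phi> \<in> real_lizorkin \<Longrightarrow> frac_level m \<gamma> (\<lambda>x. \<phi> (fst x) * b (snd x)) =
      (\<lambda>x. real_frac (fst \<gamma>) \<phi> (fst x) * b' (snd x))"
proof -
  let ?F = padic_fourier
  obtain e where e: "b = (\<lambda>y. if y \<in> fin_adeles then prime_prod (\<lambda>p. e p (y p)) else 0)"
    and fam: "test_family (primes_le m) e" and mz: "\<And>p. p \<in> primes_le m \<Longrightarrow> (LINT x|padic_haar p. e p x) = 0"
    by (rule mean_zero_productsE[OF b]) blast
  define g where "g = (\<lambda>p x. if p \<le> m then of_real (padic_norm p x) powr snd \<gamma> p * ?F p (e p) x else ?F p (e p) x)"
  define e'' where "e'' p = ?F p (?F p (?F p (g p)))" for p
  define b' where "b' = (\<lambda>y. if y \<in> fin_adeles then prime_prod (\<lambda>p. e'' p (y p)) else 0)"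
  have Fe0: "?F p (e p) (padic_of_rat p 0) = 0" if pm: "p \<in> primes_le m" for p
  proof -
    interpret haar_place p using pm by (intro haar_place) (simp add: primes_le)
    show ?thesis using mz[OF pm] by (simp add: fourier_at_0)
  qed
  have famg: "test_family (primes_le m) g"
    unfolding g_def by (rule test_family_mult[OF test_family_fourier[OF fam] Fe0])
  have fam'': "test_family (primes_le m) e''"
    unfolding e''_def[abs_def] by (rule test_family_fourier[OF test_family_fourier[OF test_family_fourier[OF famg]]])
  have mz'': "(LINT x|padic_haar p. e'' p x) = 0" if pm: "p \<in> primes_le m" for p
  proof -
    have p: "prime p" using pm by (simp add: primes_le)
    interpret haar_place p by (rule haar_place[OF p])
    obtain N where N: "lev N (g p)" using test_family_lev[OF famg p] .
    have "g p (rat_in 0) = 0" using Fe0[OF pm] pm by (simp add: g_def primes_le)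
    then show ?thesis using integral_fourier_3[OF N] by (simp add: e''_def)
  qed
  have b': "b' \<in> mean_zero_products m"
    unfolding mean_zero_products_def mem_Collect_eq
  proof (intro exI[of _ e''] conjI allI impI ballI)
    show "b' = (\<lambda>y. if y \<in> fin_adeles then prime_prod (\<lambda>p. e'' p (y p)) else 0)" by (rule b'_def)
    show "e'' p \<in> padic_test p" if "prime p" for p using fam'' that by (simp add: test_family_def)
    show "(LINT x|padic_haar p. e'' p x) = 0" if "p \<le> m" "prime p" for p using mz'' that by (simp add: primes_le)
    show "e'' p x = Omega_p p x" if "m < p" "prime p" "x \<in> Qp p" for p x
      using fam'' that unfolding test_family_def by (simp add: primes_le)
  qed
  have tensor: "(\<lambda>x. \<phi> (fst x) * b (snd x)) = elementary \<phi> e" for \<phi>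
    unfolding e by (rule elementary_eq_tensor)
  have Phi: "elementary \<phi> e \<in> Phi_level m" if \<phi>: "\<phi> \<in> real_lizorkin" for \<phi>
  proof -
    obtain \<psi> where \<psi>: "\<psi> \<in> flat_schwartz" "\<phi> = real_fourier \<psi>" using \<phi> by (auto simp: real_lizorkin_eq)
    have \<psi>s: "\<psi> \<in> schwartz" using \<psi>(1) flat_schwartz_sub by auto
    \<comment> \<open>Three transforms of \<open>e p\<close>, that is its inverse transform, give
      the preimage in \<open>\<Psi>\<close>; there mean zero becomes vanishing at 0.\<close>
    let ?e = "\<lambda>p. ?F p (?F p (?F p (e p)))"
    have fam3: "test_family (primes_le m) ?e"
      by (rule test_family_fourier[OF test_family_fourier[OF test_family_fourier[OF fam]]])
    have "?e p (padic_of_rat p 0) = 0" if pm: "p \<in> primes_le m" for p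
    proof -
      have p: "prime p" using pm by (simp add: primes_le)
      interpret haar_place p by (rule haar_place[OF p])
      obtain N where N: "lev N (e p)" using test_family_lev[OF fam p] .
      show ?thesis using fourier_3_at_0[OF N] mz[OF pm] by simp
    qed
    then have "elementary \<psi> ?e \<in> flat_elementary m" using \<psi>(1) fam3 unfolding flat_elementary_def by blast
    then have "elementary \<psi> ?e \<in> Psi_level m" unfolding Psi_level_eq by (rule cfun.span_base)
    then have "adele_fourier (elementary \<psi> ?e) \<in> Phi_level m" unfolding Phi_level_def by (rule imageI)
    also have "adele_fourier (elementary \<psi> ?e) = elementary (real_fourier \<psi>) (\<lambda>p. ?F p (?e p))"
      by (rule adele_fourier_elementary[OF \<psi>s fam3])
    also have "\<dots> = elementary \<phi> e"
    proof (rule elementary_cong)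
      show "?F p (?e p) x = e p x" if "prime p" "x \<in> Qp p" for p x
        using test_family_lev[OF fam that(1)] haar_place.fourier_4[OF haar_place[OF that(1)] _ that(2)] by metis
    qed (simp add: \<psi>(2))
    finally show ?thesis .
  qed
  have frac: "frac_level m \<gamma> (elementary \<phi> e) = elementary (real_frac (fst \<gamma>) \<phi>) e''" if \<phi>: "\<phi> \<in> real_lizorkin" for \<phi>
  proof -
    have \<phi>s: "\<phi> \<in> schwartz" using \<phi> real_lizorkin_sub by auto
    have Fs: "(\<lambda>t. of_real \<bar>t\<bar> powr fst \<gamma> * real_fourier \<phi> t) \<in> schwartz"
      using abs_powr_flat[OF real_fourier_lizorkin[OF \<phi>]] flat_schwartz_sub by blast
    have "mult_op m \<gamma> (adele_fourier (elementary \<phi> e)) = elementary (\<lambda>t. of_real \<bar>t\<bar> powr fst \<gamma> * real_fourier \<phi> t) g"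
      unfolding adele_fourier_elementary[OF \<phi>s fam] mult_op_elementary[OF test_family_fourier[OF fam]] g_def ..
    then have "frac_level m \<gamma> (elementary \<phi> e) =
        adele_fourier (adele_fourier (adele_fourier (elementary (\<lambda>t. of_real \<bar>t\<bar> powr fst \<gamma> * real_fourier \<phi> t) g)))"
      using frac_level_eq'[OF Phi[OF \<phi>], of \<gamma>] by (simp only:)
    also have "\<dots> = elementary (real_frac (fst \<gamma>) \<phi>) e''"
      unfolding adele_fourier_3_elementary[OF Fs famg] real_frac_def e''_def ..
    finally show ?thesis .
  qed
  show ?thesis
  proof (rule that[OF b'])
    show "(\<lambda>x. \<phi> (fst x) * b (snd x)) \<in> Phi_level m" if "\<phi> \<in> real_lizorkin" for \<phi>
      unfolding tensor by (rule Phi[OF that])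
    show "frac_level m \<gamma> (\<lambda>x. \<phi> (fst x) * b (snd x)) = (\<lambda>x. real_frac (fst \<gamma>) \<phi> (fst x) * b' (snd x))"
      if "\<phi> \<in> real_lizorkin" for \<phi>
      unfolding tensor frac[OF that] b'_def elementary_eq_tensor ..
  qed
qed

lemma frac_level_sum:
  assumes "finite B" "\<And>b. b \<in> B \<Longrightarrow> v b \<in> Phi_level m"
  shows "(\<Sum>b\<in>B. v b) \<in> Phi_level m \<and> frac_level m \<gamma> (\<Sum>b\<in>B. v b) = (\<Sum>b\<in>B. frac_level m \<gamma> (v b))"
  using assms
proof (induction rule: finite_induct)
  case empty
  show ?case unfolding sum.empty using zero_Phi_level frac_level_0 by blast
next
  case (insert b B)
  then have v: "v b \<in> Phi_level m" and IH: "(\<Sum>b\<in>B. v b) \<in> Phi_level m"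
    "frac_level m \<gamma> (\<Sum>b\<in>B. v b) = (\<Sum>b\<in>B. frac_level m \<gamma> (v b))" by blast+
  have 1: "cscale 1 f = f" for f :: "adele \<Rightarrow> complex" by (simp add: cscale_def)
  have eq: "frac_level m \<gamma> (v b + (\<Sum>b\<in>B. v b)) = frac_level m \<gamma> (v b) + frac_level m \<gamma> (\<Sum>b\<in>B. v b)"
    using frac_level_lincomb[OF v IH(1), of \<gamma> 1] by (simp only: 1)
  show ?case
    unfolding sum.insert[OF insert(1,2)] eq IH(2) using cfun.subspace_add[OF subspace_Phi_level v IH(1)] by blast
qed

text \<open>The map factors through the tensor space of the one-dimensional \<open>E\<close> spanned
  by \<open>b\<close>. The zero function is treated apart, because \<open>{b}\<close> is then
  dependent and the map is constant.\<close>

lemma continuous_tensor_factor: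
  assumes T: "locally_convex (Phi_level m) T"
    and incl: "\<And>B. finite B \<Longrightarrow> B \<subseteq> mean_zero_products m \<Longrightarrow> cfun.independent B \<Longrightarrow> continuous_map (tensor_topology B) T (\<lambda>f. f)"
    and b: "b \<in> mean_zero_products m"
  shows "continuous_map real_lizorkin_topology T (\<lambda>\<phi> x. \<phi> (fst x) * b (snd x))"
proof (cases "b = 0")
  case True
  have "(\<lambda>x. 0) \<in> topspace T" using T zero_Phi_level by (simp add: locally_convex_def zero_fun_def)
  then show ?thesis using True by (simp add: continuous_map_const)
next
  case False
  then obtain y where y: "b y \<noteq> 0" by (auto simp: fun_eq_iff)
  let ?H = "\<lambda>\<phi> x. \<phi> (fst x) * b (snd x)" and ?R = "\<lambda>\<phi>. \<lambda>c\<in>{b}. \<phi>"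
  have H: "tensor_sum {b} (?R \<phi>) = ?H \<phi>" for \<phi> by (simp add: tensor_sum_def)
  have inv: "inv_into ({b} \<rightarrow>\<^sub>E real_lizorkin) (tensor_sum {b}) (?H \<phi>) = ?R \<phi>" if "\<phi> \<in> real_lizorkin" for \<phi>
  proof -
    \<comment> \<open>Evaluation at the point \<open>y\<close>, where \<open>b y\<close> is nonzero,
      recovers the coefficient function.\<close>
    have inj: "inj_on (tensor_sum {b}) ({b} \<rightarrow>\<^sub>E real_lizorkin)"
    proof (rule inj_onI)
      fix u v assume uv: "u \<in> {b} \<rightarrow>\<^sub>E real_lizorkin" "v \<in> {b} \<rightarrow>\<^sub>E real_lizorkin" "tensor_sum {b} u = tensor_sum {b} v"
      have "u b t = v b t" for t
        using fun_cong[OF uv(3), of "(t, y)"] y by (simp add: tensor_sum_def)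
      then show "u = v" using uv(1,2) by (intro PiE_ext[of u "{b}" _ v]) auto
    qed
    have "?R \<phi> \<in> {b} \<rightarrow>\<^sub>E real_lizorkin" using that by auto
    from inv_into_f_f[OF inj this] show ?thesis unfolding H .
  qed
  have "continuous_map real_lizorkin_topology (tensor_topology {b}) ?H"
    unfolding tensor_topology_def
  proof (rule continuous_map_pullback')
    have "continuous_map real_lizorkin_topology (product_topology (\<lambda>_. real_lizorkin_topology) {b}) ?R"
      by (auto simp: continuous_map_componentwise)
    then show "continuous_map real_lizorkin_topology (product_topology (\<lambda>_. real_lizorkin_topology) {b})
        (inv_into ({b} \<rightarrow>\<^sub>E real_lizorkin) (tensor_sum {b}) \<circ> ?H)"
      by (rule continuous_map_eq) (simp add: inv)
    show "topspace real_lizorkin_topology \<subseteq> ?H -` tensor_sum {b} ` ({b} \<rightarrow>\<^sub>E real_lizorkin)"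
    proof
      fix \<phi> assume "\<phi> \<in> topspace real_lizorkin_topology"
      then have "?R \<phi> \<in> {b} \<rightarrow>\<^sub>E real_lizorkin" by auto
      then have "tensor_sum {b} (?R \<phi>) \<in> tensor_sum {b} ` ({b} \<rightarrow>\<^sub>E real_lizorkin)" by (rule imageI)
      then show "\<phi> \<in> ?H -` tensor_sum {b} ` ({b} \<rightarrow>\<^sub>E real_lizorkin)" unfolding H by (simp only: vimage_eq)
    qed
  qed
  moreover have "continuous_map (tensor_topology {b}) T (\<lambda>f. f)"
  proof (rule incl)
    show "cfun.independent {b}" using False cfun.dependent_single[of b] by simp
  qed (use b in auto)
  ultimately have "continuous_map real_lizorkin_topology T ((\<lambda>f. f) \<circ> ?H)"
    by (rule continuous_map_compose)
  then show ?thesis by (simp add: o_def)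
qed

lemma tensor_sum_eq: "tensor_sum B \<phi> = (\<Sum>b\<in>B. (\<lambda>x. \<phi> b (fst x) * b (snd x)))"
proof
  fix x
  show "tensor_sum B \<phi> x = (\<Sum>b\<in>B. (\<lambda>x. \<phi> b (fst x) * b (snd x))) x"
    unfolding tensor_sum_def by (induction B rule: infinite_finite_induct) auto
qed

text \<open>Each coordinate \<open>\<phi>\<close> of a tensor depends continuously on it by the
  choice of topology. The summands \<open>real_frac (fst \<gamma>) \<phi>\<close> times
  \<open>\<beta> b\<close> are continuous into \<open>T\<close> one at a time and are added in
  \<open>T\<close>, so the images \<open>\<beta> b\<close> need not be collected into a
  basis.\<close>

lemma continuous_frac_level_tensor:
  assumes T: "locally_convex (Phi_level m) T"
    and incl: "\<And>B. finite B \<Longrightarrow> B \<subseteq> mean_zero_products m \<Longrightarrow> cfun.independent B \<Longrightarrow> continuous_map (tensor_topology B) T (\<lambda>f. f)"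
    and B: "finite B" "B \<subseteq> mean_zero_products m"
  shows "continuous_map (tensor_topology B) T (frac_level m \<gamma>)"
proof -
  let ?inv = "inv_into (B \<rightarrow>\<^sub>E real_lizorkin) (tensor_sum B)"
  have "\<forall>b\<in>B. \<exists>b'. b' \<in> mean_zero_products m \<and> (\<forall>\<phi>\<in>real_lizorkin. (\<lambda>x. \<phi> (fst x) * b (snd x)) \<in> Phi_level m \<and>
      frac_level m \<gamma> (\<lambda>x. \<phi> (fst x) * b (snd x)) = (\<lambda>x. real_frac (fst \<gamma>) \<phi> (fst x) * b' (snd x)))"
  proof
    fix b assume "b \<in> B"
    then have bm: "b \<in> mean_zero_products m" using B by auto
    show "\<exists>b'. b' \<in> mean_zero_products m \<and> (\<forall>\<phi>\<in>real_lizorkin. (\<lambda>x. \<phi> (fst x) * b (snd x)) \<in> Phi_level m \<and>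
      frac_level m \<gamma> (\<lambda>x. \<phi> (fst x) * b (snd x)) = (\<lambda>x. real_frac (fst \<gamma>) \<phi> (fst x) * b' (snd x)))"
    proof (rule frac_level_tensor[OF bm, of \<gamma>], goal_cases)
      case (1 b')
      then show ?case by (intro exI[of _ b'] conjI ballI)
    qed
  qed
  from bchoice[OF this] obtain \<beta> where \<beta>: "\<And>b. b \<in> B \<Longrightarrow> \<beta> b \<in> mean_zero_products m"
    "\<And>b \<phi>. b \<in> B \<Longrightarrow> \<phi> \<in> real_lizorkin \<Longrightarrow> (\<lambda>x. \<phi> (fst x) * b (snd x)) \<in> Phi_level m"
    "\<And>b \<phi>. b \<in> B \<Longrightarrow> \<phi> \<in> real_lizorkin \<Longrightarrow> frac_level m \<gamma> (\<lambda>x. \<phi> (fst x) * b (snd x)) = (\<lambda>x. real_frac (fst \<gamma>) \<phi> (fst x) * \<beta> b (snd x))"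
    by blast
  let ?G = "\<lambda>b \<phi> x. real_frac (fst \<gamma>) \<phi> (fst x) * \<beta> b (snd x)"
  have inv: "continuous_map (tensor_topology B) (product_topology (\<lambda>_. real_lizorkin_topology) B) ?inv"
    unfolding tensor_topology_def by (intro continuous_map_pullback[of _ _ id, simplified]) simp
  have "continuous_map (tensor_topology B) T (\<lambda>f. \<Sum>b\<in>B. ?G b (?inv f b))"
  proof (rule continuous_map_sum_locally_convex[OF subspace_Phi_level T B(1)])
    fix b assume b: "b \<in> B"
    have 1: "continuous_map (tensor_topology B) real_lizorkin_topology (\<lambda>f. ?inv f b)"
      using inv b by (simp add: continuous_map_componentwise)
    have "continuous_map real_lizorkin_topology T ((\<lambda>\<phi> x. \<phi> (fst x) * \<beta> b (snd x)) \<circ> real_frac (fst \<gamma>))"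
      by (rule continuous_map_compose[OF continuous_real_frac continuous_tensor_factor[OF T incl \<beta>(1)[OF b]]])
    from continuous_map_compose[OF 1 this] show "continuous_map (tensor_topology B) T (\<lambda>f. ?G b (?inv f b))"
      by (simp add: o_def)
  qed
  then show ?thesis
  proof (rule continuous_map_eq)
    fix f assume "f \<in> topspace (tensor_topology B)"
    then have f: "f \<in> tensor_sum B ` (B \<rightarrow>\<^sub>E real_lizorkin)"
      by (simp add: tensor_topology_def topspace_pullback_topology)
    have "f = tensor_sum B (?inv f)" using f_inv_into_f[OF f] by simp
    then have f_eq: "f = (\<Sum>b\<in>B. (\<lambda>x. ?inv f b (fst x) * b (snd x)))" unfolding tensor_sum_eq .
    have i: "?inv f b \<in> real_lizorkin" if "b \<in> B" for b using inv_into_into[OF f] that by auto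
    have "frac_level m \<gamma> f = (\<Sum>b\<in>B. frac_level m \<gamma> (\<lambda>x. ?inv f b (fst x) * b (snd x)))"
      using frac_level_sum[OF B(1), of "\<lambda>b x. ?inv f b (fst x) * b (snd x)" m \<gamma>] \<beta>(2)[OF _ i] f_eq by simp
    also have "\<dots> = (\<Sum>b\<in>B. ?G b (?inv f b))"
      using \<beta>(3)[OF _ i] by (intro sum.cong) auto
    finally show "(\<Sum>b\<in>B. ?G b (?inv f b)) = frac_level m \<gamma> f" by simp
  qed
qed

lemma continuous_frac_level: "continuous_map (Phi_level_topology m) (Phi_level_topology m) (frac_level m \<gamma>)"
  unfolding Phi_level_topology_def
proof (rule inductive_limit_continuous[OF subspace_Phi_level])
  show "frac_level m \<gamma> ` Phi_level m \<subseteq> Phi_level m" using frac_level_Phi_level by blast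
  show "frac_level m \<gamma> (cscale c f + g) = cscale c (frac_level m \<gamma> f) + frac_level m \<gamma> g"
    if "f \<in> Phi_level m" "g \<in> Phi_level m" for c f g
    using that by (rule frac_level_lincomb)
  fix T S assume T: "locally_convex (Phi_level m) T"
    and incl: "\<And>S. S \<in> {tensor_topology B | B. finite B \<and> B \<subseteq> mean_zero_products m \<and> cfun.independent B} \<Longrightarrow> continuous_map S T (\<lambda>f. f)"
    and "S \<in> {tensor_topology B | B. finite B \<and> B \<subseteq> mean_zero_products m \<and> cfun.independent B}"
  then obtain B where B: "S = tensor_topology B" "finite B" "B \<subseteq> mean_zero_products m" by blast
  show "continuous_map S T (frac_level m \<gamma>)"
    unfolding B(1) by (rule continuous_frac_level_tensor[OF T _ B(2,3)]) (use incl in blast)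
qed

lemma continuous_frac_op: "continuous_map Phi_topology Phi_topology (frac_op \<gamma>)"
  unfolding Phi_topology_def
proof (rule inductive_limit_continuous[OF subspace_Phi])
  show "frac_op \<gamma> ` Phi \<subseteq> Phi" using frac_op_Phi by blast
  show "frac_op \<gamma> (cscale c f + g) = cscale c (frac_op \<gamma> f) + frac_op \<gamma> g"
    if "f \<in> Phi" "g \<in> Phi" for c f g
    using that by (rule frac_op_lincomb)
  fix T S assume incl: "\<And>S. S \<in> {Phi_level_topology m | m. prime m} \<Longrightarrow> continuous_map S T (\<lambda>f. f)"
    and S: "S \<in> {Phi_level_topology m | m. prime m}"
  then obtain m where m: "S = Phi_level_topology m" "prime m" by blast
  \<comment> \<open>On level \<open>m\<close> the operator is continuous into the level itself; the
    assumed inclusion carries the result on to \<open>T\<close>.\<close>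
  have "continuous_map S T ((\<lambda>f. f) \<circ> frac_level m \<gamma>)"
    by (rule continuous_map_compose[OF _ incl[OF S]]) (unfold m(1), rule continuous_frac_level)
  then show "continuous_map S T (frac_op \<gamma>)"
  proof (rule continuous_map_eq)
    fix f assume "f \<in> topspace S"
    then have "f \<in> Phi_level m" using topspace_inductive_limit unfolding m(1) Phi_level_topology_def by blast
    then show "((\<lambda>f. f) \<circ> frac_level m \<gamma>) f = frac_op \<gamma> f" using frac_op_level[OF m(2)] by simp
  qed
qed

lemma frac_op_dual_Phi_dual:
  assumes f: "f \<in> Phi_dual"
  shows "frac_op_dual \<gamma> f \<in> Phi_dual"
  unfolding Phi_dual_def mem_Collect_eq
proof (intro conjI)
  have lin: "linear_on Phi (*) f" and cont: "continuous_map Phi_topology euclidean f"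
    using f by (auto simp: Phi_dual_def)
  have D: "linear_on Phi cscale (frac_op \<gamma>)"
    by (rule linear_onI[OF frac_op_lincomb cfun.subspace_0[OF subspace_Phi]])
  show "frac_op_dual \<gamma> f \<in> extensional Phi" by (simp add: frac_op_dual_def)
  show "linear_on Phi (*) (frac_op_dual \<gamma> f)"
    unfolding linear_on_def
  proof (intro conjI ballI allI)
    fix \<zeta> \<theta> assume "\<zeta> \<in> Phi" "\<theta> \<in> Phi"
    then show "frac_op_dual \<gamma> f (\<zeta> + \<theta>) = frac_op_dual \<gamma> f \<zeta> + frac_op_dual \<gamma> f \<theta>"
      using lin D cfun.subspace_add[OF subspace_Phi] frac_op_Phi by (simp add: frac_op_dual_def linear_on_def)
  next
    fix c \<zeta> assume "\<zeta> \<in> Phi"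
    then show "frac_op_dual \<gamma> f (cscale c \<zeta>) = c * frac_op_dual \<gamma> f \<zeta>"
      using lin D cfun.subspace_scale[OF subspace_Phi] frac_op_Phi by (simp add: frac_op_dual_def linear_on_def)
  qed
  have "continuous_map Phi_topology euclidean (f \<circ> frac_op \<gamma>)"
    by (rule continuous_map_compose[OF continuous_frac_op cont])
  then show "continuous_map Phi_topology euclidean (frac_op_dual \<gamma> f)"
  proof (rule continuous_map_eq)
    fix \<zeta> assume "\<zeta> \<in> topspace Phi_topology"
    then have "\<zeta> \<in> Phi" using topspace_inductive_limit unfolding Phi_topology_def by blast
    then show "(f \<circ> frac_op \<gamma>) \<zeta> = frac_op_dual \<gamma> f \<zeta>" by (simp add: frac_op_dual_def)
  qed
qed

lemma frac_op_dual_cancel: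
  assumes f: "f \<in> Phi_dual"
  shows "frac_op_dual \<gamma> (frac_op_dual (neg_exponent \<gamma>) f) = f"
proof (rule extensionalityI[of _ Phi])
  show "f \<in> extensional Phi" using f by (simp add: Phi_dual_def)
  show "frac_op_dual \<gamma> (frac_op_dual (neg_exponent \<gamma>) f) \<zeta> = f \<zeta>" if "\<zeta> \<in> Phi" for \<zeta>
    using that frac_op_Phi[OF that, of \<gamma>] frac_op_cancel[OF that, of \<gamma>] by (simp add: frac_op_dual_def)
qed (simp add: frac_op_dual_def)

theorem frac_op_invariance:
  "frac_op \<gamma> ` Phi \<subseteq> Phi \<and> frac_op_dual \<gamma> ` Phi_dual \<subseteq> Phi_dual \<and> frac_op_dual \<gamma> ` Phi_dual = Phi_dual"
proof -
  have "frac_op_dual \<gamma> ` Phi_dual \<subseteq> Phi_dual" using frac_op_dual_Phi_dual by blast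
  moreover have "Phi_dual \<subseteq> frac_op_dual \<gamma> ` Phi_dual"
  proof
    fix f assume "f \<in> Phi_dual"
    then show "f \<in> frac_op_dual \<gamma> ` Phi_dual"
      using frac_op_dual_cancel[of f \<gamma>] frac_op_dual_Phi_dual[of f "neg_exponent \<gamma>"] by (metis imageI)
  qed
  ultimately show ?thesis using frac_op_Phi by blast
qed

end

lemma null_fin_adele_haar:
  assumes 0: "\<And>A. emeasure fin_adele_haar A = 0"
  shows "integral\<^sup>L adele_haar f = 0"
proof -
  interpret sigma_finite_measure fin_adele_haar
    by (rule sigma_finite_measure.intro, rule exI[of _ "{space fin_adele_haar}"]) (auto simp: 0 simp del: space_fin_adele_haar)
  have "emeasure adele_haar (space adele_haar) = 0"
    unfolding adele_haar_def space_pair_measure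
    by (subst emeasure_pair_measure_Times) (simp_all add: 0 del: space_fin_adele_haar)
  then have "AE x in adele_haar. False" by (auto intro!: AE_I[where N = "space adele_haar"])
  then have "AE x in adele_haar. f x = 0" by eventually_elim simp
  then show ?thesis by (rule integral_eq_zero_AE)
qed

theorem lemma9p3:
  fixes \<gamma> :: "complex \<times> (nat \<Rightarrow> complex)"
  shows "frac_op \<gamma> ` Phi \<subseteq> Phi \<and>
         frac_op_dual \<gamma> ` Phi_dual \<subseteq> Phi_dual \<and>
         frac_op_dual \<gamma> ` Phi_dual = Phi_dual"
proof (cases adelic_haar)
  case True
  then show ?thesis by (rule adelic_haar.frac_op_invariance)
next
  case False
  then have 0: "integral\<^sup>L adele_haar f = 0" for f :: "adele \<Rightarrow> complex"
    using fin_adele_haar_cases null_fin_adele_haar by blast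
  have F: "adele_fourier \<phi> = 0" "adele_inv_fourier \<phi> = 0" for \<phi>
    by (simp_all add: fun_eq_iff adele_fourier_def adele_inv_fourier_def 0)
  \<comment> \<open>All integrals vanish, so every transform is 0 and each level is contained in the
    zero space.\<close>
  have "(\<Union>m\<in>{m. prime m}. Phi_level m) \<subseteq> {0}" by (auto simp: Phi_level_def F)
  from cfun.span_minimal[OF this cfun.subspace_single_0] have "Phi \<subseteq> {0}" unfolding Phi_def .
  moreover have "0 \<in> Phi" unfolding Phi_def by (rule cfun.span_zero)
  ultimately have Phi: "Phi = {0}" by auto
  have "frac_op \<gamma> = (\<lambda>\<zeta>\<in>Phi. 0)"
  proof (rule frac_op_eqI)
    show "linear_on Phi cscale (\<lambda>\<zeta>\<in>Phi. 0)"
      by (rule linear_onI) (auto simp: Phi cscale_def fun_eq_iff)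
    show "(\<lambda>\<zeta>\<in>Phi. 0) \<zeta> = frac_level m \<gamma> \<zeta>" if "prime m" "\<zeta> \<in> Phi_level m" for m \<zeta>
      using that by (auto simp: Phi_level_def Phi F frac_level_def)
  qed simp
  then have D0: "frac_op \<gamma> 0 = 0" by (simp add: Phi)
  \<comment> \<open>On \<open>Phi = {0}\<close> the dual operator is the identity: it evaluates
    \<open>f\<close> at \<open>frac_op \<gamma> 0 = 0\<close>.\<close>
  have "frac_op_dual \<gamma> f = f" if "f \<in> Phi_dual" for f
  proof (rule extensionalityI[of _ Phi])
    show "f \<in> extensional Phi" using that by (simp add: Phi_dual_def)
  qed (simp_all add: frac_op_dual_def Phi D0)
  then show ?thesis using D0 by (auto simp: Phi)
qed

end
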